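(* Let $N$ be a smooth finite dimensional Poisson manifold, let $(A,\{\cdot,\cdot\})$ be its real Poisson algebra of smooth functions, and let $\zeta$ be a smooth vector bundle on $N$ with a flat $D_{\{\cdot,\cdot\}}^{\mathrm{geo}}$-connection, with space of smooth sections $\Gamma(\zeta)$. Then the morphism $$q^*\colon \mathrm{Alt}_A(D_{\{\cdot,\cdot\}}^{\mathrm{geo}},\Gamma(\zeta))\longrightarrow \mathrm{Alt}_A(D_{\{\cdot,\cdot\}},\Gamma(\zeta))$$ induced by the canonical surjection $q\colon D_A\to D_A^{\mathrm{geo}}$ is an isomorphism of real chain complexes. Consequently the induced morphism $$\mathrm{H}^*_{\mathrm{Poisson}}(N,\{\cdot,\cdot\};\zeta)\longrightarrow \mathrm{H}^*_{\mathrm{Poisson}}(A,\{\cdot,\cdot\};\Gamma(\zeta))$$ is an isomorphism of real graded vector spaces.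
   Context: $A=C^\infty(N)$ with Poisson bracket $\{\cdot,\cdot\}$ (a real Lie bracket with $\{fg,h\}=f\{g,h\}+\{f,h\}g$). Algebraic side: $D_A$ is the $A$-module of (formal, algebraic) Kähler differentials of $A$ over $\mathbb R$. $D_{\{\cdot,\cdot\}}$ is $D_A$ with bracket $[a\,du,b\,dv]=a\{u,b\}dv+b\{a,v\}du+ab\,d\{u,v\}$ and action on $A$ given by $(a\,du)(c)=a\{u,c\}$. Geometric side: $D_A^{\mathrm{geo}}$ is the $A$-module of smooth $1$-forms on $N$. Let $\pi_G$ be the alternating $A$-bilinear form on $D_A^{\mathrm{geo}}$ with $\pi_G(df,dg)=\{f,g\}$, and $\alpha\mapsto\alpha^\sharp$ the $A$-linear map from $1$-forms to vector fields with $\beta(\alpha^\sharp)=\pi_G(\alpha,\beta)$. $D_{\{\cdot,\cdot\}}^{\mathrm{geo}}$ is $D_A^{\mathrm{geo}}$ with bracket $[\alpha,\beta]=\lambda_{\alpha^\sharp}\beta-\lambda_{\beta^\sharp}\alpha-d(\pi_G(\alpha,\beta))$ ($\lambda$ = Lie derivative) and action on $A$ by $\alpha(f)=\alpha^\sharp(f)$. Both are $(\mathbb R,A)$-Lie algebras, i.e. real Lie algebras $L$ that are $A$-modules acting on $A$ by derivations, with $(a\alpha)(b)=a\alpha(b)$ and $[\alpha,a\beta]=a[\alpha,\beta]+\alpha(a)\beta$. The map $q\colon D_A\to D_A^{\mathrm{geo}}$ sends a formal differential to the corresponding differential form; it is a surjective morphism of $(\mathbb R,A)$-Lie algebras. For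 an $(\mathbb R,A)$-Lie algebra $L$, a flat $L$-connection on an $A$-module $M$ is a morphism of real Lie algebras $L\to\mathrm{End}_{\mathbb R}(M)$ with $(a\alpha)(m)=a(\alpha(m))$ and $\alpha(am)=a\,\alpha(m)+\alpha(a)m$; a flat connection on $\zeta$ means one on $\Gamma(\zeta)$. Via $q$, $\Gamma(\zeta)$ also carries a flat $D_{\{\cdot,\cdot\}}$-connection. $\mathrm{Alt}_A(L,M)$ is the complex of $A$-multilinear alternating forms on $L$ with values in $M$ and differential $$(df)(\alpha_1,\dots,\alpha_n)=(-1)^n\sum_{i}(-1)^{i-1}\alpha_i(f(\dots,\widehat{\alpha_i},\dots))+(-1)^n\sum_{j<k}(-1)^{j+k}f([\alpha_j,\alpha_k],\dots,\widehat{\alpha_j},\dots,\widehat{\alpha_k},\dots).$$ $\mathrm{H}^*_{\mathrm{Poisson}}(N,\{\cdot,\cdot\};\zeta)$ is the cohomology of $\mathrm{Alt}_A(D_{\{\cdot,\cdot\}}^{\mathrm{geo}},\Gamma(\zeta))$ and $\mathrm{H}^*_{\mathrm{Poisson}}(A,\{\cdot,\cdot\};\Gamma(\zeta))$ is the cohomology of $\mathrm{Alt}_A(D_{\{\cdot,\cdot\}},\Gamma(\zeta))$. *)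

theory Defs
  imports
    "HOL-Analysis.Analysis"
    "HOL-Algebra.Module"
    "HOL-Algebra.AbelCoset"
begin

section \<open>Modules and cochain complexes\<close>

text \<open>
  Throughout, modules are records of type \<^typ>\<open>('r, 'm) module\<close>; the ring fields \<open>mult\<close> and
  \<open>one\<close> of such a record play no role in a module and are left undefined. Real vector spaces are
  modules over \<open>real_ring\<close>, and an \<open>\<real>\<close>-algebra is a record of type \<^typ>\<open>(real, 'r) module\<close>
  whose ring fields do matter.
\<close>

definition real_ring :: "real ring" where
  "real_ring = \<lparr>carrier = UNIV, monoid.mult = (*), one = 1, zero = 0, add = (+)\<rparr>"

definition mod_hom ::
  "('r, 'x) ring_scheme \<Rightarrow> ('r, 'm, 'y) module_scheme \<Rightarrow> ('r, 'n, 'z) module_scheme \<Rightarrow> ('m \<Rightarrow> 'n) set"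
  where
  "mod_hom R M N = {h \<in> carrier M \<rightarrow> carrier N.
     (\<forall>x\<in>carrier M. \<forall>y\<in>carrier M. h (x \<oplus>\<^bsub>M\<^esub> y) = h x \<oplus>\<^bsub>N\<^esub> h y) \<and>
     (\<forall>r\<in>carrier R. \<forall>x\<in>carrier M. h (r \<odot>\<^bsub>M\<^esub> x) = r \<odot>\<^bsub>N\<^esub> h x)}"

definition mod_iso ::
  "('r, 'x) ring_scheme \<Rightarrow> ('r, 'm, 'y) module_scheme \<Rightarrow> ('r, 'n, 'z) module_scheme \<Rightarrow> ('m \<Rightarrow> 'n) set"
  where
  "mod_iso R M N = {h \<in> mod_hom R M N. bij_betw h (carrier M) (carrier N)}"

definition quotient_module :: "('r, 'm, 'y) module_scheme \<Rightarrow> 'm set \<Rightarrow> ('r, 'm set) module" where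
  "quotient_module M S =
     \<lparr>carrier = a_rcosets\<^bsub>M\<^esub> S, monoid.mult = undefined, one = undefined,
      zero = S, add = set_add M,
      smult = (\<lambda>r X. \<Union>x\<in>X. S +>\<^bsub>M\<^esub> (r \<odot>\<^bsub>M\<^esub> x))\<rparr>"

definition generated_submodule ::
  "('r, 'x) ring_scheme \<Rightarrow> ('r, 'm, 'y) module_scheme \<Rightarrow> 'm set \<Rightarrow> 'm set" where
  "generated_submodule R M G = \<Inter>{H. submodule H R M \<and> G \<subseteq> H}"

locale cochain_complex =
  fixes R :: "('r, 'x) ring_scheme"
    and C :: "nat \<Rightarrow> ('r, 'c, 'y) module_scheme"
    and d :: "nat \<Rightarrow> 'c \<Rightarrow> 'c"
  assumes module_C: "Module.module R (C n)"
    and d_hom: "d n \<in> mod_hom R (C n) (C (Suc n))"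
    and d_d: "x \<in> carrier (C n) \<Longrightarrow> d (Suc n) (d n x) = \<zero>\<^bsub>C (Suc (Suc n))\<^esub>"

definition cochain_complex_iso ::
  "('r, 'x) ring_scheme \<Rightarrow> (nat \<Rightarrow> ('r, 'c, 'y) module_scheme) \<Rightarrow> (nat \<Rightarrow> 'c \<Rightarrow> 'c) \<Rightarrow>
   (nat \<Rightarrow> ('r, 'k, 'z) module_scheme) \<Rightarrow> (nat \<Rightarrow> 'k \<Rightarrow> 'k) \<Rightarrow> (nat \<Rightarrow> 'c \<Rightarrow> 'k) \<Rightarrow> bool" where
  "cochain_complex_iso R C d C' d' h \<longleftrightarrow>
     cochain_complex R C d \<and> cochain_complex R C' d' \<and>
     (\<forall>n. h n \<in> mod_iso R (C n) (C' n)) \<and>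
     (\<forall>n. \<forall>x\<in>carrier (C n). h (Suc n) (d n x) = d' n (h n x))"

definition cocycles ::
  "(nat \<Rightarrow> ('r, 'c, 'y) module_scheme) \<Rightarrow> (nat \<Rightarrow> 'c \<Rightarrow> 'c) \<Rightarrow> nat \<Rightarrow> 'c set" where
  "cocycles C d n = {x \<in> carrier (C n). d n x = \<zero>\<^bsub>C (Suc n)\<^esub>}"

definition coboundaries ::
  "(nat \<Rightarrow> ('r, 'c, 'y) module_scheme) \<Rightarrow> (nat \<Rightarrow> 'c \<Rightarrow> 'c) \<Rightarrow> nat \<Rightarrow> 'c set" where
  "coboundaries C d n = (case n of 0 \<Rightarrow> {\<zero>\<^bsub>C 0\<^esub>} | Suc m \<Rightarrow> d m ` carrier (C m))"

definition cohomology ::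
  "(nat \<Rightarrow> ('r, 'c, 'y) module_scheme) \<Rightarrow> (nat \<Rightarrow> 'c \<Rightarrow> 'c) \<Rightarrow> nat \<Rightarrow> ('r, 'c set) module" where
  "cohomology C d n = quotient_module ((C n)\<lparr>carrier := cocycles C d n\<rparr>) (coboundaries C d n)"

text \<open>The map induced in degree \<open>n\<close> by a cochain map \<open>h\<close> into \<open>(C', d')\<close>: \<open>[x] \<mapsto> [h x]\<close>.\<close>

definition cohomology_map ::
  "(nat \<Rightarrow> ('r, 'k, 'z) module_scheme) \<Rightarrow> (nat \<Rightarrow> 'k \<Rightarrow> 'k) \<Rightarrow> (nat \<Rightarrow> 'c \<Rightarrow> 'k) \<Rightarrow>
   nat \<Rightarrow> 'c set \<Rightarrow> 'k set" where
  "cohomology_map C' d' h n X = (\<Union>x\<in>X. coboundaries C' d' n +>\<^bsub>C' n\<^esub> h n x)"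


section \<open>Lie-Rinehart structures, flat connections, alternating forms\<close>

text \<open>The data of an \<open>(\<real>, A)\<close>-Lie algebra: \<open>anchor L \<alpha> a\<close> is the value \<open>\<alpha>(a)\<close>.\<close>

record ('r, 'l) lie_rinehart = "('r, 'l) module" +
  lie_bracket :: "'l \<Rightarrow> 'l \<Rightarrow> 'l"
  anchor :: "'l \<Rightarrow> 'r \<Rightarrow> 'r"

text \<open>The real vector space underlying a module over an \<open>\<real>\<close>-algebra.\<close>

definition real_module ::
  "(real, 'r, 'x) module_scheme \<Rightarrow> ('r, 'm, 'y) module_scheme \<Rightarrow> (real, 'm) module" where
  "real_module A M =
     \<lparr>carrier = carrier M, monoid.mult = undefined, one = undefined,
      zero = \<zero>\<^bsub>M\<^esub>, add = add M,
      smult = (\<lambda>r m. (r \<odot>\<^bsub>A\<^esub> \<one>\<^bsub>A\<^esub>) \<odot>\<^bsub>M\<^esub> m)\<rparr>"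

definition flat_connection ::
  "(real, 'r, 'x) module_scheme \<Rightarrow> ('r, 'l, 'y) lie_rinehart_scheme \<Rightarrow> ('r, 'm, 'z) module_scheme \<Rightarrow>
   ('l \<Rightarrow> 'm \<Rightarrow> 'm) \<Rightarrow> bool" where
  "flat_connection A L M \<omega> \<longleftrightarrow>
     (\<forall>\<alpha>\<in>carrier L. \<omega> \<alpha> \<in> mod_hom real_ring (real_module A M) (real_module A M)) \<and>
     (\<forall>\<alpha>\<in>carrier L. \<forall>\<beta>\<in>carrier L. \<forall>m\<in>carrier M. \<omega> (\<alpha> \<oplus>\<^bsub>L\<^esub> \<beta>) m = \<omega> \<alpha> m \<oplus>\<^bsub>M\<^esub> \<omega> \<beta> m) \<and>
     (\<forall>\<alpha>\<in>carrier L. \<forall>\<beta>\<in>carrier L. \<forall>m\<in>carrier M.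
        \<omega> (lie_bracket L \<alpha> \<beta>) m = \<omega> \<alpha> (\<omega> \<beta> m) \<ominus>\<^bsub>M\<^esub> \<omega> \<beta> (\<omega> \<alpha> m)) \<and>
     (\<forall>a\<in>carrier A. \<forall>\<alpha>\<in>carrier L. \<forall>m\<in>carrier M. \<omega> (a \<odot>\<^bsub>L\<^esub> \<alpha>) m = a \<odot>\<^bsub>M\<^esub> \<omega> \<alpha> m) \<and>
     (\<forall>a\<in>carrier A. \<forall>\<alpha>\<in>carrier L. \<forall>m\<in>carrier M.
        \<omega> \<alpha> (a \<odot>\<^bsub>M\<^esub> m) = (a \<odot>\<^bsub>M\<^esub> \<omega> \<alpha> m) \<oplus>\<^bsub>M\<^esub> (anchor L \<alpha> a \<odot>\<^bsub>M\<^esub> m))"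

definition arguments :: "('l, 'y) partial_object_scheme \<Rightarrow> nat \<Rightarrow> 'l list set" where
  "arguments L n = {xs. length xs = n \<and> set xs \<subseteq> carrier L}"

definition alternating_forms ::
  "('r, 'x) ring_scheme \<Rightarrow> ('r, 'l, 'y) module_scheme \<Rightarrow> ('r, 'm, 'z) module_scheme \<Rightarrow> nat \<Rightarrow>
   ('l list \<Rightarrow> 'm) set" where
  "alternating_forms A L M n = {f \<in> arguments L n \<rightarrow>\<^sub>E carrier M.
     (\<forall>xs\<in>arguments L n. \<forall>i<n. \<forall>x\<in>carrier L. \<forall>y\<in>carrier L.
        f (xs[i := x \<oplus>\<^bsub>L\<^esub> y]) = f (xs[i := x]) \<oplus>\<^bsub>M\<^esub> f (xs[i := y])) \<and>
     (\<forall>xs\<in>arguments L n. \<forall>i<n. \<forall>a\<in>carrier A. \<forall>x\<in>carrier L.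
        f (xs[i := a \<odot>\<^bsub>L\<^esub> x]) = a \<odot>\<^bsub>M\<^esub> f (xs[i := x])) \<and>
     (\<forall>xs\<in>arguments L n. \<forall>i<n. \<forall>j<n. i \<noteq> j \<and> xs ! i = xs ! j \<longrightarrow> f xs = \<zero>\<^bsub>M\<^esub>)}"

definition alt_complex ::
  "(real, 'r, 'x) module_scheme \<Rightarrow> ('r, 'l, 'y) module_scheme \<Rightarrow> ('r, 'm, 'z) module_scheme \<Rightarrow> nat \<Rightarrow>
   (real, 'l list \<Rightarrow> 'm) module" where
  "alt_complex A L M n =
     \<lparr>carrier = alternating_forms A L M n, monoid.mult = undefined, one = undefined,
      zero = (\<lambda>xs\<in>arguments L n. \<zero>\<^bsub>M\<^esub>),
      add = (\<lambda>f g. \<lambda>xs\<in>arguments L n. f xs \<oplus>\<^bsub>M\<^esub> g xs),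
      smult = (\<lambda>r f. \<lambda>xs\<in>arguments L n. r \<odot>\<^bsub>real_module A M\<^esub> f xs)\<rparr>"

definition signed :: "('m, 'x) ring_scheme \<Rightarrow> nat \<Rightarrow> 'm \<Rightarrow> 'm" where
  "signed M k m = (if even k then m else \<ominus>\<^bsub>M\<^esub> m)"

definition omit :: "nat \<Rightarrow> 'l list \<Rightarrow> 'l list" where
  "omit i xs = take i xs @ drop (Suc i) xs"

text \<open>
  The differential from degree \<open>n\<close> to degree \<open>n + 1\<close>. Positions are counted from \<open>0\<close>, which
  changes \<open>(-1)\<^sup>i\<^sup>-\<^sup>1\<close> to \<open>(-1)\<^sup>i\<close> and leaves \<open>(-1)\<^sup>j\<^sup>+\<^sup>k\<close> unchanged; the global sign is
  \<open>(-1)\<close> to the number of arguments of \<open>df\<close>.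
\<close>

definition alt_differential ::
  "('r, 'l, 'y) lie_rinehart_scheme \<Rightarrow> ('r, 'm, 'z) module_scheme \<Rightarrow> ('l \<Rightarrow> 'm \<Rightarrow> 'm) \<Rightarrow> nat \<Rightarrow>
   ('l list \<Rightarrow> 'm) \<Rightarrow> ('l list \<Rightarrow> 'm)" where
  "alt_differential L M \<omega> n f = (\<lambda>xs\<in>arguments L (Suc n).
     signed M (Suc n) (\<Oplus>\<^bsub>M\<^esub>i\<in>{..n}. signed M i (\<omega> (xs ! i) (f (omit i xs))))
     \<oplus>\<^bsub>M\<^esub>
     signed M (Suc n) (\<Oplus>\<^bsub>M\<^esub>p\<in>{(j, k). j < k \<and> k \<le> n}. case p of (j, k) \<Rightarrow>
       signed M (j + k) (f (lie_bracket L (xs ! j) (xs ! k) # omit j (omit k xs)))))"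

definition alt_pullback ::
  "('l, 'y) partial_object_scheme \<Rightarrow> ('l \<Rightarrow> 'k) \<Rightarrow> nat \<Rightarrow> ('k list \<Rightarrow> 'm) \<Rightarrow> ('l list \<Rightarrow> 'm)" where
  "alt_pullback L h n f = (\<lambda>xs\<in>arguments L n. f (map h xs))"


section \<open>Poisson algebras and formal differentials\<close>

definition poisson_bracket ::
  "(real, 'r, 'x) module_scheme \<Rightarrow> ('r \<Rightarrow> 'r \<Rightarrow> 'r) \<Rightarrow> bool" where
  "poisson_bracket A br \<longleftrightarrow>
     (\<forall>f\<in>carrier A. \<forall>g\<in>carrier A. br f g \<in> carrier A) \<and>
     (\<forall>f\<in>carrier A. \<forall>g\<in>carrier A. \<forall>h\<in>carrier A.
        br (f \<oplus>\<^bsub>A\<^esub> g) h = br f h \<oplus>\<^bsub>A\<^esub> br g h \<and> br h (f \<oplus>\<^bsub>A\<^esub> g) = br h f \<oplus>\<^bsub>A\<^esub> br h g) \<and>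
     (\<forall>r. \<forall>f\<in>carrier A. \<forall>g\<in>carrier A.
        br (r \<odot>\<^bsub>A\<^esub> f) g = r \<odot>\<^bsub>A\<^esub> br f g \<and> br f (r \<odot>\<^bsub>A\<^esub> g) = r \<odot>\<^bsub>A\<^esub> br f g) \<and>
     (\<forall>f\<in>carrier A. br f f = \<zero>\<^bsub>A\<^esub>) \<and>
     (\<forall>f\<in>carrier A. \<forall>g\<in>carrier A. \<forall>h\<in>carrier A.
        br f (br g h) \<oplus>\<^bsub>A\<^esub> br g (br h f) \<oplus>\<^bsub>A\<^esub> br h (br f g) = \<zero>\<^bsub>A\<^esub>) \<and>
     (\<forall>f\<in>carrier A. \<forall>g\<in>carrier A. \<forall>h\<in>carrier A.
        br (f \<otimes>\<^bsub>A\<^esub> g) h = (f \<otimes>\<^bsub>A\<^esub> br g h) \<oplus>\<^bsub>A\<^esub> (br f h \<otimes>\<^bsub>A\<^esub> g))"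

text \<open>
  Kaehler differentials of an \<open>\<real>\<close>-algebra \<open>A\<close>: the free \<open>A\<close>-module on symbols \<open>du\<close>, \<open>u \<in> A\<close>
  (finitely supported functions on \<open>A\<close>), modulo additivity, the Leibniz rule and \<open>dr = 0\<close> for
  real constants \<open>r\<close>.
\<close>

definition free_module :: "('r, 'x) ring_scheme \<Rightarrow> ('r, 'r \<Rightarrow> 'r) module" where
  "free_module A =
     \<lparr>carrier = {x \<in> carrier A \<rightarrow>\<^sub>E carrier A. finite {u \<in> carrier A. x u \<noteq> \<zero>\<^bsub>A\<^esub>}},
      monoid.mult = undefined, one = undefined,
      zero = (\<lambda>u\<in>carrier A. \<zero>\<^bsub>A\<^esub>),
      add = (\<lambda>x y. \<lambda>u\<in>carrier A. x u \<oplus>\<^bsub>A\<^esub> y u),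
      smult = (\<lambda>a x. \<lambda>u\<in>carrier A. a \<otimes>\<^bsub>A\<^esub> x u)\<rparr>"

definition free_gen :: "('r, 'x) ring_scheme \<Rightarrow> 'r \<Rightarrow> 'r \<Rightarrow> 'r" where
  "free_gen A u = (\<lambda>v\<in>carrier A. if v = u then \<one>\<^bsub>A\<^esub> else \<zero>\<^bsub>A\<^esub>)"

definition kaehler_relations :: "(real, 'r, 'x) module_scheme \<Rightarrow> ('r \<Rightarrow> 'r) set" where
  "kaehler_relations A = generated_submodule A (free_module A)
     ({free_gen A (u \<oplus>\<^bsub>A\<^esub> v) \<ominus>\<^bsub>free_module A\<^esub> (free_gen A u \<oplus>\<^bsub>free_module A\<^esub> free_gen A v)
        | u v. u \<in> carrier A \<and> v \<in> carrier A}
      \<union> {free_gen A (u \<otimes>\<^bsub>A\<^esub> v) \<ominus>\<^bsub>free_module A\<^esub>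
          ((u \<odot>\<^bsub>free_module A\<^esub> free_gen A v) \<oplus>\<^bsub>free_module A\<^esub> (v \<odot>\<^bsub>free_module A\<^esub> free_gen A u))
        | u v. u \<in> carrier A \<and> v \<in> carrier A}
      \<union> {free_gen A (r \<odot>\<^bsub>A\<^esub> \<one>\<^bsub>A\<^esub>) | r. True})"

definition kaehler :: "(real, 'r, 'x) module_scheme \<Rightarrow> ('r, ('r \<Rightarrow> 'r) set) module" where
  "kaehler A = quotient_module (free_module A) (kaehler_relations A)"

definition kaehler_d :: "(real, 'r, 'x) module_scheme \<Rightarrow> 'r \<Rightarrow> ('r \<Rightarrow> 'r) set" where
  "kaehler_d A u = kaehler_relations A +>\<^bsub>free_module A\<^esub> free_gen A u"

text \<open>
  The elements \<open>a du\<close> generate the additive group of \<^const>\<open>kaehler\<close>, so an additive map is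
  determined by its values on them.
\<close>

definition kaehler_bracket ::
  "(real, 'r, 'x) module_scheme \<Rightarrow> ('r \<Rightarrow> 'r \<Rightarrow> 'r) \<Rightarrow>
   ('r \<Rightarrow> 'r) set \<Rightarrow> ('r \<Rightarrow> 'r) set \<Rightarrow> ('r \<Rightarrow> 'r) set" where
  "kaehler_bracket A br = (let D = kaehler A; d = kaehler_d A in
     (THE b. b \<in> carrier D \<rightarrow>\<^sub>E (carrier D \<rightarrow>\<^sub>E carrier D) \<and>
       (\<forall>x\<in>carrier D. \<forall>y\<in>carrier D. \<forall>z\<in>carrier D.
          b (x \<oplus>\<^bsub>D\<^esub> y) z = b x z \<oplus>\<^bsub>D\<^esub> b y z \<and> b z (x \<oplus>\<^bsub>D\<^esub> y) = b z x \<oplus>\<^bsub>D\<^esub> b z y) \<and>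
       (\<forall>a\<in>carrier A. \<forall>u\<in>carrier A. \<forall>c\<in>carrier A. \<forall>v\<in>carrier A.
          b (a \<odot>\<^bsub>D\<^esub> d u) (c \<odot>\<^bsub>D\<^esub> d v) =
            ((a \<otimes>\<^bsub>A\<^esub> br u c) \<odot>\<^bsub>D\<^esub> d v) \<oplus>\<^bsub>D\<^esub> ((c \<otimes>\<^bsub>A\<^esub> br a v) \<odot>\<^bsub>D\<^esub> d u)
            \<oplus>\<^bsub>D\<^esub> ((a \<otimes>\<^bsub>A\<^esub> c) \<odot>\<^bsub>D\<^esub> d (br u v)))))"

definition kaehler_anchor ::
  "(real, 'r, 'x) module_scheme \<Rightarrow> ('r \<Rightarrow> 'r \<Rightarrow> 'r) \<Rightarrow> ('r \<Rightarrow> 'r) set \<Rightarrow> 'r \<Rightarrow> 'r" where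
  "kaehler_anchor A br = (let D = kaehler A in
     (THE \<rho>. \<rho> \<in> carrier D \<rightarrow>\<^sub>E (carrier A \<rightarrow>\<^sub>E carrier A) \<and>
       (\<forall>x\<in>carrier D. \<forall>y\<in>carrier D. \<forall>c\<in>carrier A. \<rho> (x \<oplus>\<^bsub>D\<^esub> y) c = \<rho> x c \<oplus>\<^bsub>A\<^esub> \<rho> y c) \<and>
       (\<forall>a\<in>carrier A. \<forall>u\<in>carrier A. \<forall>c\<in>carrier A.
          \<rho> (a \<odot>\<^bsub>D\<^esub> kaehler_d A u) c = a \<otimes>\<^bsub>A\<^esub> br u c)))"

definition kaehler_lie_rinehart ::
  "(real, 'r, 'x) module_scheme \<Rightarrow> ('r \<Rightarrow> 'r \<Rightarrow> 'r) \<Rightarrow> ('r, ('r \<Rightarrow> 'r) set) lie_rinehart" where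
  "kaehler_lie_rinehart A br =
     module.extend (kaehler A) (lie_rinehart.fields (kaehler_bracket A br) (kaehler_anchor A br))"


section \<open>Smooth manifolds\<close>

text \<open>
  The derivatives are two-sided, so these notions are meaningful only for open \<open>S\<close>.
\<close>

fun k_times_differentiable_on ::
  "nat \<Rightarrow> 'e::euclidean_space set \<Rightarrow> ('e \<Rightarrow> 'b::real_normed_vector) \<Rightarrow> bool" where
  "k_times_differentiable_on 0 S f \<longleftrightarrow> continuous_on S f"
| "k_times_differentiable_on (Suc k) S f \<longleftrightarrow> (\<forall>x\<in>S. f differentiable (at x)) \<and>
     (\<forall>v. k_times_differentiable_on k S (\<lambda>x. frechet_derivative f (at x) v))"

definition smooth_on :: "'e::euclidean_space set \<Rightarrow> ('e \<Rightarrow> 'b::real_normed_vector) \<Rightarrow> bool" where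
  "smooth_on S f \<longleftrightarrow> (\<forall>k. k_times_differentiable_on k S f)"

text \<open>
  Every Euclidean space type has positive dimension. To include manifolds of dimension \<open>0\<close>, the
  model space is the coordinate subspace of \<^typ>\<open>'e\<close> spanned by a set \<open>B\<close> of standard basis vectors,
  a copy of \<open>\<real>\<^sup>n\<close> with \<open>n = card B\<close>. A function on a relatively open subset \<open>W\<close> of it is smooth
  iff its composition with the coordinate projection is smooth on the preimage of \<open>W\<close>.
\<close>

definition coord_proj :: "'e::euclidean_space set \<Rightarrow> 'e \<Rightarrow> 'e" where
  "coord_proj B x = (\<Sum>b\<in>B. (x \<bullet> b) *\<^sub>R b)"

definition smooth_in ::
  "'e::euclidean_space set \<Rightarrow> 'e set \<Rightarrow> ('e \<Rightarrow> 'b::real_normed_vector) \<Rightarrow> bool" where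
  "smooth_in B W f \<longleftrightarrow> smooth_on {x. coord_proj B x \<in> W} (\<lambda>x. f (coord_proj B x))"

text \<open>
  The underlying set and topology of a manifold are those of the type \<^typ>\<open>'a\<close>. Charts and local
  trivializations are given by an open domain together with a map; the values of that map outside
  the domain are irrelevant.
\<close>

record ('a, 'e) smooth_structure =
  model_basis :: "'e set"
  charts :: "('a set \<times> ('a \<Rightarrow> 'e)) set"

definition smooth_map_on ::
  "('a, 'e::euclidean_space) smooth_structure \<Rightarrow> 'a set \<Rightarrow> ('a \<Rightarrow> 'b::real_normed_vector) \<Rightarrow> bool"
  where
  "smooth_map_on N S f \<longleftrightarrow>
     (\<forall>(U, \<phi>)\<in>charts N. smooth_in (model_basis N) (\<phi> ` (U \<inter> S)) (\<lambda>x. f (inv_into U \<phi> x)))"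

locale smooth_manifold =
  fixes N :: "('a::{t2_space, second_countable_topology}, 'e::euclidean_space) smooth_structure"
  assumes model_basis: "model_basis N \<subseteq> Basis"
    and charts_open: "(U, \<phi>) \<in> charts N \<Longrightarrow> open U"
    and charts_image:
      "(U, \<phi>) \<in> charts N \<Longrightarrow> openin (top_of_set (span (model_basis N))) (\<phi> ` U)"
    and charts_homeomorphism:
      "(U, \<phi>) \<in> charts N \<Longrightarrow> homeomorphism U (\<phi> ` U) \<phi> (inv_into U \<phi>)"
    and charts_cover: "(\<Union>(U, \<phi>)\<in>charts N. U) = UNIV"
    and charts_compatible:
      "(U, \<phi>) \<in> charts N \<Longrightarrow> (W, \<psi>) \<in> charts N \<Longrightarrow>
         smooth_in (model_basis N) (\<phi> ` (U \<inter> W)) (\<lambda>x. \<psi> (inv_into U \<phi> x))"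

definition smooth_functions ::
  "('a, 'e::euclidean_space) smooth_structure \<Rightarrow> (real, 'a \<Rightarrow> real) module" where
  "smooth_functions N =
     \<lparr>carrier = {f. smooth_map_on N UNIV f},
      monoid.mult = (\<lambda>f g p. f p * g p), one = (\<lambda>p. 1),
      zero = (\<lambda>p. 0), add = (\<lambda>f g p. f p + g p),
      smult = (\<lambda>r f p. r * f p)\<rparr>"

locale poisson_manifold = smooth_manifold N
  for N :: "('a::{t2_space, second_countable_topology}, 'e::euclidean_space) smooth_structure" +
  fixes br :: "('a \<Rightarrow> real) \<Rightarrow> ('a \<Rightarrow> real) \<Rightarrow> 'a \<Rightarrow> real"
  assumes poisson_bracket: "poisson_bracket (smooth_functions N) br"


section \<open>Vector fields and one-forms\<close>

text \<open>
  Tangent vectors are derivations at a point; vector fields and one-forms are sections of the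
  tangent and cotangent bundles that are smooth in the sense that \<open>X f\<close>, respectively \<open>\<alpha>(X)\<close>,
  is a smooth function for every smooth function \<open>f\<close>, respectively smooth vector field \<open>X\<close>.
\<close>

type_synonym 'a tangent_vector = "('a \<Rightarrow> real) \<Rightarrow> real"
type_synonym 'a vector_field = "'a \<Rightarrow> 'a tangent_vector"
type_synonym 'a one_form = "'a \<Rightarrow> 'a tangent_vector \<Rightarrow> real"

definition tangent_space ::
  "('a, 'e::euclidean_space) smooth_structure \<Rightarrow> 'a \<Rightarrow> 'a tangent_vector set" where
  "tangent_space N p = {v \<in> extensional (carrier (smooth_functions N)).
     (\<forall>f\<in>carrier (smooth_functions N). \<forall>g\<in>carrier (smooth_functions N).
        v (\<lambda>x. f x + g x) = v f + v g) \<and>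
     (\<forall>c. \<forall>f\<in>carrier (smooth_functions N). v (\<lambda>x. c * f x) = c * v f) \<and>
     (\<forall>f\<in>carrier (smooth_functions N). \<forall>g\<in>carrier (smooth_functions N).
        v (\<lambda>x. f x * g x) = f p * v g + g p * v f)}"

definition cotangent_space ::
  "('a, 'e::euclidean_space) smooth_structure \<Rightarrow> 'a \<Rightarrow> ('a tangent_vector \<Rightarrow> real) set" where
  "cotangent_space N p = {w \<in> extensional (tangent_space N p).
     (\<forall>u\<in>tangent_space N p. \<forall>v\<in>tangent_space N p.
        w (\<lambda>f\<in>carrier (smooth_functions N). u f + v f) = w u + w v) \<and>
     (\<forall>c. \<forall>v\<in>tangent_space N p. w (\<lambda>f\<in>carrier (smooth_functions N). c * v f) = c * w v)}"

definition vector_fields ::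
  "('a, 'e::euclidean_space) smooth_structure \<Rightarrow> 'a vector_field set" where
  "vector_fields N = {X. (\<forall>p. X p \<in> tangent_space N p) \<and>
     (\<forall>f\<in>carrier (smooth_functions N). (\<lambda>p. X p f) \<in> carrier (smooth_functions N))}"

definition one_forms :: "('a, 'e::euclidean_space) smooth_structure \<Rightarrow> 'a one_form set" where
  "one_forms N = {\<alpha>. (\<forall>p. \<alpha> p \<in> cotangent_space N p) \<and>
     (\<forall>X\<in>vector_fields N. (\<lambda>p. \<alpha> p (X p)) \<in> carrier (smooth_functions N))}"

definition one_form_module ::
  "('a, 'e::euclidean_space) smooth_structure \<Rightarrow> ('a \<Rightarrow> real, 'a one_form) module" where
  "one_form_module N =
     \<lparr>carrier = one_forms N, monoid.mult = undefined, one = undefined,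
      zero = (\<lambda>p. \<lambda>v\<in>tangent_space N p. 0),
      add = (\<lambda>\<alpha> \<beta> p. \<lambda>v\<in>tangent_space N p. \<alpha> p v + \<beta> p v),
      smult = (\<lambda>f \<alpha> p. \<lambda>v\<in>tangent_space N p. f p * \<alpha> p v)\<rparr>"

definition exterior_d ::
  "('a, 'e::euclidean_space) smooth_structure \<Rightarrow> ('a \<Rightarrow> real) \<Rightarrow> 'a one_form" where
  "exterior_d N f = (\<lambda>p. \<lambda>v\<in>tangent_space N p. v f)"

definition vector_field_bracket ::
  "('a, 'e::euclidean_space) smooth_structure \<Rightarrow> 'a vector_field \<Rightarrow> 'a vector_field \<Rightarrow> 'a vector_field"
  where
  "vector_field_bracket N X Y =
     (\<lambda>p. \<lambda>f\<in>carrier (smooth_functions N). X p (\<lambda>q. Y q f) - Y p (\<lambda>q. X q f))"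

text \<open>
  The descriptions below are unique: every tangent vector is the value of a vector field, and every
  one-form is, near a given point, a combination of differentials of smooth functions.
\<close>

definition lie_derivative ::
  "('a, 'e::euclidean_space) smooth_structure \<Rightarrow> 'a vector_field \<Rightarrow> 'a one_form \<Rightarrow> 'a one_form" where
  "lie_derivative N X \<beta> = (THE \<gamma>. \<gamma> \<in> one_forms N \<and>
     (\<forall>Y\<in>vector_fields N. \<forall>p.
        \<gamma> p (Y p) = X p (\<lambda>q. \<beta> q (Y q)) - \<beta> p (vector_field_bracket N X Y p)))"

definition poisson_form ::
  "('a, 'e::euclidean_space) smooth_structure \<Rightarrow> (('a \<Rightarrow> real) \<Rightarrow> ('a \<Rightarrow> real) \<Rightarrow> 'a \<Rightarrow> real) \<Rightarrow>
   'a one_form \<Rightarrow> 'a one_form \<Rightarrow> 'a \<Rightarrow> real" where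
  "poisson_form N br = (let A = smooth_functions N; D = one_form_module N in
     (THE \<pi>. \<pi> \<in> carrier D \<rightarrow>\<^sub>E (carrier D \<rightarrow>\<^sub>E carrier A) \<and>
       (\<forall>\<alpha>\<in>carrier D. \<forall>\<beta>\<in>carrier D. \<forall>\<gamma>\<in>carrier D.
          \<pi> (\<alpha> \<oplus>\<^bsub>D\<^esub> \<beta>) \<gamma> = \<pi> \<alpha> \<gamma> \<oplus>\<^bsub>A\<^esub> \<pi> \<beta> \<gamma> \<and> \<pi> \<gamma> (\<alpha> \<oplus>\<^bsub>D\<^esub> \<beta>) = \<pi> \<gamma> \<alpha> \<oplus>\<^bsub>A\<^esub> \<pi> \<gamma> \<beta>) \<and>
       (\<forall>a\<in>carrier A. \<forall>\<alpha>\<in>carrier D. \<forall>\<beta>\<in>carrier D.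
          \<pi> (a \<odot>\<^bsub>D\<^esub> \<alpha>) \<beta> = a \<otimes>\<^bsub>A\<^esub> \<pi> \<alpha> \<beta> \<and> \<pi> \<alpha> (a \<odot>\<^bsub>D\<^esub> \<beta>) = a \<otimes>\<^bsub>A\<^esub> \<pi> \<alpha> \<beta>) \<and>
       (\<forall>\<alpha>\<in>carrier D. \<pi> \<alpha> \<alpha> = \<zero>\<^bsub>A\<^esub>) \<and>
       (\<forall>f\<in>carrier A. \<forall>g\<in>carrier A. \<pi> (exterior_d N f) (exterior_d N g) = br f g)))"

definition sharp ::
  "('a, 'e::euclidean_space) smooth_structure \<Rightarrow> (('a \<Rightarrow> real) \<Rightarrow> ('a \<Rightarrow> real) \<Rightarrow> 'a \<Rightarrow> real) \<Rightarrow>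
   'a one_form \<Rightarrow> 'a vector_field" where
  "sharp N br \<alpha> = (THE X. X \<in> vector_fields N \<and>
     (\<forall>\<beta>\<in>one_forms N. (\<lambda>p. \<beta> p (X p)) = poisson_form N br \<alpha> \<beta>))"

definition one_form_bracket ::
  "('a, 'e::euclidean_space) smooth_structure \<Rightarrow> (('a \<Rightarrow> real) \<Rightarrow> ('a \<Rightarrow> real) \<Rightarrow> 'a \<Rightarrow> real) \<Rightarrow>
   'a one_form \<Rightarrow> 'a one_form \<Rightarrow> 'a one_form" where
  "one_form_bracket N br \<alpha> \<beta> =
     (lie_derivative N (sharp N br \<alpha>) \<beta> \<ominus>\<^bsub>one_form_module N\<^esub> lie_derivative N (sharp N br \<beta>) \<alpha>)
     \<ominus>\<^bsub>one_form_module N\<^esub> exterior_d N (poisson_form N br \<alpha> \<beta>)"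

definition one_form_lie_rinehart ::
  "('a, 'e::euclidean_space) smooth_structure \<Rightarrow> (('a \<Rightarrow> real) \<Rightarrow> ('a \<Rightarrow> real) \<Rightarrow> 'a \<Rightarrow> real) \<Rightarrow>
   ('a \<Rightarrow> real, 'a one_form) lie_rinehart" where
  "one_form_lie_rinehart N br =
     module.extend (one_form_module N)
       (lie_rinehart.fields (one_form_bracket N br) (\<lambda>\<alpha> f p. sharp N br \<alpha> p f))"

text \<open>The \<open>A\<close>-linear map \<open>q\<close> sending a formal differential \<open>du\<close> to the differential form \<open>du\<close>.\<close>

definition kaehler_to_forms ::
  "('a, 'e::euclidean_space) smooth_structure \<Rightarrow>
   (('a \<Rightarrow> real) \<Rightarrow> 'a \<Rightarrow> real) set \<Rightarrow> 'a one_form" where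
  "kaehler_to_forms N = (let A = smooth_functions N in
     (THE h. h \<in> mod_hom A (kaehler A) (one_form_module N) \<and> h \<in> extensional (carrier (kaehler A)) \<and>
       (\<forall>u\<in>carrier A. h (kaehler_d A u) = exterior_d N u)))"


section \<open>Vector bundles\<close>

text \<open>
  The total space of a vector bundle is the disjoint union of its fibres, a family of finite
  dimensional real vector spaces indexed by the points of the base. They are realized as subspaces
  of one vector space type \<^typ>\<open>'v\<close>, which carries no topology: all smoothness is relative to local
  trivializations \<open>(U, \<tau>)\<close>, where \<open>\<tau> p\<close> maps the fibre over \<open>p \<in> U\<close> linearly and bijectively to a
  fixed subspace of a Euclidean space (possibly \<open>0\<close>, so rank \<open>0\<close> is included). Transition
  functions are required to be smooth.
\<close>

record ('a, 'v, 'f) vector_bundle =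
  fibre_model :: "'f set"
  fibre :: "'a \<Rightarrow> 'v set"
  trivializations :: "('a set \<times> ('a \<Rightarrow> 'v \<Rightarrow> 'f)) set"

locale smooth_vector_bundle = smooth_manifold N
  for N :: "('a::{t2_space, second_countable_topology}, 'e::euclidean_space) smooth_structure" +
  fixes Z :: "('a, 'v::real_vector, 'f::euclidean_space) vector_bundle"
  assumes subspace_fibre_model: "subspace (fibre_model Z)"
    and subspace_fibre: "subspace (fibre Z p)"
    and trivializations_open: "(U, \<tau>) \<in> trivializations Z \<Longrightarrow> open U"
    and trivializations_bij:
      "(U, \<tau>) \<in> trivializations Z \<Longrightarrow> p \<in> U \<Longrightarrow> bij_betw (\<tau> p) (fibre Z p) (fibre_model Z)"
    and trivializations_linear:
      "(U, \<tau>) \<in> trivializations Z \<Longrightarrow> p \<in> U \<Longrightarrow> x \<in> fibre Z p \<Longrightarrow> y \<in> fibre Z p \<Longrightarrow>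
         \<tau> p (r *\<^sub>R x + y) = r *\<^sub>R \<tau> p x + \<tau> p y"
    and trivializations_cover: "(\<Union>(U, \<tau>)\<in>trivializations Z. U) = UNIV"
    and trivializations_compatible:
      "(U, \<tau>) \<in> trivializations Z \<Longrightarrow> (W, \<sigma>) \<in> trivializations Z \<Longrightarrow> w \<in> fibre_model Z \<Longrightarrow>
         smooth_map_on N (U \<inter> W) (\<lambda>p. \<sigma> p (inv_into (fibre Z p) (\<tau> p) w))"

definition smooth_sections ::
  "('a, 'e::euclidean_space) smooth_structure \<Rightarrow>
   ('a, 'v::real_vector, 'f::euclidean_space) vector_bundle \<Rightarrow> ('a \<Rightarrow> real, 'a \<Rightarrow> 'v) module" where
  "smooth_sections N Z =
     \<lparr>carrier = {s. (\<forall>p. s p \<in> fibre Z p) \<and>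
        (\<forall>(U, \<tau>)\<in>trivializations Z. smooth_map_on N U (\<lambda>p. \<tau> p (s p)))},
      monoid.mult = undefined, one = undefined,
      zero = (\<lambda>p. 0), add = (\<lambda>s t p. s p + t p),
      smult = (\<lambda>f s p. f p *\<^sub>R s p)\<rparr>"


section \<open>Poisson cohomology\<close>

definition geometric_cochains where
  "geometric_cochains N br Z =
     alt_complex (smooth_functions N) (one_form_lie_rinehart N br) (smooth_sections N Z)"

definition geometric_differential where
  "geometric_differential N br Z \<omega> =
     alt_differential (one_form_lie_rinehart N br) (smooth_sections N Z) \<omega>"

definition algebraic_cochains where
  "algebraic_cochains A br M = alt_complex A (kaehler_lie_rinehart A br) M"

definition algebraic_differential where
  "algebraic_differential A br M \<omega> = alt_differential (kaehler_lie_rinehart A br) M \<omega>"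

definition kaehler_connection ::
  "('a, 'e::euclidean_space) smooth_structure \<Rightarrow> ('a one_form \<Rightarrow> ('a \<Rightarrow> 'v) \<Rightarrow> 'a \<Rightarrow> 'v) \<Rightarrow>
   (('a \<Rightarrow> real) \<Rightarrow> 'a \<Rightarrow> real) set \<Rightarrow> ('a \<Rightarrow> 'v) \<Rightarrow> 'a \<Rightarrow> 'v" where
  "kaehler_connection N \<omega> = (\<lambda>x. \<omega> (kaehler_to_forms N x))"

definition q_pullback where
  "q_pullback N br = alt_pullback (kaehler_lie_rinehart (smooth_functions N) br) (kaehler_to_forms N)"

definition manifold_poisson_cohomology where
  "manifold_poisson_cohomology N br Z \<omega> =
     cohomology (geometric_cochains N br Z) (geometric_differential N br Z \<omega>)"

definition algebra_poisson_cohomology where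
  "algebra_poisson_cohomology A br M \<omega> =
     cohomology (algebraic_cochains A br M) (algebraic_differential A br M \<omega>)"

end

theory Submission
  imports Defs "HOL-Library.Function_Algebras"
begin

text \<open>
  Write \<open>A\<close> for the smooth functions, \<open>\<Omega>\<close> for the formal differentials of \<open>A\<close> and \<open>q\<close> for the map
  from \<open>\<Omega>\<close> to one-forms. The kernel of \<open>q\<close> is in general large, yet no alternating form with values in sections
  of a vector bundle can see it. Fix a form \<open>f\<close> on \<open>\<Omega>\<close>, a point \<open>p\<close>, all arguments but one, and a
  coordinate on the finite-dimensional fibre at \<open>p\<close>. The coordinate of \<open>f(\<dots>, du, \<dots>)\<close> at \<open>p\<close> is a
  derivation at \<open>p\<close> in the function \<open>u\<close>, hence a tangent vector \<open>v\<close>; by linearity over \<open>A\<close> the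
  coordinate of \<open>f(\<dots>, x, \<dots>)\<close> is then \<open>q(x)\<^sub>p(v)\<close> for every \<open>x\<close>. So \<open>f(x\<^sub>1, \<dots>, x\<^sub>n)\<close> at \<open>p\<close> depends only
  on the cotangent vectors \<open>q(x\<^sub>i)\<^sub>p\<close> (\<open>KF_local\<close>), and \<open>f\<close> descends to a function \<open>F\<close> of one-forms.

  Smoothness of the values of \<open>F\<close>, and the uniqueness of \<open>F\<close>, rest on local frames
  (\<open>local_frame_exists\<close>). Hadamard's lemma in a chart, multiplied by a bump function, yields globally
  defined functions \<open>u\<^sub>i\<close>, vector fields \<open>E\<^sub>i\<close> and a function \<open>\<eta>\<close> with \<open>\<eta>(p) \<noteq> 0\<close> such that
  \<open>\<eta> \<alpha> = \<Sum>\<^sub>i \<alpha>(E\<^sub>i) du\<^sub>i\<close> for all one-forms \<open>\<alpha>\<close>. Hence \<open>\<eta> \<alpha>\<close> lies in the image of \<open>q\<close>, and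
  \<open>\<eta>\<^sup>n F(\<alpha>\<^sub>1, \<dots>, \<alpha>\<^sub>n) = f(x\<^sub>1, \<dots>, x\<^sub>n)\<close> for \<open>x\<^sub>i\<close> with \<open>q(x\<^sub>i) = \<eta> \<alpha>\<^sub>i\<close>, which is a smooth section. Division by
  \<open>\<eta>\<close> near \<open>p\<close> shows that \<open>F\<close> has smooth values (\<open>descend_smooth\<close>). Therefore \<open>q\<^sup>*\<close> is bijective in each
  degree (\<open>q_pullback_bij\<close>).

  The same frames justify the geometric objects, which are given by unique description: the Lie
  derivative of a one-form (\<open>lie_derivative\<close>), the Poisson bivector and the map \<open>\<alpha> \<mapsto> \<alpha>\<^sup>\<sharp>\<close>. On the
  algebraic side, \<open>q\<close> and the bracket of \<open>\<Omega>\<close> come from a universal property for first-order operators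
  (\<open>kaehler_first_order_extension\<close>). Both brackets are biadditive and have the same values on elements
  \<open>a du\<close>, so \<open>q\<close> preserves brackets (\<open>q_bracket\<close>) and \<open>q\<^sup>*\<close> commutes with the differentials.

  That the differential preserves alternating forms, preserves linearity over \<open>A\<close> and squares to zero
  is proved by induction on the degree from Cartan's formula \<open>\<iota>\<^sub>x d = L\<^sub>x - d \<iota>\<^sub>x\<close> (\<open>differential_Cons\<close>).
  For \<open>d\<^sup>2 = 0\<close>, a form is determined by its values on exact one-forms
  (\<open>forms_determined_on_exact\<close>), and there \<open>d\<close> is the Chevalley-Eilenberg differential of the Lie
  algebra \<open>(A, {\<cdot>, \<cdot>})\<close>, which acts on sections by \<open>u \<mapsto> \<omega>(du)\<close>. The axioms of the algebraic complex are
  transported along \<open>q\<^sup>*\<close>, and an isomorphism of complexes induces isomorphisms in cohomology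
  (\<open>cohomology_iso\<close>).
\<close>

section \<open>Calculus of smooth maps between Euclidean spaces\<close>

lemma k_times_differentiable_on_subset:
  "k_times_differentiable_on k S f \<Longrightarrow> T \<subseteq> S \<Longrightarrow> k_times_differentiable_on k T f"
  by (induction k arbitrary: f) (auto intro: continuous_on_subset)

lemma frechet_derivative_cong_open:
  assumes "open S" "x \<in> S" "\<And>y. y \<in> S \<Longrightarrow> f y = g y" "f differentiable (at x)"
  shows "g differentiable (at x)" "frechet_derivative g (at x) = frechet_derivative f (at x)"
proof -
  have "(f has_derivative frechet_derivative f (at x)) (at x)"
    using assms(4) by (simp add: frechet_derivative_works)
  then have *: "(g has_derivative frechet_derivative f (at x)) (at x)"
    using assms(1-3) by (rule has_derivative_transform_within_open)
  then show "g differentiable (at x)"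
    by (rule differentiableI)
  show "frechet_derivative g (at x) = frechet_derivative f (at x)"
    using frechet_derivative_at[OF *] by (rule sym)
qed

lemma k_times_differentiable_on_cong:
  assumes "open S" "\<And>x. x \<in> S \<Longrightarrow> f x = g x" "k_times_differentiable_on k S f"
  shows "k_times_differentiable_on k S g"
  using assms(2,3)
proof (induction k arbitrary: f g)
  case 0
  then show ?case using continuous_on_cong[of S S f g] by simp
next
  case (Suc k)
  note D = frechet_derivative_cong_open[OF assms(1) _ Suc.prems(1)]
  have "\<forall>x\<in>S. g differentiable (at x)"
    using D(1) Suc.prems(2) by auto
  moreover have "k_times_differentiable_on k S (\<lambda>x. frechet_derivative g (at x) v)" for v
    by (rule Suc.IH[of "\<lambda>x. frechet_derivative f (at x) v"]) (use D(2) Suc.prems(2) in auto)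
  ultimately show ?case by simp
qed

lemma k_times_differentiable_on_pred:
  "k_times_differentiable_on (Suc k) S f \<Longrightarrow> k_times_differentiable_on k S f"
proof (induction k arbitrary: f)
  case 0
  then have "isCont f x" if "x \<in> S" for x
    using that by (intro differentiable_imp_continuous_within) simp
  then show ?case
    by (simp add: continuous_at_imp_continuous_on)
next
  case (Suc k)
  show ?case
    unfolding k_times_differentiable_on.simps(2)[of k]
  proof (intro conjI ballI allI)
    show "f differentiable (at x)" if "x \<in> S" for x
      using Suc.prems that by auto
    show "k_times_differentiable_on k S (\<lambda>x. frechet_derivative f (at x) v)" for v
      by (rule Suc.IH) (use Suc.prems in auto)
  qed
qed

lemma k_times_differentiable_on_continuous:
  "k_times_differentiable_on k S f \<Longrightarrow> continuous_on S f"
  by (induction k) (auto dest: k_times_differentiable_on_pred simp del: k_times_differentiable_on.simps(2))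

lemma k_times_differentiable_on_local:
  assumes "\<And>x. x \<in> S \<Longrightarrow> \<exists>T. open T \<and> x \<in> T \<and> k_times_differentiable_on k T f"
  shows "k_times_differentiable_on k S f"
  using assms
proof (induction k arbitrary: f)
  case 0
  have "isCont f x" if "x \<in> S" for x
    using 0[OF that] by (auto simp: continuous_on_eq_continuous_at)
  then show ?case
    by (simp add: continuous_at_imp_continuous_on)
next
  case (Suc k)
  have "f differentiable (at x)" if "x \<in> S" for x
    using Suc.prems[OF that] by auto
  moreover have "k_times_differentiable_on k S (\<lambda>x. frechet_derivative f (at x) v)" for v
    by (rule Suc.IH) (use Suc.prems in fastforce)
  ultimately show ?case by simp
qed

text \<open>
  Reduces differentiability of order \<open>k + 1\<close> to a pointwise formula for the derivative, together
  with differentiability of order \<open>k\<close> of the terms of that formula.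
\<close>

lemma k_times_differentiable_on_SucI:
  assumes "open S" "\<And>x. x \<in> S \<Longrightarrow> (f has_derivative D x) (at x)"
    and "\<And>v. k_times_differentiable_on k S (\<lambda>x. D x v)"
  shows "k_times_differentiable_on (Suc k) S f"
proof -
  have "k_times_differentiable_on k S (\<lambda>x. frechet_derivative f (at x) v)" for v
    by (rule k_times_differentiable_on_cong[OF assms(1) _ assms(3)[of v]])
      (use assms(2) frechet_derivative_at in metis)
  then show ?thesis
    using assms(2) by (auto simp: differentiable_def)
qed

lemma k_times_differentiable_on_has_derivative:
  "k_times_differentiable_on (Suc k) S f \<Longrightarrow> x \<in> S \<Longrightarrow>
    (f has_derivative frechet_derivative f (at x)) (at x)"
  by (simp add: frechet_derivative_works)

lemma k_times_differentiable_on_const: "k_times_differentiable_on k S (\<lambda>x. c)"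
proof (induction k arbitrary: c)
  case (Suc k)
  have "frechet_derivative (\<lambda>x. c) (at x) v = 0" for x v
    by (simp add: frechet_derivative_const)
  with Suc show ?case by simp
qed auto

lemma k_times_differentiable_on_bounded_linear:
  assumes "open S" "bounded_linear L" "k_times_differentiable_on k S f"
  shows "k_times_differentiable_on k S (\<lambda>x. L (f x))"
  using assms(3)
proof (induction k arbitrary: f)
  case 0
  then show ?case
    using assms(2) by (auto intro: linear_continuous_on_compose bounded_linear.continuous_on)
next
  case (Suc k)
  show ?case
  proof (rule k_times_differentiable_on_SucI[OF assms(1)])
    show "((\<lambda>x. L (f x)) has_derivative (\<lambda>v. L (frechet_derivative f (at x) v))) (at x)"
      if "x \<in> S" for x
      using bounded_linear.has_derivative[OF assms(2)]
        k_times_differentiable_on_has_derivative[OF Suc.prems that] by blast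
    show "k_times_differentiable_on k S (\<lambda>x. L (frechet_derivative f (at x) v))" for v
      by (rule Suc.IH) (use Suc.prems in auto)
  qed
qed

lemma k_times_differentiable_on_ident: 
  assumes "open S" shows "k_times_differentiable_on k S (\<lambda>x. x)"
proof (cases k)
  case (Suc m)
  then show ?thesis
    using k_times_differentiable_on_SucI[OF assms, of "\<lambda>x. x" "\<lambda>x v. v" m]
      k_times_differentiable_on_const by auto
qed auto

lemma k_times_differentiable_on_add:
  assumes "open S" "k_times_differentiable_on k S f" "k_times_differentiable_on k S g"
  shows "k_times_differentiable_on k S (\<lambda>x. f x + g x)"
  using assms(2,3)
proof (induction k arbitrary: f g)
  case 0
  then show ?case by (auto intro: continuous_intros)
next
  case (Suc k)
  show ?case
  proof (rule k_times_differentiable_on_SucI[OF assms(1)])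
    show "((\<lambda>x. f x + g x) has_derivative
        (\<lambda>v. frechet_derivative f (at x) v + frechet_derivative g (at x) v)) (at x)"
      if "x \<in> S" for x
      using Suc.prems[THEN k_times_differentiable_on_has_derivative, OF that]
      by (rule has_derivative_add)
    show "k_times_differentiable_on k S
        (\<lambda>x. frechet_derivative f (at x) v + frechet_derivative g (at x) v)" for v
      by (rule Suc.IH) (use Suc.prems in auto)
  qed
qed

lemma k_times_differentiable_on_sum:
  assumes "open S" "\<And>i. i \<in> I \<Longrightarrow> k_times_differentiable_on k S (f i)"
  shows "k_times_differentiable_on k S (\<lambda>x. \<Sum>i\<in>I. f i x)"
  using assms(2)
  by (induction I rule: infinite_finite_induct)
    (auto simp: k_times_differentiable_on_const intro: k_times_differentiable_on_add[OF assms(1)])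

lemma k_times_differentiable_on_bilinear:
  assumes "open S" "bounded_bilinear pr"
    and "k_times_differentiable_on k S f" "k_times_differentiable_on k S g"
  shows "k_times_differentiable_on k S (\<lambda>x. pr (f x) (g x))"
  using assms(3,4)
proof (induction k arbitrary: f g)
  case 0
  then show ?case
    by (auto intro: bounded_bilinear.continuous_on[OF assms(2)])
next
  case (Suc k)
  show ?case
  proof (rule k_times_differentiable_on_SucI[OF assms(1)])
    show "((\<lambda>x. pr (f x) (g x)) has_derivative
        (\<lambda>v. pr (f x) (frechet_derivative g (at x) v) + pr (frechet_derivative f (at x) v) (g x))) (at x)"
      if "x \<in> S" for x
      using Suc.prems[THEN k_times_differentiable_on_has_derivative, OF that]
      by (rule bounded_bilinear.FDERIV[OF assms(2)])
    show "k_times_differentiable_on k S (\<lambda>x. pr (f x) (frechet_derivative g (at x) v)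
        + pr (frechet_derivative f (at x) v) (g x))" for v
      by (rule k_times_differentiable_on_add[OF assms(1)];
          rule Suc.IH; use Suc.prems[THEN k_times_differentiable_on_pred] Suc.prems in simp)
  qed
qed

lemma k_times_differentiable_on_compose:
  fixes f :: "'d::euclidean_space \<Rightarrow> 'e::euclidean_space"
  assumes "open S" "open T" "f ` S \<subseteq> T"
    and "k_times_differentiable_on k T g" "k_times_differentiable_on k S f"
  shows "k_times_differentiable_on k S (\<lambda>x. g (f x))"
  using assms(4,5)
proof (induction k arbitrary: g)
  case 0
  then show ?case
    using assms(3) by (auto intro: continuous_on_compose2)
next
  case (Suc k)
  let ?Df = "\<lambda>x. frechet_derivative f (at x)" and ?Dg = "\<lambda>y. frechet_derivative g (at y)"
  show ?case
  proof (rule k_times_differentiable_on_SucI[OF assms(1)])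
    fix x assume x: "x \<in> S"
    then have Dg: "(g has_derivative ?Dg (f x)) (at (f x))"
      using k_times_differentiable_on_has_derivative[OF Suc.prems(1), of "f x"] assms(3) by auto
    have *: "((\<lambda>x. g (f x)) has_derivative (\<lambda>v. ?Dg (f x) (?Df x v))) (at x)"
      using has_derivative_compose[OF k_times_differentiable_on_has_derivative[OF Suc.prems(2) x] Dg] .
    \<comment> \<open>In coordinates the derivative of \<open>g \<circ> f\<close> is a sum of products of real functions with maps of the
        form \<open>D \<circ> f\<close>, to which the induction hypothesis and the product rule apply.\<close>
    have "?Dg (f x) w = (\<Sum>b\<in>Basis. (w \<bullet> b) *\<^sub>R ?Dg (f x) b)" for w
    proof -
      interpret linear "?Dg (f x)" using Dg by (rule has_derivative_linear)
      show ?thesis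
        by (subst euclidean_representation[of w, symmetric]) (simp only: sum scale)
    qed
    then have "(\<lambda>v. ?Dg (f x) (?Df x v)) = (\<lambda>v. \<Sum>b\<in>Basis. (?Df x v \<bullet> b) *\<^sub>R ?Dg (f x) b)"
      by blast
    with * show "((\<lambda>x. g (f x)) has_derivative
        (\<lambda>v. \<Sum>b\<in>Basis. (?Df x v \<bullet> b) *\<^sub>R ?Dg (f x) b)) (at x)"
      by (rule subst[rotated])
  next
    fix v
    have f: "k_times_differentiable_on k S f"
      using Suc.prems(2) by (rule k_times_differentiable_on_pred)
    have *: "k_times_differentiable_on k S (\<lambda>x. ?Df x v \<bullet> b)" for b
      by (rule k_times_differentiable_on_bounded_linear[OF assms(1) bounded_linear_inner_left])
        (use Suc.prems(2) in simp)
    have **: "k_times_differentiable_on k S (\<lambda>x. ?Dg (f x) b)" for b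
      by (rule Suc.IH[OF _ f]) (use Suc.prems(1) in simp)
    show "k_times_differentiable_on k S (\<lambda>x. \<Sum>b\<in>Basis. (?Df x v \<bullet> b) *\<^sub>R ?Dg (f x) b)"
      by (rule k_times_differentiable_on_sum[OF assms(1)],
          rule k_times_differentiable_on_bilinear[OF assms(1) bounded_bilinear_scaleR * **])
  qed
qed

lemma k_times_differentiable_on_inverse:
  fixes f :: "'e::euclidean_space \<Rightarrow> real"
  assumes "open S" "\<And>x. x \<in> S \<Longrightarrow> f x \<noteq> 0" "k_times_differentiable_on k S f"
  shows "k_times_differentiable_on k S (\<lambda>x. inverse (f x))"
  using assms(3)
proof (induction k)
  case 0
  then show ?case
    using assms(2) by (auto intro: continuous_on_inverse)
next
  case (Suc k)
  let ?Df = "\<lambda>x. frechet_derivative f (at x)"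
  show ?case
  proof (rule k_times_differentiable_on_SucI[OF assms(1)])
    \<comment> \<open>Writing the sign as a factor makes the derivative a product of functions.\<close>
    show "((\<lambda>x. inverse (f x)) has_derivative
        (\<lambda>v. - 1 * (inverse (f x) * ?Df x v * inverse (f x)))) (at x)" if "x \<in> S" for x
      using Deriv.has_derivative_inverse[OF assms(2)[OF that]
          k_times_differentiable_on_has_derivative[OF Suc.prems that]] by simp
    show "k_times_differentiable_on k S
        (\<lambda>x. - 1 * (inverse (f x) * ?Df x v * inverse (f x)))" for v
      using Suc.prems
      by (intro k_times_differentiable_on_bilinear[OF assms(1) bounded_bilinear_mult]
          Suc.IH[OF k_times_differentiable_on_pred[OF Suc.prems]] k_times_differentiable_on_const)
        simp
  qed
qed

lemma smooth_on_subset: "smooth_on S f \<Longrightarrow> T \<subseteq> S \<Longrightarrow> smooth_on T f"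
  unfolding smooth_on_def using k_times_differentiable_on_subset by blast

lemma smooth_on_cong: "open S \<Longrightarrow> (\<And>x. x \<in> S \<Longrightarrow> f x = g x) \<Longrightarrow> smooth_on S f \<Longrightarrow> smooth_on S g"
  unfolding smooth_on_def using k_times_differentiable_on_cong by blast

lemma smooth_on_local:
  "(\<And>x. x \<in> S \<Longrightarrow> \<exists>T. open T \<and> x \<in> T \<and> smooth_on T f) \<Longrightarrow> smooth_on S f"
  unfolding smooth_on_def using k_times_differentiable_on_local by meson

lemma smooth_on_differentiable: "smooth_on S f \<Longrightarrow> x \<in> S \<Longrightarrow> f differentiable (at x)"
  unfolding smooth_on_def using k_times_differentiable_on.simps(2) by blast

lemma smooth_on_has_derivative:
  "smooth_on S f \<Longrightarrow> x \<in> S \<Longrightarrow> (f has_derivative frechet_derivative f (at x)) (at x)"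
  using smooth_on_differentiable frechet_derivative_works by blast

lemma smooth_on_frechet_derivative:
  "smooth_on S f \<Longrightarrow> smooth_on S (\<lambda>x. frechet_derivative f (at x) v)"
  unfolding smooth_on_def using k_times_differentiable_on.simps(2) by blast

lemma smooth_on_continuous: "smooth_on S f \<Longrightarrow> continuous_on S f"
  unfolding smooth_on_def using k_times_differentiable_on_continuous by blast

lemma smooth_on_const: "smooth_on S (\<lambda>x. c)"
  by (simp add: smooth_on_def k_times_differentiable_on_const)

lemma smooth_on_ident: "open S \<Longrightarrow> smooth_on S (\<lambda>x. x)"
  by (simp add: smooth_on_def k_times_differentiable_on_ident)

lemma smooth_on_bounded_linear:
  "open S \<Longrightarrow> bounded_linear L \<Longrightarrow> smooth_on S f \<Longrightarrow> smooth_on S (\<lambda>x. L (f x))"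
  by (simp add: smooth_on_def k_times_differentiable_on_bounded_linear)

lemma smooth_on_add:
  "open S \<Longrightarrow> smooth_on S f \<Longrightarrow> smooth_on S g \<Longrightarrow> smooth_on S (\<lambda>x. f x + g x)"
  by (simp add: smooth_on_def k_times_differentiable_on_add)

lemma smooth_on_scaleR:
  "open S \<Longrightarrow> smooth_on S f \<Longrightarrow> smooth_on S g \<Longrightarrow> smooth_on S (\<lambda>x. f x *\<^sub>R g x)"
  by (simp add: smooth_on_def k_times_differentiable_on_bilinear bounded_bilinear_scaleR)

lemma smooth_on_mult:
  fixes f g :: "'e::euclidean_space \<Rightarrow> real"
  shows "open S \<Longrightarrow> smooth_on S f \<Longrightarrow> smooth_on S g \<Longrightarrow> smooth_on S (\<lambda>x. f x * g x)"
  by (simp add: smooth_on_def k_times_differentiable_on_bilinear bounded_bilinear_mult)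

lemma smooth_on_minus:
  fixes f g :: "'e::euclidean_space \<Rightarrow> real"
  shows "open S \<Longrightarrow> smooth_on S f \<Longrightarrow> smooth_on S g \<Longrightarrow> smooth_on S (\<lambda>x. f x - g x)"
  using smooth_on_add[of S f "\<lambda>x. - g x"] smooth_on_bounded_linear[of S uminus g]
  by (simp add: bounded_linear_minus[OF bounded_linear_ident])

lemma smooth_on_compose:
  fixes f :: "'d::euclidean_space \<Rightarrow> 'e::euclidean_space"
  shows "open S \<Longrightarrow> open T \<Longrightarrow> f ` S \<subseteq> T \<Longrightarrow> smooth_on T g \<Longrightarrow> smooth_on S f \<Longrightarrow>
    smooth_on S (\<lambda>x. g (f x))"
  unfolding smooth_on_def by (auto intro: k_times_differentiable_on_compose)

lemma smooth_on_inverse: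
  fixes f :: "'e::euclidean_space \<Rightarrow> real"
  shows "open S \<Longrightarrow> (\<And>x. x \<in> S \<Longrightarrow> f x \<noteq> 0) \<Longrightarrow> smooth_on S f \<Longrightarrow> smooth_on S (\<lambda>x. inverse (f x))"
  by (simp add: smooth_on_def k_times_differentiable_on_inverse)


section \<open>Bump functions\<close>

text \<open>
  The functions \<open>t \<mapsto> t\<^sup>-\<^sup>n e\<^sup>-\<^sup>1\<^sup>/\<^sup>t\<close>, extended by \<open>0\<close> to \<open>t \<le> 0\<close>. The span of these functions is
  closed under differentiation, so smoothness is proved for all \<open>n\<close> at once.
\<close>

definition flat_exp :: "nat \<Rightarrow> real \<Rightarrow> real" where
  "flat_exp n t = (if t > 0 then inverse t ^ n * exp (- inverse t) else 0)"

lemma flat_exp_tendsto_0: "(flat_exp n \<longlongrightarrow> 0) (at 0)"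
proof -
  have "((\<lambda>t. inverse t ^ n / exp (inverse t)) \<longlongrightarrow> 0) (at_right (0::real))"
    using filterlim_compose[OF tendsto_power_div_exp_0[of n] filterlim_inverse_at_top_right] .
  then have "(flat_exp n \<longlongrightarrow> 0) (at_right 0)"
    by (rule Lim_transform_eventually)
      (auto simp: flat_exp_def exp_minus divide_inverse eventually_at_filter)
  moreover have "(flat_exp n \<longlongrightarrow> 0) (at_left 0)"
    by (rule tendsto_eventually) (auto simp: flat_exp_def eventually_at_filter)
  ultimately show ?thesis
    by (simp add: filterlim_split_at)
qed

lemma flat_exp_has_derivative:
  "(flat_exp n has_field_derivative (flat_exp (n + 2) t - real n * flat_exp (n + 1) t)) (at t)"
proof -
  consider "t > 0" | "t < 0" | "t = 0" by linarith
  then show ?thesis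
  proof cases
    case 1
    have "((\<lambda>t. inverse t ^ n * exp (- inverse t)) has_field_derivative
        (flat_exp (n + 2) t - real n * flat_exp (n + 1) t)) (at t)"
      using 1 by (auto intro!: derivative_eq_intros simp: flat_exp_def divide_simps)
        (cases n; simp add: field_simps power2_eq_square)
    then show ?thesis
      by (rule has_field_derivative_transform_within_open[where S="{0<..}"])
        (use 1 in \<open>auto simp: flat_exp_def\<close>)
  next
    case 2
    have "((\<lambda>t. 0) has_field_derivative (flat_exp (n + 2) t - real n * flat_exp (n + 1) t)) (at t)"
      using 2 by (auto simp: flat_exp_def)
    then show ?thesis
      by (rule has_field_derivative_transform_within_open[where S="{..<0}"])
        (use 2 in \<open>auto simp: flat_exp_def\<close>)
  next
    case 3
    \<comment> \<open>The difference quotient of the function with index \<open>n\<close> at \<open>0\<close> is the function with index \<open>n + 1\<close>.\<close>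
    have "((\<lambda>h. (flat_exp n (0 + h) - flat_exp n 0) / h) \<longlongrightarrow> 0) (at 0)"
      by (rule Lim_transform_eventually[OF flat_exp_tendsto_0[of "Suc n"]])
        (auto simp: flat_exp_def eventually_at_filter field_simps)
    then show ?thesis
      using 3 by (simp add: DERIV_def flat_exp_def)
  qed
qed

lemma smooth_on_flat_exp: "smooth_on UNIV (flat_exp n)"
proof -
  have "k_times_differentiable_on k UNIV (flat_exp n)" for k
  proof (induction k arbitrary: n)
    case 0
    show ?case
      using DERIV_isCont[OF flat_exp_has_derivative] by (simp add: continuous_on_eq_continuous_at)
  next
    case (Suc k)
    show ?case
    proof (rule k_times_differentiable_on_SucI)
      show "(flat_exp n has_derivative
          (\<lambda>v. flat_exp (n + 2) t * v + (- real n) * (flat_exp (n + 1) t * v))) (at t)" for t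
        by (rule has_derivative_eq_rhs[OF flat_exp_has_derivative[of n t, THEN has_field_derivative_imp_has_derivative]])
          (simp add: algebra_simps fun_eq_iff)
      show "k_times_differentiable_on k UNIV
          (\<lambda>t. flat_exp (n + 2) t * v + (- real n) * (flat_exp (n + 1) t * v))" for v
        by (intro k_times_differentiable_on_add
            k_times_differentiable_on_bilinear[OF _ bounded_bilinear_mult]
            k_times_differentiable_on_const Suc.IH open_UNIV)
    qed auto
  qed
  then show ?thesis by (simp add: smooth_on_def)
qed

lemma bump_function_exists:
  fixes x0 :: "'e::euclidean_space"
  assumes "s > 0"
  shows "\<exists>\<rho>::'e \<Rightarrow> real. smooth_on UNIV \<rho> \<and> \<rho> x0 \<noteq> 0 \<and> (\<forall>x. x \<notin> cball x0 s \<longrightarrow> \<rho> x = 0)"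
proof (intro exI conjI)
  let ?\<rho> = "\<lambda>x. flat_exp 0 (s\<^sup>2 - (x - x0) \<bullet> (x - x0))"
  have "k_times_differentiable_on k UNIV (\<lambda>x. x - x0)" for k
    using k_times_differentiable_on_add[OF open_UNIV k_times_differentiable_on_ident[OF open_UNIV]
        k_times_differentiable_on_const[of _ _ "- x0"]] by simp
  then have "smooth_on UNIV (\<lambda>x. (x - x0) \<bullet> (x - x0))"
    unfolding smooth_on_def
    by (intro allI k_times_differentiable_on_bilinear[OF open_UNIV bounded_bilinear_inner])
  then have "smooth_on UNIV (\<lambda>x. s\<^sup>2 - (x - x0) \<bullet> (x - x0))"
    by (intro smooth_on_minus smooth_on_const open_UNIV)
  then show "smooth_on UNIV ?\<rho>"
    by (rule smooth_on_compose[OF open_UNIV open_UNIV _ smooth_on_flat_exp, rotated]) auto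
  show "?\<rho> x0 \<noteq> 0"
    using assms by (simp add: flat_exp_def)
  show "\<forall>x. x \<notin> cball x0 s \<longrightarrow> ?\<rho> x = 0"
  proof (intro allI impI)
    fix x assume "x \<notin> cball x0 s"
    then have "s < norm (x - x0)" by (simp add: dist_norm norm_minus_commute)
    then have "s\<^sup>2 < (norm (x - x0))\<^sup>2" using assms by (intro power_strict_mono) auto
    then show "?\<rho> x = 0" by (simp add: flat_exp_def power2_norm_eq_inner)
  qed
qed


section \<open>Hadamard's lemma\<close>

lemma segment_in_ball:
  fixes z :: "'e::real_normed_vector"
  assumes "z \<in> ball x0 r" "x \<in> ball x0 r" "0 \<le> t" "t \<le> 1"
  shows "z + t *\<^sub>R (x - z) \<in> ball x0 r"
proof -
  have "(1 - t) *\<^sub>R z + t *\<^sub>R x \<in> ball x0 r"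
    using convex_ball[of x0 r] assms unfolding convex_alt by blast
  then show ?thesis by (simp add: algebra_simps)
qed

lemma continuous_on_segment_compose:
  fixes z :: "'e::real_normed_vector"
  assumes "z \<in> ball x0 r" "continuous_on (ball x0 r) g"
  shows "continuous_on (ball x0 r \<times> {0..1}) (\<lambda>p. g (z + snd p *\<^sub>R (fst p - z)))"
proof (rule continuous_on_compose2[OF assms(2)])
  show "continuous_on (ball x0 r \<times> {0..1}) (\<lambda>p. z + snd p *\<^sub>R (fst p - z))"
    by (intro continuous_intros)
qed (use segment_in_ball[OF assms(1)] in auto)

lemma continuous_on_segment:
  fixes z :: "'e::real_normed_vector"
  assumes "z \<in> ball x0 r" "continuous_on (ball x0 r) g" "x \<in> ball x0 r"
  shows "continuous_on {0..1} (\<lambda>t. g (z + t *\<^sub>R (x - z)))"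
proof (rule continuous_on_compose2[OF assms(2)])
  show "continuous_on {0..1} (\<lambda>t. z + t *\<^sub>R (x - z))"
    by (intro continuous_intros)
qed (use segment_in_ball[OF assms(1,3)] in auto)

text \<open>
  Differentiation under the integral sign brings out a further factor \<open>t\<close>; the induction on the
  order of differentiability therefore needs the weight \<open>t\<^sup>m\<close>.
\<close>

lemma k_times_differentiable_on_segment_integral:
  fixes g :: "'e::euclidean_space \<Rightarrow> real"
  assumes z: "z \<in> ball x0 r" and g: "k_times_differentiable_on k (ball x0 r) g"
  shows "k_times_differentiable_on k (ball x0 r)
    (\<lambda>x. integral (cbox 0 1) (\<lambda>t. t ^ m * g (z + t *\<^sub>R (x - z))))"
  using g
proof (induction k arbitrary: g m)
  case 0
  have "continuous_on (ball x0 r \<times> cbox 0 1) (\<lambda>(x, t). t ^ m * g (z + t *\<^sub>R (x - z)))"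
    unfolding split_beta
    using continuous_on_segment_compose[OF z, of g] 0
    by (auto intro!: continuous_on_mult continuous_on_power continuous_on_snd simp: cbox_interval)
  then show ?case
    unfolding k_times_differentiable_on.simps by (rule integral_continuous_on_param)
next
  case (Suc k)
  let ?S = "ball x0 r" and ?Dg = "\<lambda>x. frechet_derivative g (at x)"
  \<comment> \<open>The Leibniz rule for integrals asks for a derivative with values in bounded linear functions.\<close>
  let ?D = "\<lambda>x t. Blinfun (\<lambda>v. t ^ Suc m * ?Dg (z + t *\<^sub>R (x - z)) v)"
  have Dg: "(g has_derivative ?Dg y) (at y)" if "y \<in> ?S" for y
    using k_times_differentiable_on_has_derivative[OF Suc.prems that] .
  have seg: "z + t *\<^sub>R (x - z) \<in> ?S" if "x \<in> ?S" "t \<in> cbox 0 1" for x t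
    using segment_in_ball[OF z] that by auto
  have D: "blinfun_apply (?D x t) = (\<lambda>v. t ^ Suc m * ?Dg (z + t *\<^sub>R (x - z)) v)"
    if "x \<in> ?S" "t \<in> cbox 0 1" for x t
    using has_derivative_bounded_linear[OF Dg[OF seg[OF that]]]
    by (intro bounded_linear_Blinfun_apply bounded_linear_const_mult)
  have contD: "continuous_on ?S (\<lambda>x. ?Dg x v)" for v
    by (rule k_times_differentiable_on_continuous[of k]) (use Suc.prems in simp)
  have cont: "continuous_on (?S \<times> cbox 0 1) (\<lambda>(x, t). ?D x t)"
  proof (rule continuous_on_blinfun_componentwise)
    fix i :: 'e assume "i \<in> Basis"
    have "continuous_on (?S \<times> cbox 0 1) (\<lambda>p. snd p ^ Suc m * ?Dg (z + snd p *\<^sub>R (fst p - z)) i)"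
      using continuous_on_segment_compose[OF z contD[of i]]
      by (auto intro!: continuous_on_mult continuous_on_power continuous_on_snd simp: cbox_interval)
    then show "continuous_on (?S \<times> cbox 0 1) (\<lambda>p. (case p of (x, t) \<Rightarrow> ?D x t) i)"
      by (rule continuous_on_cong[THEN iffD1, rotated 2]) (use D in auto)
  qed
  have derF: "((\<lambda>x. t ^ m * g (z + t *\<^sub>R (x - z))) has_derivative blinfun_apply (?D x t)) (at x within ?S)"
    if "x \<in> ?S" "t \<in> cbox 0 1" for x t
  proof -
    have "((\<lambda>x. z + t *\<^sub>R (x - z)) has_derivative (\<lambda>v. t *\<^sub>R v)) (at x within ?S)"
      by (auto intro!: derivative_eq_intros)
    from has_derivative_compose[OF this Dg[OF seg[OF that]]]
    have "((\<lambda>x. g (z + t *\<^sub>R (x - z))) has_derivative (\<lambda>v. ?Dg (z + t *\<^sub>R (x - z)) (t *\<^sub>R v)))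
        (at x within ?S)" .
    from has_derivative_mult_right[OF this, of "t ^ m"]
    show ?thesis
      unfolding D[OF that]
      using linear_scale[OF has_derivative_linear[OF Dg[OF seg[OF that]]]]
      by (simp add: mult_ac)
  qed
  have integ: "(\<lambda>t. t ^ m * g (z + t *\<^sub>R (x - z))) integrable_on cbox 0 1" if "x \<in> ?S" for x
    using continuous_on_segment[OF z k_times_differentiable_on_continuous[OF Suc.prems] that]
    by (auto intro!: integrable_continuous_interval continuous_on_mult continuous_on_power simp: cbox_interval)
  have integD: "(\<lambda>t. ?D x t) integrable_on cbox 0 1" if "x \<in> ?S" for x
  proof (rule integrable_continuous)
    have "continuous_on (cbox 0 1) (\<lambda>t. (\<lambda>(x, t). ?D x t) (x, t))"
      by (rule continuous_on_compose2[OF cont]) (use that in \<open>auto intro!: continuous_intros\<close>)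
    then show "continuous_on (cbox 0 1) (?D x)" by simp
  qed
  show ?case
  proof (rule k_times_differentiable_on_SucI[OF open_ball])
    fix x assume x: "x \<in> ?S"
    have "((\<lambda>x. integral (cbox 0 1) (\<lambda>t. t ^ m * g (z + t *\<^sub>R (x - z)))) has_derivative
        integral (cbox 0 1) (?D x)) (at x within ?S)"
      by (rule leibniz_rule[OF derF integ cont x convex_ball])
    moreover have "blinfun_apply (integral (cbox 0 1) (?D x)) =
        (\<lambda>v. integral (cbox 0 1) (\<lambda>t. t ^ Suc m * ?Dg (z + t *\<^sub>R (x - z)) v))"
      unfolding blinfun_apply_integral[OF integD[OF x], abs_def]
      by (intro ext integral_cong) (simp only: D[OF x])
    ultimately have "((\<lambda>x. integral (cbox 0 1) (\<lambda>t. t ^ m * g (z + t *\<^sub>R (x - z)))) has_derivative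
        (\<lambda>v. integral (cbox 0 1) (\<lambda>t. t ^ Suc m * ?Dg (z + t *\<^sub>R (x - z)) v))) (at x within ?S)"
      by (simp only:)
    then show "((\<lambda>x. integral (cbox 0 1) (\<lambda>t. t ^ m * g (z + t *\<^sub>R (x - z)))) has_derivative
        (\<lambda>v. integral (cbox 0 1) (\<lambda>t. t ^ Suc m * ?Dg (z + t *\<^sub>R (x - z)) v))) (at x)"
      by (simp only: at_within_open[OF x open_ball])
  next
    fix v
    show "k_times_differentiable_on k ?S
        (\<lambda>x. integral (cbox 0 1) (\<lambda>t. t ^ Suc m * ?Dg (z + t *\<^sub>R (x - z)) v))"
      by (rule Suc.IH) (use Suc.prems in auto)
  qed
qed

text \<open>
  The first-order Taylor expansion with smooth coefficients: integrate the derivative of \<open>f\<close> along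
  the segment from \<open>z\<close> to \<open>x\<close>.
\<close>

lemma Hadamard:
  fixes f :: "'e::euclidean_space \<Rightarrow> real"
  assumes z: "z \<in> ball x0 r" and f: "smooth_on (ball x0 r) f"
  obtains G :: "'e \<Rightarrow> 'e \<Rightarrow> real" where "\<And>b. smooth_on (ball x0 r) (G b)"
    "\<And>b. G b z = frechet_derivative f (at z) b"
    "\<And>x. x \<in> ball x0 r \<Longrightarrow> f x = f z + (\<Sum>b\<in>Basis. ((x - z) \<bullet> b) * G b x)"
proof
  let ?Df = "\<lambda>x. frechet_derivative f (at x)"
  let ?G = "\<lambda>b x. integral (cbox 0 1) (\<lambda>t. t ^ 0 * ?Df (z + t *\<^sub>R (x - z)) b)"
  have smooth_Df: "smooth_on (ball x0 r) (\<lambda>x. ?Df x b)" for b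
    using f by (rule smooth_on_frechet_derivative)
  show "smooth_on (ball x0 r) (?G b)" for b
    using smooth_Df k_times_differentiable_on_segment_integral[OF z]
    unfolding smooth_on_def by blast
  show "?G b z = ?Df z b" for b
    by simp
  show "f x = f z + (\<Sum>b\<in>Basis. ((x - z) \<bullet> b) * ?G b x)" if x: "x \<in> ball x0 r" for x
  proof -
    have seg: "z + t *\<^sub>R (x - z) \<in> ball x0 r" if "t \<in> {0..1}" for t
      using segment_in_ball[OF z x] that by auto
    have Df: "(f has_derivative ?Df y) (at y)" if "y \<in> ball x0 r" for y
      using smooth_on_has_derivative[OF f that] .
    have int: "(\<lambda>t. ?Df (z + t *\<^sub>R (x - z)) b) integrable_on {0..1}" for b
      using continuous_on_segment[OF z smooth_on_continuous[OF smooth_Df] x]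
      by (intro integrable_continuous_interval)
    have "((\<lambda>t. ?Df (z + t *\<^sub>R (x - z)) (x - z)) has_integral
        f (z + 1 *\<^sub>R (x - z)) - f (z + 0 *\<^sub>R (x - z))) {0..1}"
    proof (rule fundamental_theorem_of_calculus)
      fix t :: real assume t: "t \<in> {0..1}"
      have "((\<lambda>t. z + t *\<^sub>R (x - z)) has_derivative (\<lambda>h. h *\<^sub>R (x - z))) (at t within {0..1})"
        by (auto intro!: derivative_eq_intros)
      from has_derivative_compose[OF this Df[OF seg[OF t]]]
      show "((\<lambda>t. f (z + t *\<^sub>R (x - z))) has_vector_derivative ?Df (z + t *\<^sub>R (x - z)) (x - z))
          (at t within {0..1})"
        unfolding has_vector_derivative_def
        using linear_scale[OF has_derivative_linear[OF Df[OF seg[OF t]]]] by simp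
    qed simp
    then have "f x - f z = integral {0..1} (\<lambda>t. ?Df (z + t *\<^sub>R (x - z)) (x - z))"
      by (simp add: integral_unique)
    also have "\<dots> = integral {0..1} (\<lambda>t. \<Sum>b\<in>Basis. ((x - z) \<bullet> b) * ?Df (z + t *\<^sub>R (x - z)) b)"
    proof (rule integral_cong)
      fix t :: real assume t: "t \<in> {0..1}"
      interpret linear "?Df (z + t *\<^sub>R (x - z))" using Df[OF seg[OF t]] by (rule has_derivative_linear)
      show "?Df (z + t *\<^sub>R (x - z)) (x - z) = (\<Sum>b\<in>Basis. ((x - z) \<bullet> b) * ?Df (z + t *\<^sub>R (x - z)) b)"
        by (subst (2) euclidean_representation[of "x - z", symmetric])
          (simp only: sum scale real_scaleR_def)
    qed
    also have "\<dots> = (\<Sum>b\<in>Basis. ((x - z) \<bullet> b) * ?G b x)"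
      using int by (subst integral_sum) (auto intro: integrable_on_mult_right simp: cbox_interval)
    finally show ?thesis by simp
  qed
qed

section \<open>Smooth functions on a manifold\<close>

lemma bounded_linear_coord_proj: "bounded_linear (coord_proj B)"
  unfolding coord_proj_def[abs_def]
  by (intro bounded_linear_sum bounded_linear_scaleR_left[THEN bounded_linear_compose]
      bounded_linear_inner_left)

lemma coord_proj_in_span: "coord_proj B x \<in> span B"
  unfolding coord_proj_def by (intro span_sum span_scale span_base)

lemma coord_proj_inner:
  assumes "B \<subseteq> Basis" "b \<in> Basis"
  shows "coord_proj B x \<bullet> b = (if b \<in> B then x \<bullet> b else 0)"
proof -
  have "coord_proj B x \<bullet> b = (\<Sum>c\<in>B. if c = b then x \<bullet> b else 0)"
    unfolding coord_proj_def inner_sum_left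
    by (rule sum.cong) (use assms in \<open>auto simp: inner_Basis\<close>)
  then show ?thesis
    using finite_subset[OF assms(1) finite_Basis] by simp
qed

lemma span_Basis_inner:
  assumes "B \<subseteq> Basis" "x \<in> span B" "b \<in> Basis" "b \<notin> B"
  shows "x \<bullet> b = 0"
  using assms(2)
proof (induction rule: span_induct)
  case base
  show ?case by (auto simp: subspace_def inner_add_left)
next
  case (step c)
  then show ?case using assms by (metis inner_not_same_Basis subsetD)
qed

lemma coord_proj_on_span:
  assumes "B \<subseteq> Basis" "x \<in> span B"
  shows "coord_proj B x = x"
  by (rule euclidean_eqI)
    (use coord_proj_inner[OF assms(1)] span_Basis_inner[OF assms] in auto)

lemma norm_coord_proj_le:
  assumes "B \<subseteq> Basis"
  shows "norm (coord_proj B x) \<le> norm x"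
proof -
  have "(norm (coord_proj B x))\<^sup>2 = (\<Sum>b\<in>Basis. (coord_proj B x \<bullet> b)\<^sup>2)"
    unfolding power2_norm_eq_inner by (subst euclidean_inner) (simp add: power2_eq_square)
  also have "\<dots> \<le> (\<Sum>b\<in>Basis. (x \<bullet> b)\<^sup>2)"
    by (rule sum_mono) (simp add: coord_proj_inner[OF assms])
  also have "\<dots> = (norm x)\<^sup>2"
    unfolding power2_norm_eq_inner by (subst euclidean_inner) (simp add: power2_eq_square)
  finally show ?thesis by (rule power2_le_imp_le) simp
qed

lemma coord_proj_in_ball:
  assumes "B \<subseteq> Basis" "x0 \<in> span B" "x \<in> ball x0 r"
  shows "coord_proj B x \<in> ball x0 r \<inter> span B"
proof -
  have "dist x0 (coord_proj B x) = norm (coord_proj B (x0 - x))"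
    using coord_proj_on_span[OF assms(1,2)] linear_diff[OF bounded_linear.linear[OF bounded_linear_coord_proj]]
    by (metis dist_norm)
  also have "\<dots> \<le> norm (x0 - x)"
    using assms(1) by (rule norm_coord_proj_le)
  finally show ?thesis
    using assms(3) coord_proj_in_span by (auto simp: dist_norm)
qed

lemma mem_smooth_functions: "f \<in> carrier (smooth_functions N) \<longleftrightarrow> smooth_map_on N UNIV f"
  by (simp add: smooth_functions_def)

context smooth_manifold
begin

abbreviation "basis \<equiv> model_basis N"

text \<open>
  The expression of a map in a chart. The model is the span of some of the basis vectors; composing
  with the projection onto it gives functions on open sets of the full Euclidean space, where
  derivatives in all directions make sense.
\<close>

definition in_chart :: "'a set \<Rightarrow> ('a \<Rightarrow> 'e) \<Rightarrow> ('a \<Rightarrow> 'b) \<Rightarrow> 'e \<Rightarrow> 'b" where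
  "in_chart U \<phi> f x = f (inv_into U \<phi> (coord_proj basis x))"

definition chart_domain :: "'a set \<Rightarrow> ('a \<Rightarrow> 'e) \<Rightarrow> 'a set \<Rightarrow> 'e set" where
  "chart_domain U \<phi> S = {x. coord_proj basis x \<in> \<phi> ` (U \<inter> S)}"

lemma smooth_map_on_in_chart:
  "smooth_map_on N S f \<longleftrightarrow> (\<forall>(U, \<phi>)\<in>charts N. smooth_on (chart_domain U \<phi> S) (in_chart U \<phi> f))"
  by (simp add: smooth_map_on_def smooth_in_def in_chart_def[abs_def] chart_domain_def)

lemma smooth_map_onD:
  "smooth_map_on N S f \<Longrightarrow> (U, \<phi>) \<in> charts N \<Longrightarrow> smooth_on (chart_domain U \<phi> S) (in_chart U \<phi> f)"
  by (auto simp: smooth_map_on_in_chart)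

lemma chart_inv: "(U, \<phi>) \<in> charts N \<Longrightarrow> y \<in> U \<Longrightarrow> inv_into U \<phi> (\<phi> y) = y"
  using charts_homeomorphism by (auto simp: homeomorphism_def)

lemma chart_span: "(U, \<phi>) \<in> charts N \<Longrightarrow> y \<in> U \<Longrightarrow> \<phi> y \<in> span basis"
  using charts_image openin_imp_subset by fastforce

lemma in_chart_at: "(U, \<phi>) \<in> charts N \<Longrightarrow> y \<in> U \<Longrightarrow> in_chart U \<phi> f (\<phi> y) = f y"
  by (simp add: in_chart_def coord_proj_on_span[OF model_basis chart_span] chart_inv)

lemma open_chart_domain:
  assumes "(U, \<phi>) \<in> charts N" "open S"
  shows "open (chart_domain U \<phi> S)"
proof -
  have "openin (top_of_set U) (U \<inter> S)"
    using assms(2) by (simp add: openin_open_Int)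
  then have "openin (top_of_set (\<phi> ` U)) (\<phi> ` (U \<inter> S))"
    by (rule homeomorphism_imp_open_map[OF charts_homeomorphism[OF assms(1)]])
  then have "openin (top_of_set (span basis)) (\<phi> ` (U \<inter> S))"
    by (rule openin_trans[OF _ charts_image[OF assms(1)]])
  then obtain T where T: "open T" "\<phi> ` (U \<inter> S) = span basis \<inter> T"
    by (auto simp: openin_open)
  have "chart_domain U \<phi> S = coord_proj basis -` T"
    unfolding chart_domain_def T(2) using coord_proj_in_span by auto
  then show ?thesis
    using open_vimage[OF T(1) linear_continuous_on[OF bounded_linear_coord_proj]] by simp
qed

lemma chart_at_point:
  obtains U \<phi> where "(U, \<phi>) \<in> charts N" "p \<in> U"
proof -
  have "p \<in> (\<Union>(U, \<phi>)\<in>charts N. U)"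
    using charts_cover by simp
  then show ?thesis
    using that by auto
qed

lemma smooth_map_on_subset:
  "smooth_map_on N S f \<Longrightarrow> T \<subseteq> S \<Longrightarrow> smooth_map_on N T f"
  unfolding smooth_map_on_in_chart chart_domain_def by (blast intro: smooth_on_subset)

lemma smooth_map_on_cong:
  assumes "open S" "\<And>x. x \<in> S \<Longrightarrow> f x = g x" "smooth_map_on N S f"
  shows "smooth_map_on N S g"
  unfolding smooth_map_on_in_chart
proof safe
  fix U \<phi> assume c: "(U, \<phi>) \<in> charts N"
  show "smooth_on (chart_domain U \<phi> S) (in_chart U \<phi> g)"
    by (rule smooth_on_cong[OF open_chart_domain[OF c assms(1)] _ smooth_map_onD[OF assms(3) c]])
      (auto simp: in_chart_def chart_domain_def chart_inv[OF c] assms(2))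
qed

lemma smooth_map_on_local:
  assumes "\<And>p. p \<in> S \<Longrightarrow> \<exists>T. open T \<and> p \<in> T \<and> smooth_map_on N T f"
  shows "smooth_map_on N S f"
  unfolding smooth_map_on_in_chart
proof safe
  fix U \<phi> assume c: "(U, \<phi>) \<in> charts N"
  show "smooth_on (chart_domain U \<phi> S) (in_chart U \<phi> f)"
  proof (rule smooth_on_local)
    fix x assume "x \<in> chart_domain U \<phi> S"
    then obtain p where p: "p \<in> U" "p \<in> S" "coord_proj basis x = \<phi> p"
      by (auto simp: chart_domain_def)
    obtain T where T: "open T" "p \<in> T" "smooth_map_on N T f"
      using assms[OF p(2)] by blast
    show "\<exists>T. open T \<and> x \<in> T \<and> smooth_on T (in_chart U \<phi> f)"
      using open_chart_domain[OF c T(1)] smooth_map_onD[OF T(3) c] p T(2)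
      by (auto simp: chart_domain_def)
  qed
qed

lemma smooth_map_on_const: "smooth_map_on N S (\<lambda>p. c)"
  by (auto simp: smooth_map_on_in_chart in_chart_def[abs_def] smooth_on_const)

lemma smooth_map_on_add:
  assumes "open S" "smooth_map_on N S f" "smooth_map_on N S g"
  shows "smooth_map_on N S (\<lambda>p. f p + g p)"
  unfolding smooth_map_on_in_chart
  using smooth_on_add[OF open_chart_domain[OF _ assms(1)] smooth_map_onD[OF assms(2)] smooth_map_onD[OF assms(3)]]
  by (auto simp: in_chart_def[abs_def])

lemma smooth_map_on_scaleR:
  assumes "open S" "smooth_map_on N S f" "smooth_map_on N S g"
  shows "smooth_map_on N S (\<lambda>p. f p *\<^sub>R g p)"
  unfolding smooth_map_on_in_chart
  using smooth_on_scaleR[OF open_chart_domain[OF _ assms(1)] smooth_map_onD[OF assms(2)] smooth_map_onD[OF assms(3)]]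
  by (auto simp: in_chart_def[abs_def])

lemma smooth_map_on_inverse:
  fixes f :: "'a \<Rightarrow> real"
  assumes "open S" "\<And>p. p \<in> S \<Longrightarrow> f p \<noteq> 0" "smooth_map_on N S f"
  shows "smooth_map_on N S (\<lambda>p. inverse (f p))"
  unfolding smooth_map_on_in_chart
proof safe
  fix U \<phi> assume c: "(U, \<phi>) \<in> charts N"
  have "smooth_on (chart_domain U \<phi> S) (\<lambda>x. inverse (in_chart U \<phi> f x))"
    by (rule smooth_on_inverse[OF open_chart_domain[OF c assms(1)] _ smooth_map_onD[OF assms(3) c]])
      (auto simp: in_chart_def chart_domain_def chart_inv[OF c] assms(2))
  then show "smooth_on (chart_domain U \<phi> S) (in_chart U \<phi> (\<lambda>p. inverse (f p)))"
    by (simp add: in_chart_def[abs_def])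
qed

lemma smooth_map_continuous:
  assumes "smooth_map_on N UNIV f"
  shows "continuous_on UNIV f"
  unfolding continuous_on_eq_continuous_at[OF open_UNIV]
proof
  fix p
  obtain U \<phi> where c: "(U, \<phi>) \<in> charts N" "p \<in> U" by (rule chart_at_point)
  have "continuous_on U (\<lambda>y. in_chart U \<phi> f (\<phi> y))"
  proof (rule continuous_on_compose2[of "chart_domain U \<phi> UNIV" "in_chart U \<phi> f"])
    show "continuous_on (chart_domain U \<phi> UNIV) (in_chart U \<phi> f)"
      using smooth_on_continuous[OF smooth_map_onD[OF assms c(1)]] .
    show "continuous_on U \<phi>"
      using charts_homeomorphism[OF c(1)] by (simp add: homeomorphism_def)
    show "\<phi> ` U \<subseteq> chart_domain U \<phi> UNIV"
      using coord_proj_on_span[OF model_basis chart_span[OF c(1)]] by (auto simp: chart_domain_def)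
  qed
  then have "continuous_on U f"
    by (rule continuous_on_cong[THEN iffD1, OF refl, rotated]) (simp add: in_chart_at[OF c(1)])
  then show "isCont f p"
    using charts_open[OF c(1)] c(2) by (simp add: continuous_on_eq_continuous_at)
qed

text \<open>
  Smoothness can be tested after multiplication by smooth functions without common zero, because
  such a function is invertible near a point where it does not vanish.
\<close>

lemma smooth_map_on_divide:
  assumes "open S"
    and "\<And>p. p \<in> S \<Longrightarrow> \<exists>\<eta>. smooth_map_on N UNIV \<eta> \<and> \<eta> p \<noteq> 0 \<and> smooth_map_on N S (\<lambda>x. \<eta> x *\<^sub>R s x)"
  shows "smooth_map_on N S s"
proof (rule smooth_map_on_local)
  fix p assume p: "p \<in> S"
  then obtain \<eta> where \<eta>: "smooth_map_on N UNIV \<eta>" "\<eta> p \<noteq> 0" "smooth_map_on N S (\<lambda>x. \<eta> x *\<^sub>R s x)"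
    using assms(2) by blast
  define T where "T = S \<inter> \<eta> -` (- {0})"
  have T: "open T"
    unfolding T_def using assms(1) smooth_map_continuous[OF \<eta>(1)]
    by (intro open_Int open_vimage) auto
  have "smooth_map_on N T (\<lambda>x. inverse (\<eta> x) *\<^sub>R (\<eta> x *\<^sub>R s x))"
  proof (rule smooth_map_on_scaleR[OF T smooth_map_on_inverse[OF T]])
    show "smooth_map_on N T \<eta>" "smooth_map_on N T (\<lambda>x. \<eta> x *\<^sub>R s x)"
      using \<eta>(1,3) by (auto elim: smooth_map_on_subset simp: T_def)
  qed (simp add: T_def)
  then have "smooth_map_on N T s"
    by (rule smooth_map_on_cong[OF T, rotated]) (auto simp: T_def)
  then show "\<exists>T. open T \<and> p \<in> T \<and> smooth_map_on N T s"
    using T p \<eta>(2) by (auto simp: T_def)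
qed

abbreviation "A \<equiv> carrier (smooth_functions N)"

lemma smooth_const [simp, intro]: "(\<lambda>p. c) \<in> A"
  by (simp add: mem_smooth_functions smooth_map_on_const)

lemma smooth_add [simp, intro]: "f \<in> A \<Longrightarrow> g \<in> A \<Longrightarrow> (\<lambda>p. f p + g p) \<in> A"
  by (simp add: mem_smooth_functions smooth_map_on_add)

lemma smooth_mult [simp, intro]: "f \<in> A \<Longrightarrow> g \<in> A \<Longrightarrow> (\<lambda>p. f p * g p) \<in> A"
  using smooth_map_on_scaleR[OF open_UNIV] by (fastforce simp: mem_smooth_functions)

lemma smooth_uminus [simp, intro]: "f \<in> A \<Longrightarrow> (\<lambda>p. - f p) \<in> A"
  using smooth_mult[OF smooth_const[of "-1"]] by simp

lemma smooth_diff [simp, intro]: "f \<in> A \<Longrightarrow> g \<in> A \<Longrightarrow> (\<lambda>p. f p - g p) \<in> A"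
  using smooth_add[OF _ smooth_uminus] by simp

lemma smooth_sum [intro]: "(\<And>i. i \<in> I \<Longrightarrow> f i \<in> A) \<Longrightarrow> (\<lambda>p. \<Sum>i\<in>I. f i p) \<in> A"
  by (induction I rule: infinite_finite_induct) auto

lemma smooth_power [intro]: "f \<in> A \<Longrightarrow> (\<lambda>p. f p ^ n) \<in> A"
  by (induction n) auto

text \<open>
  A function on the coordinate ball of a chart that vanishes near its boundary extends by \<open>0\<close> to
  the whole manifold: the image of the smaller closed ball is compact, hence closed because the
  manifold is Hausdorff, and the extension is \<open>0\<close> on its open complement.
\<close>

lemma smooth_cutoff:
  fixes g :: "'e \<Rightarrow> real"
  assumes c: "(U, \<phi>) \<in> charts N" and sub: "ball x0 r \<inter> span basis \<subseteq> \<phi> ` U"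
    and g: "smooth_on (ball x0 r) g" and s: "s < r" and zero: "\<And>x. x \<notin> cball x0 s \<Longrightarrow> g x = 0"
  shows "(\<lambda>y. if y \<in> U then g (\<phi> y) else 0) \<in> A" (is "?h \<in> A")
  unfolding mem_smooth_functions smooth_map_on_in_chart
proof safe
  have g_UNIV: "smooth_on UNIV g"
  proof (rule smooth_on_local)
    fix x :: 'e
    have "smooth_on (- cball x0 s) g"
      by (rule smooth_on_cong[OF _ _ smooth_on_const[of _ 0]]) (use zero in auto)
    moreover have "x \<in> ball x0 r \<or> x \<in> - cball x0 s"
      using s by auto
    ultimately show "\<exists>T. open T \<and> x \<in> T \<and> smooth_on T g"
      using g by (metis open_ball open_Compl closed_cball)
  qed
  fix W \<psi> assume d: "(W, \<psi>) \<in> charts N"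
  let ?K = "inv_into U \<phi> ` (cball x0 s \<inter> span basis)"
  have "cball x0 s \<subseteq> ball x0 r"
    using s by auto
  then have K_sub: "cball x0 s \<inter> span basis \<subseteq> \<phi> ` U"
    using sub by blast
  have "compact (cball x0 s \<inter> span basis)"
    by (intro compact_Int_closed compact_cball closed_subspace subspace_span)
  then have "compact ?K"
    using charts_homeomorphism[OF c] continuous_on_subset[OF _ K_sub]
    by (intro compact_continuous_image) (auto simp: homeomorphism_def)
  then have open_K: "open (- ?K)"
    by (simp add: compact_imp_closed open_Compl)
  have h_zero: "?h y = 0" if "y \<notin> ?K" for y
  proof (rule ccontr)
    assume "?h y \<noteq> 0"
    then have "y \<in> U" "\<phi> y \<in> cball x0 s \<inter> span basis"
      using zero chart_span[OF c] by (auto split: if_splits)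
    then show False
      using that chart_inv[OF c] by (metis imageI)
  qed
  have K_U: "?K \<subseteq> U"
    using K_sub by (auto intro: inv_into_into)
  show "smooth_on (chart_domain W \<psi> UNIV) (in_chart W \<psi> ?h)"
  proof (rule smooth_on_local)
    fix x assume x: "x \<in> chart_domain W \<psi> UNIV"
    have "smooth_on (chart_domain W \<psi> (- ?K)) (in_chart W \<psi> ?h)"
    proof (rule smooth_on_cong[OF open_chart_domain[OF d open_K] _ smooth_on_const[of _ 0]])
      fix x assume "x \<in> chart_domain W \<psi> (- ?K)"
      then have "inv_into W \<psi> (coord_proj basis x) \<notin> ?K"
        by (auto simp: chart_domain_def chart_inv[OF d])
      then show "0 = in_chart W \<psi> ?h x"
        using h_zero by (simp add: in_chart_def)
    qed
    moreover have "smooth_on (chart_domain W \<psi> U) (in_chart W \<psi> ?h)"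
    proof (rule smooth_on_cong[OF open_chart_domain[OF d charts_open[OF c]]])
      have "smooth_on (chart_domain W \<psi> U) (in_chart W \<psi> \<phi>)"
        using charts_compatible[OF d c]
        by (simp add: smooth_in_def in_chart_def[abs_def] chart_domain_def)
      then show "smooth_on (chart_domain W \<psi> U) (\<lambda>x. g (in_chart W \<psi> \<phi> x))"
        by (rule smooth_on_compose[OF open_chart_domain[OF d charts_open[OF c]] open_UNIV _ g_UNIV, rotated])
          simp
    qed (auto simp: in_chart_def chart_domain_def chart_inv[OF d])
    moreover have "x \<in> chart_domain W \<psi> U \<or> x \<in> chart_domain W \<psi> (- ?K)"
    proof -
      obtain y where "y \<in> W" "coord_proj basis x = \<psi> y"
        using x by (auto simp: chart_domain_def)
      then show ?thesis
        using K_U by (cases "y \<in> ?K") (auto simp: chart_domain_def)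
    qed
    ultimately show "\<exists>T. open T \<and> x \<in> T \<and> smooth_on T (in_chart W \<psi> ?h)"
      using open_chart_domain[OF d] open_K charts_open[OF c] by metis
  qed
qed


section \<open>Tangent vectors and local frames\<close>

lemma tangent_add:
  "v \<in> tangent_space N p \<Longrightarrow> f \<in> A \<Longrightarrow> g \<in> A \<Longrightarrow> v (\<lambda>x. f x + g x) = v f + v g"
  by (simp add: tangent_space_def)

lemma tangent_scale: "v \<in> tangent_space N p \<Longrightarrow> f \<in> A \<Longrightarrow> v (\<lambda>x. c * f x) = c * v f"
  by (simp add: tangent_space_def)

lemma tangent_mult:
  "v \<in> tangent_space N p \<Longrightarrow> f \<in> A \<Longrightarrow> g \<in> A \<Longrightarrow> v (\<lambda>x. f x * g x) = f p * v g + g p * v f"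
  by (simp add: tangent_space_def)

lemma tangent_zero: "v \<in> tangent_space N p \<Longrightarrow> v (\<lambda>x. 0) = 0"
  using tangent_scale[of v p "\<lambda>x. 0" 0] by simp

lemma tangent_const: "v \<in> tangent_space N p \<Longrightarrow> v (\<lambda>x. c) = 0"
  using tangent_mult[of v p "\<lambda>x. 1" "\<lambda>x. 1"] tangent_scale[of v p "\<lambda>x. 1" c] by simp

lemma tangent_uminus: "v \<in> tangent_space N p \<Longrightarrow> f \<in> A \<Longrightarrow> v (\<lambda>x. - f x) = - v f"
  using tangent_scale[of v p f "-1"] by simp

lemma tangent_diff:
  "v \<in> tangent_space N p \<Longrightarrow> f \<in> A \<Longrightarrow> g \<in> A \<Longrightarrow> v (\<lambda>x. f x - g x) = v f - v g"
  using tangent_add[of v p f "\<lambda>x. - g x"] by (simp add: tangent_uminus)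

lemma tangent_sum:
  "v \<in> tangent_space N p \<Longrightarrow> (\<And>i. i \<in> I \<Longrightarrow> f i \<in> A) \<Longrightarrow>
    v (\<lambda>x. \<Sum>i\<in>I. f i x) = (\<Sum>i\<in>I. v (f i))"
proof (induction I rule: infinite_finite_induct)
  case (insert i I)
  then show ?case
    using tangent_add[OF insert.prems(1), of "f i" "\<lambda>x. \<Sum>i\<in>I. f i x"] smooth_sum[of I f] by simp
qed (simp_all add: tangent_zero)

lemma tangent_space_combination:
  assumes "\<And>i. i \<in> I \<Longrightarrow> v i \<in> tangent_space N p"
  shows "(\<lambda>f\<in>A. \<Sum>i\<in>I. c i * v i f) \<in> tangent_space N p"
proof -
  have "(\<Sum>i\<in>I. c i * v i (\<lambda>x. f x + g x)) = (\<Sum>i\<in>I. c i * v i f) + (\<Sum>i\<in>I. c i * v i g)"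
    "(\<Sum>i\<in>I. c i * v i (\<lambda>x. k * f x)) = k * (\<Sum>i\<in>I. c i * v i f)"
    "(\<Sum>i\<in>I. c i * v i (\<lambda>x. f x * g x)) = f p * (\<Sum>i\<in>I. c i * v i g) + g p * (\<Sum>i\<in>I. c i * v i f)"
    if "f \<in> A" "g \<in> A" for f g k
    using that unfolding sum_distrib_left sum.distrib[symmetric]
    by (auto intro!: sum.cong simp: tangent_add[OF assms] tangent_scale[OF assms]
        tangent_mult[OF assms] algebra_simps)
  then show ?thesis
    by (simp add: tangent_space_def smooth_mult[OF smooth_const])
qed

lemma tangent_eqI:
  "v \<in> tangent_space N p \<Longrightarrow> w \<in> tangent_space N q \<Longrightarrow> (\<And>f. f \<in> A \<Longrightarrow> v f = w f) \<Longrightarrow> v = w"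
  unfolding tangent_space_def by (auto intro: extensionalityI)

text \<open>
  Functions \<open>u\<^sub>i\<close> and vector fields \<open>E\<^sub>i\<close> on the whole manifold such that \<open>\<eta> v = \<Sum>\<^sub>i v(u\<^sub>i) E\<^sub>i\<close> for
  every tangent vector \<open>v\<close> at every point; equivalently \<open>\<eta> \<alpha> = \<Sum>\<^sub>i \<alpha>(E\<^sub>i) du\<^sub>i\<close> for every one-form
  \<open>\<alpha>\<close>. This expresses, without reference to charts, that the differentials \<open>du\<^sub>i\<close> span the
  cotangent bundle near \<open>p\<close>.
\<close>

definition local_frame ::
  "'a \<Rightarrow> ('a \<Rightarrow> real) \<Rightarrow> 'i set \<Rightarrow> ('i \<Rightarrow> 'a \<Rightarrow> real) \<Rightarrow> ('i \<Rightarrow> 'a vector_field) \<Rightarrow> bool" where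
  "local_frame p \<eta> I u E \<longleftrightarrow> \<eta> \<in> A \<and> \<eta> p \<noteq> 0 \<and> finite I \<and>
     (\<forall>i\<in>I. u i \<in> A \<and> E i \<in> vector_fields N) \<and>
     (\<forall>y. \<forall>v\<in>tangent_space N y. \<forall>f\<in>A. \<eta> y * v f = (\<Sum>i\<in>I. v (u i) * E i y f))"

text \<open>
  Let \<open>\<kappa>\<close> be a bump function supported in a coordinate ball with coordinates \<open>x\<^sub>b\<close>. Hadamard's lemma
  at a point \<open>y\<close> gives \<open>\<kappa>\<^sup>2 (f - f(y)) = \<Sum>\<^sub>b (\<kappa> x\<^sub>b - x\<^sub>b(y) \<kappa>) (\<kappa> g\<^sub>b)\<close> with \<open>g\<^sub>b(y) = \<partial>\<^sub>b f(y)\<close>, an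
  identity between functions on the whole manifold. A tangent vector \<open>v\<close> at \<open>y\<close> turns it into
  \<open>\<kappa>(y)\<^sup>2 v(f) = \<Sum>\<^sub>b (v(\<kappa> x\<^sub>b) - x\<^sub>b(y) v(\<kappa>)) \<kappa>(y) \<partial>\<^sub>b f(y)\<close>. So the functions \<open>\<kappa> x\<^sub>b\<close> with the vector
  fields \<open>\<kappa> \<partial>\<^sub>b\<close>, together with the function \<open>\<kappa>\<close> and the vector field \<open>- \<Sum>\<^sub>b x\<^sub>b \<kappa> \<partial>\<^sub>b\<close>, form a frame
  for \<open>\<eta> = \<kappa>\<^sup>2\<close>.
\<close>

proposition local_frame_exists:
  obtains \<eta> and I :: "'e option set" and u E where "local_frame p \<eta> I u E"
proof -
  obtain U \<phi> where c: "(U, \<phi>) \<in> charts N" and pU: "p \<in> U" by (rule chart_at_point)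
  define x0 where "x0 = \<phi> p"
  have "x0 \<in> \<phi> ` U" using pU by (simp add: x0_def)
  then obtain r where r: "r > 0" and sub: "ball x0 r \<inter> span basis \<subseteq> \<phi> ` U"
    using charts_image[OF c] by (auto simp: openin_contains_ball)
  obtain \<rho> :: "'e \<Rightarrow> real" where \<rho>: "smooth_on UNIV \<rho>" "\<rho> x0 \<noteq> 0"
    and \<rho>0: "\<And>x. x \<notin> cball x0 (r / 2) \<Longrightarrow> \<rho> x = 0"
    using bump_function_exists[of "r / 2" x0] r by auto
  have x0: "x0 \<in> span basis" using chart_span[OF c pU] by (simp add: x0_def)
  let ?S = "ball x0 r"
  define cut where "cut g = (\<lambda>y. if y \<in> U then \<rho> (\<phi> y) * g (\<phi> y) else 0)" for g :: "'e \<Rightarrow> real"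
  have cut: "cut g \<in> A" if "smooth_on ?S g" for g
  proof -
    have "smooth_on ?S (\<lambda>x. \<rho> x * g x)"
      using smooth_on_subset[OF \<rho>(1)] that by (intro smooth_on_mult) auto
    from smooth_cutoff[OF c sub this, of "r / 2"] show ?thesis
      using r \<rho>0 unfolding cut_def by simp
  qed
  have supp: "\<phi> y \<in> ?S" if "\<rho> (\<phi> y) \<noteq> 0" for y
  proof -
    have "\<phi> y \<in> cball x0 (r / 2)"
      using \<rho>0 that by blast
    then show ?thesis using r by (auto simp: field_simps)
  qed
  have S_dom: "?S \<subseteq> chart_domain U \<phi> UNIV"
    using coord_proj_in_ball[OF model_basis x0] sub by (fastforce simp: chart_domain_def)
  have rep: "smooth_on ?S (in_chart U \<phi> f)" if "f \<in> A" for f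
    using smooth_on_subset[OF smooth_map_onD[OF _ c] S_dom] that by (simp add: mem_smooth_functions)
  define D where "D b f x = frechet_derivative (in_chart U \<phi> f) (at x) b"
    for b and f :: "'a \<Rightarrow> real" and x
  have smooth_D: "smooth_on ?S (D b f)" if "f \<in> A" for b f
    unfolding D_def[abs_def] using smooth_on_frechet_derivative[OF rep[OF that]] .
  have inner: "smooth_on ?S (\<lambda>x. x \<bullet> b)" for b
    by (intro smooth_on_bounded_linear[OF _ bounded_linear_inner_left] smooth_on_ident open_ball)
  define \<kappa> where "\<kappa> = cut (\<lambda>x. 1)"
  define coord where "coord b = cut (\<lambda>x. x \<bullet> b)" for b
  define E1 :: "'e \<Rightarrow> 'a vector_field" where "E1 b y = (\<lambda>f\<in>A. cut (D b f) y)" for b :: 'e and y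
  define E2 :: "'a vector_field" where "E2 y = (\<lambda>f\<in>A. \<Sum>b\<in>basis. - (\<phi> y \<bullet> b) * E1 b y f)" for y
  have \<kappa>: "\<kappa> \<in> A" unfolding \<kappa>_def by (intro cut smooth_on_const)
  have coord: "coord b \<in> A" for b unfolding coord_def by (intro cut inner)
  have dersum: "frechet_derivative (\<lambda>x. F x + G x) (at x) b = frechet_derivative F (at x) b + frechet_derivative G (at x) b"
    "frechet_derivative (\<lambda>x. c * F x) (at x) b = c * frechet_derivative F (at x) b"
    "frechet_derivative (\<lambda>x. F x * G x) (at x) b = F x * frechet_derivative G (at x) b + G x * frechet_derivative F (at x) b"
    if "(F has_derivative frechet_derivative F (at x)) (at x)" "(G has_derivative frechet_derivative G (at x)) (at x)"
    for F G :: "'e \<Rightarrow> real" and x b c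
    using frechet_derivative_at[OF has_derivative_add[OF that]]
      frechet_derivative_at[OF has_derivative_mult_right[OF that(1), of c]]
      frechet_derivative_at[OF has_derivative_mult[OF that]]
    by (simp_all only: fun_eq_iff mult.commute[of _ "G x"])
  have E1_tangent: "E1 b y \<in> tangent_space N y" for b y
  proof (cases "y \<in> U \<and> \<rho> (\<phi> y) \<noteq> 0")
    case True
    then have y: "\<phi> y \<in> ?S" using supp by blast
    have der: "(in_chart U \<phi> f has_derivative frechet_derivative (in_chart U \<phi> f) (at (\<phi> y))) (at (\<phi> y))"
      if "f \<in> A" for f using smooth_on_has_derivative[OF rep[OF that] y] .
    have "D b (\<lambda>x. f x + g x) (\<phi> y) = D b f (\<phi> y) + D b g (\<phi> y)"
      "D b (\<lambda>x. k * f x) (\<phi> y) = k * D b f (\<phi> y)"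
      "D b (\<lambda>x. f x * g x) (\<phi> y) = f y * D b g (\<phi> y) + g y * D b f (\<phi> y)"
      if "f \<in> A" "g \<in> A" for f g k
      using dersum[OF der[OF that(1)] der[OF that(2)]] True
      by (simp_all add: D_def in_chart_def[abs_def] in_chart_at[OF c, unfolded in_chart_def])
    then show ?thesis
      using True by (auto simp: tangent_space_def E1_def cut_def algebra_simps)
  next
    case False
    then show ?thesis by (auto simp: tangent_space_def E1_def cut_def)
  qed
  have E1: "E1 b \<in> vector_fields N" for b
    using E1_tangent cut[OF smooth_D] by (simp add: vector_fields_def E1_def)
  have "E2 y \<in> tangent_space N y" for y
    unfolding E2_def by (rule tangent_space_combination) (rule E1_tangent)
  moreover have "(\<lambda>y. E2 y f) \<in> A" if f: "f \<in> A" for f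
  proof -
    have "(\<lambda>y. \<Sum>b\<in>basis. - cut (\<lambda>x. (x \<bullet> b) * D b f x) y) \<in> A"
      by (intro smooth_sum smooth_uminus cut smooth_on_mult[OF open_ball] inner smooth_D f)
    also have "(\<lambda>y. \<Sum>b\<in>basis. - cut (\<lambda>x. (x \<bullet> b) * D b f x) y) = (\<lambda>y. E2 y f)"
      using f by (auto simp: E2_def E1_def cut_def sum_negf algebra_simps intro!: ext sum.cong)
    finally show ?thesis .
  qed
  ultimately have E2: "E2 \<in> vector_fields N"
    by (simp add: vector_fields_def)
  have frame: "\<kappa> y * \<kappa> y * v f = (\<Sum>b\<in>basis. v (coord b) * E1 b y f) + v \<kappa> * E2 y f"
    if v: "v \<in> tangent_space N y" and f: "f \<in> A" for y v f
  proof (cases "y \<in> U \<and> \<rho> (\<phi> y) \<noteq> 0")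
    case False
    then have "\<kappa> y = 0" "\<And>b. E1 b y f = 0"
      using f by (auto simp: \<kappa>_def cut_def E1_def)
    then show ?thesis using f by (simp add: E2_def)
  next
    case True
    let ?z = "\<phi> y"
    have z: "?z \<in> ?S" using True supp by blast
    obtain G where G: "\<And>b. smooth_on ?S (G b)" "\<And>b. G b ?z = D b f ?z"
      and exp: "\<And>x. x \<in> ?S \<Longrightarrow> in_chart U \<phi> f x = in_chart U \<phi> f ?z + (\<Sum>b\<in>Basis. ((x - ?z) \<bullet> b) * G b x)"
      by (rule Hadamard[OF z rep[OF f], folded D_def]) (rule that)
    \<comment> \<open>The function \<open>\<kappa> (x\<^sub>b - x\<^sub>b(y))\<close>, which vanishes at \<open>y\<close>.\<close>
    let ?h = "\<lambda>b y'. coord b y' - (?z \<bullet> b) * \<kappa> y'"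
    have h: "?h b \<in> A" for b
      by (intro smooth_diff coord smooth_mult smooth_const \<kappa>)
    have "\<kappa> y' * \<kappa> y' * f y' = f y * (\<kappa> y' * \<kappa> y') + (\<Sum>b\<in>basis. ?h b y' * cut (G b) y')" for y'
    proof (cases "y' \<in> U \<and> \<rho> (\<phi> y') \<noteq> 0")
      case False
      then show ?thesis by (auto simp: \<kappa>_def coord_def cut_def)
    next
      case True': True
      \<comment> \<open>Charts take values in the model, so only its coordinates occur in the expansion.\<close>
      have "(\<phi> y' - ?z) \<bullet> b = 0" if "b \<in> Basis - basis" for b
        using span_Basis_inner[OF model_basis _ _] chart_span[OF c] True True' that
        by (auto simp: inner_diff_left)
      then have "(\<Sum>b\<in>Basis. ((\<phi> y' - ?z) \<bullet> b) * G b (\<phi> y')) =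
          (\<Sum>b\<in>basis. ((\<phi> y' - ?z) \<bullet> b) * G b (\<phi> y'))"
        by (intro sum.mono_neutral_right) (use model_basis in auto)
      then have "f y' = f y + (\<Sum>b\<in>basis. ((\<phi> y' - ?z) \<bullet> b) * G b (\<phi> y'))"
        using exp[of "\<phi> y'"] supp True' True by (simp add: in_chart_at[OF c])
      then show ?thesis
        using True' by (simp add: \<kappa>_def coord_def cut_def sum_distrib_left algebra_simps inner_diff_left)
    qed
    then have "v (\<lambda>y'. \<kappa> y' * \<kappa> y' * f y') =
        v (\<lambda>y'. f y * (\<kappa> y' * \<kappa> y') + (\<Sum>b\<in>basis. ?h b y' * cut (G b) y'))"
      by simp
    moreover have "v (\<lambda>y'. \<kappa> y' * \<kappa> y' * f y') = \<kappa> y * \<kappa> y * v f + f y * v (\<lambda>y'. \<kappa> y' * \<kappa> y')"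
      using tangent_mult[OF v smooth_mult[OF \<kappa> \<kappa>] f] by simp
    moreover have "v (\<lambda>y'. f y * (\<kappa> y' * \<kappa> y') + (\<Sum>b\<in>basis. ?h b y' * cut (G b) y')) =
        f y * v (\<lambda>y'. \<kappa> y' * \<kappa> y') + (\<Sum>b\<in>basis. v (\<lambda>y'. ?h b y' * cut (G b) y'))"
      using \<kappa> h cut[OF G(1)]
      by (subst tangent_add[OF v]; (subst tangent_scale[OF v] tangent_sum[OF v])?) (auto intro!: smooth_sum simp: tangent_sum[OF v] tangent_scale[OF v])
    moreover have "v (\<lambda>y'. ?h b y' * cut (G b) y') = (v (coord b) - (?z \<bullet> b) * v \<kappa>) * E1 b y f" for b
    proof -
      have "?h b y = 0" "cut (G b) y = E1 b y f"
        using True f G(2) by (auto simp: coord_def \<kappa>_def cut_def E1_def)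
      moreover have "v (?h b) = v (coord b) - (?z \<bullet> b) * v \<kappa>"
        by (simp add: tangent_diff[OF v] coord \<kappa> tangent_scale[OF v] smooth_mult)
      ultimately show ?thesis
        using tangent_mult[OF v h[of b] cut[OF G(1)[of b]]] by simp
    qed
    ultimately have "\<kappa> y * \<kappa> y * v f = (\<Sum>b\<in>basis. (v (coord b) - (?z \<bullet> b) * v \<kappa>) * E1 b y f)"
      by simp
    then show ?thesis
      using f by (simp add: E2_def sum_distrib_left sum_subtractf sum_negf algebra_simps)
  qed
  have "finite basis" using model_basis finite_Basis finite_subset by blast
  moreover have "\<kappa> p \<noteq> 0" using pU \<rho>(2) by (simp add: \<kappa>_def cut_def x0_def)
  \<comment> \<open>The index \<open>None\<close> stands for the additional function \<open>\<kappa>\<close>.\<close>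
  ultimately have "local_frame p (\<lambda>y. \<kappa> y * \<kappa> y) (insert None (Some ` basis))
      (case_option \<kappa> coord) (case_option E2 E1)"
    using \<kappa> coord E1 E2 frame unfolding local_frame_def
    by (auto simp: sum.reindex add.commute)
  then show ?thesis by (rule that)
qed

end

section \<open>One-forms\<close>

context
  fixes N :: "('a, 'e::euclidean_space) smooth_structure"
begin

lemma smooth_functions_simps [simp]:
  "f \<oplus>\<^bsub>smooth_functions N\<^esub> g = (\<lambda>p. f p + g p)"
  "f \<otimes>\<^bsub>smooth_functions N\<^esub> g = (\<lambda>p. f p * g p)"
  "r \<odot>\<^bsub>smooth_functions N\<^esub> g = (\<lambda>p. r * g p)"
  "\<zero>\<^bsub>smooth_functions N\<^esub> = (\<lambda>p. 0)"
  "\<one>\<^bsub>smooth_functions N\<^esub> = (\<lambda>p. 1)"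
  by (simp_all add: smooth_functions_def)

lemma one_form_module_simps [simp]:
  "carrier (one_form_module N) = one_forms N"
  "\<alpha> \<oplus>\<^bsub>one_form_module N\<^esub> \<beta> = (\<lambda>p. \<lambda>v\<in>tangent_space N p. \<alpha> p v + \<beta> p v)"
  "a \<odot>\<^bsub>one_form_module N\<^esub> \<beta> = (\<lambda>p. \<lambda>v\<in>tangent_space N p. a p * \<beta> p v)"
  "\<zero>\<^bsub>one_form_module N\<^esub> = (\<lambda>p. \<lambda>v\<in>tangent_space N p. 0)"
  by (simp_all add: one_form_module_def)

end

context smooth_manifold
begin

lemma cring_smooth_functions: "cring (smooth_functions N)"
proof (rule cringI)
  show "abelian_group (smooth_functions N)"
  proof (rule abelian_groupI)
    fix f assume "f \<in> A"
    then show "\<exists>g\<in>A. g \<oplus>\<^bsub>smooth_functions N\<^esub> f = \<zero>\<^bsub>smooth_functions N\<^esub>"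
      by (intro bexI[of _ "\<lambda>p. - f p"]) auto
  qed (auto simp: add_ac)
  show "comm_monoid (smooth_functions N)"
    by (rule comm_monoidI) (auto simp: mult_ac)
qed (auto simp: distrib_right)

abbreviation "D \<equiv> one_form_module N"
abbreviation "T \<equiv> tangent_space N"

lemma tangent_space_add: "u \<in> T p \<Longrightarrow> v \<in> T p \<Longrightarrow> (\<lambda>f\<in>A. u f + v f) \<in> T p"
  using tangent_space_combination[of "{False, True}" "\<lambda>b. if b then v else u" p "\<lambda>_. 1"]
  by (auto split: if_splits)

lemma tangent_space_scale: "v \<in> T p \<Longrightarrow> (\<lambda>f\<in>A. c * v f) \<in> T p"
  using tangent_space_combination[of "{()}" "\<lambda>_. v" p "\<lambda>_. c"] by simp

lemma tangent_space_zero: "(\<lambda>f\<in>A. 0) \<in> T p"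
  using tangent_space_combination[of "{}" undefined p "\<lambda>_. 1"] by simp

lemma vector_field_tangent: "X \<in> vector_fields N \<Longrightarrow> X p \<in> T p"
  by (simp add: vector_fields_def)

lemma vector_field_smooth: "X \<in> vector_fields N \<Longrightarrow> f \<in> A \<Longrightarrow> (\<lambda>p. X p f) \<in> A"
  by (simp add: vector_fields_def)

lemma vector_field_combination:
  assumes "\<And>i. i \<in> I \<Longrightarrow> g i \<in> A" "\<And>i. i \<in> I \<Longrightarrow> X i \<in> vector_fields N"
  shows "(\<lambda>p. \<lambda>f\<in>A. \<Sum>i\<in>I. g i p * X i p f) \<in> vector_fields N"
  using assms tangent_space_combination[of I "\<lambda>i. X i p" p "\<lambda>i. g i p" for p]
  by (auto simp: vector_fields_def intro!: smooth_sum smooth_mult)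

lemma one_form_smooth: "\<alpha> \<in> one_forms N \<Longrightarrow> X \<in> vector_fields N \<Longrightarrow> (\<lambda>p. \<alpha> p (X p)) \<in> A"
  by (simp add: one_forms_def)

lemma one_form_add:
  "\<alpha> \<in> one_forms N \<Longrightarrow> u \<in> T p \<Longrightarrow> v \<in> T p \<Longrightarrow> \<alpha> p (\<lambda>f\<in>A. u f + v f) = \<alpha> p u + \<alpha> p v"
  by (simp add: one_forms_def cotangent_space_def)

lemma one_form_scale: "\<alpha> \<in> one_forms N \<Longrightarrow> v \<in> T p \<Longrightarrow> \<alpha> p (\<lambda>f\<in>A. c * v f) = c * \<alpha> p v"
  by (simp add: one_forms_def cotangent_space_def)

lemma one_form_zero: "\<alpha> \<in> one_forms N \<Longrightarrow> \<alpha> p (\<lambda>f\<in>A. 0) = 0"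
  using one_form_scale[OF _ tangent_space_zero, of \<alpha> p 0] by (simp cong: restrict_cong)

lemma one_form_sum:
  assumes \<alpha>: "\<alpha> \<in> one_forms N" and "finite I" "\<And>i. i \<in> I \<Longrightarrow> v i \<in> T p"
  shows "\<alpha> p (\<lambda>f\<in>A. \<Sum>i\<in>I. c i * v i f) = (\<Sum>i\<in>I. c i * \<alpha> p (v i))"
  using assms(2,3)
proof (induction I)
  case (insert i I)
  have "\<alpha> p (\<lambda>f\<in>A. \<Sum>i\<in>insert i I. c i * v i f) =
      \<alpha> p (\<lambda>f\<in>A. (\<lambda>f\<in>A. c i * v i f) f + (\<lambda>f\<in>A. \<Sum>i\<in>I. c i * v i f) f)"
    using insert.hyps by (simp cong: restrict_cong)
  also have "\<dots> = c i * \<alpha> p (v i) + (\<Sum>i\<in>I. c i * \<alpha> p (v i))"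
  proof -
    have "(\<lambda>f\<in>A. c i * v i f) \<in> T p" "(\<lambda>f\<in>A. \<Sum>i\<in>I. c i * v i f) \<in> T p"
      using insert.prems by (auto intro!: tangent_space_scale tangent_space_combination)
    note add = one_form_add[OF \<alpha> this]
    have IH: "\<alpha> p (\<lambda>f\<in>A. \<Sum>i\<in>I. c i * v i f) = (\<Sum>i\<in>I. c i * \<alpha> p (v i))"
      using insert.IH insert.prems by blast
    have "\<alpha> p (\<lambda>f\<in>A. c i * v i f) = c i * \<alpha> p (v i)"
      using insert.prems by (intro one_form_scale[OF \<alpha>]) simp
    then show ?thesis
      unfolding add IH by (rule arg_cong)
  qed
  finally show ?case by (simp only: sum.insert[OF insert.hyps])
qed (simp add: one_form_zero[OF \<alpha>])

lemma one_formI: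
  assumes "\<And>p u v. u \<in> T p \<Longrightarrow> v \<in> T p \<Longrightarrow> a p (\<lambda>f\<in>A. u f + v f) = a p u + a p v"
    and "\<And>p c v. v \<in> T p \<Longrightarrow> a p (\<lambda>f\<in>A. c * v f) = c * a p v"
    and "\<And>X. X \<in> vector_fields N \<Longrightarrow> (\<lambda>p. a p (X p)) \<in> A"
  shows "(\<lambda>p. \<lambda>v\<in>T p. a p v) \<in> one_forms N"
  using assms
  by (simp add: one_forms_def cotangent_space_def tangent_space_add tangent_space_scale vector_field_tangent)

lemma one_form_eqI:
  assumes "\<alpha> \<in> one_forms N" "\<beta> \<in> one_forms N" "\<And>p v. v \<in> T p \<Longrightarrow> \<alpha> p v = \<beta> p v"
  shows "\<alpha> = \<beta>"
proof
  fix p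
  have "\<alpha> p \<in> extensional (T p)" "\<beta> p \<in> extensional (T p)"
    using assms(1,2) by (auto simp: one_forms_def cotangent_space_def)
  then show "\<alpha> p = \<beta> p"
    using assms(3) by (rule extensionalityI)
qed

lemma one_forms_add [simp]:
  assumes "\<alpha> \<in> one_forms N" "\<beta> \<in> one_forms N"
  shows "\<alpha> \<oplus>\<^bsub>D\<^esub> \<beta> \<in> one_forms N"
  unfolding one_form_module_simps
proof (rule one_formI)
  show "(\<lambda>p. \<alpha> p (X p) + \<beta> p (X p)) \<in> A" if "X \<in> vector_fields N" for X
    using one_form_smooth[OF assms(1) that] one_form_smooth[OF assms(2) that] by (rule smooth_add)
qed (simp_all add: one_form_add[OF assms(1)] one_form_add[OF assms(2)]
    one_form_scale[OF assms(1)] one_form_scale[OF assms(2)] distrib_left)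

lemma one_forms_smult [simp]:
  assumes "a \<in> A" "\<beta> \<in> one_forms N"
  shows "a \<odot>\<^bsub>D\<^esub> \<beta> \<in> one_forms N"
  unfolding one_form_module_simps
proof (rule one_formI)
  show "(\<lambda>p. a p * \<beta> p (X p)) \<in> A" if "X \<in> vector_fields N" for X
    using assms(1) one_form_smooth[OF assms(2) that] by (rule smooth_mult)
qed (simp_all add: one_form_add[OF assms(2)] one_form_scale[OF assms(2)] distrib_left)

lemma one_forms_zero [simp]: "\<zero>\<^bsub>D\<^esub> \<in> one_forms N"
  unfolding one_form_module_simps by (rule one_formI) auto

lemma module_one_forms: "Module.module (smooth_functions N) D"
proof (rule moduleI[OF cring_smooth_functions])
  show "abelian_group D"
  proof (rule abelian_groupI)
    fix \<alpha> assume "\<alpha> \<in> carrier D"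
    then have "(\<lambda>p. \<lambda>v\<in>T p. (-1) * \<alpha> p v) \<in> one_forms N"
      using one_forms_smult[of "\<lambda>p. -1" \<alpha>] by simp
    then show "\<exists>\<beta>\<in>carrier D. \<beta> \<oplus>\<^bsub>D\<^esub> \<alpha> = \<zero>\<^bsub>D\<^esub>"
      by (intro bexI[of _ "\<lambda>p. \<lambda>v\<in>T p. (-1) * \<alpha> p v"]) (auto simp: fun_eq_iff)
  next
    fix \<alpha> assume "\<alpha> \<in> carrier D"
    then have \<alpha>: "\<alpha> \<in> one_forms N" by simp
    show "\<zero>\<^bsub>D\<^esub> \<oplus>\<^bsub>D\<^esub> \<alpha> = \<alpha>"
      using one_forms_add[OF one_forms_zero \<alpha>] \<alpha> by (rule one_form_eqI) simp
  qed (use one_forms_add one_forms_zero in \<open>auto simp: fun_eq_iff\<close>)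
next
  fix \<alpha> assume "\<alpha> \<in> carrier D"
  then have \<alpha>: "\<alpha> \<in> one_forms N" by simp
  show "\<one>\<^bsub>smooth_functions N\<^esub> \<odot>\<^bsub>D\<^esub> \<alpha> = \<alpha>"
    by (rule one_form_eqI[OF one_forms_smult \<alpha>]) (use \<alpha> in auto)
qed (use one_forms_smult in \<open>auto simp: fun_eq_iff algebra_simps\<close>)

lemma one_form_minus:
  assumes "\<alpha> \<in> one_forms N" "\<beta> \<in> one_forms N" "v \<in> T p"
  shows "(\<alpha> \<ominus>\<^bsub>D\<^esub> \<beta>) p v = \<alpha> p v - \<beta> p v"
proof -
  interpret D: abelian_group D
    using module_one_forms by (rule module.axioms)
  have "\<alpha> = (\<alpha> \<ominus>\<^bsub>D\<^esub> \<beta>) \<oplus>\<^bsub>D\<^esub> \<beta>"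
  proof -
    have "\<alpha> \<in> carrier D" "\<beta> \<in> carrier D" using assms by simp_all
    then show ?thesis
      by (simp del: one_form_module_simps add: D.minus_eq D.a_assoc D.l_neg)
  qed
  then have "\<alpha> p v = ((\<alpha> \<ominus>\<^bsub>D\<^esub> \<beta>) \<oplus>\<^bsub>D\<^esub> \<beta>) p v"
    by (rule arg_cong)
  then show ?thesis
    using assms(3) by simp
qed

lemma one_forms_minus: "\<alpha> \<in> one_forms N \<Longrightarrow> \<beta> \<in> one_forms N \<Longrightarrow> \<alpha> \<ominus>\<^bsub>D\<^esub> \<beta> \<in> one_forms N"
  using abelian_group.minus_closed[OF module.axioms(2)[OF module_one_forms]] by simp

lemma exterior_d_apply [simp]: "v \<in> T p \<Longrightarrow> exterior_d N f p v = v f"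
  by (simp add: exterior_d_def)

lemma exterior_d_one_form [simp, intro]: "f \<in> A \<Longrightarrow> exterior_d N f \<in> one_forms N"
  unfolding exterior_d_def by (rule one_formI) (auto simp: vector_field_smooth)

lemma exterior_d_add: "f \<in> A \<Longrightarrow> g \<in> A \<Longrightarrow>
    exterior_d N (\<lambda>p. f p + g p) = exterior_d N f \<oplus>\<^bsub>D\<^esub> exterior_d N g"
  by (auto simp: exterior_d_def fun_eq_iff tangent_add)

lemma exterior_d_mult: "f \<in> A \<Longrightarrow> g \<in> A \<Longrightarrow>
    exterior_d N (\<lambda>p. f p * g p) = f \<odot>\<^bsub>D\<^esub> exterior_d N g \<oplus>\<^bsub>D\<^esub> g \<odot>\<^bsub>D\<^esub> exterior_d N f"
  by (auto simp: exterior_d_def fun_eq_iff tangent_mult)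

lemma exterior_d_const: "exterior_d N (\<lambda>p. c) = \<zero>\<^bsub>D\<^esub>"
  by (auto simp: exterior_d_def fun_eq_iff tangent_const)


text \<open>The two readings of a local frame: every tangent vector extends to a vector field, and every
  one-form is, up to the factor \<open>\<eta>\<close>, a combination of the differentials \<open>du\<^sub>i\<close>.\<close>

lemma tangent_extends:
  assumes "v \<in> T p"
  obtains Y where "Y \<in> vector_fields N" "Y p = v"
proof -
  obtain \<eta> and I :: "'e option set" and u E where fr: "local_frame p \<eta> I u E"
    by (rule local_frame_exists)
  let ?Y = "\<lambda>y. \<lambda>f\<in>A. \<Sum>i\<in>I. (v (u i) / \<eta> p) * E i y f"
  have Y: "?Y \<in> vector_fields N"
    using fr vector_field_combination[of I "\<lambda>i y. v (u i) / \<eta> p" E] by (simp add: local_frame_def)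
  have "?Y p f = v f" if "f \<in> A" for f
  proof -
    have "\<eta> p * v f = (\<Sum>i\<in>I. v (u i) * E i p f)" "\<eta> p \<noteq> 0"
      using fr assms that unfolding local_frame_def by blast+
    then show ?thesis
      using that by (simp add: sum_divide_distrib[symmetric] field_simps)
  qed
  then have "?Y p = v"
    by (rule tangent_eqI[OF vector_field_tangent[OF Y] assms])
  with Y show ?thesis by (rule that)
qed

lemma frame_one_form:
  assumes fr: "local_frame p \<eta> I u E" and \<alpha>: "\<alpha> \<in> one_forms N" and v: "v \<in> T y"
  shows "\<eta> y * \<alpha> y v = (\<Sum>i\<in>I. \<alpha> y (E i y) * v (u i))"
proof -
  have E: "E i y \<in> T y" if "i \<in> I" for i
    using fr that vector_field_tangent by (simp add: local_frame_def)
  have "(\<lambda>f\<in>A. \<eta> y * v f) = (\<lambda>f\<in>A. \<Sum>i\<in>I. v (u i) * E i y f)"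
    using fr v by (intro restrict_ext) (auto simp: local_frame_def)
  then have "\<alpha> y (\<lambda>f\<in>A. \<eta> y * v f) = \<alpha> y (\<lambda>f\<in>A. \<Sum>i\<in>I. v (u i) * E i y f)"
    by (rule arg_cong)
  then show ?thesis
    using one_form_sum[OF \<alpha> _ E, where I=I] fr
    by (simp add: one_form_scale[OF \<alpha> v] local_frame_def mult.commute)
qed

text \<open>The induction runs over the sum \<open>\<Sum>\<^sub>i \<alpha>(E\<^sub>i) du\<^sub>i = \<eta> \<alpha>\<close>.\<close>

lemma frame_combination_induct:
  assumes fr: "local_frame p \<eta> I u E" and \<alpha>: "\<alpha> \<in> one_forms N"
    and zero: "P \<zero>\<^bsub>D\<^esub>"
    and add: "\<And>\<beta> \<gamma>. \<beta> \<in> one_forms N \<Longrightarrow> \<gamma> \<in> one_forms N \<Longrightarrow> P \<beta> \<Longrightarrow> P \<gamma> \<Longrightarrow> P (\<beta> \<oplus>\<^bsub>D\<^esub> \<gamma>)"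
    and gen: "\<And>a f. a \<in> A \<Longrightarrow> f \<in> A \<Longrightarrow> P (a \<odot>\<^bsub>D\<^esub> exterior_d N f)"
  shows "P (\<eta> \<odot>\<^bsub>D\<^esub> \<alpha>)"
proof -
  let ?s = "\<lambda>J p. \<lambda>v\<in>T p. \<Sum>i\<in>J. \<alpha> p (E i p) * v (u i)"
  have "?s J \<in> one_forms N \<and> P (?s J)" if "finite J" "J \<subseteq> I" for J
    using that
  proof (induction J)
    case empty
    have "?s {} = \<zero>\<^bsub>D\<^esub>" by (simp add: fun_eq_iff)
    then show ?case using zero one_forms_zero by (simp only:)
  next
    case (insert i J)
    have i: "u i \<in> A" and Ei: "E i \<in> vector_fields N"
      using fr insert.prems by (auto simp: local_frame_def)
    note aE = one_form_smooth[OF \<alpha> Ei]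
    let ?t = "(\<lambda>p. \<alpha> p (E i p)) \<odot>\<^bsub>D\<^esub> exterior_d N (u i)"
    have "?s (insert i J) = ?t \<oplus>\<^bsub>D\<^esub> ?s J"
      using insert.hyps by (auto simp: fun_eq_iff)
    moreover have t: "?t \<in> one_forms N" "P ?t"
      by (rule one_forms_smult[OF aE exterior_d_one_form[OF i]]) (rule gen[OF aE i])
    moreover have IH: "?s J \<in> one_forms N" "P (?s J)"
      using insert.IH insert.prems by blast+
    ultimately show ?case
      using one_forms_add[OF t(1) IH(1)] add[OF t(1) IH(1) t(2) IH(2)] by (simp only:)
  qed
  then have "P (?s I)" using fr by (simp add: local_frame_def)
  also have "?s I = \<eta> \<odot>\<^bsub>D\<^esub> \<alpha>"
    using frame_one_form[OF fr \<alpha>] by (auto simp: fun_eq_iff)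
  finally show ?thesis .
qed

text \<open>
  To compare two linear maps at \<open>p\<close>, multiply the one-form by the function \<open>\<eta>\<close> of a frame at \<open>p\<close>: the
  product is a combination of exact forms, and \<open>\<eta>(p)\<close> can be cancelled.
\<close>

lemma tensorial_eqI:
  fixes \<phi> \<psi> :: "'a one_form \<Rightarrow> 'a \<Rightarrow> 'w::real_vector"
  assumes add: "\<And>\<beta> \<gamma> p. \<beta> \<in> one_forms N \<Longrightarrow> \<gamma> \<in> one_forms N \<Longrightarrow> \<phi> (\<beta> \<oplus>\<^bsub>D\<^esub> \<gamma>) p = \<phi> \<beta> p + \<phi> \<gamma> p"
      "\<And>\<beta> \<gamma> p. \<beta> \<in> one_forms N \<Longrightarrow> \<gamma> \<in> one_forms N \<Longrightarrow> \<psi> (\<beta> \<oplus>\<^bsub>D\<^esub> \<gamma>) p = \<psi> \<beta> p + \<psi> \<gamma> p"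
    and smult: "\<And>a \<beta> p. a \<in> A \<Longrightarrow> \<beta> \<in> one_forms N \<Longrightarrow> \<phi> (a \<odot>\<^bsub>D\<^esub> \<beta>) p = a p *\<^sub>R \<phi> \<beta> p"
      "\<And>a \<beta> p. a \<in> A \<Longrightarrow> \<beta> \<in> one_forms N \<Longrightarrow> \<psi> (a \<odot>\<^bsub>D\<^esub> \<beta>) p = a p *\<^sub>R \<psi> \<beta> p"
    and exact: "\<And>f. f \<in> A \<Longrightarrow> \<phi> (exterior_d N f) = \<psi> (exterior_d N f)"
    and \<alpha>: "\<alpha> \<in> one_forms N"
  shows "\<phi> \<alpha> = \<psi> \<alpha>"
proof
  fix p
  obtain \<eta> and I :: "'e option set" and u E where fr: "local_frame p \<eta> I u E"
    by (rule local_frame_exists)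
  then have \<eta>: "\<eta> \<in> A" "\<eta> p \<noteq> 0" by (auto simp: local_frame_def)
  have "\<phi> (\<eta> \<odot>\<^bsub>D\<^esub> \<alpha>) p = \<psi> (\<eta> \<odot>\<^bsub>D\<^esub> \<alpha>) p"
  proof (rule frame_combination_induct[OF fr \<alpha>])
    have "\<phi> \<zero>\<^bsub>D\<^esub> p = 0" "\<psi> \<zero>\<^bsub>D\<^esub> p = 0"
      using add(1)[OF one_forms_zero one_forms_zero, of p] add(2)[OF one_forms_zero one_forms_zero, of p]
      by (simp_all cong: restrict_cong)
    then show "\<phi> \<zero>\<^bsub>D\<^esub> p = \<psi> \<zero>\<^bsub>D\<^esub> p" by (simp only:)
  next
    show "\<phi> (a \<odot>\<^bsub>D\<^esub> exterior_d N f) p = \<psi> (a \<odot>\<^bsub>D\<^esub> exterior_d N f) p" if "a \<in> A" "f \<in> A" for a f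
      using smult[OF that(1) exterior_d_one_form[OF that(2)]] exact[OF that(2)] by (simp only:)
  qed (simp only: add)
  then show "\<phi> \<alpha> p = \<psi> \<alpha> p"
    using smult[OF \<eta>(1) \<alpha>] \<eta>(2) by (simp del: one_form_module_simps)
qed


section \<open>The Lie derivative of one-forms\<close>

lemma vector_field_bracket:
  assumes "X \<in> vector_fields N" "Y \<in> vector_fields N"
  shows "vector_field_bracket N X Y \<in> vector_fields N"
proof -
  note X = vector_field_tangent[OF assms(1)] and Y = vector_field_tangent[OF assms(2)]
  note sm = vector_field_smooth[OF assms(1)] vector_field_smooth[OF assms(2)]
  have "vector_field_bracket N X Y p \<in> T p" for p
    unfolding tangent_space_def vector_field_bracket_def
    by (auto simp: tangent_add[OF X] tangent_add[OF Y] tangent_scale[OF X] tangent_scale[OF Y]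
        tangent_mult[OF X] tangent_mult[OF Y] sm smooth_mult[OF smooth_const] smooth_mult smooth_add
        algebra_simps)
  then show ?thesis
    unfolding vector_fields_def by (auto simp: vector_field_bracket_def sm smooth_diff)
qed

text \<open>
  The value \<open>(L\<^sub>X \<beta>)(Y)\<close> as a function of a vector field \<open>Y\<close>, which has to be shown to depend on the
  tangent vector \<open>Y p\<close> alone.
\<close>

definition lie_derivative_on :: "'a vector_field \<Rightarrow> 'a one_form \<Rightarrow> 'a vector_field \<Rightarrow> 'a \<Rightarrow> real" where
  "lie_derivative_on X \<beta> Y p = X p (\<lambda>q. \<beta> q (Y q)) - \<beta> p (vector_field_bracket N X Y p)"

text \<open>
  The expression that defines the Lie derivative is tensorial in \<open>Y\<close>: the terms with \<open>X(g)\<close> for a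
  coefficient \<open>g\<close> of \<open>Y\<close> cancel. Hence its value at \<open>p\<close> is determined by \<open>Y p\<close>.
\<close>

lemma lie_derivative_on_frame:
  assumes fr: "local_frame p \<eta> I u E"
    and X: "X \<in> vector_fields N" and \<beta>: "\<beta> \<in> one_forms N" and Y: "Y \<in> vector_fields N"
  shows "\<eta> p * lie_derivative_on X \<beta> Y p = (\<Sum>i\<in>I. Y p (u i) * lie_derivative_on X \<beta> (E i) p)"
proof -
  have fin: "finite I" and \<eta>: "\<eta> \<in> A" and u: "\<And>i. i \<in> I \<Longrightarrow> u i \<in> A"
    and E: "\<And>i. i \<in> I \<Longrightarrow> E i \<in> vector_fields N"
    using fr by (auto simp: local_frame_def)
  note Xp = vector_field_tangent[OF X, of p] and Yp = vector_field_tangent[OF Y]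
  let ?g = "\<lambda>i q. Y q (u i)"
  have g: "?g i \<in> A" if "i \<in> I" for i using vector_field_smooth[OF Y u[OF that]] .
  have bE: "(\<lambda>q. \<beta> q (E i q)) \<in> A" if "i \<in> I" for i using one_form_smooth[OF \<beta> E[OF that]] .
  have EA: "(\<lambda>q. E i q f) \<in> A" if "i \<in> I" "f \<in> A" for i f using vector_field_smooth[OF E[OF that(1)] that(2)] .
  \<comment> \<open>Apply \<open>X\<close> to the identity between \<open>\<eta> \<beta>(Y)\<close> and the combination of the \<open>\<beta>(E\<^sub>i)\<close>.\<close>
  have "(\<lambda>q. \<eta> q * \<beta> q (Y q)) = (\<lambda>q. \<Sum>i\<in>I. ?g i q * \<beta> q (E i q))"
    using frame_one_form[OF fr \<beta> Yp] by (simp add: mult.commute)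
  then have "X p (\<lambda>q. \<eta> q * \<beta> q (Y q)) = X p (\<lambda>q. \<Sum>i\<in>I. ?g i q * \<beta> q (E i q))"
    by (rule arg_cong)
  then have 1: "\<eta> p * X p (\<lambda>q. \<beta> q (Y q)) + \<beta> p (Y p) * X p \<eta> =
      (\<Sum>i\<in>I. ?g i p * X p (\<lambda>q. \<beta> q (E i q)) + \<beta> p (E i p) * X p (?g i))"
    using g bE by (simp add: tangent_mult[OF Xp \<eta> one_form_smooth[OF \<beta> Y]] tangent_sum[OF Xp]
        smooth_mult tangent_mult[OF Xp])
  \<comment> \<open>The same for the bracket with \<open>X\<close>, evaluated by \<open>\<beta>\<close> at \<open>p\<close>.\<close>
  let ?B = "\<lambda>Z. vector_field_bracket N X Z p"
  have 2: "\<eta> p * ?B Y f + X p \<eta> * Y p f = (\<Sum>i\<in>I. ?g i p * ?B (E i) f) + (\<Sum>i\<in>I. X p (?g i) * E i p f)"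
    if f: "f \<in> A" for f
  proof -
    have frY: "\<eta> q * Y q h = (\<Sum>i\<in>I. ?g i q * E i q h)" if "h \<in> A" for h q
      using fr Yp that by (auto simp: local_frame_def)
    then have "(\<lambda>q. \<eta> q * Y q f) = (\<lambda>q. \<Sum>i\<in>I. ?g i q * E i q f)"
      using f by simp
    then have "X p (\<lambda>q. \<eta> q * Y q f) = X p (\<lambda>q. \<Sum>i\<in>I. ?g i q * E i q f)"
      by (rule arg_cong)
    then have "\<eta> p * X p (\<lambda>q. Y q f) + Y p f * X p \<eta> =
        (\<Sum>i\<in>I. ?g i p * X p (\<lambda>q. E i q f) + E i p f * X p (?g i))"
      using g EA[OF _ f] by (simp add: tangent_mult[OF Xp \<eta> vector_field_smooth[OF Y f]]
          tangent_sum[OF Xp] smooth_mult tangent_mult[OF Xp])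
    moreover have "\<eta> p * Y p (\<lambda>q. X q f) = (\<Sum>i\<in>I. ?g i p * E i p (\<lambda>q. X q f))"
      by (rule frY[OF vector_field_smooth[OF X f]])
    ultimately show ?thesis
      using f by (simp add: vector_field_bracket_def algebra_simps sum.distrib sum_subtractf)
  qed
  \<comment> \<open>Both sides of the last identity as single linear combinations, to which \<open>\<beta>\<close> can be applied.\<close>
  let ?c = "\<lambda>(b, i). if b then ?g i p else X p (?g i)"
  let ?w = "\<lambda>(b, i). if b then ?B (E i) else E i p"
  have w: "?w j \<in> T p" if "j \<in> UNIV \<times> I" for j
    using that vector_field_tangent[OF vector_field_bracket[OF X E]] vector_field_tangent[OF E] by auto
  let ?c' = "\<lambda>b. if b then \<eta> p else X p \<eta>" and ?w' = "\<lambda>b. if b then ?B Y else Y p"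
  have w': "?w' b \<in> T p" for b
    using vector_field_tangent[OF vector_field_bracket[OF X Y]] vector_field_tangent[OF Y] by auto
  have split: "(\<Sum>j\<in>UNIV \<times> I. ?c j * F (?w j)) =
      (\<Sum>i\<in>I. ?g i p * F (?B (E i))) + (\<Sum>i\<in>I. X p (?g i) * F (E i p))" for F :: "_ \<Rightarrow> real"
    unfolding sum.cartesian_product' by (simp add: UNIV_bool add.commute)
  have "(\<lambda>f\<in>A. \<Sum>b\<in>UNIV. ?c' b * ?w' b f) = (\<lambda>f\<in>A. \<Sum>j\<in>UNIV \<times> I. ?c j * ?w j f)"
    using 2 split[of "\<lambda>v. v f" for f] by (intro restrict_ext) (simp add: UNIV_bool add.commute)
  then have "\<beta> p (\<lambda>f\<in>A. \<Sum>b\<in>UNIV. ?c' b * ?w' b f) = \<beta> p (\<lambda>f\<in>A. \<Sum>j\<in>UNIV \<times> I. ?c j * ?w j f)"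
    by (rule arg_cong)
  then have 3: "\<eta> p * \<beta> p (?B Y) + X p \<eta> * \<beta> p (Y p) =
      (\<Sum>i\<in>I. ?g i p * \<beta> p (?B (E i))) + (\<Sum>i\<in>I. X p (?g i) * \<beta> p (E i p))"
  proof -
    assume eq: "\<beta> p (\<lambda>f\<in>A. \<Sum>b\<in>UNIV. ?c' b * ?w' b f) = \<beta> p (\<lambda>f\<in>A. \<Sum>j\<in>UNIV \<times> I. ?c j * ?w j f)"
    have "\<beta> p (\<lambda>f\<in>A. \<Sum>j\<in>UNIV \<times> I. ?c j * ?w j f) = (\<Sum>j\<in>UNIV \<times> I. ?c j * \<beta> p (?w j))"
      by (rule one_form_sum[OF \<beta>]) (use fin w in auto)
    moreover have "\<beta> p (\<lambda>f\<in>A. \<Sum>b\<in>UNIV. ?c' b * ?w' b f) = (\<Sum>b\<in>UNIV. ?c' b * \<beta> p (?w' b))"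
      by (rule one_form_sum[OF \<beta>]) (use w' in auto)
    ultimately have "(\<Sum>b\<in>UNIV. ?c' b * \<beta> p (?w' b)) = (\<Sum>j\<in>UNIV \<times> I. ?c j * \<beta> p (?w j))"
      using eq by (simp only:)
    then show ?thesis
      unfolding split[of "\<beta> p"] by (simp add: UNIV_bool add.commute)
  qed
  show ?thesis
    using 1 3 by (simp add: lie_derivative_on_def algebra_simps sum.distrib sum_subtractf)
qed

text \<open>
  A tangent vector \<open>v\<close> is extended to a vector field in order to define the value of the Lie derivative
  on \<open>v\<close>; the frame formula shows that the result is linear in \<open>v\<close> whatever extension is taken.
\<close>

lemma lie_derivative:
  assumes X: "X \<in> vector_fields N" and \<beta>: "\<beta> \<in> one_forms N"
  shows "lie_derivative N X \<beta> \<in> one_forms N"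
    and "Y \<in> vector_fields N \<Longrightarrow> lie_derivative N X \<beta> p (Y p) = lie_derivative_on X \<beta> Y p"
proof -
  define ext where "ext p v = (SOME Y. Y \<in> vector_fields N \<and> Y p = v)" for p v
  have ext: "ext p v \<in> vector_fields N" "ext p v p = v" if "v \<in> T p" for p v
    using someI_ex[of "\<lambda>Y. Y \<in> vector_fields N \<and> Y p = v"] tangent_extends[OF that]
    unfolding ext_def by metis+
  define \<gamma> where "\<gamma> = (\<lambda>p. \<lambda>v\<in>T p. lie_derivative_on X \<beta> (ext p v) p)"
  have formula: "\<eta> p * \<gamma> p v = (\<Sum>i\<in>I. v (u i) * lie_derivative_on X \<beta> (E i) p)"
    if "local_frame p \<eta> I u E" "v \<in> T p" for p \<eta> v u E and I :: "'e option set"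
    using lie_derivative_on_frame[OF that(1) X \<beta> ext(1)[OF that(2)]] ext(2)[OF that(2)] that(2)
    by (simp add: \<gamma>_def)
  have \<gamma>: "\<gamma> p (Y p) = lie_derivative_on X \<beta> Y p" if Y: "Y \<in> vector_fields N" for Y p
  proof -
    obtain \<eta> and I :: "'e option set" and u E where fr: "local_frame p \<eta> I u E"
      by (rule local_frame_exists)
    have "\<eta> p * \<gamma> p (Y p) = \<eta> p * lie_derivative_on X \<beta> Y p"
      using formula[OF fr vector_field_tangent[OF Y]] lie_derivative_on_frame[OF fr X \<beta> Y] by simp
    then show ?thesis using fr by (simp add: local_frame_def)
  qed
  have "\<gamma> \<in> one_forms N"
    unfolding \<gamma>_def
  proof (rule one_formI)
    fix p u v c assume uv: "u \<in> T p" "v \<in> T p"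
    obtain \<eta> and I :: "'e option set" and w E where fr: "local_frame p \<eta> I w E"
      by (rule local_frame_exists)
    then have w: "\<And>i. i \<in> I \<Longrightarrow> w i \<in> A" and \<eta>: "\<eta> p \<noteq> 0" by (auto simp: local_frame_def)
    note [simp] = uv tangent_space_add[OF uv] tangent_space_scale[OF uv(2)]
    note F = formula[OF fr uv(1)] formula[OF fr uv(2)] formula[OF fr tangent_space_add[OF uv]]
      formula[OF fr tangent_space_scale[OF uv(2)]]
    have "\<eta> p * \<gamma> p (\<lambda>f\<in>A. u f + v f) = \<eta> p * (\<gamma> p u + \<gamma> p v)"
      unfolding distrib_left F using w by (simp add: sum.distrib[symmetric] algebra_simps)
    then show "lie_derivative_on X \<beta> (ext p (\<lambda>f\<in>A. u f + v f)) p = lie_derivative_on X \<beta> (ext p u) p + lie_derivative_on X \<beta> (ext p v) p"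
      using \<eta> by (simp add: \<gamma>_def)
  next
    fix p v c assume v: "v \<in> T p"
    obtain \<eta> and I :: "'e option set" and w E where fr: "local_frame p \<eta> I w E"
      by (rule local_frame_exists)
    then have w: "\<And>i. i \<in> I \<Longrightarrow> w i \<in> A" and \<eta>: "\<eta> p \<noteq> 0" by (auto simp: local_frame_def)
    have "\<eta> p * \<gamma> p (\<lambda>f\<in>A. c * v f) = c * (\<eta> p * \<gamma> p v)"
      unfolding formula[OF fr tangent_space_scale[OF v]] formula[OF fr v]
      using w by (simp add: sum_distrib_left algebra_simps)
    then show "lie_derivative_on X \<beta> (ext p (\<lambda>f\<in>A. c * v f)) p = c * lie_derivative_on X \<beta> (ext p v) p"
      using \<eta> v tangent_space_scale[OF v] by (simp add: \<gamma>_def)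
  next
    fix Y assume Y: "Y \<in> vector_fields N"
    have "(\<lambda>p. lie_derivative_on X \<beta> Y p) \<in> A"
      unfolding lie_derivative_on_def
      by (intro smooth_diff vector_field_smooth[OF X] one_form_smooth[OF \<beta>] vector_field_bracket X Y)
    also have "(\<lambda>p. lie_derivative_on X \<beta> Y p) = (\<lambda>p. lie_derivative_on X \<beta> (ext p (Y p)) p)"
      using \<gamma>[OF Y] vector_field_tangent[OF Y] by (simp add: \<gamma>_def fun_eq_iff)
    finally show "(\<lambda>p. lie_derivative_on X \<beta> (ext p (Y p)) p) \<in> A" .
  qed
  note \<gamma>1 = this
  have "lie_derivative N X \<beta> = \<gamma>"
    unfolding lie_derivative_def
  proof (rule the_equality)
    show "\<gamma> \<in> one_forms N \<and> (\<forall>Y\<in>vector_fields N. \<forall>p. \<gamma> p (Y p) = X p (\<lambda>q. \<beta> q (Y q)) - \<beta> p (vector_field_bracket N X Y p))"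
      using \<gamma>1 \<gamma> by (simp add: lie_derivative_on_def)
    fix \<delta> assume \<delta>: "\<delta> \<in> one_forms N \<and> (\<forall>Y\<in>vector_fields N. \<forall>p. \<delta> p (Y p) = X p (\<lambda>q. \<beta> q (Y q)) - \<beta> p (vector_field_bracket N X Y p))"
    show "\<delta> = \<gamma>"
    proof (rule one_form_eqI)
      fix p v assume "v \<in> T p"
      then obtain Y where "Y \<in> vector_fields N" "Y p = v" by (rule tangent_extends)
      then show "\<delta> p v = \<gamma> p v" using \<delta> \<gamma> by (auto simp: lie_derivative_on_def)
    qed (use \<delta> \<gamma>1 in auto)
  qed
  then show "lie_derivative N X \<beta> \<in> one_forms N"
    and "Y \<in> vector_fields N \<Longrightarrow> lie_derivative N X \<beta> p (Y p) = lie_derivative_on X \<beta> Y p"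
    using \<gamma>1 \<gamma> by simp_all
qed

end

section \<open>The bracket of one-forms on a Poisson manifold\<close>

context poisson_manifold
begin

lemma br_closed [simp, intro]: "f \<in> A \<Longrightarrow> g \<in> A \<Longrightarrow> br f g \<in> A"
  using poisson_bracket by (simp add: poisson_bracket_def)

lemma br_add_left: "f \<in> A \<Longrightarrow> g \<in> A \<Longrightarrow> h \<in> A \<Longrightarrow> br (\<lambda>p. f p + g p) h = (\<lambda>p. br f h p + br g h p)"
  and br_add_right: "f \<in> A \<Longrightarrow> g \<in> A \<Longrightarrow> h \<in> A \<Longrightarrow> br h (\<lambda>p. f p + g p) = (\<lambda>p. br h f p + br h g p)"
  using poisson_bracket unfolding poisson_bracket_def smooth_functions_simps by blast+

lemma br_scale_left: "f \<in> A \<Longrightarrow> g \<in> A \<Longrightarrow> br (\<lambda>p. r * f p) g = (\<lambda>p. r * br f g p)"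
  and br_scale_right: "f \<in> A \<Longrightarrow> g \<in> A \<Longrightarrow> br f (\<lambda>p. r * g p) = (\<lambda>p. r * br f g p)"
  using poisson_bracket unfolding poisson_bracket_def smooth_functions_simps by blast+

lemma br_self: "f \<in> A \<Longrightarrow> br f f = (\<lambda>p. 0)"
  using poisson_bracket unfolding poisson_bracket_def smooth_functions_simps by blast

lemma br_jacobi: "f \<in> A \<Longrightarrow> g \<in> A \<Longrightarrow> h \<in> A \<Longrightarrow>
    (\<lambda>p. br f (br g h) p + br g (br h f) p + br h (br f g) p) = (\<lambda>p. 0)"
  using poisson_bracket unfolding poisson_bracket_def smooth_functions_simps by blast

lemma br_mult_left: "f \<in> A \<Longrightarrow> g \<in> A \<Longrightarrow> h \<in> A \<Longrightarrow>
    br (\<lambda>p. f p * g p) h = (\<lambda>p. f p * br g h p + br f h p * g p)"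
  using poisson_bracket unfolding poisson_bracket_def smooth_functions_simps by blast

lemma br_antisym: 
  assumes "f \<in> A" "g \<in> A"
  shows "br f g = (\<lambda>p. - br g f p)"
proof
  fix p
  have "br (\<lambda>p. f p + g p) (\<lambda>p. f p + g p) p = 0"
    using br_self[OF smooth_add[OF assms]] by (rule fun_cong)
  then show "br f g p = - br g f p"
    using assms by (simp add: br_add_left br_add_right br_self)
qed

lemma br_mult_right:
  assumes "f \<in> A" "g \<in> A" "h \<in> A"
  shows "br h (\<lambda>p. f p * g p) = (\<lambda>p. f p * br h g p + br h f p * g p)"
proof
  fix p
  show "br h (\<lambda>p. f p * g p) p = f p * br h g p + br h f p * g p"
    unfolding br_antisym[OF assms(3) smooth_mult[OF assms(1,2)]] br_mult_left[OF assms]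
      br_antisym[OF assms(2,3)] br_antisym[OF assms(1,3)] by simp
qed

text \<open>The vector field \<open>f \<mapsto> {f, g}\<close>; its sign is the one that gives \<open>\<pi>(\<alpha>, dg) = \<alpha>(X\<^sub>g)\<close>.\<close>

definition hamiltonian :: "('a \<Rightarrow> real) \<Rightarrow> 'a vector_field" where
  "hamiltonian g p = (\<lambda>f\<in>A. br f g p)"

lemma hamiltonian_vector_field: "g \<in> A \<Longrightarrow> hamiltonian g \<in> vector_fields N"
  by (auto simp: vector_fields_def tangent_space_def hamiltonian_def br_add_left br_scale_left
      br_mult_left smooth_mult[OF smooth_const] algebra_simps)

lemmas hamiltonian_tangent = vector_field_tangent[OF hamiltonian_vector_field]

text \<open>
  The field \<open>\<alpha>\<^sup>\<sharp>\<close> must satisfy \<open>\<alpha>\<^sup>\<sharp>(g) = \<pi>(\<alpha>, dg) = \<alpha>(X\<^sub>g)\<close>. Taking this as the definition gives a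
  derivation, because \<open>g \<mapsto> X\<^sub>g\<close> is one.
\<close>

definition sharp_field :: "'a one_form \<Rightarrow> 'a vector_field" where
  "sharp_field \<alpha> p = (\<lambda>g\<in>A. \<alpha> p (hamiltonian g p))"

lemma sharp_field_apply: "g \<in> A \<Longrightarrow> sharp_field \<alpha> p g = \<alpha> p (hamiltonian g p)"
  by (simp add: sharp_field_def)

lemma sharp_field_vector_field:
  assumes \<alpha>: "\<alpha> \<in> one_forms N"
  shows "sharp_field \<alpha> \<in> vector_fields N"
proof -
  have 1: "\<alpha> p (hamiltonian (\<lambda>x. f x + g x) p) = \<alpha> p (hamiltonian f p) + \<alpha> p (hamiltonian g p)"
    if "f \<in> A" "g \<in> A" for f g p
  proof -
    have "hamiltonian (\<lambda>x. f x + g x) p = (\<lambda>h\<in>A. hamiltonian f p h + hamiltonian g p h)"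
      unfolding hamiltonian_def using that by (intro restrict_ext) (simp add: br_add_right)
    then show ?thesis
      using one_form_add[OF \<alpha> hamiltonian_tangent hamiltonian_tangent, OF that] by simp
  qed
  have 2: "\<alpha> p (hamiltonian (\<lambda>x. c * f x) p) = c * \<alpha> p (hamiltonian f p)" if "f \<in> A" for f c p
  proof -
    have "hamiltonian (\<lambda>x. c * f x) p = (\<lambda>h\<in>A. c * hamiltonian f p h)"
      unfolding hamiltonian_def using that by (intro restrict_ext) (simp add: br_scale_right)
    then show ?thesis
      using one_form_scale[OF \<alpha> hamiltonian_tangent, OF that] by simp
  qed
  have 3: "\<alpha> p (hamiltonian (\<lambda>x. f x * g x) p) = f p * \<alpha> p (hamiltonian g p) + g p * \<alpha> p (hamiltonian f p)"
    if "f \<in> A" "g \<in> A" for f g p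
  proof -
    have "hamiltonian (\<lambda>x. f x * g x) p =
        (\<lambda>h\<in>A. (\<lambda>h\<in>A. f p * hamiltonian g p h) h + (\<lambda>h\<in>A. g p * hamiltonian f p h) h)"
      unfolding hamiltonian_def using that by (intro restrict_ext) (simp add: br_mult_right)
    then show ?thesis
      using one_form_add[OF \<alpha> tangent_space_scale tangent_space_scale, OF hamiltonian_tangent hamiltonian_tangent,
          OF that(2,1)] that
      by (simp only: one_form_scale[OF \<alpha> hamiltonian_tangent])
  qed
  have "(\<lambda>p. \<alpha> p (hamiltonian g p)) \<in> A" if "g \<in> A" for g
    using one_form_smooth[OF \<alpha> hamiltonian_vector_field[OF that]] .
  then show ?thesis
    unfolding vector_fields_def tangent_space_def
    by (auto simp: sharp_field_def 1 2 3 smooth_mult[OF smooth_const])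
qed

lemmas sharp_field_tangent = vector_field_tangent[OF sharp_field_vector_field]

text \<open>The explicit formula for the Poisson bivector \<open>\<pi>\<close>.\<close>

definition pairing :: "'a one_form \<Rightarrow> 'a one_form \<Rightarrow> 'a \<Rightarrow> real" where
  "pairing \<alpha> \<beta> p = \<beta> p (sharp_field \<alpha> p)"

lemma pairing_closed [simp, intro]: "\<alpha> \<in> one_forms N \<Longrightarrow> \<beta> \<in> one_forms N \<Longrightarrow> pairing \<alpha> \<beta> \<in> A"
  unfolding pairing_def[abs_def] by (rule one_form_smooth[OF _ sharp_field_vector_field])

lemma sharp_field_add:
  "\<alpha> \<in> one_forms N \<Longrightarrow> \<beta> \<in> one_forms N \<Longrightarrow>
    sharp_field (\<alpha> \<oplus>\<^bsub>D\<^esub> \<beta>) p = (\<lambda>g\<in>A. sharp_field \<alpha> p g + sharp_field \<beta> p g)"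
  unfolding sharp_field_def by (intro restrict_ext) (simp add: hamiltonian_tangent)

lemma sharp_field_smult:
  "a \<in> A \<Longrightarrow> \<beta> \<in> one_forms N \<Longrightarrow> sharp_field (a \<odot>\<^bsub>D\<^esub> \<beta>) p = (\<lambda>g\<in>A. a p * sharp_field \<beta> p g)"
  unfolding sharp_field_def by (intro restrict_ext) (simp add: hamiltonian_tangent)

lemma pairing_add_left:
  "\<alpha> \<in> one_forms N \<Longrightarrow> \<beta> \<in> one_forms N \<Longrightarrow> \<gamma> \<in> one_forms N \<Longrightarrow>
    pairing (\<alpha> \<oplus>\<^bsub>D\<^esub> \<beta>) \<gamma> p = pairing \<alpha> \<gamma> p + pairing \<beta> \<gamma> p"
  unfolding pairing_def sharp_field_add by (rule one_form_add) (auto intro: sharp_field_tangent)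

lemma pairing_add_right:
  "\<alpha> \<in> one_forms N \<Longrightarrow> pairing \<alpha> (\<beta> \<oplus>\<^bsub>D\<^esub> \<gamma>) p = pairing \<alpha> \<beta> p + pairing \<alpha> \<gamma> p"
  by (simp add: pairing_def sharp_field_tangent)

lemma pairing_smult_left:
  "a \<in> A \<Longrightarrow> \<alpha> \<in> one_forms N \<Longrightarrow> \<beta> \<in> one_forms N \<Longrightarrow> pairing (a \<odot>\<^bsub>D\<^esub> \<alpha>) \<beta> p = a p * pairing \<alpha> \<beta> p"
  unfolding pairing_def sharp_field_smult by (rule one_form_scale) (auto intro: sharp_field_tangent)

lemma pairing_smult_right:
  "\<alpha> \<in> one_forms N \<Longrightarrow> pairing \<alpha> (a \<odot>\<^bsub>D\<^esub> \<beta>) p = a p * pairing \<alpha> \<beta> p"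
  by (simp add: pairing_def sharp_field_tangent)

lemma pairing_exact_right: "\<alpha> \<in> one_forms N \<Longrightarrow> g \<in> A \<Longrightarrow> pairing \<alpha> (exterior_d N g) p = sharp_field \<alpha> p g"
  by (simp add: pairing_def sharp_field_tangent)

lemma sharp_field_exact: "f \<in> A \<Longrightarrow> g \<in> A \<Longrightarrow> sharp_field (exterior_d N f) p g = br f g p"
  by (simp add: sharp_field_apply hamiltonian_tangent) (simp add: hamiltonian_def)

lemma pairing_exact: "f \<in> A \<Longrightarrow> g \<in> A \<Longrightarrow> pairing (exterior_d N f) (exterior_d N g) = br f g"
  by (simp add: fun_eq_iff pairing_exact_right sharp_field_exact)

text \<open>Apply the comparison of linear maps in each of the two arguments.\<close>

lemma bilinear_eqI:
  fixes \<phi> \<psi> :: "'a one_form \<Rightarrow> 'a one_form \<Rightarrow> 'a \<Rightarrow> real"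
  assumes add: "\<And>\<alpha> \<beta> \<gamma> p. \<alpha> \<in> one_forms N \<Longrightarrow> \<beta> \<in> one_forms N \<Longrightarrow> \<gamma> \<in> one_forms N \<Longrightarrow> \<phi> (\<alpha> \<oplus>\<^bsub>D\<^esub> \<beta>) \<gamma> p = \<phi> \<alpha> \<gamma> p + \<phi> \<beta> \<gamma> p"
      "\<And>\<alpha> \<beta> \<gamma> p. \<alpha> \<in> one_forms N \<Longrightarrow> \<beta> \<in> one_forms N \<Longrightarrow> \<gamma> \<in> one_forms N \<Longrightarrow> \<psi> (\<alpha> \<oplus>\<^bsub>D\<^esub> \<beta>) \<gamma> p = \<psi> \<alpha> \<gamma> p + \<psi> \<beta> \<gamma> p"
      "\<And>\<alpha> \<beta> \<gamma> p. \<alpha> \<in> one_forms N \<Longrightarrow> \<beta> \<in> one_forms N \<Longrightarrow> \<gamma> \<in> one_forms N \<Longrightarrow> \<phi> \<gamma> (\<alpha> \<oplus>\<^bsub>D\<^esub> \<beta>) p = \<phi> \<gamma> \<alpha> p + \<phi> \<gamma> \<beta> p"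
      "\<And>\<alpha> \<beta> \<gamma> p. \<alpha> \<in> one_forms N \<Longrightarrow> \<beta> \<in> one_forms N \<Longrightarrow> \<gamma> \<in> one_forms N \<Longrightarrow> \<psi> \<gamma> (\<alpha> \<oplus>\<^bsub>D\<^esub> \<beta>) p = \<psi> \<gamma> \<alpha> p + \<psi> \<gamma> \<beta> p"
    and smult: "\<And>a \<alpha> \<beta> p. a \<in> A \<Longrightarrow> \<alpha> \<in> one_forms N \<Longrightarrow> \<beta> \<in> one_forms N \<Longrightarrow> \<phi> (a \<odot>\<^bsub>D\<^esub> \<alpha>) \<beta> p = a p * \<phi> \<alpha> \<beta> p"
      "\<And>a \<alpha> \<beta> p. a \<in> A \<Longrightarrow> \<alpha> \<in> one_forms N \<Longrightarrow> \<beta> \<in> one_forms N \<Longrightarrow> \<psi> (a \<odot>\<^bsub>D\<^esub> \<alpha>) \<beta> p = a p * \<psi> \<alpha> \<beta> p"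
      "\<And>a \<alpha> \<beta> p. a \<in> A \<Longrightarrow> \<alpha> \<in> one_forms N \<Longrightarrow> \<beta> \<in> one_forms N \<Longrightarrow> \<phi> \<alpha> (a \<odot>\<^bsub>D\<^esub> \<beta>) p = a p * \<phi> \<alpha> \<beta> p"
      "\<And>a \<alpha> \<beta> p. a \<in> A \<Longrightarrow> \<alpha> \<in> one_forms N \<Longrightarrow> \<beta> \<in> one_forms N \<Longrightarrow> \<psi> \<alpha> (a \<odot>\<^bsub>D\<^esub> \<beta>) p = a p * \<psi> \<alpha> \<beta> p"
    and exact: "\<And>f g. f \<in> A \<Longrightarrow> g \<in> A \<Longrightarrow> \<phi> (exterior_d N f) (exterior_d N g) = \<psi> (exterior_d N f) (exterior_d N g)"
    and \<alpha>: "\<alpha> \<in> one_forms N" and \<beta>: "\<beta> \<in> one_forms N"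
  shows "\<phi> \<alpha> \<beta> = \<psi> \<alpha> \<beta>"
proof (rule tensorial_eqI[of "\<lambda>\<beta>. \<phi> \<alpha> \<beta>" "\<lambda>\<beta>. \<psi> \<alpha> \<beta>"])
  fix g assume g: "g \<in> A"
  note dg = exterior_d_one_form[OF g]
  show "\<phi> \<alpha> (exterior_d N g) = \<psi> \<alpha> (exterior_d N g)"
    by (rule tensorial_eqI[of "\<lambda>\<alpha>. \<phi> \<alpha> (exterior_d N g)" "\<lambda>\<alpha>. \<psi> \<alpha> (exterior_d N g)"])
      (simp_all only: add smult dg exact g \<alpha> real_scaleR_def)
qed (simp_all only: add smult \<alpha> \<beta> real_scaleR_def)

text \<open>The two sides are bilinear and agree on exact forms, by antisymmetry of the Poisson bracket.\<close>

lemma pairing_antisym: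
  assumes "\<alpha> \<in> one_forms N" "\<beta> \<in> one_forms N"
  shows "pairing \<alpha> \<beta> p = - pairing \<beta> \<alpha> p"
proof -
  have "pairing \<alpha> \<beta> = (\<lambda>p. - pairing \<beta> \<alpha> p)"
  proof (rule bilinear_eqI[of pairing "\<lambda>\<alpha> \<beta> p. - pairing \<beta> \<alpha> p"])
    show "pairing (exterior_d N f) (exterior_d N g) = (\<lambda>p. - pairing (exterior_d N g) (exterior_d N f) p)"
      if "f \<in> A" "g \<in> A" for f g
      unfolding pairing_exact[OF that] pairing_exact[OF that(2,1)] by (rule br_antisym[OF that])
  qed (simp_all del: one_form_module_simps(2-) add: assms pairing_add_left pairing_add_right
      pairing_smult_left pairing_smult_right)
  then show ?thesis by (rule fun_cong)
qed

lemma pairing_self: "\<alpha> \<in> one_forms N \<Longrightarrow> pairing \<alpha> \<alpha> = (\<lambda>p. 0)"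
  using pairing_antisym[of \<alpha> \<alpha>] by (simp add: fun_eq_iff)

lemma poisson_form_eq_pairing:
  assumes "\<alpha> \<in> one_forms N" "\<beta> \<in> one_forms N"
  shows "poisson_form N br \<alpha> \<beta> = pairing \<alpha> \<beta>"
proof -
  let ?\<pi> = "\<lambda>\<alpha>\<in>one_forms N. \<lambda>\<beta>\<in>one_forms N. pairing \<alpha> \<beta>"
  have "poisson_form N br = ?\<pi>"
    unfolding poisson_form_def Let_def
  proof (rule the_equality)
    show "?\<pi> \<in> carrier D \<rightarrow>\<^sub>E (carrier D \<rightarrow>\<^sub>E A) \<and>
       (\<forall>\<alpha>\<in>carrier D. \<forall>\<beta>\<in>carrier D. \<forall>\<gamma>\<in>carrier D.
          ?\<pi> (\<alpha> \<oplus>\<^bsub>D\<^esub> \<beta>) \<gamma> = ?\<pi> \<alpha> \<gamma> \<oplus>\<^bsub>smooth_functions N\<^esub> ?\<pi> \<beta> \<gamma> \<and> ?\<pi> \<gamma> (\<alpha> \<oplus>\<^bsub>D\<^esub> \<beta>) = ?\<pi> \<gamma> \<alpha> \<oplus>\<^bsub>smooth_functions N\<^esub> ?\<pi> \<gamma> \<beta>) \<and>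
       (\<forall>a\<in>A. \<forall>\<alpha>\<in>carrier D. \<forall>\<beta>\<in>carrier D.
          ?\<pi> (a \<odot>\<^bsub>D\<^esub> \<alpha>) \<beta> = a \<otimes>\<^bsub>smooth_functions N\<^esub> ?\<pi> \<alpha> \<beta> \<and> ?\<pi> \<alpha> (a \<odot>\<^bsub>D\<^esub> \<beta>) = a \<otimes>\<^bsub>smooth_functions N\<^esub> ?\<pi> \<alpha> \<beta>) \<and>
       (\<forall>\<alpha>\<in>carrier D. ?\<pi> \<alpha> \<alpha> = \<zero>\<^bsub>smooth_functions N\<^esub>) \<and>
       (\<forall>f\<in>A. \<forall>g\<in>A. ?\<pi> (exterior_d N f) (exterior_d N g) = br f g)"
      by (simp del: one_form_module_simps(2-) add: pairing_add_left pairing_add_right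
          pairing_smult_left pairing_smult_right pairing_self pairing_exact fun_eq_iff)
  next
    fix \<pi>
    assume \<pi>: "\<pi> \<in> carrier D \<rightarrow>\<^sub>E (carrier D \<rightarrow>\<^sub>E A) \<and>
       (\<forall>\<alpha>\<in>carrier D. \<forall>\<beta>\<in>carrier D. \<forall>\<gamma>\<in>carrier D.
          \<pi> (\<alpha> \<oplus>\<^bsub>D\<^esub> \<beta>) \<gamma> = \<pi> \<alpha> \<gamma> \<oplus>\<^bsub>smooth_functions N\<^esub> \<pi> \<beta> \<gamma> \<and> \<pi> \<gamma> (\<alpha> \<oplus>\<^bsub>D\<^esub> \<beta>) = \<pi> \<gamma> \<alpha> \<oplus>\<^bsub>smooth_functions N\<^esub> \<pi> \<gamma> \<beta>) \<and>
       (\<forall>a\<in>A. \<forall>\<alpha>\<in>carrier D. \<forall>\<beta>\<in>carrier D.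
          \<pi> (a \<odot>\<^bsub>D\<^esub> \<alpha>) \<beta> = a \<otimes>\<^bsub>smooth_functions N\<^esub> \<pi> \<alpha> \<beta> \<and> \<pi> \<alpha> (a \<odot>\<^bsub>D\<^esub> \<beta>) = a \<otimes>\<^bsub>smooth_functions N\<^esub> \<pi> \<alpha> \<beta>) \<and>
       (\<forall>\<alpha>\<in>carrier D. \<pi> \<alpha> \<alpha> = \<zero>\<^bsub>smooth_functions N\<^esub>) \<and>
       (\<forall>f\<in>A. \<forall>g\<in>A. \<pi> (exterior_d N f) (exterior_d N g) = br f g)"
    have "\<pi> \<alpha> \<beta> = pairing \<alpha> \<beta>" if "\<alpha> \<in> one_forms N" "\<beta> \<in> one_forms N" for \<alpha> \<beta>
    proof (rule bilinear_eqI[of \<pi> pairing])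
      show "\<pi> (exterior_d N f) (exterior_d N g) = pairing (exterior_d N f) (exterior_d N g)"
        if "f \<in> A" "g \<in> A" for f g
        using \<pi> that by (simp add: pairing_exact)
    qed (use \<pi> that in \<open>simp_all del: one_form_module_simps(2-) add: pairing_add_left pairing_add_right
        pairing_smult_left pairing_smult_right\<close>)
    moreover have "\<pi> \<in> one_forms N \<rightarrow>\<^sub>E (one_forms N \<rightarrow>\<^sub>E A)"
      using \<pi> by simp
    ultimately show "\<pi> = ?\<pi>"
      by (intro ext) (auto simp: restrict_def PiE_iff extensional_def)
  qed
  then show ?thesis using assms by simp
qed

lemma sharp_eq_sharp_field:
  assumes \<alpha>: "\<alpha> \<in> one_forms N"
  shows "sharp N br \<alpha> = sharp_field \<alpha>"
  unfolding sharp_def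
proof (rule the_equality)
  show "sharp_field \<alpha> \<in> vector_fields N \<and> (\<forall>\<beta>\<in>one_forms N. (\<lambda>p. \<beta> p (sharp_field \<alpha> p)) = poisson_form N br \<alpha> \<beta>)"
    using \<alpha> by (simp add: sharp_field_vector_field poisson_form_eq_pairing pairing_def[abs_def])
  fix X assume X: "X \<in> vector_fields N \<and> (\<forall>\<beta>\<in>one_forms N. (\<lambda>p. \<beta> p (X p)) = poisson_form N br \<alpha> \<beta>)"
  show "X = sharp_field \<alpha>"
  proof
    fix p
    have X_tangent: "X p \<in> T p" using X vector_field_tangent by blast
    show "X p = sharp_field \<alpha> p"
    proof (rule tangent_eqI[OF X_tangent sharp_field_tangent[OF \<alpha>]])
      fix f assume f: "f \<in> A"
      have "exterior_d N f p (X p) = poisson_form N br \<alpha> (exterior_d N f) p"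
        using X exterior_d_one_form[OF f] by (metis (mono_tags, lifting))
      then show "X p f = sharp_field \<alpha> p f"
        using \<alpha> f X_tangent by (simp add: poisson_form_eq_pairing pairing_exact_right)
    qed
  qed
qed

abbreviation bracket :: "'a one_form \<Rightarrow> 'a one_form \<Rightarrow> 'a one_form" where
  "bracket \<equiv> one_form_bracket N br"

lemma bracket_closed:
  assumes "\<alpha> \<in> one_forms N" "\<beta> \<in> one_forms N"
  shows "bracket \<alpha> \<beta> \<in> one_forms N"
  unfolding one_form_bracket_def poisson_form_eq_pairing[OF assms] sharp_eq_sharp_field[OF assms(1)]
    sharp_eq_sharp_field[OF assms(2)]
  by (intro one_forms_minus lie_derivative(1) sharp_field_vector_field assms exterior_d_one_form pairing_closed)

lemma bracket_apply:
  assumes \<alpha>: "\<alpha> \<in> one_forms N" and \<beta>: "\<beta> \<in> one_forms N" and Y: "Y \<in> vector_fields N"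
  shows "bracket \<alpha> \<beta> p (Y p) =
    lie_derivative_on (sharp_field \<alpha>) \<beta> Y p - lie_derivative_on (sharp_field \<beta>) \<alpha> Y p - Y p (pairing \<alpha> \<beta>)"
proof -
  note L = lie_derivative[OF sharp_field_vector_field[OF \<alpha>] \<beta>] lie_derivative[OF sharp_field_vector_field[OF \<beta>] \<alpha>]
  show ?thesis
    unfolding one_form_bracket_def poisson_form_eq_pairing[OF \<alpha> \<beta>] sharp_eq_sharp_field[OF \<alpha>]
      sharp_eq_sharp_field[OF \<beta>]
    by (simp add: one_form_minus one_forms_minus L(1,3) L(2,4)[OF Y] \<alpha> \<beta> vector_field_tangent[OF Y] exterior_d_one_form pairing_closed)
qed

lemma bracket_eqI:
  assumes "\<gamma> \<in> one_forms N" "\<alpha> \<in> one_forms N" "\<beta> \<in> one_forms N"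
    and "\<And>Y p. Y \<in> vector_fields N \<Longrightarrow> lie_derivative_on (sharp_field \<alpha>) \<beta> Y p
      - lie_derivative_on (sharp_field \<beta>) \<alpha> Y p - Y p (pairing \<alpha> \<beta>) = \<gamma> p (Y p)"
  shows "bracket \<alpha> \<beta> = \<gamma>"
proof (rule one_form_eqI)
  fix p v assume "v \<in> T p"
  then obtain Y where "Y \<in> vector_fields N" "Y p = v" by (rule tangent_extends)
  then show "bracket \<alpha> \<beta> p v = \<gamma> p v"
    using bracket_apply[OF assms(2,3)] assms(4) by metis
qed (use assms bracket_closed in auto)

lemma lie_derivative_on_add_form:
  assumes "X \<in> vector_fields N" "Y \<in> vector_fields N" "\<beta> \<in> one_forms N" "\<gamma> \<in> one_forms N"
  shows "lie_derivative_on X (\<beta> \<oplus>\<^bsub>D\<^esub> \<gamma>) Y p = lie_derivative_on X \<beta> Y p + lie_derivative_on X \<gamma> Y p"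
  using vector_field_tangent[OF assms(2)] vector_field_tangent[OF vector_field_bracket[OF assms(1,2)]]
    one_form_smooth[OF assms(3,2)] one_form_smooth[OF assms(4,2)]
  by (simp add: lie_derivative_on_def tangent_add[OF vector_field_tangent[OF assms(1)]])

lemma lie_derivative_on_smult_form:
  assumes "X \<in> vector_fields N" "Y \<in> vector_fields N" "\<beta> \<in> one_forms N" "a \<in> A"
  shows "lie_derivative_on X (a \<odot>\<^bsub>D\<^esub> \<beta>) Y p = a p * lie_derivative_on X \<beta> Y p + X p a * \<beta> p (Y p)"
  using vector_field_tangent[OF assms(2)] vector_field_tangent[OF vector_field_bracket[OF assms(1,2)]]
    one_form_smooth[OF assms(3,2)] assms(4)
  by (simp add: lie_derivative_on_def tangent_mult[OF vector_field_tangent[OF assms(1)]] algebra_simps)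

lemma lie_derivative_on_add_field:
  assumes Y: "Y \<in> vector_fields N" and \<alpha>: "\<alpha> \<in> one_forms N" and \<beta>: "\<beta> \<in> one_forms N" and \<gamma>: "\<gamma> \<in> one_forms N"
  shows "lie_derivative_on (sharp_field (\<alpha> \<oplus>\<^bsub>D\<^esub> \<beta>)) \<gamma> Y p =
    lie_derivative_on (sharp_field \<alpha>) \<gamma> Y p + lie_derivative_on (sharp_field \<beta>) \<gamma> Y p"
proof -
  let ?X = "sharp_field \<alpha>" and ?Z = "sharp_field \<beta>"
  note XZ = sharp_field_vector_field[OF \<alpha>] sharp_field_vector_field[OF \<beta>]
  note s = sharp_field_add[OF \<alpha> \<beta>]
  have "vector_field_bracket N (sharp_field (\<alpha> \<oplus>\<^bsub>D\<^esub> \<beta>)) Y p =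
      (\<lambda>f\<in>A. vector_field_bracket N ?X Y p f + vector_field_bracket N ?Z Y p f)"
    unfolding vector_field_bracket_def s
    by (intro restrict_ext) (simp add: vector_field_smooth[OF Y] vector_field_smooth[OF XZ(1)]
        vector_field_smooth[OF XZ(2)] tangent_add[OF vector_field_tangent[OF Y]])
  then have "\<gamma> p (vector_field_bracket N (sharp_field (\<alpha> \<oplus>\<^bsub>D\<^esub> \<beta>)) Y p) =
      \<gamma> p (vector_field_bracket N ?X Y p) + \<gamma> p (vector_field_bracket N ?Z Y p)"
    using one_form_add[OF \<gamma>] vector_field_tangent[OF vector_field_bracket[OF XZ(1) Y]]
      vector_field_tangent[OF vector_field_bracket[OF XZ(2) Y]] by simp
  then show ?thesis
    by (simp add: lie_derivative_on_def s one_form_smooth[OF \<gamma> Y] del: one_form_module_simps)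
qed

text \<open>Linearity over functions in the vector field fails by an exact term: \<open>L\<^bsub>aX\<^esub> \<gamma> = a L\<^sub>X \<gamma> + \<gamma>(X) da\<close>.\<close>

lemma lie_derivative_on_smult_field:
  assumes Y: "Y \<in> vector_fields N" and a: "a \<in> A" and \<beta>: "\<beta> \<in> one_forms N" and \<gamma>: "\<gamma> \<in> one_forms N"
  shows "lie_derivative_on (sharp_field (a \<odot>\<^bsub>D\<^esub> \<beta>)) \<gamma> Y p =
    a p * lie_derivative_on (sharp_field \<beta>) \<gamma> Y p + Y p a * pairing \<beta> \<gamma> p"
proof -
  let ?Z = "sharp_field \<beta>"
  note Z = sharp_field_vector_field[OF \<beta>]
  note s = sharp_field_smult[OF a \<beta>]
  let ?u = "\<lambda>f\<in>A. a p * vector_field_bracket N ?Z Y p f" and ?v = "\<lambda>f\<in>A. (- Y p a) * ?Z p f"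
  have "vector_field_bracket N (sharp_field (a \<odot>\<^bsub>D\<^esub> \<beta>)) Y p = (\<lambda>f\<in>A. ?u f + ?v f)"
    unfolding vector_field_bracket_def s
    by (intro restrict_ext) (simp add: vector_field_smooth[OF Y] vector_field_smooth[OF Z]
        tangent_mult[OF vector_field_tangent[OF Y]] a algebra_simps)
  then have "\<gamma> p (vector_field_bracket N (sharp_field (a \<odot>\<^bsub>D\<^esub> \<beta>)) Y p) =
      a p * \<gamma> p (vector_field_bracket N ?Z Y p) - Y p a * \<gamma> p (?Z p)"
    using one_form_add[OF \<gamma> tangent_space_scale tangent_space_scale,
        OF vector_field_tangent[OF vector_field_bracket[OF Z Y]] vector_field_tangent[OF Z], of p "a p" "- Y p a"]
    by (simp only: one_form_scale[OF \<gamma> vector_field_tangent[OF vector_field_bracket[OF Z Y]]]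
        one_form_scale[OF \<gamma> vector_field_tangent[OF Z]])
  then show ?thesis
    by (simp add: lie_derivative_on_def s one_form_smooth[OF \<gamma> Y] pairing_def algebra_simps
        del: one_form_module_simps)
qed

lemma bracket_antisym:
  assumes \<alpha>: "\<alpha> \<in> one_forms N" and \<beta>: "\<beta> \<in> one_forms N" and v: "v \<in> T p"
  shows "bracket \<alpha> \<beta> p v = - bracket \<beta> \<alpha> p v"
proof -
  obtain Y where Y: "Y \<in> vector_fields N" "Y p = v" using v by (rule tangent_extends)
  have "Y p (pairing \<alpha> \<beta>) = - Y p (pairing \<beta> \<alpha>)"
    using tangent_uminus[OF vector_field_tangent[OF Y(1)] pairing_closed[OF \<beta> \<alpha>]]
    by (simp add: pairing_antisym[OF \<alpha> \<beta>, abs_def])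
  then show ?thesis
    using bracket_apply[OF \<alpha> \<beta> Y(1), of p] bracket_apply[OF \<beta> \<alpha> Y(1), of p] Y(2) by simp
qed

lemma bracket_self: "\<alpha> \<in> one_forms N \<Longrightarrow> bracket \<alpha> \<alpha> = \<zero>\<^bsub>D\<^esub>"
  by (rule one_form_eqI[OF bracket_closed one_forms_zero]) (use bracket_antisym[of \<alpha> \<alpha>] in auto)

lemma bracket_add_left:
  assumes \<alpha>: "\<alpha> \<in> one_forms N" and \<beta>: "\<beta> \<in> one_forms N" and \<gamma>: "\<gamma> \<in> one_forms N"
  shows "bracket (\<alpha> \<oplus>\<^bsub>D\<^esub> \<beta>) \<gamma> = bracket \<alpha> \<gamma> \<oplus>\<^bsub>D\<^esub> bracket \<beta> \<gamma>"
proof (rule bracket_eqI)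
  fix Y p assume Y: "Y \<in> vector_fields N"
  have "Y p (pairing (\<alpha> \<oplus>\<^bsub>D\<^esub> \<beta>) \<gamma>) = Y p (pairing \<alpha> \<gamma>) + Y p (pairing \<beta> \<gamma>)"
    unfolding pairing_add_left[OF \<alpha> \<beta> \<gamma>, abs_def]
    by (rule tangent_add[OF vector_field_tangent[OF Y] pairing_closed[OF \<alpha> \<gamma>] pairing_closed[OF \<beta> \<gamma>]])
  then show "lie_derivative_on (sharp_field (\<alpha> \<oplus>\<^bsub>D\<^esub> \<beta>)) \<gamma> Y p - lie_derivative_on (sharp_field \<gamma>) (\<alpha> \<oplus>\<^bsub>D\<^esub> \<beta>) Y p
      - Y p (pairing (\<alpha> \<oplus>\<^bsub>D\<^esub> \<beta>) \<gamma>) = (bracket \<alpha> \<gamma> \<oplus>\<^bsub>D\<^esub> bracket \<beta> \<gamma>) p (Y p)"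
    unfolding lie_derivative_on_add_field[OF Y \<alpha> \<beta> \<gamma>] lie_derivative_on_add_form[OF sharp_field_vector_field[OF \<gamma>] Y \<alpha> \<beta>]
    by (simp add: vector_field_tangent[OF Y] bracket_apply[OF \<alpha> \<gamma> Y] bracket_apply[OF \<beta> \<gamma> Y])
qed (use assms one_forms_add bracket_closed in blast)+

lemma bracket_smult_right:
  assumes \<alpha>: "\<alpha> \<in> one_forms N" and \<beta>: "\<beta> \<in> one_forms N" and a: "a \<in> A"
  shows "bracket \<alpha> (a \<odot>\<^bsub>D\<^esub> \<beta>) = a \<odot>\<^bsub>D\<^esub> bracket \<alpha> \<beta> \<oplus>\<^bsub>D\<^esub> (\<lambda>p. sharp_field \<alpha> p a) \<odot>\<^bsub>D\<^esub> \<beta>"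
proof (rule bracket_eqI)
  fix Y p assume Y: "Y \<in> vector_fields N"
  have "Y p (pairing \<alpha> (a \<odot>\<^bsub>D\<^esub> \<beta>)) = a p * Y p (pairing \<alpha> \<beta>) + pairing \<alpha> \<beta> p * Y p a"
    unfolding pairing_smult_right[OF \<alpha>, abs_def]
    by (rule tangent_mult[OF vector_field_tangent[OF Y] a pairing_closed[OF \<alpha> \<beta>]])
  then show "lie_derivative_on (sharp_field \<alpha>) (a \<odot>\<^bsub>D\<^esub> \<beta>) Y p - lie_derivative_on (sharp_field (a \<odot>\<^bsub>D\<^esub> \<beta>)) \<alpha> Y p
      - Y p (pairing \<alpha> (a \<odot>\<^bsub>D\<^esub> \<beta>)) = (a \<odot>\<^bsub>D\<^esub> bracket \<alpha> \<beta> \<oplus>\<^bsub>D\<^esub> (\<lambda>p. sharp_field \<alpha> p a) \<odot>\<^bsub>D\<^esub> \<beta>) p (Y p)"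
    unfolding lie_derivative_on_smult_field[OF Y a \<beta> \<alpha>] lie_derivative_on_smult_form[OF sharp_field_vector_field[OF \<alpha>] Y \<beta> a]
      pairing_antisym[OF \<beta> \<alpha>]
    by (simp add: vector_field_tangent[OF Y] bracket_apply[OF \<alpha> \<beta> Y] algebra_simps)
next
  show "a \<odot>\<^bsub>D\<^esub> bracket \<alpha> \<beta> \<oplus>\<^bsub>D\<^esub> (\<lambda>p. sharp_field \<alpha> p a) \<odot>\<^bsub>D\<^esub> \<beta> \<in> one_forms N"
    by (intro one_forms_add one_forms_smult bracket_closed \<alpha> \<beta> a
        vector_field_smooth[OF sharp_field_vector_field])
qed (use assms one_forms_smult in blast)+

lemma bracket_exact:
  assumes f: "f \<in> A" and g: "g \<in> A"
  shows "bracket (exterior_d N f) (exterior_d N g) = exterior_d N (br f g)"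
proof (rule bracket_eqI)
  fix Y p assume Y: "Y \<in> vector_fields N"
  have defect: "lie_derivative_on (sharp_field (exterior_d N h)) (exterior_d N k) Y p = Y p (br h k)"
    if h: "h \<in> A" and k: "k \<in> A" for h k
  proof -
    have X: "sharp_field (exterior_d N h) \<in> vector_fields N"
      by (rule sharp_field_vector_field[OF exterior_d_one_form[OF h]])
    have "(\<lambda>q. sharp_field (exterior_d N h) q k) = br h k"
      using sharp_field_exact[OF h k] by auto
    then show ?thesis
      using k vector_field_tangent[OF Y] vector_field_tangent[OF vector_field_bracket[OF X Y], of p]
      by (simp add: lie_derivative_on_def) (simp add: vector_field_bracket_def)
  qed
  have "Y p (br g f) = - Y p (br f g)"
    unfolding br_antisym[OF g f] by (rule tangent_uminus[OF vector_field_tangent[OF Y] br_closed[OF f g]])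
  then show "lie_derivative_on (sharp_field (exterior_d N f)) (exterior_d N g) Y p
      - lie_derivative_on (sharp_field (exterior_d N g)) (exterior_d N f) Y p
      - Y p (pairing (exterior_d N f) (exterior_d N g)) = exterior_d N (br f g) p (Y p)"
    using f g vector_field_tangent[OF Y] by (simp add: defect pairing_exact)
qed (use f g exterior_d_one_form br_closed in blast)+

end

section \<open>Quotient modules and Kaehler differentials\<close>

lemma submodule_generated:
  assumes "Module.module R M" "G \<subseteq> carrier M"
  shows "submodule (generated_submodule R M G) R M"
proof -
  interpret module R M by fact
  have sub: "generated_submodule R M G \<subseteq> carrier M"
    using carrier_is_submodule assms(2) by (auto simp: generated_submodule_def)
  show ?thesis
  proof (rule submoduleI[OF sub])
    show "\<zero>\<^bsub>M\<^esub> \<in> generated_submodule R M G"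
      unfolding generated_submodule_def using submodule.axioms(1) subgroup.one_closed by fastforce
  qed (auto simp: generated_submodule_def submoduleE(3-5))
qed

lemma generated_submodule_least: "submodule H R M \<Longrightarrow> G \<subseteq> H \<Longrightarrow> generated_submodule R M G \<subseteq> H"
  by (auto simp: generated_submodule_def)

lemma generated_submodule_base: "G \<subseteq> generated_submodule R M G"
  by (auto simp: generated_submodule_def)

locale quotient_by_submodule = module R M for R (structure) and M (structure) +
  fixes S assumes submodule_S: "submodule S R M"
begin

sublocale S: abelian_subgroup S M
  by (intro abelian_subgroupI3 additive_subgroup.intro submodule.axioms(1)[OF submodule_S])
    (rule M.abelian_group_axioms)

abbreviation "Q \<equiv> quotient_module M S"
abbreviation "cls x \<equiv> S +>\<^bsub>M\<^esub> x"

lemma Q_carrierE: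
  assumes "X \<in> carrier Q" obtains x where "x \<in> carrier M" "X = cls x"
  using assms by (auto simp: quotient_module_def A_RCOSETS_def')

lemma cls_closed [simp, intro]: "x \<in> carrier M \<Longrightarrow> cls x \<in> carrier Q"
  by (auto simp: quotient_module_def A_RCOSETS_def')

lemma cls_add: "x \<in> carrier M \<Longrightarrow> y \<in> carrier M \<Longrightarrow> cls x \<oplus>\<^bsub>Q\<^esub> cls y = cls (x \<oplus>\<^bsub>M\<^esub> y)"
  by (simp add: quotient_module_def S.a_rcos_sum)

lemma cls_absorb: "s \<in> S \<Longrightarrow> x \<in> carrier M \<Longrightarrow> cls (s \<oplus>\<^bsub>M\<^esub> x) = cls x"
  by (rule S.a_repr_independence'[symmetric]) (auto simp: a_r_coset_def')

lemma cls_eqI: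
  assumes "x \<in> carrier M" "y \<in> carrier M" "x \<ominus>\<^bsub>M\<^esub> y \<in> S"
  shows "cls x = cls y"
proof -
  have "x = (x \<ominus>\<^bsub>M\<^esub> y) \<oplus>\<^bsub>M\<^esub> y"
    using assms(1,2) by (simp add: M.minus_eq M.a_assoc M.l_neg)
  then show ?thesis using cls_absorb[OF assms(3,2)] by simp
qed

lemma zero_Q: "\<zero>\<^bsub>Q\<^esub> = cls \<zero>\<^bsub>M\<^esub>"
  using S.a_subset by (simp add: quotient_module_def)

lemma cls_zero: "s \<in> S \<Longrightarrow> cls s = \<zero>\<^bsub>Q\<^esub>"
  by (simp add: quotient_module_def S.a_rcos_const)

lemma cls_smult:
  assumes r: "r \<in> carrier R" and x: "x \<in> carrier M"
  shows "r \<odot>\<^bsub>Q\<^esub> cls x = cls (r \<odot>\<^bsub>M\<^esub> x)"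
proof -
  have *: "cls (r \<odot>\<^bsub>M\<^esub> y) = cls (r \<odot>\<^bsub>M\<^esub> x)" if y: "y \<in> cls x" for y
  proof -
    obtain s where s: "s \<in> S" "y = s \<oplus>\<^bsub>M\<^esub> x" using y by (auto simp: a_r_coset_def')
    then have "r \<odot>\<^bsub>M\<^esub> y = r \<odot>\<^bsub>M\<^esub> s \<oplus>\<^bsub>M\<^esub> r \<odot>\<^bsub>M\<^esub> x" using r x by (simp add: smult_r_distr)
    then show ?thesis
      using cls_absorb[of "r \<odot>\<^bsub>M\<^esub> s" "r \<odot>\<^bsub>M\<^esub> x"] submodule.smult_closed[OF submodule_S r s(1)] r x by simp
  qed
  have "x \<in> cls x" using x by (rule S.a_rcos_self)
  then have "(\<Union>y\<in>cls x. cls (r \<odot>\<^bsub>M\<^esub> x)) = cls (r \<odot>\<^bsub>M\<^esub> x)"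
    by auto
  moreover have "(\<Union>y\<in>cls x. cls (r \<odot>\<^bsub>M\<^esub> y)) = (\<Union>y\<in>cls x. cls (r \<odot>\<^bsub>M\<^esub> x))"
    by (rule SUP_cong[OF refl *])
  ultimately have "(\<Union>y\<in>cls x. cls (r \<odot>\<^bsub>M\<^esub> y)) = cls (r \<odot>\<^bsub>M\<^esub> x)"
    by (simp only:)
  then show ?thesis by (simp add: quotient_module_def)
qed

lemma module_Q: "Module.module R Q"
proof (rule moduleI)
  show "abelian_group Q"
  proof (rule abelian_groupI)
    fix X assume "X \<in> carrier Q"
    then obtain x where x: "x \<in> carrier M" "X = cls x" by (rule Q_carrierE)
    then show "\<exists>Y\<in>carrier Q. Y \<oplus>\<^bsub>Q\<^esub> X = \<zero>\<^bsub>Q\<^esub>"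
      by (intro bexI[of _ "cls (\<ominus>\<^bsub>M\<^esub> x)"]) (auto simp: cls_add zero_Q M.l_neg)
  qed (auto elim!: Q_carrierE simp: cls_add zero_Q M.a_ac)
qed (auto elim!: Q_carrierE simp: cls_add cls_smult smult_l_distr smult_r_distr smult_assoc1
    intro: R.cring_axioms)

end

locale real_algebra = cring A for A :: "(real, 'r, 'x) module_scheme" (structure) +
  assumes real_const_closed: "r \<odot> \<one> \<in> carrier A"
begin

abbreviation "F \<equiv> free_module A"
abbreviation "gen \<equiv> free_gen A"

lemma free_carrier: "x \<in> carrier F \<longleftrightarrow> x \<in> carrier A \<rightarrow>\<^sub>E carrier A \<and> finite {u \<in> carrier A. x u \<noteq> \<zero>}"
  by (simp add: free_module_def)

lemma free_simps:
  "x \<oplus>\<^bsub>F\<^esub> y = (\<lambda>u\<in>carrier A. x u \<oplus> y u)"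
  "a \<odot>\<^bsub>F\<^esub> x = (\<lambda>u\<in>carrier A. a \<otimes> x u)"
  "\<zero>\<^bsub>F\<^esub> = (\<lambda>u\<in>carrier A. \<zero>)"
  by (simp_all add: free_module_def)

lemma free_apply: "x \<in> carrier F \<Longrightarrow> u \<in> carrier A \<Longrightarrow> x u \<in> carrier A"
  by (auto simp: free_carrier)

lemma free_eqI:
  "x \<in> carrier F \<Longrightarrow> y \<in> carrier F \<Longrightarrow> (\<And>u. u \<in> carrier A \<Longrightarrow> x u = y u) \<Longrightarrow> x = y"
  unfolding free_carrier by (intro extensionalityI[of _ "carrier A"]) (auto simp: PiE_iff)

lemma free_add_closed: "x \<in> carrier F \<Longrightarrow> y \<in> carrier F \<Longrightarrow> x \<oplus>\<^bsub>F\<^esub> y \<in> carrier F"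
proof -
  assume x: "x \<in> carrier F" and y: "y \<in> carrier F"
  have "{u \<in> carrier A. x u \<oplus> y u \<noteq> \<zero>} \<subseteq> {u \<in> carrier A. x u \<noteq> \<zero>} \<union> {u \<in> carrier A. y u \<noteq> \<zero>}"
    using x y by (auto simp: free_apply)
  moreover have "finite ({u \<in> carrier A. x u \<noteq> \<zero>} \<union> {u \<in> carrier A. y u \<noteq> \<zero>})"
    using x y by (simp add: free_carrier)
  ultimately have "finite {u \<in> carrier A. x u \<oplus> y u \<noteq> \<zero>}" by (rule finite_subset)
  then show ?thesis
    using x y by (auto simp: free_carrier free_simps PiE_iff cong: conj_cong)
qed

lemma free_smult_closed: "a \<in> carrier A \<Longrightarrow> x \<in> carrier F \<Longrightarrow> a \<odot>\<^bsub>F\<^esub> x \<in> carrier F"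
proof -
  assume a: "a \<in> carrier A" and x: "x \<in> carrier F"
  have "{u \<in> carrier A. a \<otimes> x u \<noteq> \<zero>} \<subseteq> {u \<in> carrier A. x u \<noteq> \<zero>}"
    using a x by (auto simp: free_apply)
  then have "finite {u \<in> carrier A. a \<otimes> x u \<noteq> \<zero>}"
    using x by (auto simp: free_carrier intro: finite_subset)
  then show ?thesis
    using a x by (auto simp: free_carrier free_simps PiE_iff cong: conj_cong)
qed

lemma free_zero_closed: "\<zero>\<^bsub>F\<^esub> \<in> carrier F"
  by (auto simp: free_carrier free_simps)

lemma gen_closed [simp, intro]: "gen u \<in> carrier F"
proof -
  have "{v \<in> carrier A. gen u v \<noteq> \<zero>} \<subseteq> {u}" by (auto simp: free_gen_def)
  then show ?thesis
    by (auto simp: free_carrier free_gen_def intro: finite_subset split: if_splits)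
qed

lemma module_free: "Module.module A F"
proof (rule moduleI[OF cring_axioms])
  show "abelian_group F"
  proof (rule abelian_groupI)
    fix x assume x: "x \<in> carrier F"
    then have "(\<ominus> \<one>) \<odot>\<^bsub>F\<^esub> x \<in> carrier F" by (simp add: free_smult_closed)
    moreover have "(\<ominus> \<one>) \<odot>\<^bsub>F\<^esub> x \<oplus>\<^bsub>F\<^esub> x = \<zero>\<^bsub>F\<^esub>"
      using x by (auto simp: free_simps fun_eq_iff free_apply l_minus l_neg)
    ultimately show "\<exists>y\<in>carrier F. y \<oplus>\<^bsub>F\<^esub> x = \<zero>\<^bsub>F\<^esub>" by blast
  next
    fix x assume x: "x \<in> carrier F"
    show "\<zero>\<^bsub>F\<^esub> \<oplus>\<^bsub>F\<^esub> x = x"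
      by (rule free_eqI[OF free_add_closed[OF free_zero_closed x] x]) (use x in \<open>auto simp: free_simps free_apply\<close>)
  next
    show "x \<oplus>\<^bsub>F\<^esub> y \<in> carrier F" if "x \<in> carrier F" "y \<in> carrier F" for x y
      using that by (rule free_add_closed)
  qed (rule free_zero_closed, auto simp: free_simps fun_eq_iff free_apply a_ac)
next
  fix x assume x: "x \<in> carrier F"
  show "\<one> \<odot>\<^bsub>F\<^esub> x = x"
    by (rule free_eqI[OF free_smult_closed[OF one_closed x] x]) (use x in \<open>auto simp: free_simps free_apply\<close>)
next
  show "a \<odot>\<^bsub>F\<^esub> x \<in> carrier F" if "a \<in> carrier A" "x \<in> carrier F" for a x
    using that by (rule free_smult_closed)
qed (auto simp: free_simps fun_eq_iff free_apply l_distr r_distr m_assoc)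

lemma free_induct [consumes 1, case_names zero step]:
  assumes "x \<in> carrier F" and zero: "P \<zero>\<^bsub>F\<^esub>"
    and step: "\<And>x a u. x \<in> carrier F \<Longrightarrow> P x \<Longrightarrow> a \<in> carrier A \<Longrightarrow> u \<in> carrier A \<Longrightarrow> P (x \<oplus>\<^bsub>F\<^esub> a \<odot>\<^bsub>F\<^esub> gen u)"
  shows "P x"
proof -
  have "P x" if "finite S" "S \<subseteq> carrier A" "x \<in> carrier F" "{u \<in> carrier A. x u \<noteq> \<zero>} \<subseteq> S" for S x
    using that
  proof (induction S arbitrary: x)
    case empty
    have "x = \<zero>\<^bsub>F\<^esub>"
      by (rule free_eqI[OF empty.prems(2) free_zero_closed]) (use empty in \<open>auto simp: free_simps\<close>)
    then show ?case using zero by simp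
  next
    case (insert v S)
    let ?y = "\<lambda>u\<in>carrier A. if u = v then \<zero> else x u"
    have v: "v \<in> carrier A" and xv: "x v \<in> carrier A" using insert.prems by (auto simp: free_apply)
    have "{u \<in> carrier A. ?y u \<noteq> \<zero>} \<subseteq> {u \<in> carrier A. x u \<noteq> \<zero>}" by auto
    then have y: "?y \<in> carrier F"
      using insert.prems(2) by (auto simp: free_carrier intro: finite_subset split: if_splits)
    have "P ?y"
    proof (rule insert.IH[OF _ y])
      show "{u \<in> carrier A. ?y u \<noteq> \<zero>} \<subseteq> S"
        using insert.prems(3) by (auto split: if_splits)
    qed (use insert.prems in auto)
    moreover have "x = ?y \<oplus>\<^bsub>F\<^esub> x v \<odot>\<^bsub>F\<^esub> gen v"
      by (rule free_eqI[OF insert.prems(2) free_add_closed[OF y free_smult_closed[OF xv gen_closed]]])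
        (use insert.prems(2) xv in \<open>auto simp: free_simps free_gen_def free_apply\<close>)
    ultimately show ?case using step[OF y _ xv v] by simp
  qed
  from this[of "{u \<in> carrier A. x u \<noteq> \<zero>}"] show ?thesis
    using assms(1) by (auto simp: free_carrier)
qed

lemma relations_subset:
  "({gen (u \<oplus> v) \<ominus>\<^bsub>F\<^esub> (gen u \<oplus>\<^bsub>F\<^esub> gen v) | u v. u \<in> carrier A \<and> v \<in> carrier A}
      \<union> {gen (u \<otimes> v) \<ominus>\<^bsub>F\<^esub> ((u \<odot>\<^bsub>F\<^esub> gen v) \<oplus>\<^bsub>F\<^esub> (v \<odot>\<^bsub>F\<^esub> gen u)) | u v. u \<in> carrier A \<and> v \<in> carrier A}
      \<union> {gen (r \<odot> \<one>) | r. True}) \<subseteq> carrier F"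
proof -
  interpret F: module A F by (rule module_free)
  show ?thesis by (auto intro!: F.M.minus_closed F.M.add.m_closed F.smult_closed)
qed

sublocale K: quotient_by_submodule A F "kaehler_relations A"
  rewrites "quotient_module F (kaehler_relations A) \<equiv> kaehler A"
  using submodule_generated[OF module_free relations_subset] module_free
  by (auto simp: quotient_by_submodule_def quotient_by_submodule_axioms_def kaehler_relations_def kaehler_def)

abbreviation "\<Omega> \<equiv> kaehler A"
abbreviation "du \<equiv> kaehler_d A"

lemma module_kaehler: "Module.module A \<Omega>"
  by (rule K.module_Q)

lemma kaehler_d_closed [simp, intro]: "du u \<in> carrier \<Omega>"
  unfolding kaehler_d_def by (rule K.cls_closed[OF gen_closed])

lemma kaehler_d_add:
  assumes "u \<in> carrier A" "v \<in> carrier A"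
  shows "du (u \<oplus> v) = du u \<oplus>\<^bsub>\<Omega>\<^esub> du v"
proof -
  have "gen (u \<oplus> v) \<ominus>\<^bsub>F\<^esub> (gen u \<oplus>\<^bsub>F\<^esub> gen v) \<in> kaehler_relations A"
    unfolding kaehler_relations_def
    by (rule generated_submodule_base[THEN subsetD]) (use assms in blast)
  then show ?thesis
    unfolding kaehler_d_def using K.cls_eqI[OF gen_closed K.M.add.m_closed[OF gen_closed gen_closed]]
    by (simp add: K.cls_add)
qed

lemma kaehler_d_mult:
  assumes "u \<in> carrier A" "v \<in> carrier A"
  shows "du (u \<otimes> v) = u \<odot>\<^bsub>\<Omega>\<^esub> du v \<oplus>\<^bsub>\<Omega>\<^esub> v \<odot>\<^bsub>\<Omega>\<^esub> du u"
proof -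
  have "gen (u \<otimes> v) \<ominus>\<^bsub>F\<^esub> (u \<odot>\<^bsub>F\<^esub> gen v \<oplus>\<^bsub>F\<^esub> v \<odot>\<^bsub>F\<^esub> gen u) \<in> kaehler_relations A"
    unfolding kaehler_relations_def
    by (rule generated_submodule_base[THEN subsetD]) (use assms in blast)
  then show ?thesis
    unfolding kaehler_d_def
    using K.cls_eqI[OF gen_closed K.M.add.m_closed[OF K.smult_closed K.smult_closed], OF assms(1) gen_closed assms(2) gen_closed]
      assms by (simp add: K.cls_add K.cls_smult)
qed

lemma kaehler_d_const: "du (r \<odot> \<one>) = \<zero>\<^bsub>\<Omega>\<^esub>"
proof -
  have "gen (r \<odot> \<one>) \<in> kaehler_relations A"
    unfolding kaehler_relations_def by (rule generated_submodule_base[THEN subsetD]) blast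
  then show ?thesis unfolding kaehler_d_def by (rule K.cls_zero)
qed

lemma kaehler_induct [consumes 1, case_names gen add]:
  assumes "x \<in> carrier \<Omega>"
    and gen: "\<And>a u. a \<in> carrier A \<Longrightarrow> u \<in> carrier A \<Longrightarrow> P (a \<odot>\<^bsub>\<Omega>\<^esub> du u)"
    and add: "\<And>x y. x \<in> carrier \<Omega> \<Longrightarrow> y \<in> carrier \<Omega> \<Longrightarrow> P x \<Longrightarrow> P y \<Longrightarrow> P (x \<oplus>\<^bsub>\<Omega>\<^esub> y)"
  shows "P x"
proof -
  interpret \<Omega>: module A \<Omega> by (rule module_kaehler)
  obtain y where y: "y \<in> carrier F" "x = K.cls y" using assms(1) by (rule K.Q_carrierE)
  from y(1) have "P (K.cls y)"
  proof (induction y rule: free_induct)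
    case zero
    have "\<zero> \<odot>\<^bsub>\<Omega>\<^esub> du \<zero> = \<zero>\<^bsub>\<Omega>\<^esub>" by simp
    then show ?case using gen[of \<zero> \<zero>] by (simp add: K.zero_Q)
  next
    case (step y a u)
    have "K.cls (y \<oplus>\<^bsub>F\<^esub> a \<odot>\<^bsub>F\<^esub> gen u) = K.cls y \<oplus>\<^bsub>\<Omega>\<^esub> a \<odot>\<^bsub>\<Omega>\<^esub> du u"
      using step by (simp add: K.cls_add K.cls_smult kaehler_d_def)
    then show ?case using add[of "K.cls y" "a \<odot>\<^bsub>\<Omega>\<^esub> du u"] gen step by simp
  qed
  then show ?thesis using y by simp
qed

text \<open>
  The additive map on the free module with value \<open>h u a\<close> on \<open>a\<close> times the generator of \<open>u\<close>. The map \<open>h u\<close>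
  is only additive in \<open>a\<close>, so that operators obeying a Leibniz rule are covered.
\<close>

definition extend :: "('p, 'y) ring_scheme \<Rightarrow> ('r \<Rightarrow> 'r \<Rightarrow> 'p) \<Rightarrow> ('r \<Rightarrow> 'r) \<Rightarrow> 'p" where
  "extend P h x = (\<Oplus>\<^bsub>P\<^esub>u\<in>{u \<in> carrier A. x u \<noteq> \<zero>}. h u (x u))"

context
  fixes P :: "('r, 'p, 'y) module_scheme" and h :: "'r \<Rightarrow> 'r \<Rightarrow> 'p"
  assumes P: "abelian_group P"
    and h_closed: "\<And>u a. u \<in> carrier A \<Longrightarrow> a \<in> carrier A \<Longrightarrow> h u a \<in> carrier P"
    and h_add: "\<And>u a b. u \<in> carrier A \<Longrightarrow> a \<in> carrier A \<Longrightarrow> b \<in> carrier A \<Longrightarrow> h u (a \<oplus> b) = h u a \<oplus>\<^bsub>P\<^esub> h u b"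
begin

interpretation P: abelian_group P by (rule P)

lemma h_zero: "u \<in> carrier A \<Longrightarrow> h u \<zero> = \<zero>\<^bsub>P\<^esub>"
  using h_add[of u \<zero> \<zero>] h_closed[of u \<zero>] by (simp add: P.add.l_cancel_one')

lemma extend_superset:
  assumes "x \<in> carrier F" "finite S" "S \<subseteq> carrier A" "{u \<in> carrier A. x u \<noteq> \<zero>} \<subseteq> S"
  shows "extend P h x = (\<Oplus>\<^bsub>P\<^esub>u\<in>S. h u (x u))"
  unfolding extend_def
  by (rule P.add.finprod_mono_neutral_cong_left)
    (use assms h_zero h_closed free_apply in \<open>auto simp: subset_iff\<close>)

lemma extend_closed: "x \<in> carrier F \<Longrightarrow> extend P h x \<in> carrier P"
  unfolding extend_def using h_closed free_apply by (intro P.finsum_closed) auto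

lemma extend_add:
  assumes x: "x \<in> carrier F" and y: "y \<in> carrier F"
  shows "extend P h (x \<oplus>\<^bsub>F\<^esub> y) = extend P h x \<oplus>\<^bsub>P\<^esub> extend P h y"
proof -
  let ?S = "{u \<in> carrier A. x u \<noteq> \<zero>} \<union> {u \<in> carrier A. y u \<noteq> \<zero>}"
  have S: "finite ?S" "?S \<subseteq> carrier A" using x y by (auto simp: free_carrier)
  have "extend P h (x \<oplus>\<^bsub>F\<^esub> y) = (\<Oplus>\<^bsub>P\<^esub>u\<in>?S. h u ((x \<oplus>\<^bsub>F\<^esub> y) u))"
    by (rule extend_superset[OF free_add_closed[OF x y] S]) (use x y in \<open>auto simp: free_simps free_apply\<close>)
  also have "\<dots> = (\<Oplus>\<^bsub>P\<^esub>u\<in>?S. h u (x u) \<oplus>\<^bsub>P\<^esub> h u (y u))"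
    by (rule P.add.finprod_cong') (use x y in \<open>auto simp: free_simps free_apply h_add h_closed\<close>)
  also have "\<dots> = (\<Oplus>\<^bsub>P\<^esub>u\<in>?S. h u (x u)) \<oplus>\<^bsub>P\<^esub> (\<Oplus>\<^bsub>P\<^esub>u\<in>?S. h u (y u))"
    by (rule P.finsum_addf) (use x y h_closed free_apply in auto)
  also have "\<dots> = extend P h x \<oplus>\<^bsub>P\<^esub> extend P h y"
    using extend_superset[OF x S] extend_superset[OF y S] by auto
  finally show ?thesis .
qed

lemma extend_gen:
  assumes "a \<in> carrier A" "u \<in> carrier A"
  shows "extend P h (a \<odot>\<^bsub>F\<^esub> gen u) = h u a"
proof -
  have "extend P h (a \<odot>\<^bsub>F\<^esub> gen u) = (\<Oplus>\<^bsub>P\<^esub>v\<in>{u}. h v ((a \<odot>\<^bsub>F\<^esub> gen u) v))"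
    by (rule extend_superset[OF free_smult_closed[OF assms(1) gen_closed]])
      (use assms in \<open>auto simp: free_simps free_gen_def split: if_splits\<close>)
  also have "\<dots> = h u ((a \<odot>\<^bsub>F\<^esub> gen u) u)"
    using P.finsum_insert[of "{}" u "\<lambda>v. h v ((a \<odot>\<^bsub>F\<^esub> gen u) v)"] assms h_closed
    by (simp add: free_simps free_gen_def)
  also have "\<dots> = h u a"
    using assms by (simp add: free_simps free_gen_def)
  finally show ?thesis .
qed

lemma extend_zero: "extend P h \<zero>\<^bsub>F\<^esub> = \<zero>\<^bsub>P\<^esub>"
  using extend_add[OF free_zero_closed free_zero_closed] extend_closed[OF free_zero_closed]
  by (simp add: free_zero_closed)

lemma extend_minus:
  assumes x: "x \<in> carrier F" and y: "y \<in> carrier F"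
  shows "extend P h (x \<ominus>\<^bsub>F\<^esub> y) = extend P h x \<ominus>\<^bsub>P\<^esub> extend P h y"
proof -
  have "x = (x \<ominus>\<^bsub>F\<^esub> y) \<oplus>\<^bsub>F\<^esub> y"
    using x y by (simp add: K.M.minus_eq K.M.a_assoc K.M.l_neg)
  then have "extend P h x = extend P h (x \<ominus>\<^bsub>F\<^esub> y) \<oplus>\<^bsub>P\<^esub> extend P h y"
    using extend_add[OF K.M.minus_closed[OF x y] y] by simp
  then show ?thesis
    using extend_closed[OF K.M.minus_closed[OF x y]] extend_closed[OF y]
    by (simp add: P.minus_eq P.a_assoc P.r_neg)
qed

end

text \<open>
  An additive map on the free module need not be linear to descend to the Kaehler differentials: it
  may be a first-order operator, with \<open>\<Psi>(a x) = a \<Psi>(x) + X(a) J(x)\<close> for a derivation \<open>X\<close> and a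
  linear map \<open>J\<close> that descends. With \<open>X = 0\<close> this is the universal property; the general case gives
  Lie derivatives and the bracket.
\<close>

context
  fixes P :: "('r, 'p, 'y) module_scheme" and X :: "'r \<Rightarrow> 'r" and j \<delta> :: "'r \<Rightarrow> 'p"
  assumes P: "Module.module A P"
    and X_closed: "\<And>a. a \<in> carrier A \<Longrightarrow> X a \<in> carrier A"
    and X_add: "\<And>a b. a \<in> carrier A \<Longrightarrow> b \<in> carrier A \<Longrightarrow> X (a \<oplus> b) = X a \<oplus> X b"
    and X_mult: "\<And>a b. a \<in> carrier A \<Longrightarrow> b \<in> carrier A \<Longrightarrow> X (a \<otimes> b) = a \<otimes> X b \<oplus> b \<otimes> X a"
    and j_closed: "\<And>u. u \<in> carrier A \<Longrightarrow> j u \<in> carrier P"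
    and \<delta>_closed: "\<And>u. u \<in> carrier A \<Longrightarrow> \<delta> u \<in> carrier P"
    and \<delta>_add: "\<And>u v. u \<in> carrier A \<Longrightarrow> v \<in> carrier A \<Longrightarrow> \<delta> (u \<oplus> v) = \<delta> u \<oplus>\<^bsub>P\<^esub> \<delta> v"
    and \<delta>_const: "\<And>r. \<delta> (r \<odot> \<one>) = \<zero>\<^bsub>P\<^esub>"
    and \<delta>_mult: "\<And>u v. u \<in> carrier A \<Longrightarrow> v \<in> carrier A \<Longrightarrow>
      \<delta> (u \<otimes> v) = (X u \<odot>\<^bsub>P\<^esub> j v \<oplus>\<^bsub>P\<^esub> u \<odot>\<^bsub>P\<^esub> \<delta> v) \<oplus>\<^bsub>P\<^esub> (X v \<odot>\<^bsub>P\<^esub> j u \<oplus>\<^bsub>P\<^esub> v \<odot>\<^bsub>P\<^esub> \<delta> u)"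
begin

interpretation P: module A P by (rule P)

abbreviation (input) "twisted \<equiv> \<lambda>u a. X a \<odot>\<^bsub>P\<^esub> j u \<oplus>\<^bsub>P\<^esub> a \<odot>\<^bsub>P\<^esub> \<delta> u"
abbreviation (input) "untwisted \<equiv> \<lambda>u a. a \<odot>\<^bsub>P\<^esub> j u"

lemma twisted_closed: "u \<in> carrier A \<Longrightarrow> a \<in> carrier A \<Longrightarrow> twisted u a \<in> carrier P"
  by (simp add: X_closed j_closed \<delta>_closed)

lemma twisted_add: "u \<in> carrier A \<Longrightarrow> a \<in> carrier A \<Longrightarrow> b \<in> carrier A \<Longrightarrow> twisted u (a \<oplus> b) = twisted u a \<oplus>\<^bsub>P\<^esub> twisted u b"
  by (simp add: X_closed j_closed \<delta>_closed X_add P.smult_l_distr P.M.a_ac)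

lemma untwisted_closed: "u \<in> carrier A \<Longrightarrow> a \<in> carrier A \<Longrightarrow> untwisted u a \<in> carrier P"
  by (simp add: j_closed)

lemma untwisted_add: "u \<in> carrier A \<Longrightarrow> a \<in> carrier A \<Longrightarrow> b \<in> carrier A \<Longrightarrow> untwisted u (a \<oplus> b) = untwisted u a \<oplus>\<^bsub>P\<^esub> untwisted u b"
  by (simp add: j_closed P.smult_l_distr)

lemma twisted_facts:
  shows "x \<in> carrier F \<Longrightarrow> extend P twisted x \<in> carrier P"
  and "x \<in> carrier F \<Longrightarrow> y \<in> carrier F \<Longrightarrow> extend P twisted (x \<oplus>\<^bsub>F\<^esub> y) = extend P twisted x \<oplus>\<^bsub>P\<^esub> extend P twisted y"
  and "a \<in> carrier A \<Longrightarrow> u \<in> carrier A \<Longrightarrow> extend P twisted (a \<odot>\<^bsub>F\<^esub> gen u) = twisted u a"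
  and "extend P twisted \<zero>\<^bsub>F\<^esub> = \<zero>\<^bsub>P\<^esub>"
  and "x \<in> carrier F \<Longrightarrow> y \<in> carrier F \<Longrightarrow> extend P twisted (x \<ominus>\<^bsub>F\<^esub> y) = extend P twisted x \<ominus>\<^bsub>P\<^esub> extend P twisted y"
  subgoal by (rule extend_closed[where h=twisted, OF P.abelian_group_axioms twisted_closed twisted_add]; assumption)
  subgoal by (rule extend_add[where h=twisted, OF P.abelian_group_axioms twisted_closed twisted_add]; assumption)
  subgoal by (rule extend_gen[where h=twisted, OF P.abelian_group_axioms twisted_closed twisted_add]; assumption)
  subgoal by (rule extend_zero[where h=twisted, OF P.abelian_group_axioms twisted_closed twisted_add]; assumption)
  subgoal by (rule extend_minus[where h=twisted, OF P.abelian_group_axioms twisted_closed twisted_add]; assumption)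
  done

lemma untwisted_facts:
  shows "x \<in> carrier F \<Longrightarrow> extend P untwisted x \<in> carrier P"
  and "x \<in> carrier F \<Longrightarrow> y \<in> carrier F \<Longrightarrow> extend P untwisted (x \<oplus>\<^bsub>F\<^esub> y) = extend P untwisted x \<oplus>\<^bsub>P\<^esub> extend P untwisted y"
  and "a \<in> carrier A \<Longrightarrow> u \<in> carrier A \<Longrightarrow> extend P untwisted (a \<odot>\<^bsub>F\<^esub> gen u) = untwisted u a"
  and "extend P untwisted \<zero>\<^bsub>F\<^esub> = \<zero>\<^bsub>P\<^esub>"
  subgoal by (rule extend_closed[where h=untwisted, OF P.abelian_group_axioms untwisted_closed untwisted_add]; assumption)
  subgoal by (rule extend_add[where h=untwisted, OF P.abelian_group_axioms untwisted_closed untwisted_add]; assumption)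
  subgoal by (rule extend_gen[where h=untwisted, OF P.abelian_group_axioms untwisted_closed untwisted_add]; assumption)
  subgoal by (rule extend_zero[where h=untwisted, OF P.abelian_group_axioms untwisted_closed untwisted_add]; assumption)
  done

lemma extend_twisted_smult:
  assumes a: "a \<in> carrier A" and "x \<in> carrier F"
  shows "extend P twisted (a \<odot>\<^bsub>F\<^esub> x) = a \<odot>\<^bsub>P\<^esub> extend P twisted x \<oplus>\<^bsub>P\<^esub> X a \<odot>\<^bsub>P\<^esub> extend P untwisted x"
  using assms(2)
proof (induction x rule: free_induct)
  case zero
  show ?case using a X_closed[OF a] by (simp add: twisted_facts untwisted_facts)
next
  case (step x c u)
  note cl = step(1,2,3) a X_closed j_closed \<delta>_closed
  have "a \<odot>\<^bsub>F\<^esub> (x \<oplus>\<^bsub>F\<^esub> c \<odot>\<^bsub>F\<^esub> gen u) = a \<odot>\<^bsub>F\<^esub> x \<oplus>\<^bsub>F\<^esub> (a \<otimes> c) \<odot>\<^bsub>F\<^esub> gen u"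
    using cl by (simp add: K.smult_r_distr K.smult_assoc1)
  then have "extend P twisted (a \<odot>\<^bsub>F\<^esub> (x \<oplus>\<^bsub>F\<^esub> c \<odot>\<^bsub>F\<^esub> gen u)) =
      (a \<odot>\<^bsub>P\<^esub> extend P twisted x \<oplus>\<^bsub>P\<^esub> X a \<odot>\<^bsub>P\<^esub> extend P untwisted x) \<oplus>\<^bsub>P\<^esub> twisted u (a \<otimes> c)"
    using cl step(4) by (simp add: twisted_facts)
  also have "twisted u (a \<otimes> c) = a \<odot>\<^bsub>P\<^esub> twisted u c \<oplus>\<^bsub>P\<^esub> X a \<odot>\<^bsub>P\<^esub> untwisted u c"
    using cl by (simp add: X_mult P.smult_l_distr P.smult_r_distr P.smult_assoc1[symmetric] m_comm P.M.a_ac)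
  also have "(a \<odot>\<^bsub>P\<^esub> extend P twisted x \<oplus>\<^bsub>P\<^esub> X a \<odot>\<^bsub>P\<^esub> extend P untwisted x) \<oplus>\<^bsub>P\<^esub> (a \<odot>\<^bsub>P\<^esub> twisted u c \<oplus>\<^bsub>P\<^esub> X a \<odot>\<^bsub>P\<^esub> untwisted u c)
      = a \<odot>\<^bsub>P\<^esub> (extend P twisted x \<oplus>\<^bsub>P\<^esub> twisted u c) \<oplus>\<^bsub>P\<^esub> X a \<odot>\<^bsub>P\<^esub> (extend P untwisted x \<oplus>\<^bsub>P\<^esub> untwisted u c)"
    using cl twisted_facts(1)[OF step(1)] untwisted_facts(1)[OF step(1)]
    by (simp add: P.smult_r_distr P.M.a_ac)
  finally show ?case
    using cl by (simp add: twisted_facts untwisted_facts)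
qed

text \<open>
  The relations on which the operator vanishes form a submodule, by the Leibniz rule and the assumption
  on the linear part, and contain the generating relations. That assumption is trivial for \<open>X = 0\<close>, and
  this case in turn supplies it for general \<open>X\<close>.
\<close>

lemma extend_twisted_relations:
  assumes J: "\<And>a x. a \<in> carrier A \<Longrightarrow> x \<in> kaehler_relations A \<Longrightarrow> X a \<odot>\<^bsub>P\<^esub> extend P untwisted x = \<zero>\<^bsub>P\<^esub>"
    and x: "x \<in> kaehler_relations A"
  shows "extend P twisted x = \<zero>\<^bsub>P\<^esub>"
proof -
  let ?H = "{x \<in> kaehler_relations A. extend P twisted x = \<zero>\<^bsub>P\<^esub>}"
  note sub = K.submoduleE[OF K.submodule_S]
  have KF: "y \<in> carrier F" if "y \<in> kaehler_relations A" for y using sub(1) that by blast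
  have "X \<one> \<oplus> X \<one> = X \<one>" using X_mult[OF one_closed one_closed] X_closed[OF one_closed] by simp
  then have X1: "X \<one> = \<zero>" using X_closed[OF one_closed] by (simp add: add.l_cancel_one')
  have gen: "extend P twisted (gen u) = \<delta> u" if "u \<in> carrier A" for u
  proof -
    have "gen u = \<one> \<odot>\<^bsub>F\<^esub> gen u" by simp
    then have "extend P twisted (gen u) = twisted u \<one>" using twisted_facts(3)[OF one_closed that] by simp
    then show ?thesis using that by (simp add: X1 \<delta>_closed j_closed)
  qed
  have H: "submodule ?H A F"
  proof (rule K.submoduleI)
    show "?H \<subseteq> carrier F" using KF by blast
    show "\<zero>\<^bsub>F\<^esub> \<in> ?H" using twisted_facts(4) by simp
    fix a y assume y: "y \<in> ?H"
    show "a \<odot>\<^bsub>F\<^esub> y \<in> ?H" if a: "a \<in> carrier A"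
      using y a sub(4)[OF a] extend_twisted_smult[OF a KF] J[OF a] by simp
    fix z assume "z \<in> ?H"
    with y show "y \<oplus>\<^bsub>F\<^esub> z \<in> ?H" using sub(5) KF by (simp add: twisted_facts(2))
  next
    fix y assume y: "y \<in> ?H"
    then have "extend P twisted (\<zero>\<^bsub>F\<^esub> \<ominus>\<^bsub>F\<^esub> y) = \<zero>\<^bsub>P\<^esub>"
      using twisted_facts(5)[OF free_zero_closed] twisted_facts(4) KF by (simp add: P.M.minus_eq)
    then show "\<ominus>\<^bsub>F\<^esub> y \<in> ?H"
      using y sub(3) KF by (simp add: K.M.minus_eq)
  qed
  have "kaehler_relations A \<subseteq> ?H"
  proof -
    have "extend P twisted (gen (u \<oplus> v) \<ominus>\<^bsub>F\<^esub> (gen u \<oplus>\<^bsub>F\<^esub> gen v)) = \<zero>\<^bsub>P\<^esub>"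
      if "u \<in> carrier A" "v \<in> carrier A" for u v
      using that by (simp add: twisted_facts gen \<delta>_add \<delta>_closed P.M.minus_eq P.M.r_neg)
    moreover have "extend P twisted (gen (u \<otimes> v) \<ominus>\<^bsub>F\<^esub> ((u \<odot>\<^bsub>F\<^esub> gen v) \<oplus>\<^bsub>F\<^esub> (v \<odot>\<^bsub>F\<^esub> gen u))) = \<zero>\<^bsub>P\<^esub>"
      if "u \<in> carrier A" "v \<in> carrier A" for u v
      using that by (simp add: twisted_facts gen \<delta>_mult \<delta>_closed j_closed X_closed P.M.minus_eq P.M.r_neg)
    moreover have "extend P twisted (gen (r \<odot> \<one>)) = \<zero>\<^bsub>P\<^esub>" for r
      by (simp add: gen real_const_closed \<delta>_const)
    ultimately show ?thesis
      using generated_submodule_base[of "_ \<union> _ \<union> _" A F]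
      by (subst kaehler_relations_def, intro generated_submodule_least[OF H])
        (auto simp: kaehler_relations_def intro!: generated_submodule_base[THEN subsetD])
  qed
  then show ?thesis using x by blast
qed

lemma twisted_descends:
  assumes J: "\<And>a x. a \<in> carrier A \<Longrightarrow> x \<in> kaehler_relations A \<Longrightarrow> X a \<odot>\<^bsub>P\<^esub> extend P untwisted x = \<zero>\<^bsub>P\<^esub>"
  obtains \<Psi> where "\<And>x. x \<in> carrier \<Omega> \<Longrightarrow> \<Psi> x \<in> carrier P"
    "\<And>x y. x \<in> carrier \<Omega> \<Longrightarrow> y \<in> carrier \<Omega> \<Longrightarrow> \<Psi> (x \<oplus>\<^bsub>\<Omega>\<^esub> y) = \<Psi> x \<oplus>\<^bsub>P\<^esub> \<Psi> y"
    "\<And>a u. a \<in> carrier A \<Longrightarrow> u \<in> carrier A \<Longrightarrow> \<Psi> (a \<odot>\<^bsub>\<Omega>\<^esub> du u) = X a \<odot>\<^bsub>P\<^esub> j u \<oplus>\<^bsub>P\<^esub> a \<odot>\<^bsub>P\<^esub> \<delta> u"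
    "\<And>x. x \<in> carrier F \<Longrightarrow> \<Psi> (K.cls x) = extend P twisted x"
proof -
  define \<Psi> where "\<Psi> C = extend P twisted (SOME x. x \<in> C)" for C
  have \<Psi>: "\<Psi> (K.cls x) = extend P twisted x" if x: "x \<in> carrier F" for x
  proof -
    have "(SOME y. y \<in> K.cls x) \<in> K.cls x"
      by (rule someI[of "\<lambda>y. y \<in> K.cls x"]) (rule K.S.a_rcos_self[OF x])
    then obtain s where s: "s \<in> kaehler_relations A" "(SOME y. y \<in> K.cls x) = s \<oplus>\<^bsub>F\<^esub> x"
      by (auto simp: a_r_coset_def')
    have "s \<in> carrier F" using s(1) by simp
    then show ?thesis
      using s x twisted_facts(1)[OF x] by (simp add: \<Psi>_def twisted_facts(2) extend_twisted_relations[OF J s(1)])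
  qed
  show ?thesis
  proof (rule that[of \<Psi>])
    show "\<Psi> x \<in> carrier P" if "x \<in> carrier \<Omega>" for x
      using that \<Psi> twisted_facts(1) by (auto elim!: K.Q_carrierE)
    show "\<Psi> (x \<oplus>\<^bsub>\<Omega>\<^esub> y) = \<Psi> x \<oplus>\<^bsub>P\<^esub> \<Psi> y"
      if x: "x \<in> carrier \<Omega>" and y: "y \<in> carrier \<Omega>" for x y
    proof -
      obtain x' where "x' \<in> carrier F" "x = K.cls x'" using x by (rule K.Q_carrierE)
      moreover obtain y' where "y' \<in> carrier F" "y = K.cls y'" using y by (rule K.Q_carrierE)
      ultimately show ?thesis using \<Psi> twisted_facts(2) by (simp add: K.cls_add)
    qed
    show "\<Psi> (a \<odot>\<^bsub>\<Omega>\<^esub> du u) = X a \<odot>\<^bsub>P\<^esub> j u \<oplus>\<^bsub>P\<^esub> a \<odot>\<^bsub>P\<^esub> \<delta> u" if "a \<in> carrier A" "u \<in> carrier A" for a u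
      using that \<Psi>[of "a \<odot>\<^bsub>F\<^esub> gen u"] twisted_facts(3)[OF that] by (simp add: kaehler_d_def K.cls_smult)
  qed (rule \<Psi>)
qed

end

text \<open>
  The universal property of Kaehler differentials. The formula on classes of elements of the free module
  identifies the linear part of a first-order operator.
\<close>

lemma kaehler_linear_extension:
  fixes P :: "('r, 'p, 'y) module_scheme"
  assumes P: "Module.module A P"
    and \<delta>_closed: "\<And>u. u \<in> carrier A \<Longrightarrow> \<delta> u \<in> carrier P"
    and \<delta>_add: "\<And>u v. u \<in> carrier A \<Longrightarrow> v \<in> carrier A \<Longrightarrow> \<delta> (u \<oplus> v) = \<delta> u \<oplus>\<^bsub>P\<^esub> \<delta> v"
    and \<delta>_const: "\<And>r. \<delta> (r \<odot> \<one>) = \<zero>\<^bsub>P\<^esub>"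
    and \<delta>_mult: "\<And>u v. u \<in> carrier A \<Longrightarrow> v \<in> carrier A \<Longrightarrow> \<delta> (u \<otimes> v) = u \<odot>\<^bsub>P\<^esub> \<delta> v \<oplus>\<^bsub>P\<^esub> v \<odot>\<^bsub>P\<^esub> \<delta> u"
  obtains \<Psi> where "\<Psi> \<in> mod_hom A \<Omega> P" "\<And>u. u \<in> carrier A \<Longrightarrow> \<Psi> (du u) = \<delta> u"
    "\<And>x. x \<in> carrier F \<Longrightarrow> \<Psi> (K.cls x) = extend P (\<lambda>u a. a \<odot>\<^bsub>P\<^esub> \<delta> u) x"
proof -
  interpret P: module A P by (rule P)
  interpret \<Omega>: module A \<Omega> by (rule module_kaehler)
  obtain \<Psi> where \<Psi>: "\<And>x. x \<in> carrier \<Omega> \<Longrightarrow> \<Psi> x \<in> carrier P"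
    "\<And>x y. x \<in> carrier \<Omega> \<Longrightarrow> y \<in> carrier \<Omega> \<Longrightarrow> \<Psi> (x \<oplus>\<^bsub>\<Omega>\<^esub> y) = \<Psi> x \<oplus>\<^bsub>P\<^esub> \<Psi> y"
    "\<And>a u. a \<in> carrier A \<Longrightarrow> u \<in> carrier A \<Longrightarrow> \<Psi> (a \<odot>\<^bsub>\<Omega>\<^esub> du u) = \<zero> \<odot>\<^bsub>P\<^esub> \<delta> u \<oplus>\<^bsub>P\<^esub> a \<odot>\<^bsub>P\<^esub> \<delta> u"
    "\<And>x. x \<in> carrier F \<Longrightarrow> \<Psi> (K.cls x) = extend P (\<lambda>u a. \<zero> \<odot>\<^bsub>P\<^esub> \<delta> u \<oplus>\<^bsub>P\<^esub> a \<odot>\<^bsub>P\<^esub> \<delta> u) x"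
  proof (rule twisted_descends[of P "\<lambda>_. \<zero>" \<delta> \<delta>])
    fix a x assume "x \<in> kaehler_relations A"
    then have "x \<in> carrier F" by simp
    then have "extend P (\<lambda>u a. a \<odot>\<^bsub>P\<^esub> \<delta> u) x \<in> carrier P"
      by (intro extend_closed P.abelian_group_axioms) (auto simp: \<delta>_closed P.smult_l_distr)
    then show "\<zero> \<odot>\<^bsub>P\<^esub> extend P (\<lambda>u a. a \<odot>\<^bsub>P\<^esub> \<delta> u) x = \<zero>\<^bsub>P\<^esub>" by simp
  qed (use P \<delta>_closed \<delta>_add \<delta>_const \<delta>_mult in auto)
  have gen: "\<Psi> (a \<odot>\<^bsub>\<Omega>\<^esub> du u) = a \<odot>\<^bsub>P\<^esub> \<delta> u" if "a \<in> carrier A" "u \<in> carrier A" for a u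
    using \<Psi>(3)[OF that] that by (simp add: \<delta>_closed)
  have smult: "\<Psi> (a \<odot>\<^bsub>\<Omega>\<^esub> x) = a \<odot>\<^bsub>P\<^esub> \<Psi> x" if "a \<in> carrier A" "x \<in> carrier \<Omega>" for a x
    using that(2)
  proof (induction x rule: kaehler_induct)
    case (gen c u)
    then show ?case
      using that(1) \<open>\<And>a u. a \<in> carrier A \<Longrightarrow> u \<in> carrier A \<Longrightarrow> \<Psi> (a \<odot>\<^bsub>\<Omega>\<^esub> du u) = a \<odot>\<^bsub>P\<^esub> \<delta> u\<close>[of "a \<otimes> c" u]
        \<open>\<And>a u. a \<in> carrier A \<Longrightarrow> u \<in> carrier A \<Longrightarrow> \<Psi> (a \<odot>\<^bsub>\<Omega>\<^esub> du u) = a \<odot>\<^bsub>P\<^esub> \<delta> u\<close>[of c u]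
      by (simp add: \<Omega>.smult_assoc1 P.smult_assoc1 \<delta>_closed)
  next
    case (add x y)
    then show ?case using that(1) by (simp add: \<Omega>.smult_r_distr P.smult_r_distr \<Psi>)
  qed
  show ?thesis
  proof (rule that[of \<Psi>])
    show "\<Psi> \<in> mod_hom A \<Omega> P" using \<Psi> smult by (simp add: mod_hom_def)
    show "\<Psi> (du u) = \<delta> u" if "u \<in> carrier A" for u
      using gen[OF one_closed that] by (simp add: \<delta>_closed that)
    fix x assume x: "x \<in> carrier F"
    have "extend P (\<lambda>u a. \<zero> \<odot>\<^bsub>P\<^esub> \<delta> u \<oplus>\<^bsub>P\<^esub> a \<odot>\<^bsub>P\<^esub> \<delta> u) x = extend P (\<lambda>u a. a \<odot>\<^bsub>P\<^esub> \<delta> u) x"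
      unfolding extend_def using x by (intro P.add.finprod_cong') (auto simp: \<delta>_closed free_apply)
    then show "\<Psi> (K.cls x) = extend P (\<lambda>u a. a \<odot>\<^bsub>P\<^esub> \<delta> u) x"
      using \<Psi>(4)[OF x] by simp
  qed
qed

text \<open>
  If \<open>j\<close> is itself a derivation, then its linear extension kills the relations, as the descent of a
  first-order operator requires.
\<close>

lemma kaehler_first_order_extension:
  fixes P :: "('r, 'p, 'y) module_scheme"
  assumes P: "Module.module A P"
    and X_closed: "\<And>a. a \<in> carrier A \<Longrightarrow> X a \<in> carrier A"
    and X_add: "\<And>a b. a \<in> carrier A \<Longrightarrow> b \<in> carrier A \<Longrightarrow> X (a \<oplus> b) = X a \<oplus> X b"
    and X_mult: "\<And>a b. a \<in> carrier A \<Longrightarrow> b \<in> carrier A \<Longrightarrow> X (a \<otimes> b) = a \<otimes> X b \<oplus> b \<otimes> X a"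
    and j_closed: "\<And>u. u \<in> carrier A \<Longrightarrow> j u \<in> carrier P"
    and j_add: "\<And>u v. u \<in> carrier A \<Longrightarrow> v \<in> carrier A \<Longrightarrow> j (u \<oplus> v) = j u \<oplus>\<^bsub>P\<^esub> j v"
    and j_const: "\<And>r. j (r \<odot> \<one>) = \<zero>\<^bsub>P\<^esub>"
    and j_mult: "\<And>u v. u \<in> carrier A \<Longrightarrow> v \<in> carrier A \<Longrightarrow> j (u \<otimes> v) = u \<odot>\<^bsub>P\<^esub> j v \<oplus>\<^bsub>P\<^esub> v \<odot>\<^bsub>P\<^esub> j u"
    and \<delta>_closed: "\<And>u. u \<in> carrier A \<Longrightarrow> \<delta> u \<in> carrier P"
    and \<delta>_add: "\<And>u v. u \<in> carrier A \<Longrightarrow> v \<in> carrier A \<Longrightarrow> \<delta> (u \<oplus> v) = \<delta> u \<oplus>\<^bsub>P\<^esub> \<delta> v"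
    and \<delta>_const: "\<And>r. \<delta> (r \<odot> \<one>) = \<zero>\<^bsub>P\<^esub>"
    and \<delta>_mult: "\<And>u v. u \<in> carrier A \<Longrightarrow> v \<in> carrier A \<Longrightarrow>
      \<delta> (u \<otimes> v) = (X u \<odot>\<^bsub>P\<^esub> j v \<oplus>\<^bsub>P\<^esub> u \<odot>\<^bsub>P\<^esub> \<delta> v) \<oplus>\<^bsub>P\<^esub> (X v \<odot>\<^bsub>P\<^esub> j u \<oplus>\<^bsub>P\<^esub> v \<odot>\<^bsub>P\<^esub> \<delta> u)"
  shows "\<exists>\<Psi>. (\<forall>x\<in>carrier \<Omega>. \<Psi> x \<in> carrier P) \<and>
    (\<forall>x\<in>carrier \<Omega>. \<forall>y\<in>carrier \<Omega>. \<Psi> (x \<oplus>\<^bsub>\<Omega>\<^esub> y) = \<Psi> x \<oplus>\<^bsub>P\<^esub> \<Psi> y) \<and>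
    (\<forall>a\<in>carrier A. \<forall>u\<in>carrier A. \<Psi> (a \<odot>\<^bsub>\<Omega>\<^esub> du u) = X a \<odot>\<^bsub>P\<^esub> j u \<oplus>\<^bsub>P\<^esub> a \<odot>\<^bsub>P\<^esub> \<delta> u)"
proof -
  interpret P: module A P by (rule P)
  obtain J where J: "J \<in> mod_hom A \<Omega> P"
    "\<And>x. x \<in> carrier F \<Longrightarrow> J (K.cls x) = extend P (\<lambda>u a. a \<odot>\<^bsub>P\<^esub> j u) x"
    by (rule kaehler_linear_extension[OF P j_closed j_add j_const j_mult]) blast+
  have ker: "extend P (\<lambda>u a. a \<odot>\<^bsub>P\<^esub> j u) x = \<zero>\<^bsub>P\<^esub>" if "x \<in> kaehler_relations A" for x
  proof -
    have x: "x \<in> carrier F" using that by simp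
    have "K.cls x = K.cls \<zero>\<^bsub>F\<^esub>" using K.cls_zero[OF that] K.zero_Q by simp
    then have "extend P (\<lambda>u a. a \<odot>\<^bsub>P\<^esub> j u) x = extend P (\<lambda>u a. a \<odot>\<^bsub>P\<^esub> j u) \<zero>\<^bsub>F\<^esub>"
      using J(2)[OF x] J(2)[OF free_zero_closed] by simp
    also have "\<dots> = \<zero>\<^bsub>P\<^esub>"
      by (rule extend_zero[OF P.abelian_group_axioms]) (auto simp: j_closed P.smult_l_distr)
    finally show ?thesis .
  qed
  show ?thesis
  proof (rule twisted_descends[of P X j \<delta>])
    show "X a \<odot>\<^bsub>P\<^esub> extend P (\<lambda>u a. a \<odot>\<^bsub>P\<^esub> j u) x = \<zero>\<^bsub>P\<^esub>"
      if "a \<in> carrier A" "x \<in> kaehler_relations A" for a x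
      using that by (simp add: ker X_closed)
  next
    fix \<Psi>
    assume "\<And>x. x \<in> carrier \<Omega> \<Longrightarrow> \<Psi> x \<in> carrier P"
      "\<And>x y. x \<in> carrier \<Omega> \<Longrightarrow> y \<in> carrier \<Omega> \<Longrightarrow> \<Psi> (x \<oplus>\<^bsub>\<Omega>\<^esub> y) = \<Psi> x \<oplus>\<^bsub>P\<^esub> \<Psi> y"
      "\<And>a u. a \<in> carrier A \<Longrightarrow> u \<in> carrier A \<Longrightarrow> \<Psi> (a \<odot>\<^bsub>\<Omega>\<^esub> du u) = X a \<odot>\<^bsub>P\<^esub> j u \<oplus>\<^bsub>P\<^esub> a \<odot>\<^bsub>P\<^esub> \<delta> u"
    then show ?thesis by blast
  qed (fact P X_closed X_add X_mult j_closed \<delta>_closed \<delta>_add \<delta>_const \<delta>_mult)+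
qed

end

section \<open>From formal differentials to one-forms\<close>

context smooth_manifold
begin

sublocale kd: real_algebra "smooth_functions N"
  by (intro real_algebra.intro cring_smooth_functions real_algebra_axioms.intro) simp

abbreviation "\<Omega> \<equiv> kaehler (smooth_functions N)"
abbreviation "du \<equiv> kaehler_d (smooth_functions N)"
abbreviation "q \<equiv> kaehler_to_forms N"

lemma kaehler_to_forms:
  shows q_hom: "q \<in> mod_hom (smooth_functions N) \<Omega> D"
    and q_d: "u \<in> A \<Longrightarrow> q (du u) = exterior_d N u"
proof -
  interpret \<Omega>: module "smooth_functions N" \<Omega> by (rule kd.module_kaehler)
  obtain \<Psi> where \<Psi>: "\<Psi> \<in> mod_hom (smooth_functions N) \<Omega> D" "\<And>u. u \<in> A \<Longrightarrow> \<Psi> (du u) = exterior_d N u"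
  proof (rule kd.kaehler_linear_extension[OF module_one_forms, of "exterior_d N"])
    show "exterior_d N (u \<oplus>\<^bsub>smooth_functions N\<^esub> v) = exterior_d N u \<oplus>\<^bsub>D\<^esub> exterior_d N v"
      if "u \<in> A" "v \<in> A" for u v using exterior_d_add[OF that] by simp
    show "exterior_d N (u \<otimes>\<^bsub>smooth_functions N\<^esub> v) = u \<odot>\<^bsub>D\<^esub> exterior_d N v \<oplus>\<^bsub>D\<^esub> v \<odot>\<^bsub>D\<^esub> exterior_d N u"
      if "u \<in> A" "v \<in> A" for u v using exterior_d_mult[OF that] by simp
    show "exterior_d N (r \<odot>\<^bsub>smooth_functions N\<^esub> \<one>\<^bsub>smooth_functions N\<^esub>) = \<zero>\<^bsub>D\<^esub>" for r
      using exterior_d_const by simp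
  qed auto
  have "q = restrict \<Psi> (carrier \<Omega>)"
    unfolding kaehler_to_forms_def Let_def
  proof (rule the_equality)
    show "restrict \<Psi> (carrier \<Omega>) \<in> mod_hom (smooth_functions N) \<Omega> D \<and>
        restrict \<Psi> (carrier \<Omega>) \<in> extensional (carrier \<Omega>) \<and>
        (\<forall>u\<in>A. restrict \<Psi> (carrier \<Omega>) (du u) = exterior_d N u)"
      using \<Psi> by (simp add: mod_hom_def Pi_iff del: one_form_module_simps)
    fix h assume h: "h \<in> mod_hom (smooth_functions N) \<Omega> D \<and> h \<in> extensional (carrier \<Omega>) \<and>
        (\<forall>u\<in>A. h (du u) = exterior_d N u)"
    show "h = restrict \<Psi> (carrier \<Omega>)"
    proof (rule extensionalityI[of _ "carrier \<Omega>"])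
      fix x assume "x \<in> carrier \<Omega>"
      then show "h x = restrict \<Psi> (carrier \<Omega>) x"
      proof (induction x rule: kd.kaehler_induct)
        case (gen a u)
        then show ?case
          using h \<Psi> by (simp add: mod_hom_def del: one_form_module_simps)
      next
        case (add x y)
        then show ?case
          using h \<Psi>(1) by (simp add: mod_hom_def del: one_form_module_simps)
      qed
    qed (use h in auto)
  qed
  then show "q \<in> mod_hom (smooth_functions N) \<Omega> D" "u \<in> A \<Longrightarrow> q (du u) = exterior_d N u"
    using \<Psi> by (simp_all add: mod_hom_def Pi_iff del: one_form_module_simps)
qed

lemma q_closed [simp, intro]: "x \<in> carrier \<Omega> \<Longrightarrow> q x \<in> one_forms N"
  using q_hom by (auto simp: mod_hom_def)

lemma q_add: "x \<in> carrier \<Omega> \<Longrightarrow> y \<in> carrier \<Omega> \<Longrightarrow> q (x \<oplus>\<^bsub>\<Omega>\<^esub> y) = q x \<oplus>\<^bsub>D\<^esub> q y"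
  using q_hom unfolding mod_hom_def by blast

lemma q_smult: "a \<in> A \<Longrightarrow> x \<in> carrier \<Omega> \<Longrightarrow> q (a \<odot>\<^bsub>\<Omega>\<^esub> x) = a \<odot>\<^bsub>D\<^esub> q x"
  using q_hom unfolding mod_hom_def by blast

lemma q_gen: "a \<in> A \<Longrightarrow> u \<in> A \<Longrightarrow> q (a \<odot>\<^bsub>\<Omega>\<^esub> du u) = a \<odot>\<^bsub>D\<^esub> exterior_d N u"
  using q_smult[OF _ kd.kaehler_d_closed] q_d by simp

text \<open>
  Surjectivity of \<open>q\<close> near a point, with one factor \<open>\<eta>\<close> for all one-forms: a frame expresses \<open>\<eta> \<alpha>\<close> by
  the differentials \<open>du\<^sub>i\<close>.
\<close>

lemma q_locally_surjective:
  obtains \<eta> where "\<eta> \<in> A" "\<eta> p \<noteq> 0" "\<And>\<alpha>. \<alpha> \<in> one_forms N \<Longrightarrow> \<exists>x\<in>carrier \<Omega>. q x = \<eta> \<odot>\<^bsub>D\<^esub> \<alpha>"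
proof -
  interpret \<Omega>: module "smooth_functions N" \<Omega> by (rule kd.module_kaehler)
  obtain \<eta> and I :: "'e option set" and u E where fr: "local_frame p \<eta> I u E"
    by (rule local_frame_exists)
  have "\<exists>x\<in>carrier \<Omega>. q x = \<eta> \<odot>\<^bsub>D\<^esub> \<alpha>" if "\<alpha> \<in> one_forms N" for \<alpha>
  proof (rule frame_combination_induct[OF fr that, where P = "\<lambda>\<beta>. \<exists>x\<in>carrier \<Omega>. q x = \<beta>"])
    have "(\<lambda>p. 0) \<odot>\<^bsub>D\<^esub> exterior_d N (\<lambda>p. 0) = \<zero>\<^bsub>D\<^esub>" by simp
    then show "\<exists>x\<in>carrier \<Omega>. q x = \<zero>\<^bsub>D\<^esub>"
      using q_gen[of "\<lambda>p. 0" "\<lambda>p. 0"]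
      by (intro bexI[of _ "(\<lambda>p. 0) \<odot>\<^bsub>\<Omega>\<^esub> du (\<lambda>p. 0)"]) (simp_all del: one_form_module_simps)
  next
    fix \<beta> \<gamma> assume "\<exists>x\<in>carrier \<Omega>. q x = \<beta>" "\<exists>x\<in>carrier \<Omega>. q x = \<gamma>"
    then show "\<exists>x\<in>carrier \<Omega>. q x = \<beta> \<oplus>\<^bsub>D\<^esub> \<gamma>"
      using q_add \<Omega>.M.add.m_closed by metis
  next
    fix a f assume "a \<in> A" "f \<in> A"
    then show "\<exists>x\<in>carrier \<Omega>. q x = a \<odot>\<^bsub>D\<^esub> exterior_d N f"
      using q_gen by (intro bexI[of _ "a \<odot>\<^bsub>\<Omega>\<^esub> du f"]) (simp_all del: one_form_module_simps)
  qed
  moreover have "\<eta> \<in> A" "\<eta> p \<noteq> 0" using fr by (auto simp: local_frame_def)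
  ultimately show ?thesis by (rule that[rotated 2])
qed

text \<open>At \<open>p\<close> itself the factor is a nonzero constant and can be divided out.\<close>

lemma q_surjective_at:
  assumes \<alpha>: "\<alpha> \<in> one_forms N"
  obtains x where "x \<in> carrier \<Omega>" "q x p = \<alpha> p"
proof -
  interpret \<Omega>: module "smooth_functions N" \<Omega> by (rule kd.module_kaehler)
  obtain \<eta> where \<eta>: "\<eta> \<in> A" "\<eta> p \<noteq> 0" "\<And>\<alpha>. \<alpha> \<in> one_forms N \<Longrightarrow> \<exists>x\<in>carrier \<Omega>. q x = \<eta> \<odot>\<^bsub>D\<^esub> \<alpha>"
    using q_locally_surjective[of p] by blast
  obtain x where x: "x \<in> carrier \<Omega>" "q x = \<eta> \<odot>\<^bsub>D\<^esub> \<alpha>" using \<eta>(3)[OF \<alpha>] by blast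
  let ?c = "\<lambda>_. inverse (\<eta> p)"
  have ext: "\<alpha> p \<in> extensional (T p)"
    using \<alpha> by (simp add: one_forms_def cotangent_space_def)
  have "q (?c \<odot>\<^bsub>\<Omega>\<^esub> x) = ?c \<odot>\<^bsub>D\<^esub> (\<eta> \<odot>\<^bsub>D\<^esub> \<alpha>)"
    using q_smult[of ?c x] x by (simp del: one_form_module_simps)
  then have "q (?c \<odot>\<^bsub>\<Omega>\<^esub> x) p = \<alpha> p"
    using \<eta>(2) ext by (auto simp: fun_eq_iff extensional_def)
  then show ?thesis using that[of "?c \<odot>\<^bsub>\<Omega>\<^esub> x"] x by simp
qed

end

section \<open>The bracket of formal differentials\<close>

context poisson_manifold
begin

lemma br_const: "g \<in> A \<Longrightarrow> br (\<lambda>p. c) g = (\<lambda>p. 0)" "g \<in> A \<Longrightarrow> br g (\<lambda>p. c) = (\<lambda>p. 0)"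
proof -
  assume g: "g \<in> A"
  show "br (\<lambda>p. c) g = (\<lambda>p. 0)"
    using tangent_const[OF hamiltonian_tangent[OF g]] by (auto simp: hamiltonian_def)
  then show "br g (\<lambda>p. c) = (\<lambda>p. 0)"
    using br_antisym[OF g smooth_const[of c]] by simp
qed

lemma du_simps:
  "u \<in> A \<Longrightarrow> v \<in> A \<Longrightarrow> du (\<lambda>p. u p + v p) = du u \<oplus>\<^bsub>\<Omega>\<^esub> du v"
  "u \<in> A \<Longrightarrow> v \<in> A \<Longrightarrow> du (\<lambda>p. u p * v p) = u \<odot>\<^bsub>\<Omega>\<^esub> du v \<oplus>\<^bsub>\<Omega>\<^esub> v \<odot>\<^bsub>\<Omega>\<^esub> du u"
  "du (\<lambda>p. c) = \<zero>\<^bsub>\<Omega>\<^esub>"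
  using kd.kaehler_d_add[of u v] kd.kaehler_d_mult[of u v] kd.kaehler_d_const[of c] by simp_all

interpretation \<Omega>: module "smooth_functions N" \<Omega> by (rule kd.module_kaehler)

lemma kaehler_smult_simps:
  assumes "a \<in> A" "b \<in> A" "x \<in> carrier \<Omega>"
  shows "(\<lambda>p. a p + b p) \<odot>\<^bsub>\<Omega>\<^esub> x = a \<odot>\<^bsub>\<Omega>\<^esub> x \<oplus>\<^bsub>\<Omega>\<^esub> b \<odot>\<^bsub>\<Omega>\<^esub> x"
    and "a \<odot>\<^bsub>\<Omega>\<^esub> (b \<odot>\<^bsub>\<Omega>\<^esub> x) = (\<lambda>p. a p * b p) \<odot>\<^bsub>\<Omega>\<^esub> x"
  using \<Omega>.smult_l_distr[OF assms] \<Omega>.smult_assoc1[OF assms] by simp_all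

lemma kaehler_smult_zero: "x \<in> carrier \<Omega> \<Longrightarrow> (\<lambda>p. 0) \<odot>\<^bsub>\<Omega>\<^esub> x = \<zero>\<^bsub>\<Omega>\<^esub>"
  using \<Omega>.smult_l_null[of x] by simp

text \<open>The operator \<open>b dv \<mapsto> {u, b} dv + b d{u, v}\<close>, the Lie derivative along \<open>{u, -}\<close>.\<close>

lemma kaehler_lie_exists:
  assumes u: "u \<in> A"
  shows "\<exists>L. (\<forall>x\<in>carrier \<Omega>. L x \<in> carrier \<Omega>) \<and>
    (\<forall>x\<in>carrier \<Omega>. \<forall>y\<in>carrier \<Omega>. L (x \<oplus>\<^bsub>\<Omega>\<^esub> y) = L x \<oplus>\<^bsub>\<Omega>\<^esub> L y) \<and>
    (\<forall>b\<in>A. \<forall>v\<in>A. L (b \<odot>\<^bsub>\<Omega>\<^esub> du v) = br u b \<odot>\<^bsub>\<Omega>\<^esub> du v \<oplus>\<^bsub>\<Omega>\<^esub> b \<odot>\<^bsub>\<Omega>\<^esub> du (br u v))"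
proof (rule kd.kaehler_first_order_extension[of \<Omega> "br u" du "\<lambda>v. du (br u v)"])
    show "du (br u (v \<otimes>\<^bsub>smooth_functions N\<^esub> w)) =
        (br u v \<odot>\<^bsub>\<Omega>\<^esub> du w \<oplus>\<^bsub>\<Omega>\<^esub> v \<odot>\<^bsub>\<Omega>\<^esub> du (br u w)) \<oplus>\<^bsub>\<Omega>\<^esub> (br u w \<odot>\<^bsub>\<Omega>\<^esub> du v \<oplus>\<^bsub>\<Omega>\<^esub> w \<odot>\<^bsub>\<Omega>\<^esub> du (br u v))"
      if "v \<in> A" "w \<in> A" for v w
      using that u by (simp add: br_mult_right du_simps \<Omega>.M.a_ac)
  qed (use u in \<open>simp_all add: kd.module_kaehler br_add_right br_mult_right br_const du_simps mult.commute\<close>)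

definition kaehler_lie :: "('a \<Rightarrow> real) \<Rightarrow> (('a \<Rightarrow> real) \<Rightarrow> 'a \<Rightarrow> real) set \<Rightarrow> (('a \<Rightarrow> real) \<Rightarrow> 'a \<Rightarrow> real) set" where
  "kaehler_lie u = (SOME L. (\<forall>x\<in>carrier \<Omega>. L x \<in> carrier \<Omega>) \<and>
    (\<forall>x\<in>carrier \<Omega>. \<forall>y\<in>carrier \<Omega>. L (x \<oplus>\<^bsub>\<Omega>\<^esub> y) = L x \<oplus>\<^bsub>\<Omega>\<^esub> L y) \<and>
    (\<forall>b\<in>A. \<forall>v\<in>A. L (b \<odot>\<^bsub>\<Omega>\<^esub> du v) = br u b \<odot>\<^bsub>\<Omega>\<^esub> du v \<oplus>\<^bsub>\<Omega>\<^esub> b \<odot>\<^bsub>\<Omega>\<^esub> du (br u v)))"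

lemma kaehler_lie:
  shows "u \<in> A \<Longrightarrow> x \<in> carrier \<Omega> \<Longrightarrow> kaehler_lie u x \<in> carrier \<Omega>"
    and "u \<in> A \<Longrightarrow> x \<in> carrier \<Omega> \<Longrightarrow> y \<in> carrier \<Omega> \<Longrightarrow>
      kaehler_lie u (x \<oplus>\<^bsub>\<Omega>\<^esub> y) = kaehler_lie u x \<oplus>\<^bsub>\<Omega>\<^esub> kaehler_lie u y"
    and "u \<in> A \<Longrightarrow> b \<in> A \<Longrightarrow> v \<in> A \<Longrightarrow>
      kaehler_lie u (b \<odot>\<^bsub>\<Omega>\<^esub> du v) = br u b \<odot>\<^bsub>\<Omega>\<^esub> du v \<oplus>\<^bsub>\<Omega>\<^esub> b \<odot>\<^bsub>\<Omega>\<^esub> du (br u v)"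
  using someI_ex[OF kaehler_lie_exists[of u]] unfolding kaehler_lie_def by blast+

text \<open>The derivation of \<open>A\<close> given by an element \<open>y\<close>, read off from the one-form \<open>q y\<close>.\<close>

definition symbol :: "(('a \<Rightarrow> real) \<Rightarrow> 'a \<Rightarrow> real) set \<Rightarrow> ('a \<Rightarrow> real) \<Rightarrow> 'a \<Rightarrow> real" where
  "symbol y a p = sharp_field (q y) p a"

lemma symbol_closed [simp, intro]: "y \<in> carrier \<Omega> \<Longrightarrow> a \<in> A \<Longrightarrow> symbol y a \<in> A"
  unfolding symbol_def[abs_def] by (rule vector_field_smooth[OF sharp_field_vector_field[OF q_closed]])

lemma symbol_tangent: "y \<in> carrier \<Omega> \<Longrightarrow> sharp_field (q y) p \<in> T p"
  by (rule sharp_field_tangent[OF q_closed])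

lemma symbol_simps:
  assumes "y \<in> carrier \<Omega>" "a \<in> A" "b \<in> A"
  shows "symbol y (\<lambda>p. a p + b p) = (\<lambda>p. symbol y a p + symbol y b p)"
    and "symbol y (\<lambda>p. a p * b p) = (\<lambda>p. a p * symbol y b p + b p * symbol y a p)"
  using assms by (simp_all add: symbol_def fun_eq_iff tangent_add[OF symbol_tangent] tangent_mult[OF symbol_tangent])

lemma symbol_add: "x \<in> carrier \<Omega> \<Longrightarrow> y \<in> carrier \<Omega> \<Longrightarrow> a \<in> A \<Longrightarrow> symbol (x \<oplus>\<^bsub>\<Omega>\<^esub> y) a = (\<lambda>p. symbol x a p + symbol y a p)"
  by (simp add: symbol_def fun_eq_iff q_add sharp_field_add del: one_form_module_simps)

lemma symbol_gen: "b \<in> A \<Longrightarrow> v \<in> A \<Longrightarrow> a \<in> A \<Longrightarrow> symbol (b \<odot>\<^bsub>\<Omega>\<^esub> du v) a = (\<lambda>p. b p * br v a p)"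
  by (simp add: symbol_def fun_eq_iff q_gen sharp_field_smult sharp_field_exact del: one_form_module_simps)

text \<open>
  For fixed \<open>y\<close>, the map \<open>u \<mapsto> L\<^sub>u y\<close> satisfies the Leibniz rule of a first-order operator with symbol
  \<open>a \<mapsto> - y(a)\<close>. Hence \<open>a du \<mapsto> - y(a) du + a L\<^sub>u y\<close> is well defined, and this is \<open>[a du, y]\<close>.
\<close>

lemma kaehler_lie_first_argument:
  assumes u: "u \<in> A" and w: "w \<in> A" and "y \<in> carrier \<Omega>"
  shows "kaehler_lie (\<lambda>p. u p + w p) y = kaehler_lie u y \<oplus>\<^bsub>\<Omega>\<^esub> kaehler_lie w y"
    and "kaehler_lie (\<lambda>p. c) y = \<zero>\<^bsub>\<Omega>\<^esub>"
    and "kaehler_lie (\<lambda>p. u p * w p) y =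
      ((\<lambda>p. - symbol y u p) \<odot>\<^bsub>\<Omega>\<^esub> du w \<oplus>\<^bsub>\<Omega>\<^esub> u \<odot>\<^bsub>\<Omega>\<^esub> kaehler_lie w y) \<oplus>\<^bsub>\<Omega>\<^esub>
      ((\<lambda>p. - symbol y w p) \<odot>\<^bsub>\<Omega>\<^esub> du u \<oplus>\<^bsub>\<Omega>\<^esub> w \<odot>\<^bsub>\<Omega>\<^esub> kaehler_lie u y)"
  using assms(3)
proof (induction y rule: kd.kaehler_induct)
  case (gen b v)
  {
    case 1
    show ?case using u w gen
      by (simp add: kaehler_lie br_add_left du_simps kaehler_smult_simps(1) \<Omega>.smult_r_distr \<Omega>.M.a_ac)
  next
    case 2
    show ?case using gen by (simp add: kaehler_lie br_const du_simps kaehler_smult_zero)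
  next
    case 3
    have sym: "(\<lambda>p. - symbol (b \<odot>\<^bsub>\<Omega>\<^esub> du v) h p) = (\<lambda>p. b p * br h v p)" if "h \<in> A" for h
      using that gen by (simp add: symbol_gen br_antisym[OF that gen(2)])
    show ?case using u w gen
      unfolding sym[OF u] sym[OF w]
      by (simp add: kaehler_lie br_mult_left du_simps kaehler_smult_simps \<Omega>.smult_r_distr
          smooth_mult mult_ac \<Omega>.M.a_ac)
  }
next
  case (add x y)
  note cl = u w add.hyps
  {
    case 1
    show ?case using cl add.IH(1,4) by (simp add: kaehler_lie \<Omega>.M.a_ac)
  next
    case 2
    show ?case using cl add.IH(2,5) by (simp add: kaehler_lie)
  next
    case 3
    have "(\<lambda>p. - symbol (x \<oplus>\<^bsub>\<Omega>\<^esub> y) h p) = (\<lambda>p. - symbol x h p + - symbol y h p)" if "h \<in> A" for h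
      using that add.hyps by (simp add: symbol_add)
    then show ?case using cl add.IH(3,6)
      by (simp only: kaehler_smult_simps(1) smooth_uminus symbol_closed kd.kaehler_d_closed)
        (simp add: kaehler_lie \<Omega>.smult_r_distr \<Omega>.M.a_ac smooth_mult)
  }
qed

text \<open>The operator \<open>x \<mapsto> [x, y]\<close>; the fixed second factor \<open>y\<close> comes first.\<close>

definition kaehler_bracket_with where
  "kaehler_bracket_with y = (SOME \<Psi>. (\<forall>x\<in>carrier \<Omega>. \<Psi> x \<in> carrier \<Omega>) \<and>
    (\<forall>x\<in>carrier \<Omega>. \<forall>z\<in>carrier \<Omega>. \<Psi> (x \<oplus>\<^bsub>\<Omega>\<^esub> z) = \<Psi> x \<oplus>\<^bsub>\<Omega>\<^esub> \<Psi> z) \<and>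
    (\<forall>a\<in>A. \<forall>u\<in>A. \<Psi> (a \<odot>\<^bsub>\<Omega>\<^esub> du u) = (\<lambda>p. - symbol y a p) \<odot>\<^bsub>\<Omega>\<^esub> du u \<oplus>\<^bsub>\<Omega>\<^esub> a \<odot>\<^bsub>\<Omega>\<^esub> kaehler_lie u y))"

lemma kaehler_bracket_with:
  assumes y: "y \<in> carrier \<Omega>"
  shows "x \<in> carrier \<Omega> \<Longrightarrow> kaehler_bracket_with y x \<in> carrier \<Omega>"
    and "x \<in> carrier \<Omega> \<Longrightarrow> z \<in> carrier \<Omega> \<Longrightarrow>
      kaehler_bracket_with y (x \<oplus>\<^bsub>\<Omega>\<^esub> z) = kaehler_bracket_with y x \<oplus>\<^bsub>\<Omega>\<^esub> kaehler_bracket_with y z"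
    and "a \<in> A \<Longrightarrow> u \<in> A \<Longrightarrow> kaehler_bracket_with y (a \<odot>\<^bsub>\<Omega>\<^esub> du u) =
      (\<lambda>p. - symbol y a p) \<odot>\<^bsub>\<Omega>\<^esub> du u \<oplus>\<^bsub>\<Omega>\<^esub> a \<odot>\<^bsub>\<Omega>\<^esub> kaehler_lie u y"
proof -
  have "\<exists>\<Psi>. (\<forall>x\<in>carrier \<Omega>. \<Psi> x \<in> carrier \<Omega>) \<and>
    (\<forall>x\<in>carrier \<Omega>. \<forall>z\<in>carrier \<Omega>. \<Psi> (x \<oplus>\<^bsub>\<Omega>\<^esub> z) = \<Psi> x \<oplus>\<^bsub>\<Omega>\<^esub> \<Psi> z) \<and>
    (\<forall>a\<in>A. \<forall>u\<in>A. \<Psi> (a \<odot>\<^bsub>\<Omega>\<^esub> du u) = (\<lambda>p. - symbol y a p) \<odot>\<^bsub>\<Omega>\<^esub> du u \<oplus>\<^bsub>\<Omega>\<^esub> a \<odot>\<^bsub>\<Omega>\<^esub> kaehler_lie u y)"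
    by (rule kd.kaehler_first_order_extension[of \<Omega> "\<lambda>a p. - symbol y a p" du "\<lambda>u. kaehler_lie u y"])
      (use y in \<open>simp_all add: kd.module_kaehler symbol_simps kaehler_lie du_simps
        kaehler_lie_first_argument(1,3) kaehler_lie_first_argument(2)[OF smooth_const smooth_const]\<close>)
  from someI_ex[OF this] show "x \<in> carrier \<Omega> \<Longrightarrow> kaehler_bracket_with y x \<in> carrier \<Omega>"
    and "x \<in> carrier \<Omega> \<Longrightarrow> z \<in> carrier \<Omega> \<Longrightarrow>
      kaehler_bracket_with y (x \<oplus>\<^bsub>\<Omega>\<^esub> z) = kaehler_bracket_with y x \<oplus>\<^bsub>\<Omega>\<^esub> kaehler_bracket_with y z"
    and "a \<in> A \<Longrightarrow> u \<in> A \<Longrightarrow> kaehler_bracket_with y (a \<odot>\<^bsub>\<Omega>\<^esub> du u) =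
      (\<lambda>p. - symbol y a p) \<odot>\<^bsub>\<Omega>\<^esub> du u \<oplus>\<^bsub>\<Omega>\<^esub> a \<odot>\<^bsub>\<Omega>\<^esub> kaehler_lie u y"
    unfolding kaehler_bracket_with_def by blast+
qed

lemma kaehler_bracket_with_add:
  assumes y: "y \<in> carrier \<Omega>" and z: "z \<in> carrier \<Omega>" and "x \<in> carrier \<Omega>"
  shows "kaehler_bracket_with (y \<oplus>\<^bsub>\<Omega>\<^esub> z) x = kaehler_bracket_with y x \<oplus>\<^bsub>\<Omega>\<^esub> kaehler_bracket_with z x"
  using assms(3)
proof (induction x rule: kd.kaehler_induct)
  case (gen a u)
  have "(\<lambda>p. - symbol (y \<oplus>\<^bsub>\<Omega>\<^esub> z) a p) = (\<lambda>p. - symbol y a p + - symbol z a p)"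
    using gen y z by (simp add: symbol_add)
  then show ?case
    using gen y z kaehler_smult_simps(1)[of "\<lambda>p. - symbol y a p" "\<lambda>p. - symbol z a p" "du u"]
    by (simp only: kaehler_bracket_with \<Omega>.M.add.m_closed)
      (simp add: kaehler_lie \<Omega>.smult_r_distr \<Omega>.M.a_ac)
next
  case (add x x')
  then show ?case using y z by (simp add: kaehler_bracket_with \<Omega>.M.a_ac)
qed

lemma kaehler_bracket_with_gen:
  assumes "a \<in> A" "u \<in> A" "c \<in> A" "v \<in> A"
  shows "kaehler_bracket_with (c \<odot>\<^bsub>\<Omega>\<^esub> du v) (a \<odot>\<^bsub>\<Omega>\<^esub> du u) =
    (\<lambda>p. a p * br u c p) \<odot>\<^bsub>\<Omega>\<^esub> du v \<oplus>\<^bsub>\<Omega>\<^esub> (\<lambda>p. c p * br a v p) \<odot>\<^bsub>\<Omega>\<^esub> du u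
    \<oplus>\<^bsub>\<Omega>\<^esub> (\<lambda>p. a p * c p) \<odot>\<^bsub>\<Omega>\<^esub> du (br u v)"
proof -
  have "(\<lambda>p. - symbol (c \<odot>\<^bsub>\<Omega>\<^esub> du v) a p) = (\<lambda>p. c p * br a v p)"
    using assms by (simp add: symbol_gen br_antisym[OF assms(1,4)])
  then show ?thesis
    using assms by (simp add: kaehler_bracket_with kaehler_lie \<Omega>.smult_r_distr kaehler_smult_simps(2)
        smooth_mult \<Omega>.M.a_ac)
qed

abbreviation "kbr \<equiv> kaehler_bracket (smooth_functions N) br"

lemma kaehler_bracket_eq:
  assumes "x \<in> carrier \<Omega>" "y \<in> carrier \<Omega>"
  shows "kbr x y = kaehler_bracket_with y x"
proof -
  let ?b = "\<lambda>x\<in>carrier \<Omega>. \<lambda>y\<in>carrier \<Omega>. kaehler_bracket_with y x"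
  have "kbr = ?b"
    unfolding kaehler_bracket_def Let_def
  proof (rule the_equality)
    show "?b \<in> carrier \<Omega> \<rightarrow>\<^sub>E (carrier \<Omega> \<rightarrow>\<^sub>E carrier \<Omega>) \<and>
       (\<forall>x\<in>carrier \<Omega>. \<forall>y\<in>carrier \<Omega>. \<forall>z\<in>carrier \<Omega>.
          ?b (x \<oplus>\<^bsub>\<Omega>\<^esub> y) z = ?b x z \<oplus>\<^bsub>\<Omega>\<^esub> ?b y z \<and> ?b z (x \<oplus>\<^bsub>\<Omega>\<^esub> y) = ?b z x \<oplus>\<^bsub>\<Omega>\<^esub> ?b z y) \<and>
       (\<forall>a\<in>A. \<forall>u\<in>A. \<forall>c\<in>A. \<forall>v\<in>A.
          ?b (a \<odot>\<^bsub>\<Omega>\<^esub> du u) (c \<odot>\<^bsub>\<Omega>\<^esub> du v) =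
            ((a \<otimes>\<^bsub>smooth_functions N\<^esub> br u c) \<odot>\<^bsub>\<Omega>\<^esub> du v) \<oplus>\<^bsub>\<Omega>\<^esub> ((c \<otimes>\<^bsub>smooth_functions N\<^esub> br a v) \<odot>\<^bsub>\<Omega>\<^esub> du u)
            \<oplus>\<^bsub>\<Omega>\<^esub> ((a \<otimes>\<^bsub>smooth_functions N\<^esub> c) \<odot>\<^bsub>\<Omega>\<^esub> du (br u v)))"
      using kaehler_bracket_with(1,2) kaehler_bracket_with_add kaehler_bracket_with_gen by auto
  next
    fix b
    assume b: "b \<in> carrier \<Omega> \<rightarrow>\<^sub>E (carrier \<Omega> \<rightarrow>\<^sub>E carrier \<Omega>) \<and>
       (\<forall>x\<in>carrier \<Omega>. \<forall>y\<in>carrier \<Omega>. \<forall>z\<in>carrier \<Omega>.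
          b (x \<oplus>\<^bsub>\<Omega>\<^esub> y) z = b x z \<oplus>\<^bsub>\<Omega>\<^esub> b y z \<and> b z (x \<oplus>\<^bsub>\<Omega>\<^esub> y) = b z x \<oplus>\<^bsub>\<Omega>\<^esub> b z y) \<and>
       (\<forall>a\<in>A. \<forall>u\<in>A. \<forall>c\<in>A. \<forall>v\<in>A.
          b (a \<odot>\<^bsub>\<Omega>\<^esub> du u) (c \<odot>\<^bsub>\<Omega>\<^esub> du v) =
            ((a \<otimes>\<^bsub>smooth_functions N\<^esub> br u c) \<odot>\<^bsub>\<Omega>\<^esub> du v) \<oplus>\<^bsub>\<Omega>\<^esub> ((c \<otimes>\<^bsub>smooth_functions N\<^esub> br a v) \<odot>\<^bsub>\<Omega>\<^esub> du u)
            \<oplus>\<^bsub>\<Omega>\<^esub> ((a \<otimes>\<^bsub>smooth_functions N\<^esub> c) \<odot>\<^bsub>\<Omega>\<^esub> du (br u v)))"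
    have gen: "b (a \<odot>\<^bsub>\<Omega>\<^esub> du u) y = kaehler_bracket_with y (a \<odot>\<^bsub>\<Omega>\<^esub> du u)"
      if "a \<in> A" "u \<in> A" "y \<in> carrier \<Omega>" for a u y
      using that(3)
    proof (induction y rule: kd.kaehler_induct)
      case (gen c v)
      then show ?case using b that by (simp add: kaehler_bracket_with_gen)
    next
      case (add y z)
      then show ?case using b that by (simp add: kaehler_bracket_with_add)
    qed
    have eq: "b x y = kaehler_bracket_with y x" if "x \<in> carrier \<Omega>" "y \<in> carrier \<Omega>" for x y
      using that(1)
    proof (induction x rule: kd.kaehler_induct)
      case (gen a u)
      then show ?case using \<open>\<And>y u a. a \<in> A \<Longrightarrow> u \<in> A \<Longrightarrow> y \<in> carrier \<Omega> \<Longrightarrow> b (a \<odot>\<^bsub>\<Omega>\<^esub> du u) y = kaehler_bracket_with y (a \<odot>\<^bsub>\<Omega>\<^esub> du u)\<close> that by blast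
    next
      case (add x z)
      then show ?case using b that by (simp add: kaehler_bracket_with)
    qed
    show "b = ?b"
      using b eq by (intro ext) (auto simp: restrict_def PiE_iff extensional_def)
  qed
  then show ?thesis using assms by simp
qed

lemma kaehler_bracket_closed: "x \<in> carrier \<Omega> \<Longrightarrow> y \<in> carrier \<Omega> \<Longrightarrow> kbr x y \<in> carrier \<Omega>"
  by (simp add: kaehler_bracket_eq kaehler_bracket_with)

lemma bracket_add_right:
  assumes "\<alpha> \<in> one_forms N" "\<beta> \<in> one_forms N" "\<gamma> \<in> one_forms N"
  shows "bracket \<gamma> (\<alpha> \<oplus>\<^bsub>D\<^esub> \<beta>) = bracket \<gamma> \<alpha> \<oplus>\<^bsub>D\<^esub> bracket \<gamma> \<beta>"
proof (rule one_form_eqI)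
  fix p v assume v: "v \<in> T p"
  have "bracket \<gamma> (\<alpha> \<oplus>\<^bsub>D\<^esub> \<beta>) p v = - (bracket \<alpha> \<gamma> \<oplus>\<^bsub>D\<^esub> bracket \<beta> \<gamma>) p v"
    unfolding bracket_antisym[OF assms(3) one_forms_add[OF assms(1,2)] v] bracket_add_left[OF assms] ..
  then show "bracket \<gamma> (\<alpha> \<oplus>\<^bsub>D\<^esub> \<beta>) p v = (bracket \<gamma> \<alpha> \<oplus>\<^bsub>D\<^esub> bracket \<gamma> \<beta>) p v"
    using v bracket_antisym[OF assms(3,1) v] bracket_antisym[OF assms(3,2) v] by simp
qed (use assms bracket_closed one_forms_add in blast)+

lemma bracket_gen:
  assumes "a \<in> A" "u \<in> A" "c \<in> A" "v \<in> A"
  shows "bracket (a \<odot>\<^bsub>D\<^esub> exterior_d N u) (c \<odot>\<^bsub>D\<^esub> exterior_d N v) =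
    (\<lambda>p. a p * br u c p) \<odot>\<^bsub>D\<^esub> exterior_d N v \<oplus>\<^bsub>D\<^esub> (\<lambda>p. c p * br a v p) \<odot>\<^bsub>D\<^esub> exterior_d N u
    \<oplus>\<^bsub>D\<^esub> (\<lambda>p. a p * c p) \<odot>\<^bsub>D\<^esub> exterior_d N (br u v)"
proof (rule one_form_eqI)
  let ?a = "a \<odot>\<^bsub>D\<^esub> exterior_d N u" and ?c = "c \<odot>\<^bsub>D\<^esub> exterior_d N v"
  have du: "exterior_d N u \<in> one_forms N" and dv: "exterior_d N v \<in> one_forms N"
    and a: "?a \<in> one_forms N" and c: "?c \<in> one_forms N"
    using assms by (auto intro: one_forms_smult simp del: one_form_module_simps)
  fix p w assume w: "w \<in> T p"
  have "bracket ?a ?c p w = c p * bracket ?a (exterior_d N v) p w + sharp_field ?a p c * w v"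
    unfolding bracket_smult_right[OF a dv assms(3)] using w by simp
  also have "sharp_field ?a p c = a p * br u c p"
    using assms by (simp add: sharp_field_smult sharp_field_exact del: one_form_module_simps)
  also have "bracket ?a (exterior_d N v) p w = - bracket (exterior_d N v) ?a p w"
    by (rule bracket_antisym[OF a dv w])
  also have "bracket (exterior_d N v) ?a p w = a p * w (br v u) + br v a p * w u"
    unfolding bracket_smult_right[OF dv du assms(1)] bracket_exact[OF assms(4,2)]
    using w assms by (simp add: sharp_field_exact)
  also have "w (br v u) = - w (br u v)"
    unfolding br_antisym[OF assms(4,2)] by (rule tangent_uminus[OF w br_closed[OF assms(2,4)]])
  also have "br v a p = - br a v p"
    unfolding br_antisym[OF assms(4,1)] ..
  finally have *: "bracket ?a ?c p w =
      c p * - (a p * - w (br u v) + - br a v p * w u) + a p * br u c p * w v" .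
  show "bracket ?a ?c p w = ((\<lambda>p. a p * br u c p) \<odot>\<^bsub>D\<^esub> exterior_d N v
      \<oplus>\<^bsub>D\<^esub> (\<lambda>p. c p * br a v p) \<odot>\<^bsub>D\<^esub> exterior_d N u \<oplus>\<^bsub>D\<^esub> (\<lambda>p. a p * c p) \<odot>\<^bsub>D\<^esub> exterior_d N (br u v)) p w"
    unfolding * using w by (simp add: algebra_simps)
qed (use assms in \<open>auto intro!: bracket_closed one_forms_smult one_forms_add simp del: one_form_module_simps\<close>)

text \<open>\<open>q\<close> is compatible with the brackets. Both sides are biadditive, so generators suffice.\<close>

lemma q_bracket:
  assumes "x \<in> carrier \<Omega>" "y \<in> carrier \<Omega>"
  shows "q (kbr x y) = bracket (q x) (q y)"
proof -
  have gen: "q (kaehler_bracket_with y (a \<odot>\<^bsub>\<Omega>\<^esub> du u)) = bracket (q (a \<odot>\<^bsub>\<Omega>\<^esub> du u)) (q y)"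
    if "a \<in> A" "u \<in> A" "y \<in> carrier \<Omega>" for a u y
    using that(3)
  proof (induction y rule: kd.kaehler_induct)
    case (gen c v)
    then show ?case
      using that by (simp add: kaehler_bracket_with_gen q_gen q_add smooth_mult bracket_gen del: one_form_module_simps)
  next
    case (add y z)
    then show ?case
      using that by (simp add: kaehler_bracket_with_add kaehler_bracket_with(1) q_add bracket_add_right
          del: one_form_module_simps)
  qed
  have "q (kaehler_bracket_with y x) = bracket (q x) (q y)"
    using assms(1)
  proof (induction x rule: kd.kaehler_induct)
    case (gen a u)
    with \<open>\<And>y u a. a \<in> A \<Longrightarrow> u \<in> A \<Longrightarrow> y \<in> carrier \<Omega> \<Longrightarrow> q (kaehler_bracket_with y (a \<odot>\<^bsub>\<Omega>\<^esub> du u)) = bracket (q (a \<odot>\<^bsub>\<Omega>\<^esub> du u)) (q y)\<close> assms(2)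
    show ?case by blast
  next
    case (add x z)
    then show ?case
      using assms(2) by (simp add: kaehler_bracket_with q_add bracket_add_left del: one_form_module_simps)
  qed
  then show ?thesis by (simp add: kaehler_bracket_eq assms)
qed

end

section \<open>Cartan calculus for alternating forms\<close>

definition sign :: "nat \<Rightarrow> 'm::ab_group_add \<Rightarrow> 'm" where
  "sign k m = (if even k then m else - m)"

lemma sign_simps [simp]: "sign 0 m = m" "sign (Suc k) m = - sign k m"
  by (simp_all add: sign_def)

lemma sign_add: "sign k (m + n) = sign k m + sign k n"
  by (simp add: sign_def)

lemma sign_uminus: "sign k (- m) = - sign k m"
  by (simp add: sign_def)

lemma sign_sign: "sign k (sign k m) = m"
  by (simp add: sign_def)

lemma omit_simps [simp]: "omit 0 (x # xs) = xs" "omit (Suc i) (x # xs) = x # omit i xs"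
  by (simp_all add: omit_def)

text \<open>The Chevalley-Eilenberg differential without its global sign, which would only obscure inductions.\<close>

definition ce_differential ::
  "('l \<Rightarrow> 'l \<Rightarrow> 'l) \<Rightarrow> ('l \<Rightarrow> 'm \<Rightarrow> 'm) \<Rightarrow> nat \<Rightarrow> ('l list \<Rightarrow> 'm) \<Rightarrow> 'l list \<Rightarrow> 'm::ab_group_add" where
  "ce_differential bk act n f xs = (\<Sum>i\<le>n. sign i (act (xs ! i) (f (omit i xs)))) +
     (\<Sum>k\<le>n. \<Sum>j<k. sign (j + k) (f (bk (xs ! j) (xs ! k) # omit j (omit k xs))))"

text \<open>
  Additive data common to one-forms and to functions acting through their differentials. The
  addition on \<open>C\<close> is a parameter because that of one-forms belongs to a record; the condition that \<open>zero\<close> is idempotent makes additive maps vanish there.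
\<close>

locale bracket_action =
  fixes C :: "'l set" and plus :: "'l \<Rightarrow> 'l \<Rightarrow> 'l" (infixl "\<boxplus>" 65) and zero :: 'l
    and bk :: "'l \<Rightarrow> 'l \<Rightarrow> 'l" and act :: "'l \<Rightarrow> 'm \<Rightarrow> 'm::ab_group_add" and V :: "'m::ab_group_add set"
  assumes plus_closed [simp]: "x \<in> C \<Longrightarrow> y \<in> C \<Longrightarrow> x \<boxplus> y \<in> C"
    and zero_closed [simp]: "zero \<in> C" and zero_plus: "zero \<boxplus> zero = zero"
    and bk_closed [simp]: "x \<in> C \<Longrightarrow> y \<in> C \<Longrightarrow> bk x y \<in> C"
    and bk_left: "x \<in> C \<Longrightarrow> y \<in> C \<Longrightarrow> z \<in> C \<Longrightarrow> bk (x \<boxplus> y) z = bk x z \<boxplus> bk y z"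
    and bk_right: "x \<in> C \<Longrightarrow> y \<in> C \<Longrightarrow> z \<in> C \<Longrightarrow> bk z (x \<boxplus> y) = bk z x \<boxplus> bk z y"
    and bk_self: "x \<in> C \<Longrightarrow> bk x x = zero"
    and V_zero [simp]: "0 \<in> V" and V_add [simp]: "m \<in> V \<Longrightarrow> n \<in> V \<Longrightarrow> m + n \<in> V"
    and V_uminus [simp]: "m \<in> V \<Longrightarrow> - m \<in> V"
    and act_closed [simp]: "x \<in> C \<Longrightarrow> m \<in> V \<Longrightarrow> act x m \<in> V"
    and act_add: "x \<in> C \<Longrightarrow> m \<in> V \<Longrightarrow> n \<in> V \<Longrightarrow> act x (m + n) = act x m + act x n"
    and act_plus: "x \<in> C \<Longrightarrow> y \<in> C \<Longrightarrow> m \<in> V \<Longrightarrow> act (x \<boxplus> y) m = act x m + act y m"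
begin

lemma V_diff [simp]: "m \<in> V \<Longrightarrow> n \<in> V \<Longrightarrow> m - n \<in> V"
  using V_add[of m "- n"] by simp

lemma V_sum: "(\<And>i. i \<in> I \<Longrightarrow> f i \<in> V) \<Longrightarrow> (\<Sum>i\<in>I. f i) \<in> V"
  by (induction I rule: infinite_finite_induct) auto

lemma V_sign [simp]: "m \<in> V \<Longrightarrow> sign k m \<in> V"
  by (simp add: sign_def)

lemma act_zero: "x \<in> C \<Longrightarrow> act x 0 = 0"
  using act_add[of x 0 0] by simp

lemma act_uminus: "x \<in> C \<Longrightarrow> m \<in> V \<Longrightarrow> act x (- m) = - act x m"
  using act_add[of x m "- m"] by (simp add: act_zero eq_neg_iff_add_eq_0 add.commute)

lemma act_diff: "x \<in> C \<Longrightarrow> m \<in> V \<Longrightarrow> n \<in> V \<Longrightarrow> act x (m - n) = act x m - act x n"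
  using act_add[of x m "- n"] by (simp add: act_uminus)

definition args :: "nat \<Rightarrow> 'l list set" where
  "args n = {xs. length xs = n \<and> set xs \<subseteq> C}"

lemma args_Nil [simp]: "[] \<in> args 0"
  by (simp add: args_def)

lemma args_Cons [simp]: "x # xs \<in> args (Suc n) \<longleftrightarrow> x \<in> C \<and> xs \<in> args n"
  by (auto simp: args_def)

lemma args_SucE: "xs \<in> args (Suc n) \<Longrightarrow> (\<And>x ys. xs = x # ys \<Longrightarrow> x \<in> C \<Longrightarrow> ys \<in> args n \<Longrightarrow> P) \<Longrightarrow> P"
  by (cases xs) (auto simp: args_def)

lemma args_0D: "xs \<in> args 0 \<Longrightarrow> xs = []"
  by (simp add: args_def)

lemma args_length: "xs \<in> args n \<Longrightarrow> length xs = n"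
  by (simp add: args_def)

lemma args_nth: "xs \<in> args n \<Longrightarrow> i < n \<Longrightarrow> xs ! i \<in> C"
  by (auto simp: args_def)

lemma args_update [simp]: "xs \<in> args n \<Longrightarrow> x \<in> C \<Longrightarrow> xs[i := x] \<in> args n"
  using set_update_subset_insert[of xs i x] by (auto simp: args_def)

lemma args_omit: "xs \<in> args (Suc n) \<Longrightarrow> i \<le> n \<Longrightarrow> omit i xs \<in> args n"
  by (auto simp: args_def omit_def dest: in_set_takeD in_set_dropD)

lemma args_bracket: "xs \<in> args (Suc n) \<Longrightarrow> j < k \<Longrightarrow> k \<le> n \<Longrightarrow> bk (xs ! j) (xs ! k) # omit j (omit k xs) \<in> args n"
proof -
  assume a: "xs \<in> args (Suc n)" "j < k" "k \<le> n"
  then obtain m where m: "n = Suc m" by (cases n) auto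
  have "omit k xs \<in> args (Suc m)" using args_omit[OF a(1,3)] m by simp
  then have "omit j (omit k xs) \<in> args m" using args_omit[of _ m j] a m by simp
  then show ?thesis using a m args_nth[OF a(1)] by simp
qed

text \<open>Additivity suffices for the calculus up to \<open>d\<^sup>2 = 0\<close>; linearity over functions is a separate predicate.\<close>

definition alternating :: "nat \<Rightarrow> ('l list \<Rightarrow> 'm) \<Rightarrow> bool" where
  "alternating n f \<longleftrightarrow> (\<forall>xs\<in>args n. f xs \<in> V) \<and>
     (\<forall>xs\<in>args n. \<forall>i<n. \<forall>x\<in>C. \<forall>y\<in>C. f (xs[i := x \<boxplus> y]) = f (xs[i := x]) + f (xs[i := y])) \<and>
     (\<forall>xs\<in>args n. \<forall>i<n. \<forall>j<n. i \<noteq> j \<and> xs ! i = xs ! j \<longrightarrow> f xs = 0)"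

lemma alternating_closed: "alternating n f \<Longrightarrow> xs \<in> args n \<Longrightarrow> f xs \<in> V"
  by (simp add: alternating_def)

lemma alternating_add: "alternating n f \<Longrightarrow> xs \<in> args n \<Longrightarrow> i < n \<Longrightarrow> x \<in> C \<Longrightarrow> y \<in> C \<Longrightarrow>
    f (xs[i := x \<boxplus> y]) = f (xs[i := x]) + f (xs[i := y])"
  by (simp add: alternating_def)

lemma alternating_eq: "alternating n f \<Longrightarrow> xs \<in> args n \<Longrightarrow> i < n \<Longrightarrow> j < n \<Longrightarrow> i \<noteq> j \<Longrightarrow> xs ! i = xs ! j \<Longrightarrow> f xs = 0"
  unfolding alternating_def by blast

lemma alternating_cong:
  assumes "alternating n f" "\<And>xs. xs \<in> args n \<Longrightarrow> f xs = g xs"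
  shows "alternating n g"
  using assms by (simp add: alternating_def)

lemma alternating_diff:
  "alternating n f \<Longrightarrow> alternating n g \<Longrightarrow> alternating n (\<lambda>xs. f xs - g xs)"
  unfolding alternating_def by (auto simp: algebra_simps)

lemma alternating_zero: "alternating n f \<Longrightarrow> xs \<in> args n \<Longrightarrow> i < n \<Longrightarrow> f (xs[i := zero]) = 0"
  using alternating_add[of n f xs i zero zero] by (simp add: zero_plus)

lemma alternating_swap:
  assumes f: "alternating n f" and xs: "xs \<in> args n" and ij: "i < n" "j < n" "i \<noteq> j" and ab: "a \<in> C" "b \<in> C"
  shows "f (xs[i := a, j := b]) = - f (xs[i := b, j := a])"
proof -
  let ?g = "\<lambda>x y. f (xs[i := x, j := y])"
  have right: "?g x (a \<boxplus> b) = ?g x a + ?g x b" if "x \<in> C" for x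
    using alternating_add[OF f _ ij(2) ab, of "xs[i := x]"] xs that by simp
  have left: "?g (a \<boxplus> b) y = ?g a y + ?g b y" if "y \<in> C" for y
    using alternating_add[OF f _ ij(1) ab, of "xs[j := y]"] xs that by (simp add: list_update_swap[OF ij(3)])
  have self: "?g x x = 0" if "x \<in> C" for x
    using alternating_eq[OF f _ ij, of "xs[i := x, j := x]"] xs that ij by (simp add: args_length[OF xs])
  have "0 = ?g a b + ?g b a"
    using self[of "a \<boxplus> b"] left[of "a \<boxplus> b"] right[of a] right[of b] self[of a] self[of b] ab by simp
  then show ?thesis by (simp add: eq_neg_iff_add_eq_0)
qed

lemma alternating_swap_adjacent:
  assumes f: "alternating n f" and xs: "pre @ a # b # post \<in> args n"
  shows "f (pre @ a # b # post) = - f (pre @ b # a # post)"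
proof -
  let ?i = "length pre"
  have "(pre @ a # b # post)[?i := x, Suc ?i := y] = pre @ x # y # post" for x y
    by (simp add: list_update_append)
  moreover have "?i < n" "Suc ?i < n" "a \<in> C" "b \<in> C"
    using xs by (auto simp: args_def)
  ultimately show ?thesis
    using alternating_swap[OF f xs, of ?i "Suc ?i" a b] by simp
qed

lemma alternating_move:
  assumes f: "alternating n f" and "pre @ z # us @ post \<in> args n"
  shows "f (pre @ z # us @ post) = sign (length us) (f (pre @ us @ z # post))"
  using assms(2)
proof (induction us arbitrary: pre)
  case (Cons u us)
  have "f (pre @ z # (u # us) @ post) = - f (pre @ u # z # us @ post)"
    using alternating_swap_adjacent[OF f, of pre z u "us @ post"] Cons.prems by simp
  also have "f (pre @ u # z # us @ post) = sign (length us) (f (pre @ u # us @ z # post))"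
    using Cons.IH[of "pre @ [u]"] Cons.prems by (auto simp: args_def)
  finally show ?case by simp
qed simp

text \<open>Moving an argument to the front past \<open>k\<close> others costs the sign \<open>(-1)\<^sup>k\<close>.\<close>

lemma alternating_front:
  assumes f: "alternating n f" and ys: "ys \<in> args n" and k: "k < n" and z: "z \<in> C"
  shows "sign k (f (z # omit k ys)) = f (ys[k := z])"
proof -
  have len: "k < length ys" using ys k by (simp add: args_length)
  have eq: "ys[k := z] = take k ys @ z # drop (Suc k) ys"
    using len by (rule upd_conv_take_nth_drop)
  have "z # omit k ys \<in> args n"
    using ys k z by (auto simp: args_def omit_def dest: in_set_takeD in_set_dropD)
  then have "f (z # omit k ys) = sign k (f (ys[k := z]))"
    using alternating_move[OF f, of "[]" z "take k ys" "drop (Suc k) ys"] len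
    by (simp add: omit_def eq)
  then show ?thesis by (simp add: sign_sign)
qed

lemma alternating_bk_antisym:
  assumes f: "alternating n f" and xs: "xs \<in> args n" and i: "i < n" and xy: "x \<in> C" "y \<in> C"
  shows "f (xs[i := bk x y]) = - f (xs[i := bk y x])"
proof -
  note z = alternating_zero[OF f xs i]
  have "0 = f (xs[i := bk (x \<boxplus> y) (x \<boxplus> y)])" using xy z by (simp add: bk_self)
  also have "\<dots> = f (xs[i := (bk x x \<boxplus> bk y x) \<boxplus> (bk x y \<boxplus> bk y y)])"
    using xy by (simp add: bk_left bk_right)
  also have "\<dots> = f (xs[i := bk x y]) + f (xs[i := bk y x])"
    using xy z by (simp add: alternating_add[OF f xs i] bk_self)
  finally show ?thesis by (simp add: eq_neg_iff_add_eq_0)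
qed

lemma alternating_Cons: 
  assumes f: "alternating (Suc n) f" and x: "x \<in> C"
  shows "alternating n (\<lambda>xs. f (x # xs))"
proof -
  have "f (x # xs) = 0" if "xs \<in> args n" "i < n" "j < n" "i \<noteq> j" "xs ! i = xs ! j" for xs i j
    using alternating_eq[OF f, of "x # xs" "Suc i" "Suc j"] that x by simp
  moreover have "f (x # xs[i := a \<boxplus> b]) = f (x # xs[i := a]) + f (x # xs[i := b])"
    if "xs \<in> args n" "i < n" "a \<in> C" "b \<in> C" for xs i a b
    using alternating_add[OF f, of "x # xs" "Suc i" a b] that x by simp
  moreover have "f (x # xs) \<in> V" if "xs \<in> args n" for xs
    using alternating_closed[OF f] that x by simp
  ultimately show ?thesis unfolding alternating_def by blast
qed

text \<open>
  Given that \<open>f\<close> is alternating in the remaining arguments, an argument equal to the first one can be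
  swapped into the second place, so only equality of the first two needs checking.
\<close>

lemma alternating_ConsI:
  assumes tail: "\<And>x. x \<in> C \<Longrightarrow> alternating n (\<lambda>xs. f (x # xs))"
    and head: "\<And>x y xs. x \<in> C \<Longrightarrow> y \<in> C \<Longrightarrow> xs \<in> args n \<Longrightarrow> f ((x \<boxplus> y) # xs) = f (x # xs) + f (y # xs)"
    and adj: "\<And>x xs. x \<in> C \<Longrightarrow> x # xs \<in> args n \<Longrightarrow> f (x # x # xs) = 0"
  shows "alternating (Suc n) f"
proof -
  have first: "f (x # ys) = 0" if x: "x \<in> C" and ys: "ys \<in> args n" and j: "j < n" "ys ! j = x" for x ys j
  proof -
    have len: "length ys = n" using ys by (rule args_length)
    then obtain y zs where yzs: "ys = y # zs" using j by (cases ys) auto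
    show ?thesis
    proof (cases j)
      case 0
      then show ?thesis using adj[OF x] ys j yzs by simp
    next
      case (Suc k)
      have y: "y \<in> C" using ys yzs len by (auto simp: args_def)
      have "ys[0 := y, j := x] = ys" using yzs j Suc by auto
      moreover have "f (x # ys[0 := y, j := x]) = - f (x # ys[0 := x, j := y])"
        by (rule alternating_swap[OF tail[OF x] ys]) (use j Suc x y in auto)
      moreover have "f (x # ys[0 := x, j := y]) = 0"
      proof -
        have "ys[0 := x, j := y] \<in> args n" using ys x y by simp
        moreover have "ys[0 := x, j := y] = x # zs[k := y]" using yzs Suc by simp
        ultimately show ?thesis using adj[OF x] by simp
      qed
      ultimately show ?thesis by simp
    qed
  qed
  have "f xs = 0" if xs: "xs \<in> args (Suc n)" and ij: "i < Suc n" "j < Suc n" "i \<noteq> j" "xs ! i = xs ! j" for xs i j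
  proof -
    obtain x ys where e: "xs = x # ys" "x \<in> C" "ys \<in> args n" using xs by (rule args_SucE)
    show ?thesis
    proof (cases i)
      case 0
      then obtain j' where "j = Suc j'" using ij by (cases j) auto
      then show ?thesis using first[OF e(2,3), of j'] ij e 0 by simp
    next
      case (Suc i')
      show ?thesis
      proof (cases j)
        case 0
        then show ?thesis using first[OF e(2,3), of i'] ij e Suc by simp
      next
        case (Suc j')
        then show ?thesis using alternating_eq[OF tail[OF e(2)] e(3), of i' j'] ij e \<open>i = Suc i'\<close> by simp
      qed
    qed
  qed
  moreover have "f (xs[i := a \<boxplus> b]) = f (xs[i := a]) + f (xs[i := b])"
    if xs: "xs \<in> args (Suc n)" and "i < Suc n" "a \<in> C" "b \<in> C" for xs i a b
  proof -
    obtain x ys where "xs = x # ys" "x \<in> C" "ys \<in> args n" using xs by (rule args_SucE)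
    then show ?thesis
      using that head alternating_add[OF tail[of x]] by (cases i) auto
  qed
  moreover have "f xs \<in> V" if xs: "xs \<in> args (Suc n)" for xs
    using xs alternating_closed[OF tail] by (auto elim!: args_SucE)
  ultimately show ?thesis unfolding alternating_def by blast
qed

abbreviation "differential \<equiv> ce_differential bk act"

definition lie :: "'l \<Rightarrow> ('l list \<Rightarrow> 'm) \<Rightarrow> 'l list \<Rightarrow> 'm" where
  "lie x f xs = act x (f xs) - (\<Sum>k<length xs. f (xs[k := bk x (xs ! k)]))"

lemma lie_Nil [simp]: "lie x f [] = act x (f [])"
  by (simp add: lie_def)

lemma lie_Cons: "lie x f (y # zs) = lie x (\<lambda>zs. f (y # zs)) zs - f (bk x y # zs)"
  by (simp add: lie_def sum.lessThan_Suc_shift del: sum.lessThan_Suc)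

lemma lie_cong:
  assumes "xs \<in> args n" "x \<in> C" "\<And>xs. xs \<in> args n \<Longrightarrow> f xs = g xs"
  shows "lie x f xs = lie x g xs"
  using assms by (auto simp: lie_def args_length args_nth intro!: sum.cong)

lemma lie_diff:
  assumes "xs \<in> args n" "x \<in> C" "\<And>xs. xs \<in> args n \<Longrightarrow> f xs \<in> V" "\<And>xs. xs \<in> args n \<Longrightarrow> g xs \<in> V"
  shows "lie x (\<lambda>xs. f xs - g xs) xs = lie x f xs - lie x g xs"
  using assms by (simp add: lie_def act_diff sum_subtractf)

lemma lie_closed: "alternating n f \<Longrightarrow> x \<in> C \<Longrightarrow> xs \<in> args n \<Longrightarrow> lie x f xs \<in> V"
  unfolding lie_def by (intro V_diff act_closed V_sum alternating_closed args_update bk_closed)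
    (auto simp: args_length args_nth)

text \<open>
  If arguments \<open>i\<close> and \<open>j\<close> agree, all terms of the sum vanish except the two in which one of them is
  replaced; these are interchanged by a swap and cancel.
\<close>

lemma alternating_lie:
  assumes f: "alternating n f" and x: "x \<in> C"
  shows "alternating n (lie x f)"
proof -
  have add: "lie x f (xs[i := a \<boxplus> b]) = lie x f (xs[i := a]) + lie x f (xs[i := b])"
    if xs: "xs \<in> args n" and i: "i < n" and ab: "a \<in> C" "b \<in> C" for xs i a b
  proof -
    have len: "length xs = n" using xs by (rule args_length)
    have "f (xs[i := a \<boxplus> b, k := bk x (xs[i := a \<boxplus> b] ! k)]) =
        f (xs[i := a, k := bk x (xs[i := a] ! k)]) + f (xs[i := b, k := bk x (xs[i := b] ! k)])"
      if k: "k < n" for k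
    proof (cases "k = i")
      case True
      then show ?thesis using len i xs ab x by (simp add: bk_right alternating_add[OF f xs i])
    next
      case False
      have "xs[k := bk x (xs ! k)] \<in> args n" using xs x args_nth[OF xs k] by simp
      then show ?thesis
        using False alternating_add[OF f _ i ab, of "xs[k := bk x (xs ! k)]"]
        by (simp add: list_update_swap[of i k])
    qed
    then show ?thesis
      using xs ab x alternating_closed[OF f]
      by (simp add: lie_def len alternating_add[OF f xs i] act_add sum.distrib)
  qed
  have eq: "lie x f xs = 0" if xs: "xs \<in> args n" and ij: "i < n" "j < n" "i \<noteq> j" "xs ! i = xs ! j" for xs i j
  proof -
    have len: "length xs = n" using xs by (rule args_length)
    let ?t = "\<lambda>k. f (xs[k := bk x (xs ! k)])"
    have "?t k = 0" if k: "k < n" "k \<notin> {i, j}" for k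
      by (rule alternating_eq[OF f _ ij(1,2,3)]) (use xs x k ij args_nth[OF xs k(1)] in auto)
    then have "(\<Sum>k<n. ?t k) = (\<Sum>k\<in>{i, j}. ?t k)"
      by (intro sum.mono_neutral_right) (use ij in auto)
    also have "\<dots> = ?t i + ?t j" using ij by simp
    also have "?t i = f (xs[i := bk x (xs ! i), j := xs ! i])" 
      using list_update_id[of "xs[i := bk x (xs ! i)]" j] ij by simp
    also have "\<dots> = - f (xs[i := xs ! i, j := bk x (xs ! i)])"
      by (rule alternating_swap[OF f xs ij(1,2,3)]) (use x args_nth[OF xs ij(1)] in auto)
    also have "\<dots> = - ?t j" unfolding list_update_id unfolding ij(4) ..
    finally have "(\<Sum>k<n. ?t k) = 0" by simp
    moreover have "f xs = 0" by (rule alternating_eq[OF f xs ij])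
    ultimately show ?thesis using x by (simp add: lie_def len act_zero)
  qed
  show ?thesis
    unfolding alternating_def using add eq lie_closed[OF f x] by blast
qed

text \<open>
  Cartan's formula \<open>\<iota>\<^sub>x d = L\<^sub>x - d \<iota>\<^sub>x\<close>, as a recursion for the differential on the number of
  arguments. Linearity over functions, commutation with Lie derivatives and \<open>d\<^sup>2 = 0\<close> follow from it by
  induction.
\<close>

lemma differential_Cons:
  assumes f: "alternating (Suc n) f" and x: "x \<in> C" and ys: "ys \<in> args (Suc n)"
  shows "differential (Suc n) f (x # ys) = lie x f ys - differential n (\<lambda>zs. f (x # zs)) ys"
proof -
  let ?S = "\<lambda>F. \<Sum>k\<le>n. \<Sum>j<k. F j k"
  have 1: "(\<Sum>i\<le>Suc n. sign i (act ((x # ys) ! i) (f (omit i (x # ys))))) =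
      act x (f ys) - (\<Sum>i\<le>n. sign i (act (ys ! i) (f (x # omit i ys))))"
    by (simp add: sum.atMost_Suc_shift sum_negf del: sum.atMost_Suc)
  let ?t = "\<lambda>j k. sign (j + k) (f (bk ((x # ys) ! j) ((x # ys) ! k) # omit j (omit k (x # ys))))"
  have t0: "?t 0 (Suc k) = - f (ys[k := bk x (ys ! k)])" if "k \<le> n" for k
    using alternating_front[OF f ys, of k "bk x (ys ! k)"] that x args_nth[OF ys, of k] by simp
  have tS: "?t (Suc j) (Suc k) = - sign (j + k) (f (x # bk (ys ! j) (ys ! k) # omit j (omit k ys)))"
    if "k \<le> n" "j < k" for j k
  proof -
    have "bk (ys ! j) (ys ! k) # x # omit j (omit k ys) \<in> args (Suc n)"
      using args_bracket[OF ys that(2,1)] x that by (cases n) auto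
    then show ?thesis
      using alternating_swap_adjacent[OF f, of "[]" "bk (ys ! j) (ys ! k)" x "omit j (omit k ys)"]
      by (simp add: sign_uminus)
  qed
  have "(\<Sum>k\<le>Suc n. \<Sum>j<k. ?t j k) = (\<Sum>k\<le>n. \<Sum>j<Suc k. ?t j (Suc k))"
    by (subst sum.atMost_Suc_shift) simp
  also have "\<dots> = (\<Sum>k\<le>n. ?t 0 (Suc k) + (\<Sum>j<k. ?t (Suc j) (Suc k)))"
    by (simp only: sum.lessThan_Suc_shift)
  also have "\<dots> = (\<Sum>k\<le>n. - f (ys[k := bk x (ys ! k)]) +
      (\<Sum>j<k. - sign (j + k) (f (x # bk (ys ! j) (ys ! k) # omit j (omit k ys)))))"
    by (intro sum.cong refl arg_cong2[where f="(+)"] t0 tS) auto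
  also have "\<dots> = - (\<Sum>k\<le>n. f (ys[k := bk x (ys ! k)])) -
      ?S (\<lambda>j k. sign (j + k) (f (x # bk (ys ! j) (ys ! k) # omit j (omit k ys))))"
    by (simp add: sum.distrib sum_negf sum_subtractf)
  finally show ?thesis
    unfolding ce_differential_def 1 lie_def args_length[OF ys] lessThan_Suc_atMost by simp
qed

lemma differential_0: "differential 0 f [x] = act x (f [])"
  by (simp add: ce_differential_def)

lemma differential_cong:
  assumes "xs \<in> args (Suc n)" "\<And>xs. xs \<in> args n \<Longrightarrow> f xs = g xs"
  shows "differential n f xs = differential n g xs"
  unfolding ce_differential_def using assms args_omit[OF assms(1)] args_bracket[OF assms(1)]
  by (intro arg_cong2[where f="(+)"] sum.cong refl) auto

lemma differential_add:
  assumes "xs \<in> args (Suc n)" "\<And>xs. xs \<in> args n \<Longrightarrow> f xs \<in> V" "\<And>xs. xs \<in> args n \<Longrightarrow> g xs \<in> V"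
  shows "differential n (\<lambda>xs. f xs + g xs) xs = differential n f xs + differential n g xs"
proof -
  have "act (xs ! i) (f (omit i xs) + g (omit i xs)) = act (xs ! i) (f (omit i xs)) + act (xs ! i) (g (omit i xs))"
    if "i \<le> n" for i
    using that assms(2,3) args_omit[OF assms(1)] args_nth[OF assms(1)] by (intro act_add) auto
  then show ?thesis by (simp add: ce_differential_def sign_add sum.distrib)
qed

lemma differential_diff:
  assumes "xs \<in> args (Suc n)" "\<And>xs. xs \<in> args n \<Longrightarrow> f xs \<in> V" "\<And>xs. xs \<in> args n \<Longrightarrow> g xs \<in> V"
  shows "differential n (\<lambda>xs. f xs - g xs) xs = differential n f xs - differential n g xs"
  using differential_add[OF assms(1), of "\<lambda>xs. f xs - g xs" g] assms by simp

lemma differential_zero: "xs \<in> args (Suc n) \<Longrightarrow> differential n (\<lambda>_. 0) xs = 0"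
  using differential_add[of xs n "\<lambda>_. 0" "\<lambda>_. 0"] by simp

theorem alternating_differential: "alternating n f \<Longrightarrow> alternating (Suc n) (differential n f)"
proof (induction n arbitrary: f)
  case 0
  have f: "f [] \<in> V" using alternating_closed[OF 0] by simp
  show ?case
  proof (rule alternating_ConsI)
    show "alternating 0 (\<lambda>xs. differential 0 f (x # xs))" if "x \<in> C" for x
      using f that by (auto simp: alternating_def dest!: args_0D simp: differential_0)
    show "differential 0 f ((x \<boxplus> y) # xs) = differential 0 f (x # xs) + differential 0 f (y # xs)"
      if "x \<in> C" "y \<in> C" "xs \<in> args 0" for x y xs
      using that f by (auto dest!: args_0D simp: differential_0 act_plus)
  qed (auto dest: args_0D)
next
  case (Suc n)
  note f = Suc.prems
  note ix = alternating_Cons[OF f]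
  show ?case
  proof (rule alternating_ConsI)
    fix x assume x: "x \<in> C"
    show "alternating (Suc n) (\<lambda>ys. differential (Suc n) f (x # ys))"
      by (rule alternating_cong[OF alternating_diff[OF alternating_lie[OF f x] Suc.IH[OF ix[OF x]]]])
        (simp add: differential_Cons[OF f x])
    fix xs assume "x # xs \<in> args (Suc n)"
    then have xs: "xs \<in> args n" by simp
    have lz: "f (bk x x # xs) = 0"
      using alternating_zero[OF f, of "x # xs" 0] x xs by (simp add: bk_self)
    have xx: "f (x # x # zs) = 0" if "Suc m = n" "zs \<in> args m" for zs m
      using alternating_eq[OF f, of "x # x # zs" 0 1] x that by auto
    have "differential n (\<lambda>zs. f (x # zs)) (x # xs) = lie x (\<lambda>zs. f (x # zs)) xs"
    proof (cases n)
      case 0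
      then show ?thesis using xs by (auto dest!: args_0D simp: differential_0)
    next
      case (Suc m)
      have "differential m (\<lambda>zs. f (x # x # zs)) xs = 0"
        using differential_cong[of xs m "\<lambda>zs. f (x # x # zs)" "\<lambda>_. 0"] differential_zero[of xs m] xs xx Suc by simp
      then show ?thesis
        using differential_Cons[of m "\<lambda>zs. f (x # zs)" x xs] ix[OF x] x xs Suc by simp
    qed
    then show "differential (Suc n) f (x # x # xs) = 0"
      using differential_Cons[OF f x, of "x # xs"] x xs lz by (simp add: lie_Cons)
  next
    fix x y xs assume x: "x \<in> C" and y: "y \<in> C" and xs: "xs \<in> args (Suc n)"
    have fxy: "f ((x \<boxplus> y) # zs) = f (x # zs) + f (y # zs)" if "zs \<in> args n" for zs
      using alternating_add[OF f, of "x # zs" 0 x y] x y that by simp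
    have "differential n (\<lambda>zs. f ((x \<boxplus> y) # zs)) xs =
        differential n (\<lambda>zs. f (x # zs)) xs + differential n (\<lambda>zs. f (y # zs)) xs"
      using differential_cong[OF xs fxy] differential_add[OF xs alternating_closed[OF ix[OF x]] alternating_closed[OF ix[OF y]]]
      by simp
    moreover have "f (xs[k := bk (x \<boxplus> y) (xs ! k)]) = f (xs[k := bk x (xs ! k)]) + f (xs[k := bk y (xs ! k)])"
      if "k < Suc n" for k
      using that x y args_nth[OF xs that] by (simp add: bk_left alternating_add[OF f xs])
    then have "lie (x \<boxplus> y) f xs = lie x f xs + lie y f xs"
      using x y xs alternating_closed[OF f xs] by (simp add: lie_def args_length act_plus sum.distrib)
    ultimately show "differential (Suc n) f ((x \<boxplus> y) # xs) = differential (Suc n) f (x # xs) + differential (Suc n) f (y # xs)"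
      using x y xs by (simp add: differential_Cons[OF f])
  qed
qed

end

locale flat_action = bracket_action +
  assumes jacobi: "x \<in> C \<Longrightarrow> y \<in> C \<Longrightarrow> z \<in> C \<Longrightarrow> bk x (bk y z) = bk (bk x y) z \<boxplus> bk y (bk x z)"
    and flat: "x \<in> C \<Longrightarrow> y \<in> C \<Longrightarrow> m \<in> V \<Longrightarrow> act (bk x y) m = act x (act y m) - act y (act x m)"
begin

text \<open>\<open>L\<^bsub>[x, y]\<^esub> = [L\<^sub>x, L\<^sub>y]\<close>: flatness in degree zero, the Jacobi identity for each argument.\<close>

lemma lie_lie:
  assumes "alternating n f" "x \<in> C" "y \<in> C" "zs \<in> args n"
  shows "lie (bk x y) f zs = lie x (lie y f) zs - lie y (lie x f) zs"
  using assms(1,4)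
proof (induction n arbitrary: f zs)
  case 0
  then show ?case using assms(2,3) alternating_closed[OF 0(1)] by (auto dest!: args_0D simp: flat)
next
  case (Suc n)
  note xy = assms(2,3) and f = Suc.prems(1)
  obtain z ws where zs: "zs = z # ws" "z \<in> C" "ws \<in> args n" using Suc.prems(2) by (rule args_SucE)
  have A: "alternating n (\<lambda>ws. f (a # ws))" if "a \<in> C" for a using alternating_Cons[OF f that] .
  have step: "lie a (lie b f) zs = lie a (lie b (\<lambda>ws. f (z # ws))) ws - lie a (\<lambda>ws. f (bk b z # ws)) ws
      - lie b (\<lambda>ws. f (bk a z # ws)) ws + f (bk b (bk a z) # ws)" if a: "a \<in> C" and b: "b \<in> C" for a b
  proof -
    have "lie a (\<lambda>ws. lie b f (z # ws)) ws = lie a (\<lambda>ws. lie b (\<lambda>ws. f (z # ws)) ws - f (bk b z # ws)) ws"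
      by (simp add: lie_Cons)
    also have "\<dots> = lie a (lie b (\<lambda>ws. f (z # ws))) ws - lie a (\<lambda>ws. f (bk b z # ws)) ws"
      using lie_diff[OF zs(3) a, of "lie b (\<lambda>ws. f (z # ws))" "\<lambda>ws. f (bk b z # ws)"]
        lie_closed[OF A[OF zs(2)] b] alternating_closed[OF A[of "bk b z"]] b zs(2) by simp
    finally show ?thesis unfolding zs(1) lie_Cons[of a "lie b f"] lie_Cons[of b f "bk a z"] by simp
  qed
  have "f (bk x (bk y z) # ws) = f (bk (bk x y) z # ws) + f (bk y (bk x z) # ws)"
    unfolding jacobi[OF xy zs(2)]
    using alternating_add[OF f, of "z # ws" 0 "bk (bk x y) z" "bk y (bk x z)"] zs xy by simp
  then show ?case
    using step[OF xy] step[OF xy(2,1)] Suc.IH[OF A[OF zs(2)] zs(3)] zs(1) by (simp add: lie_Cons[of "bk x y"])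
qed

text \<open>
  By Cartan's formula, commuting \<open>L\<^sub>x\<close> with \<open>d\<close> after inserting \<open>y\<close> reduces to \<open>L\<^bsub>[x, y]\<^esub> = [L\<^sub>x, L\<^sub>y]\<close> and to
  the form \<open>\<iota>\<^sub>y f\<close> of lower degree.
\<close>

lemma lie_differential:
  assumes "alternating n f" "x \<in> C" "ys \<in> args (Suc n)"
  shows "lie x (differential n f) ys = differential n (lie x f) ys"
  using assms(1,3)
proof (induction n arbitrary: f ys)
  case 0
  obtain y where "ys = [y]" "y \<in> C" using 0(2) by (auto elim!: args_SucE dest: args_0D)
  then show ?case
    using assms(2) alternating_closed[OF 0(1)] by (simp add: lie_Cons differential_0 flat)
next
  case (Suc n)
  note x = assms(2) and f = Suc.prems(1)
  obtain y zs where ys: "ys = y # zs" "y \<in> C" "zs \<in> args (Suc n)" using Suc.prems(2) by (rule args_SucE)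
  have A: "alternating n (\<lambda>zs. f (a # zs))" if "a \<in> C" for a using alternating_Cons[OF f that] .
  have xy: "bk x y \<in> C" using x ys by simp
  have dV: "differential n (\<lambda>zs. f (a # zs)) zs \<in> V" if "a \<in> C" "zs \<in> args (Suc n)" for a zs
    using alternating_closed[OF alternating_differential[OF A[OF that(1)]] that(2)] .
  have "lie x (\<lambda>zs. differential (Suc n) f (y # zs)) zs = lie x (\<lambda>zs. lie y f zs - differential n (\<lambda>zs. f (y # zs)) zs) zs"
    by (rule lie_cong[OF ys(3) x]) (rule differential_Cons[OF f ys(2)])
  also have "\<dots> = lie x (lie y f) zs - lie x (differential n (\<lambda>zs. f (y # zs))) zs"
    using lie_diff[OF ys(3) x lie_closed[OF f ys(2)] dV[OF ys(2)]] by simp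
  also have "lie x (differential n (\<lambda>zs. f (y # zs))) zs = differential n (lie x (\<lambda>zs. f (y # zs))) zs"
    by (rule Suc.IH[OF A[OF ys(2)] ys(3)])
  finally have 1: "lie x (differential (Suc n) f) ys = lie x (lie y f) zs - differential n (lie x (\<lambda>zs. f (y # zs))) zs
      - lie (bk x y) f zs + differential n (\<lambda>zs. f (bk x y # zs)) zs"
    unfolding ys(1) lie_Cons differential_Cons[OF f xy ys(3)] by simp
  have "differential n (\<lambda>zs. lie x f (y # zs)) zs = differential n (\<lambda>zs. lie x (\<lambda>zs. f (y # zs)) zs - f (bk x y # zs)) zs"
    by (simp add: lie_Cons)
  also have "\<dots> = differential n (lie x (\<lambda>zs. f (y # zs))) zs - differential n (\<lambda>zs. f (bk x y # zs)) zs"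
    using differential_diff[OF ys(3) lie_closed[OF A[OF ys(2)] x] alternating_closed[OF A[OF xy]]] by simp
  finally show ?case
    using 1 unfolding ys(1) differential_Cons[OF alternating_lie[OF f x] ys(2,3)] lie_lie[OF f x ys(2,3)] by simp
qed

text \<open>\<open>\<iota>\<^sub>x d d = L\<^sub>x d - d \<iota>\<^sub>x d = L\<^sub>x d - d L\<^sub>x + d d \<iota>\<^sub>x\<close>, and the last term has lower degree.\<close>

theorem differential_differential:
  assumes "alternating n f" "xs \<in> args (Suc (Suc n))"
  shows "differential (Suc n) (differential n f) xs = 0"
  using assms
proof (induction n arbitrary: f xs)
  case 0
  note f = 0(1)
  obtain x ys where xs: "xs = x # ys" "x \<in> C" "ys \<in> args (Suc 0)" using 0(2) by (rule args_SucE)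
  have "differential 0 (\<lambda>zs. differential 0 f (x # zs)) ys = differential 0 (lie x f) ys"
    by (rule differential_cong[OF xs(3)]) (auto dest!: args_0D simp: differential_0)
  then show ?case
    unfolding xs(1) differential_Cons[OF alternating_differential[OF f] xs(2,3)] lie_differential[OF f xs(2,3)] by simp
next
  case (Suc n)
  note f = Suc.prems(1)
  obtain x ys where xs: "xs = x # ys" "x \<in> C" "ys \<in> args (Suc (Suc n))" using Suc.prems(2) by (rule args_SucE)
  note A = alternating_Cons[OF f xs(2)]
  have "differential (Suc n) (\<lambda>zs. differential (Suc n) f (x # zs)) ys =
      differential (Suc n) (\<lambda>zs. lie x f zs - differential n (\<lambda>zs. f (x # zs)) zs) ys"
    by (rule differential_cong[OF xs(3)]) (rule differential_Cons[OF f xs(2)])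
  also have "\<dots> = differential (Suc n) (lie x f) ys - differential (Suc n) (differential n (\<lambda>zs. f (x # zs))) ys"
    using differential_diff[OF xs(3) lie_closed[OF f xs(2)] alternating_closed[OF alternating_differential[OF A]]] by simp
  also have "differential (Suc n) (differential n (\<lambda>zs. f (x # zs))) ys = 0"
    by (rule Suc.IH[OF A xs(3)])
  finally show ?case
    unfolding xs(1) differential_Cons[OF alternating_differential[OF f] xs(2,3)] lie_differential[OF f xs(2,3)] by simp
qed

end

text \<open>
  Linearity over a ring \<open>R\<close> on which \<open>C\<close> acts by \<open>anchor\<close>. The Lie derivative is not linear in its
  direction; in Cartan's formula its defect cancels against the Leibniz terms of \<open>d \<iota>\<^sub>x\<close>.
\<close>

locale linear_action = bracket_action C plus zero bk act V
  for C :: "'l set" and plus (infixl "\<boxplus>" 65) and zero bk and act :: "'l \<Rightarrow> 'm \<Rightarrow> 'm::ab_group_add" and V :: "'m::ab_group_add set" +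
  fixes R :: "'r set" and smult :: "'r \<Rightarrow> 'l \<Rightarrow> 'l" and scale :: "'r \<Rightarrow> 'm \<Rightarrow> 'm" and anchor :: "'l \<Rightarrow> 'r \<Rightarrow> 'r"
  assumes smult_closed [simp]: "a \<in> R \<Longrightarrow> x \<in> C \<Longrightarrow> smult a x \<in> C"
    and anchor_closed [simp]: "x \<in> C \<Longrightarrow> a \<in> R \<Longrightarrow> anchor x a \<in> R"
    and scale_closed [simp]: "a \<in> R \<Longrightarrow> m \<in> V \<Longrightarrow> scale a m \<in> V"
    and scale_add: "scale a (m + n) = scale a m + scale a n"
    and act_scale: "x \<in> C \<Longrightarrow> a \<in> R \<Longrightarrow> m \<in> V \<Longrightarrow> act x (scale a m) = scale a (act x m) + scale (anchor x a) m"
    and act_smult: "x \<in> C \<Longrightarrow> a \<in> R \<Longrightarrow> m \<in> V \<Longrightarrow> act (smult a x) m = scale a (act x m)"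
    and bk_smult: "x \<in> C \<Longrightarrow> y \<in> C \<Longrightarrow> a \<in> R \<Longrightarrow> bk x (smult a y) = smult a (bk x y) \<boxplus> smult (anchor x a) y"
begin

lemma scale_zero: "scale a 0 = 0"
  using scale_add[of a 0 0] by simp

lemma scale_uminus: "scale a (- m) = - scale a m"
  using scale_add[of a m "- m"] by (simp add: scale_zero eq_neg_iff_add_eq_0 add.commute)

lemma scale_diff: "scale a (m - n) = scale a m - scale a n"
  using scale_add[of a m "- n"] by (simp add: scale_uminus)

lemma scale_sum: "scale a (\<Sum>i\<in>I. f i) = (\<Sum>i\<in>I. scale a (f i))"
  by (induction I rule: infinite_finite_induct) (auto simp: scale_zero scale_add)

lemma scale_sign: "scale a (sign k m) = sign k (scale a m)"
  by (simp add: sign_def scale_uminus)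

definition linear_form :: "nat \<Rightarrow> ('l list \<Rightarrow> 'm) \<Rightarrow> bool" where
  "linear_form n f \<longleftrightarrow> (\<forall>xs\<in>args n. \<forall>i<n. \<forall>a\<in>R. \<forall>x\<in>C. f (xs[i := smult a x]) = scale a (f (xs[i := x])))"

lemma linear_formD: "linear_form n f \<Longrightarrow> xs \<in> args n \<Longrightarrow> i < n \<Longrightarrow> a \<in> R \<Longrightarrow> x \<in> C \<Longrightarrow>
    f (xs[i := smult a x]) = scale a (f (xs[i := x]))"
  by (simp add: linear_form_def)

lemma linear_form_Cons:
  assumes "linear_form (Suc n) f" "x \<in> C"
  shows "linear_form n (\<lambda>xs. f (x # xs))"
  unfolding linear_form_def using linear_formD[OF assms(1), of "x # xs" "Suc i" for xs i] assms(2) by simp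

lemma linear_form_lie:
  assumes f: "alternating n f" and lin: "linear_form n f" and x: "x \<in> C"
  shows "linear_form n (lie x f)"
  unfolding linear_form_def
proof safe
  fix xs i a y assume xs: "xs \<in> args n" and i: "i < n" and a: "a \<in> R" and y: "y \<in> C"
  have len: "length xs = n" using xs by (rule args_length)
  have "f (xs[i := smult a y, k := bk x (xs[i := smult a y] ! k)]) =
      scale a (f (xs[i := y, k := bk x (xs[i := y] ! k)])) + (if k = i then scale (anchor x a) (f (xs[i := y])) else 0)"
    if k: "k < n" for k
  proof (cases "k = i")
    case True
    then show ?thesis
      using len i xs x y a by (simp add: bk_smult alternating_add[OF f xs i] linear_formD[OF lin xs i])
  next
    case False
    have "xs[k := bk x (xs ! k)] \<in> args n" using xs x args_nth[OF xs k] by simp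
    then show ?thesis
      using False linear_formD[OF lin _ i a y, of "xs[k := bk x (xs ! k)]"] by (simp add: list_update_swap[of i k])
  qed
  then show "lie x f (xs[i := smult a y]) = scale a (lie x f (xs[i := y]))"
    using xs x y a i alternating_closed[OF f]
    by (simp add: lie_def len linear_formD[OF lin xs i] act_scale sum.distrib scale_diff scale_sum)
qed

lemma differential_scale:
  assumes g: "\<And>xs. xs \<in> args n \<Longrightarrow> g xs \<in> V" and a: "a \<in> R" and xs: "xs \<in> args (Suc n)"
  shows "differential n (\<lambda>xs. scale a (g xs)) xs =
    scale a (differential n g xs) + (\<Sum>k\<le>n. sign k (scale (anchor (xs ! k) a) (g (omit k xs))))"
proof -
  have "act (xs ! k) (scale a (g (omit k xs))) =
      scale a (act (xs ! k) (g (omit k xs))) + scale (anchor (xs ! k) a) (g (omit k xs))" if "k \<le> n" for k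
    using that a g args_omit[OF xs] args_nth[OF xs] by (intro act_scale) auto
  then show ?thesis
    by (simp add: ce_differential_def sign_add sum.distrib scale_add scale_sum scale_sign)
qed

lemma lie_smult:
  assumes f: "alternating n f" and lin: "linear_form n f" and x: "x \<in> C" and a: "a \<in> R" and ys: "ys \<in> args n"
  shows "lie (smult a x) f ys = scale a (lie x f ys) + (\<Sum>k<n. scale (anchor (ys ! k) a) (f (ys[k := x])))"
proof -
  have "f (ys[k := bk (smult a x) (ys ! k)]) =
      scale a (f (ys[k := bk x (ys ! k)])) - scale (anchor (ys ! k) a) (f (ys[k := x]))" if k: "k < n" for k
  proof -
    have y: "ys ! k \<in> C" using args_nth[OF ys k] .
    have "f (ys[k := bk (smult a x) (ys ! k)]) = - f (ys[k := bk (ys ! k) (smult a x)])"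
      by (rule alternating_bk_antisym[OF f ys k smult_closed[OF a x] y])
    also have "\<dots> = - (scale a (f (ys[k := bk (ys ! k) x])) + scale (anchor (ys ! k) a) (f (ys[k := x])))"
      using a x y by (simp add: bk_smult alternating_add[OF f ys k] linear_formD[OF lin ys k])
    also have "f (ys[k := bk (ys ! k) x]) = - f (ys[k := bk x (ys ! k)])"
      by (rule alternating_bk_antisym[OF f ys k y x])
    finally show ?thesis by (simp add: scale_uminus)
  qed
  then show ?thesis
    using x a alternating_closed[OF f ys]
    by (simp add: lie_def args_length[OF ys] act_smult scale_diff scale_sum sum_subtractf)
qed

theorem linear_form_differential:
  "alternating n f \<Longrightarrow> linear_form n f \<Longrightarrow> linear_form (Suc n) (differential n f)"
proof (induction n arbitrary: f)
  case 0
  then show ?case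
    using alternating_closed[OF 0(1)] by (auto simp: linear_form_def differential_0 act_smult elim!: args_SucE dest!: args_0D)
next
  case (Suc n)
  note f = Suc.prems
  note A = alternating_Cons[OF f(1)] and L = linear_form_Cons[OF f(2)]
  show ?case
    unfolding linear_form_def
  proof safe
    fix xs i a y assume xs: "xs \<in> args (Suc (Suc n))" and i: "i < Suc (Suc n)" and a: "a \<in> R" and y: "y \<in> C"
    obtain x ys where e: "xs = x # ys" "x \<in> C" "ys \<in> args (Suc n)" using xs by (rule args_SucE)
    show "differential (Suc n) f (xs[i := smult a y]) = scale a (differential (Suc n) f (xs[i := y]))"
    proof (cases i)
      case (Suc j)
      then show ?thesis
        using i e a y linear_formD[OF linear_form_lie[OF f e(2)] e(3), of j]
          linear_formD[OF Suc.IH[OF A[OF e(2)] L[OF e(2)]] e(3), of j]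
        by (simp add: differential_Cons[OF f(1)] scale_diff)
    next
      case 0
      have "differential n (\<lambda>zs. f (smult a y # zs)) ys = differential n (\<lambda>zs. scale a (f (y # zs))) ys"
      proof (rule differential_cong[OF e(3)])
        show "f (smult a y # zs) = scale a (f (y # zs))" if "zs \<in> args n" for zs
          using linear_formD[OF f(2), of "y # zs" 0 a y] a y that by simp
      qed
      also have "\<dots> = scale a (differential n (\<lambda>zs. f (y # zs)) ys) +
          (\<Sum>k\<le>n. sign k (scale (anchor (ys ! k) a) (f (y # omit k ys))))"
        by (rule differential_scale[OF alternating_closed[OF A[OF y]] a e(3)])
      also have "(\<Sum>k\<le>n. sign k (scale (anchor (ys ! k) a) (f (y # omit k ys)))) =
          (\<Sum>k<Suc n. scale (anchor (ys ! k) a) (f (ys[k := y])))"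
        unfolding lessThan_Suc_atMost
        by (intro sum.cong refl) (use alternating_front[OF f(1) e(3) _ y] in \<open>simp add: scale_sign[symmetric]\<close>)
      finally show ?thesis
        using 0 e a y lie_smult[OF f y a e(3)] by (simp add: differential_Cons[OF f(1)] scale_diff del: sum.lessThan_Suc)
    qed
  qed
qed

end

section \<open>Isomorphisms of complexes and cohomology\<close>

lemma cring_real_ring: "cring real_ring"
proof (rule cringI)
  show "abelian_group real_ring"
  proof (rule abelian_groupI)
    fix x assume "x \<in> carrier real_ring"
    then show "\<exists>y\<in>carrier real_ring. y \<oplus>\<^bsub>real_ring\<^esub> x = \<zero>\<^bsub>real_ring\<^esub>"
      by (intro bexI[of _ "- x"]) (auto simp: real_ring_def)
  qed (auto simp: real_ring_def)
  show "comm_monoid real_ring"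
    by (rule comm_monoidI) (auto simp: real_ring_def)
qed (auto simp: real_ring_def algebra_simps)

lemma mod_hom_zero:
  assumes "Module.module R M" "Module.module R N" "h \<in> mod_hom R M N"
  shows "h \<zero>\<^bsub>M\<^esub> = \<zero>\<^bsub>N\<^esub>"
proof -
  interpret M: module R M by fact
  interpret N: module R N by fact
  have "h (\<zero>\<^bsub>M\<^esub> \<oplus>\<^bsub>M\<^esub> \<zero>\<^bsub>M\<^esub>) = h \<zero>\<^bsub>M\<^esub> \<oplus>\<^bsub>N\<^esub> h \<zero>\<^bsub>M\<^esub>" "h \<zero>\<^bsub>M\<^esub> \<in> carrier N"
    using assms(3) M.M.zero_closed unfolding mod_hom_def by blast+
  then show ?thesis by simp
qed

lemma (in module) submodule_closedI:
  assumes "H \<subseteq> carrier M" "\<zero>\<^bsub>M\<^esub> \<in> H" "\<And>x y. x \<in> H \<Longrightarrow> y \<in> H \<Longrightarrow> x \<oplus>\<^bsub>M\<^esub> y \<in> H"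
    and smult: "\<And>r x. r \<in> carrier R \<Longrightarrow> x \<in> H \<Longrightarrow> r \<odot>\<^bsub>M\<^esub> x \<in> H"
  shows "submodule H R M"
proof (rule submoduleI[OF assms(1,2)])
  fix x assume x: "x \<in> H"
  then have "(\<ominus> \<one>) \<odot>\<^bsub>M\<^esub> x = \<ominus>\<^bsub>M\<^esub> x"
    using smult_l_minus[of \<one> x] assms(1) by auto
  then show "\<ominus>\<^bsub>M\<^esub> x \<in> H" using smult[of "\<ominus> \<one>" x] x by simp
qed (use assms in auto)

lemma (in cochain_complex) submodule_cocycles: "submodule (cocycles C d n) R (C n)"
proof -
  interpret M: module R "C n" by (rule module_C)
  interpret M': module R "C (Suc n)" by (rule module_C)
  have zero: "d n \<zero>\<^bsub>C n\<^esub> = \<zero>\<^bsub>C (Suc n)\<^esub>"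
    by (rule mod_hom_zero[OF module_C module_C d_hom])
  show ?thesis
    by (rule M.submodule_closedI) (use d_hom[of n] zero in \<open>auto simp: cocycles_def mod_hom_def\<close>)
qed

lemma (in cochain_complex) coboundaries_subset: "coboundaries C d n \<subseteq> cocycles C d n"
proof (cases n)
  case 0
  interpret M: module R "C 0" by (rule module_C)
  show ?thesis
    using mod_hom_zero[OF module_C module_C d_hom[of 0]] 0 by (simp add: coboundaries_def cocycles_def)
next
  case (Suc m)
  then show ?thesis
    using d_hom[of m] d_d[of _ m] by (auto simp: coboundaries_def cocycles_def mod_hom_def)
qed

lemma (in cochain_complex) quotient_cohomology:
  "quotient_by_submodule R ((C n)\<lparr>carrier := cocycles C d n\<rparr>) (coboundaries C d n)"
proof -
  interpret M: module R "C n" by (rule module_C)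
  interpret Z: module R "(C n)\<lparr>carrier := cocycles C d n\<rparr>"
    by (rule submodule.submodule_is_module[OF submodule_cocycles module_C])
  have "submodule (coboundaries C d n) R ((C n)\<lparr>carrier := cocycles C d n\<rparr>)"
  proof (rule Z.submodule_closedI)
    show "coboundaries C d n \<subseteq> carrier ((C n)\<lparr>carrier := cocycles C d n\<rparr>)"
      using coboundaries_subset by simp
    have "\<zero>\<^bsub>C n\<^esub> \<in> coboundaries C d n \<and>
        (\<forall>x\<in>coboundaries C d n. \<forall>y\<in>coboundaries C d n. x \<oplus>\<^bsub>C n\<^esub> y \<in> coboundaries C d n) \<and>
        (\<forall>r\<in>carrier R. \<forall>x\<in>coboundaries C d n. r \<odot>\<^bsub>C n\<^esub> x \<in> coboundaries C d n)"
    proof (cases n)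
      case 0
      interpret M0: module R "C 0" by (rule module_C)
      show ?thesis using 0 by (simp add: coboundaries_def)
    next
      case (Suc m)
      interpret Mm: module R "C m" by (rule module_C)
      have hom: "d m (x \<oplus>\<^bsub>C m\<^esub> y) = d m x \<oplus>\<^bsub>C n\<^esub> d m y" "r \<in> carrier R \<Longrightarrow> d m (r \<odot>\<^bsub>C m\<^esub> x) = r \<odot>\<^bsub>C n\<^esub> d m x"
        if "x \<in> carrier (C m)" "y \<in> carrier (C m)" for x y r
        using d_hom[of m] that Suc unfolding mod_hom_def by blast+
      have "d m \<zero>\<^bsub>C m\<^esub> = \<zero>\<^bsub>C n\<^esub>"
        using mod_hom_zero[OF module_C module_C d_hom[of m]] Suc by simp
      then have "\<zero>\<^bsub>C n\<^esub> \<in> d m ` carrier (C m)" by (metis Mm.M.zero_closed imageI)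
      moreover have "d m x \<oplus>\<^bsub>C n\<^esub> d m y \<in> d m ` carrier (C m)" if "x \<in> carrier (C m)" "y \<in> carrier (C m)" for x y
        using hom(1)[OF that] that by (metis Mm.M.add.m_closed imageI)
      moreover have "r \<odot>\<^bsub>C n\<^esub> d m x \<in> d m ` carrier (C m)" if "x \<in> carrier (C m)" "r \<in> carrier R" for x r
        using hom(2)[OF that(1,1,2)] that by (metis Mm.smult_closed imageI)
      ultimately show ?thesis using Suc by (auto simp: coboundaries_def)
    qed
    then show "\<zero>\<^bsub>(C n)\<lparr>carrier := cocycles C d n\<rparr>\<^esub> \<in> coboundaries C d n"
      "\<And>x y. x \<in> coboundaries C d n \<Longrightarrow> y \<in> coboundaries C d n \<Longrightarrow>
        x \<oplus>\<^bsub>(C n)\<lparr>carrier := cocycles C d n\<rparr>\<^esub> y \<in> coboundaries C d n"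
      "\<And>r x. r \<in> carrier R \<Longrightarrow> x \<in> coboundaries C d n \<Longrightarrow>
        r \<odot>\<^bsub>(C n)\<lparr>carrier := cocycles C d n\<rparr>\<^esub> x \<in> coboundaries C d n"
      by simp_all
  qed
  then show ?thesis
    by (simp add: quotient_by_submodule_def quotient_by_submodule_axioms_def Z.module_axioms)
qed

text \<open>A structure-preserving bijection transports the axioms of a complex.\<close>

lemma cochain_complex_iso_transport:
  assumes C: "cochain_complex R C d" and C': "\<And>n. Module.module R (C' n)"
    and h: "\<And>n. h n \<in> mod_iso R (C n) (C' n)"
    and comm: "\<And>n x. x \<in> carrier (C n) \<Longrightarrow> h (Suc n) (d n x) = d' n (h n x)"
  shows "cochain_complex_iso R C d C' d' h"
proof -
  interpret C: cochain_complex R C d by (rule C)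
  have hom: "h n (x \<oplus>\<^bsub>C n\<^esub> y) = h n x \<oplus>\<^bsub>C' n\<^esub> h n y" "r \<in> carrier R \<Longrightarrow> h n (r \<odot>\<^bsub>C n\<^esub> x) = r \<odot>\<^bsub>C' n\<^esub> h n x"
    "h n x \<in> carrier (C' n)"
    if "x \<in> carrier (C n)" "y \<in> carrier (C n)" for x y r n
    using h[of n] that unfolding mod_iso_def mod_hom_def by blast+
  have dhom: "d n (x \<oplus>\<^bsub>C n\<^esub> y) = d n x \<oplus>\<^bsub>C (Suc n)\<^esub> d n y" "r \<in> carrier R \<Longrightarrow> d n (r \<odot>\<^bsub>C n\<^esub> x) = r \<odot>\<^bsub>C (Suc n)\<^esub> d n x"
    "d n x \<in> carrier (C (Suc n))"
    if "x \<in> carrier (C n)" "y \<in> carrier (C n)" for x y r n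
    using C.d_hom[of n] that unfolding mod_hom_def by blast+
  have surj: "\<exists>x\<in>carrier (C n). y = h n x" if "y \<in> carrier (C' n)" for y n
    using h[of n] that unfolding mod_iso_def bij_betw_def by blast
  have cl: "x \<oplus>\<^bsub>C n\<^esub> y \<in> carrier (C n)" "r \<in> carrier R \<Longrightarrow> r \<odot>\<^bsub>C n\<^esub> x \<in> carrier (C n)"
    if "x \<in> carrier (C n)" "y \<in> carrier (C n)" for x y r n
  proof -
    interpret M: module R "C n" by (rule C.module_C)
    show "x \<oplus>\<^bsub>C n\<^esub> y \<in> carrier (C n)" "r \<in> carrier R \<Longrightarrow> r \<odot>\<^bsub>C n\<^esub> x \<in> carrier (C n)" using that by auto
  qed
  have "cochain_complex R C' d'"
  proof (rule cochain_complex.intro)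
    fix n
    show "Module.module R (C' n)" by (rule C')
    show "d' n \<in> mod_hom R (C' n) (C' (Suc n))"
      unfolding mod_hom_def
    proof safe
      fix y assume "y \<in> carrier (C' n)"
      then obtain x where x: "x \<in> carrier (C n)" "y = h n x" using surj by blast
      then show "d' n y \<in> carrier (C' (Suc n))"
        using hom(3)[of "d n x" "Suc n" "d n x"] dhom(3)[of x n x] comm[OF x(1)] by simp
    next
      fix y z assume "y \<in> carrier (C' n)" "z \<in> carrier (C' n)"
      then obtain x w where x: "x \<in> carrier (C n)" "y = h n x" "w \<in> carrier (C n)" "z = h n w" using surj by blast
      note dc = dhom(3)[OF x(1,1)] dhom(3)[OF x(3,3)]
      have "y \<oplus>\<^bsub>C' n\<^esub> z = h n (x \<oplus>\<^bsub>C n\<^esub> w)" using hom(1)[OF x(1,3)] x by simp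
      then have "d' n (y \<oplus>\<^bsub>C' n\<^esub> z) = h (Suc n) (d n (x \<oplus>\<^bsub>C n\<^esub> w))" using comm[OF cl(1)[OF x(1,3)]] by simp
      also have "\<dots> = h (Suc n) (d n x) \<oplus>\<^bsub>C' (Suc n)\<^esub> h (Suc n) (d n w)"
        unfolding dhom(1)[OF x(1,3)] by (rule hom(1)[OF dc])
      finally show "d' n (y \<oplus>\<^bsub>C' n\<^esub> z) = d' n y \<oplus>\<^bsub>C' (Suc n)\<^esub> d' n z" using comm x by simp
    next
      fix r y assume r: "r \<in> carrier R" and "y \<in> carrier (C' n)"
      then obtain x where x: "x \<in> carrier (C n)" "y = h n x" using surj by blast
      have "r \<odot>\<^bsub>C' n\<^esub> y = h n (r \<odot>\<^bsub>C n\<^esub> x)" using hom(2)[OF x(1,1) r] x by simp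
      then have "d' n (r \<odot>\<^bsub>C' n\<^esub> y) = h (Suc n) (d n (r \<odot>\<^bsub>C n\<^esub> x))" using comm[OF cl(2)[OF x(1,1) r]] by simp
      also have "\<dots> = r \<odot>\<^bsub>C' (Suc n)\<^esub> h (Suc n) (d n x)"
        unfolding dhom(2)[OF x(1,1) r] by (rule hom(2)[OF dhom(3)[OF x(1,1)] dhom(3)[OF x(1,1)] r])
      finally show "d' n (r \<odot>\<^bsub>C' n\<^esub> y) = r \<odot>\<^bsub>C' (Suc n)\<^esub> d' n y" using comm x by simp
    qed
    fix y assume "y \<in> carrier (C' n)"
    then obtain x where x: "x \<in> carrier (C n)" "y = h n x" using surj by blast
    have "d' (Suc n) (d' n y) = h (Suc (Suc n)) (d (Suc n) (d n x))"
      using comm[OF x(1)] comm[OF dhom(3)[OF x(1,1)]] x(2) by simp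
    also have "\<dots> = \<zero>\<^bsub>C' (Suc (Suc n))\<^esub>"
      using C.d_d[OF x(1)] mod_hom_zero[OF C.module_C C', of "h (Suc (Suc n))" "Suc (Suc n)" "Suc (Suc n)"] h unfolding mod_iso_def by simp
    finally show "d' (Suc n) (d' n y) = \<zero>\<^bsub>C' (Suc (Suc n))\<^esub>" .
  qed
  then show ?thesis using C h comm by (simp add: cochain_complex_iso_def)
qed

text \<open>
  An isomorphism of complexes matches cocycles with cocycles and coboundaries with coboundaries, so it
  maps each coset onto a coset.
\<close>

lemma cohomology_iso:
  assumes "cochain_complex_iso R C d C' d' h"
  shows "cohomology_map C' d' h n \<in> mod_iso R (cohomology C d n) (cohomology C' d' n)"
proof -
  interpret C: cochain_complex R C d using assms by (simp add: cochain_complex_iso_def)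
  interpret C': cochain_complex R C' d' using assms by (simp add: cochain_complex_iso_def)
  let ?Z = "cocycles C d n" and ?Z' = "cocycles C' d' n" and ?B = "coboundaries C d n" and ?B' = "coboundaries C' d' n"
  interpret Q: quotient_by_submodule R "(C n)\<lparr>carrier := ?Z\<rparr>" ?B by (rule C.quotient_cohomology)
  interpret Q': quotient_by_submodule R "(C' n)\<lparr>carrier := ?Z'\<rparr>" ?B' by (rule C'.quotient_cohomology)
  have bij: "bij_betw (h m) (carrier (C m)) (carrier (C' m))" and comm: "x \<in> carrier (C m) \<Longrightarrow> h (Suc m) (d m x) = d' m (h m x)"
    and h_hom: "h m \<in> mod_hom R (C m) (C' m)" for m x
    using assms by (auto simp: cochain_complex_iso_def mod_iso_def)
  have hom: "h m (x \<oplus>\<^bsub>C m\<^esub> y) = h m x \<oplus>\<^bsub>C' m\<^esub> h m y" "r \<in> carrier R \<Longrightarrow> h m (r \<odot>\<^bsub>C m\<^esub> x) = r \<odot>\<^bsub>C' m\<^esub> h m x"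
    if "x \<in> carrier (C m)" "y \<in> carrier (C m)" for x y r m
    using h_hom[of m] that unfolding mod_hom_def by blast+
  have zero: "h m \<zero>\<^bsub>C m\<^esub> = \<zero>\<^bsub>C' m\<^esub>" for m
    by (rule mod_hom_zero[OF C.module_C C'.module_C h_hom])
  have inj: "x = y" if "h m x = h m y" "x \<in> carrier (C m)" "y \<in> carrier (C m)" for x y m
    using bij[of m] that by (auto simp: bij_betw_def inj_on_def)
  have surj: "\<exists>x\<in>carrier (C m). h m x = y" if "y \<in> carrier (C' m)" for y m
    using bij[of m] that by (force simp: bij_betw_def)
  have dC: "d m x \<in> carrier (C (Suc m))" if "x \<in> carrier (C m)" for m x
    using C.d_hom[of m] that by (auto simp: mod_hom_def)
  have Z_sub: "?Z \<subseteq> carrier (C n)" by (auto simp: cocycles_def)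
  have Z_iff: "h n x \<in> ?Z' \<longleftrightarrow> x \<in> ?Z" if x: "x \<in> carrier (C n)" for x
  proof -
    have zC: "\<zero>\<^bsub>C (Suc n)\<^esub> \<in> carrier (C (Suc n))"
      using module.axioms(2)[OF C.module_C[of "Suc n"]] abelian_group_def abelian_monoid.zero_closed by blast
    have "d' n (h n x) = \<zero>\<^bsub>C' (Suc n)\<^esub> \<longleftrightarrow> h (Suc n) (d n x) = h (Suc n) \<zero>\<^bsub>C (Suc n)\<^esub>"
      using comm[OF x] zero by simp
    also have "\<dots> \<longleftrightarrow> d n x = \<zero>\<^bsub>C (Suc n)\<^esub>" using inj[OF _ dC[OF x] zC] by auto
    finally show ?thesis using x h_hom[of n] by (auto simp: cocycles_def mod_hom_def)
  qed
  have B_image: "?B' = h n ` ?B"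
  proof (cases n)
    case 0
    then show ?thesis using zero[of 0] by (simp add: coboundaries_def)
  next
    case (Suc m)
    have "d' m ` carrier (C' m) = d' m ` h m ` carrier (C m)" using bij[of m] by (simp add: bij_betw_def)
    also have "\<dots> = h n ` d m ` carrier (C m)" using comm[of _ m] Suc by (force simp: image_image)
    finally show ?thesis using Suc by (simp add: coboundaries_def)
  qed
  have B_Z: "b \<in> ?Z" if "b \<in> ?B" for b using C.coboundaries_subset that by blast
  have cls: "Q.cls x = (\<lambda>b. b \<oplus>\<^bsub>C n\<^esub> x) ` ?B" "Q'.cls y = (\<lambda>b. b \<oplus>\<^bsub>C' n\<^esub> y) ` ?B'" for x y
    by (auto simp: a_r_coset_def')
  have map_cls: "cohomology_map C' d' h n (Q.cls z) = Q'.cls (h n z)" if z: "z \<in> ?Z" for z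
  proof -
    have hz: "h n z \<in> ?Z'" using Z_iff z Z_sub by blast
    have eq: "Q'.cls (h n x) = Q'.cls (h n z)" if x: "x \<in> Q.cls z" for x
    proof -
      obtain b where b: "b \<in> ?B" "x = b \<oplus>\<^bsub>C n\<^esub> z" using x by (auto simp: cls)
      have "h n x = h n b \<oplus>\<^bsub>C' n\<^esub> h n z" using b hom(1)[of b n z] B_Z[OF b(1)] z Z_sub by auto
      then show ?thesis using Q'.cls_absorb[of "h n b" "h n z"] hz b(1) B_image by simp
    qed
    have "coboundaries C' d' n +>\<^bsub>C' n\<^esub> y = Q'.cls y" for y by (simp add: a_r_coset_def')
    then have "(\<Union>x\<in>Q.cls z. coboundaries C' d' n +>\<^bsub>C' n\<^esub> h n x) = (\<Union>x\<in>Q.cls z. Q'.cls (h n x))"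
      by (simp only:)
    also have "\<dots> = (\<Union>x\<in>Q.cls z. Q'.cls (h n z))"
      by (rule SUP_cong[OF refl eq])
    finally have "(\<Union>x\<in>Q.cls z. coboundaries C' d' n +>\<^bsub>C' n\<^esub> h n x) = (\<Union>x\<in>Q.cls z. Q'.cls (h n z))" .
    moreover have "z \<in> Q.cls z" using Q.S.a_rcos_self z by simp
    ultimately show ?thesis
      unfolding cohomology_map_def by auto
  qed
  have Q_elim: "\<exists>z\<in>?Z. X = Q.cls z" if "X \<in> carrier (cohomology C d n)" for X
    using that Q.Q_carrierE[of X] unfolding cohomology_def by auto
  have hZ: "h n z \<in> ?Z'" if "z \<in> ?Z" for z using Z_iff Z_sub that by blast
  have sub: "z \<in> carrier (C n)" if "z \<in> ?Z" for z using Z_sub that by blast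
  have map_closed: "cohomology_map C' d' h n X \<in> carrier (cohomology C' d' n)"
    if X: "X \<in> carrier (cohomology C d n)" for X
  proof -
    obtain z where z: "z \<in> ?Z" "X = Q.cls z" using Q_elim[OF X] by blast
    then show "cohomology_map C' d' h n X \<in> carrier (cohomology C' d' n)"
      using map_cls[OF z(1)] hZ[OF z(1)] Q'.cls_closed by (simp add: cohomology_def)
  qed
  have map_add: "cohomology_map C' d' h n (X \<oplus>\<^bsub>cohomology C d n\<^esub> Y) =
      cohomology_map C' d' h n X \<oplus>\<^bsub>cohomology C' d' n\<^esub> cohomology_map C' d' h n Y"
    if XY: "X \<in> carrier (cohomology C d n)" "Y \<in> carrier (cohomology C d n)" for X Y
  proof -
    obtain z w where z: "z \<in> ?Z" "X = Q.cls z" "w \<in> ?Z" "Y = Q.cls w"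
      using Q_elim[OF XY(1)] Q_elim[OF XY(2)] by blast
    have zw: "z \<oplus>\<^bsub>C n\<^esub> w \<in> ?Z" using Q.M.add.m_closed z by simp
    have "X \<oplus>\<^bsub>cohomology C d n\<^esub> Y = Q.cls (z \<oplus>\<^bsub>C n\<^esub> w)"
      using Q.cls_add[of z w] z by (simp add: cohomology_def)
    moreover have "Q'.cls (h n z \<oplus>\<^bsub>C' n\<^esub> h n w) = Q'.cls (h n z) \<oplus>\<^bsub>cohomology C' d' n\<^esub> Q'.cls (h n w)"
      using Q'.cls_add[of "h n z" "h n w"] hZ z by (simp add: cohomology_def)
    ultimately show "cohomology_map C' d' h n (X \<oplus>\<^bsub>cohomology C d n\<^esub> Y) =
        cohomology_map C' d' h n X \<oplus>\<^bsub>cohomology C' d' n\<^esub> cohomology_map C' d' h n Y"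
      using map_cls zw z hom(1)[OF sub sub] by simp
  qed
  have map_smult: "cohomology_map C' d' h n (r \<odot>\<^bsub>cohomology C d n\<^esub> X) =
      r \<odot>\<^bsub>cohomology C' d' n\<^esub> cohomology_map C' d' h n X"
    if r: "r \<in> carrier R" and X: "X \<in> carrier (cohomology C d n)" for r X
  proof -
    obtain z where z: "z \<in> ?Z" "X = Q.cls z" using Q_elim[OF X] by blast
    have rz: "r \<odot>\<^bsub>C n\<^esub> z \<in> ?Z" using Q.smult_closed[OF r, of z] z by simp
    have "r \<odot>\<^bsub>cohomology C d n\<^esub> X = Q.cls (r \<odot>\<^bsub>C n\<^esub> z)"
      using Q.cls_smult[OF r, of z] z by (simp add: cohomology_def)
    moreover have "Q'.cls (r \<odot>\<^bsub>C' n\<^esub> h n z) = r \<odot>\<^bsub>cohomology C' d' n\<^esub> Q'.cls (h n z)"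
      using Q'.cls_smult[OF r, of "h n z"] hZ z by (simp add: cohomology_def)
    ultimately show "cohomology_map C' d' h n (r \<odot>\<^bsub>cohomology C d n\<^esub> X) =
        r \<odot>\<^bsub>cohomology C' d' n\<^esub> cohomology_map C' d' h n X"
      using map_cls rz z hom(2)[OF sub sub r] by simp
  qed
  have "cohomology_map C' d' h n \<in> mod_hom R (cohomology C d n) (cohomology C' d' n)"
    unfolding mod_hom_def using map_closed map_add map_smult by blast
  moreover have "bij_betw (cohomology_map C' d' h n) (carrier (cohomology C d n)) (carrier (cohomology C' d' n))"
    unfolding bij_betw_def
  proof
    show "inj_on (cohomology_map C' d' h n) (carrier (cohomology C d n))"
    proof (rule inj_onI)
      fix X Y assume "X \<in> carrier (cohomology C d n)" "Y \<in> carrier (cohomology C d n)"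
        and eq: "cohomology_map C' d' h n X = cohomology_map C' d' h n Y"
      then obtain z w where z: "z \<in> ?Z" "X = Q.cls z" "w \<in> ?Z" "Y = Q.cls w" using Q_elim by blast
      have "h n z \<in> Q'.cls (h n z)" using Q'.S.a_rcos_self hZ z by simp
      then have "h n z \<in> Q'.cls (h n w)" using eq map_cls z by simp
      then obtain b where b: "b \<in> ?B" "h n z = h n b \<oplus>\<^bsub>C' n\<^esub> h n w"
        unfolding cls unfolding B_image by auto
      have bw: "b \<oplus>\<^bsub>C n\<^esub> w \<in> ?Z" using Q.M.add.m_closed z B_Z[OF b(1)] by simp
      have "h n z = h n (b \<oplus>\<^bsub>C n\<^esub> w)" using b hom(1)[OF sub sub] B_Z z by simp
      then have "z = b \<oplus>\<^bsub>C n\<^esub> w" using inj[OF _ sub sub] z bw by simp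
      then show "X = Y" using Q.cls_absorb[OF b(1), of w] z by simp
    qed
    show "cohomology_map C' d' h n ` carrier (cohomology C d n) = carrier (cohomology C' d' n)"
    proof
      show "cohomology_map C' d' h n ` carrier (cohomology C d n) \<subseteq> carrier (cohomology C' d' n)"
        using calculation by (auto simp: mod_hom_def)
      show "carrier (cohomology C' d' n) \<subseteq> cohomology_map C' d' h n ` carrier (cohomology C d n)"
      proof
        fix Y assume "Y \<in> carrier (cohomology C' d' n)"
        then obtain y where y: "y \<in> ?Z'" "Y = Q'.cls y"
          using Q'.Q_carrierE[of Y] unfolding cohomology_def by auto
        then have "y \<in> carrier (C' n)" by (simp add: cocycles_def)
        then obtain x where x: "x \<in> carrier (C n)" "h n x = y" using surj by blast
        then have xZ: "x \<in> ?Z" using Z_iff y by blast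
        then have "Q.cls x \<in> carrier (cohomology C d n)" using Q.cls_closed[of x] by (simp add: cohomology_def)
        then show "Y \<in> cohomology_map C' d' h n ` carrier (cohomology C d n)"
          using map_cls[OF xZ] x y by (metis imageI)
      qed
    qed
  qed
  ultimately show ?thesis by (simp add: mod_iso_def)
qed

section \<open>Sections of a vector bundle\<close>

lemma arguments_update: "xs \<in> arguments L n \<Longrightarrow> x \<in> carrier L \<Longrightarrow> xs[i := x] \<in> arguments L n"
  using set_update_subset_insert[of xs i x] by (auto simp: arguments_def)

lemma arguments_nth: "xs \<in> arguments L n \<Longrightarrow> i < n \<Longrightarrow> xs ! i \<in> carrier L"
  by (auto simp: arguments_def)

lemma arguments_length: "xs \<in> arguments L n \<Longrightarrow> length xs = n"
  by (simp add: arguments_def)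

text \<open>Passage from one list of arguments to another, one position at a time.\<close>

lemma arguments_replace_induct:
  assumes xs: "xs \<in> arguments L n" and ys: "ys \<in> arguments L n" and base: "P 0 xs"
    and step: "\<And>zs k. zs \<in> arguments L n \<Longrightarrow> k < n \<Longrightarrow> zs ! k = xs ! k \<Longrightarrow> P k zs \<Longrightarrow> P (Suc k) (zs[k := ys ! k])"
  shows "P n ys"
proof -
  have len: "length xs = n" "length ys = n" using xs ys by (auto simp: arguments_def)
  have "P k (take k ys @ drop k xs)" if "k \<le> n" for k
    using that
  proof (induction k)
    case 0
    show ?case using base by simp
  next
    case (Suc k)
    let ?zs = "take k ys @ drop k xs"
    have "?zs \<in> arguments L n"
      using xs ys Suc.prems len by (auto simp: arguments_def dest: in_set_takeD in_set_dropD)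
    moreover have "?zs ! k = xs ! k" using Suc.prems len by (simp add: nth_append)
    moreover have "?zs[k := ys ! k] = take (Suc k) ys @ drop (Suc k) xs"
      using Suc.prems len by (simp add: list_update_append take_Suc_conv_app_nth Cons_nth_drop_Suc[symmetric])
    ultimately show ?case using step[of ?zs k] Suc by simp
  qed
  from this[of n] show ?thesis using len by simp
qed

text \<open>From here on the module operations on one-forms are treated abstractly.\<close>

declare one_form_module_simps(2-4) [simp del]

context smooth_vector_bundle
begin

abbreviation "G \<equiv> smooth_sections N Z"
abbreviation "\<Gamma> \<equiv> carrier (smooth_sections N Z)"

lemma section_simps [simp]:
  "s \<oplus>\<^bsub>G\<^esub> t = s + t" "a \<odot>\<^bsub>G\<^esub> s = (\<lambda>p. a p *\<^sub>R s p)" "\<zero>\<^bsub>G\<^esub> = 0"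
  by (simp_all add: smooth_sections_def plus_fun_def zero_fun_def)

lemma mem_sections: "s \<in> \<Gamma> \<longleftrightarrow> (\<forall>p. s p \<in> fibre Z p) \<and>
    (\<forall>(U, \<tau>)\<in>trivializations Z. smooth_map_on N U (\<lambda>p. \<tau> p (s p)))"
  by (simp add: smooth_sections_def)

lemma trivialization_zero: "(U, \<tau>) \<in> trivializations Z \<Longrightarrow> p \<in> U \<Longrightarrow> \<tau> p 0 = 0"
  using trivializations_linear[of U \<tau> p 0 0 1] subspace_0[OF subspace_fibre] by simp

lemma trivialization_add: "(U, \<tau>) \<in> trivializations Z \<Longrightarrow> p \<in> U \<Longrightarrow> x \<in> fibre Z p \<Longrightarrow> y \<in> fibre Z p \<Longrightarrow>
    \<tau> p (x + y) = \<tau> p x + \<tau> p y"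
  using trivializations_linear[of U \<tau> p x y 1] by simp

lemma trivialization_scale: "(U, \<tau>) \<in> trivializations Z \<Longrightarrow> p \<in> U \<Longrightarrow> x \<in> fibre Z p \<Longrightarrow>
    \<tau> p (r *\<^sub>R x) = r *\<^sub>R \<tau> p x"
  using trivializations_linear[of U \<tau> p x 0 r] trivialization_zero[of U \<tau> p] subspace_0[OF subspace_fibre] by simp

lemma trivialization_at_point:
  obtains U \<tau> where "(U, \<tau>) \<in> trivializations Z" "p \<in> U"
proof -
  have "p \<in> (\<Union>(U, \<tau>)\<in>trivializations Z. U)" using trivializations_cover by simp
  then show ?thesis using that by auto
qed

lemma section_fibre: "s \<in> \<Gamma> \<Longrightarrow> s p \<in> fibre Z p"
  by (simp add: mem_sections)

lemma sections_smult [simp]: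
  assumes a: "a \<in> A" and s: "s \<in> \<Gamma>"
  shows "(\<lambda>p. a p *\<^sub>R s p) \<in> \<Gamma>"
  unfolding mem_sections
proof safe
  show "a p *\<^sub>R s p \<in> fibre Z p" for p using section_fibre[OF s] subspace_scale[OF subspace_fibre] by blast
  fix U \<tau> assume t: "(U, \<tau>) \<in> trivializations Z"
  note U = trivializations_open[OF t]
  have "smooth_map_on N U (\<lambda>p. a p *\<^sub>R \<tau> p (s p))"
    using a s t by (intro smooth_map_on_scaleR[OF U]) (auto simp: mem_smooth_functions mem_sections elim: smooth_map_on_subset)
  then show "smooth_map_on N U (\<lambda>p. \<tau> p (a p *\<^sub>R s p))"
    by (rule smooth_map_on_cong[OF U, rotated]) (simp add: trivialization_scale[OF t] section_fibre[OF s])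
qed

lemma sections_add [simp]:
  assumes s: "s \<in> \<Gamma>" and u: "u \<in> \<Gamma>"
  shows "s + u \<in> \<Gamma>"
  unfolding mem_sections
proof safe
  show "(s + u) p \<in> fibre Z p" for p using section_fibre[OF s] section_fibre[OF u] subspace_add[OF subspace_fibre] by simp
  fix U \<tau> assume t: "(U, \<tau>) \<in> trivializations Z"
  note U = trivializations_open[OF t]
  have "smooth_map_on N U (\<lambda>p. \<tau> p (s p) + \<tau> p (u p))"
    using s u t by (intro smooth_map_on_add[OF U]) (auto simp: mem_sections)
  then show "smooth_map_on N U (\<lambda>p. \<tau> p ((s + u) p))"
    by (rule smooth_map_on_cong[OF U, rotated])
      (simp add: trivialization_add[OF t] section_fibre[OF s] section_fibre[OF u])
qed

lemma sections_zero [simp]: "0 \<in> \<Gamma>"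
  unfolding mem_sections
proof safe
  show "0 p \<in> fibre Z p" for p using subspace_0[OF subspace_fibre] by simp
  fix U \<tau> assume t: "(U, \<tau>) \<in> trivializations Z"
  show "smooth_map_on N U (\<lambda>p. \<tau> p (0 p))"
    by (rule smooth_map_on_cong[OF trivializations_open[OF t] _ smooth_map_on_const[of _ 0]])
      (simp add: trivialization_zero[OF t])
qed

lemma sections_uminus [simp]: "s \<in> \<Gamma> \<Longrightarrow> - s \<in> \<Gamma>"
  using sections_smult[OF smooth_const[of "-1"], of s] by (simp add: fun_Compl_def)

text \<open>The coordinates of \<open>s\<close> in a trivialization are smooth after multiplication by \<open>\<eta>\<close>, hence near \<open>p\<close>.\<close>

lemma sections_divide:
  assumes fib: "\<And>p. s p \<in> fibre Z p"
    and "\<And>p. \<exists>\<eta>\<in>A. \<eta> p \<noteq> 0 \<and> (\<lambda>x. \<eta> x *\<^sub>R s x) \<in> \<Gamma>"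
  shows "s \<in> \<Gamma>"
  unfolding mem_sections
proof safe
  fix U \<tau> assume t: "(U, \<tau>) \<in> trivializations Z"
  note U = trivializations_open[OF t]
  show "smooth_map_on N U (\<lambda>p. \<tau> p (s p))"
  proof (rule smooth_map_on_divide[OF U])
    fix p
    obtain \<eta> where \<eta>: "\<eta> \<in> A" "\<eta> p \<noteq> 0" "(\<lambda>x. \<eta> x *\<^sub>R s x) \<in> \<Gamma>" using assms(2) by blast
    then have "smooth_map_on N U (\<lambda>x. \<tau> x (\<eta> x *\<^sub>R s x))" using t by (auto simp: mem_sections)
    then have "smooth_map_on N U (\<lambda>x. \<eta> x *\<^sub>R \<tau> x (s x))"
      by (rule smooth_map_on_cong[OF U, rotated]) (simp add: trivialization_scale[OF t] fib)
    then show "\<exists>\<eta>. smooth_map_on N UNIV \<eta> \<and> \<eta> p \<noteq> 0 \<and> smooth_map_on N U (\<lambda>x. \<eta> x *\<^sub>R \<tau> x (s x))"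
      using \<eta> by (auto simp: mem_smooth_functions)
  qed
qed (rule fib)

lemma abelian_group_sections: "abelian_group G"
proof (rule abelian_groupI)
  fix s assume "s \<in> \<Gamma>"
  then show "\<exists>t\<in>\<Gamma>. t \<oplus>\<^bsub>G\<^esub> s = \<zero>\<^bsub>G\<^esub>" by (intro bexI[of _ "- s"]) auto
qed (auto simp: add_ac)

lemma section_a_inv: "s \<in> \<Gamma> \<Longrightarrow> \<ominus>\<^bsub>G\<^esub> s = - s"
  using abelian_group.minus_equality[OF abelian_group_sections, of "- s" s] by simp

lemma section_a_minus: "s \<in> \<Gamma> \<Longrightarrow> t \<in> \<Gamma> \<Longrightarrow> s \<ominus>\<^bsub>G\<^esub> t = s - t"
  by (simp add: a_minus_def section_a_inv)

lemma section_signed: "s \<in> \<Gamma> \<Longrightarrow> signed G k s = sign k s"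
  by (simp add: signed_def sign_def section_a_inv)

lemma sections_sign: "s \<in> \<Gamma> \<Longrightarrow> sign k s \<in> \<Gamma>"
  by (simp add: sign_def)

lemma sections_sum: "(\<And>i. i \<in> I \<Longrightarrow> f i \<in> \<Gamma>) \<Longrightarrow> (\<Sum>i\<in>I. f i) \<in> \<Gamma>"
  by (induction I rule: infinite_finite_induct) auto

lemma section_finsum:
  assumes "finite I" "\<And>i. i \<in> I \<Longrightarrow> f i \<in> \<Gamma>"
  shows "(\<Oplus>\<^bsub>G\<^esub>i\<in>I. f i) = (\<Sum>i\<in>I. f i)"
proof -
  interpret G: abelian_group G by (rule abelian_group_sections)
  show ?thesis
    using assms
  proof (induction I)
    case (insert i I)
    then show ?case by (simp add: G.finsum_insert Pi_def)
  qed simp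
qed

text \<open>
  The algebra of sections is pointwise, so the sums over an abstract abelian group in the definition of
  the differential become ordinary sums of functions, and the Cartan calculus applies.
\<close>

lemma alt_differential_eq:
  fixes L :: "('a \<Rightarrow> real, 'l) lie_rinehart"
  assumes xs: "xs \<in> arguments L (Suc n)"
    and t: "\<And>i. i \<le> n \<Longrightarrow> act (xs ! i) (f (omit i xs)) \<in> \<Gamma>"
    and t': "\<And>j k. j < k \<Longrightarrow> k \<le> n \<Longrightarrow> f (lie_bracket L (xs ! j) (xs ! k) # omit j (omit k xs)) \<in> \<Gamma>"
  shows "alt_differential L G act n f xs = sign (Suc n) (ce_differential (lie_bracket L) act n f xs)"
proof -
  let ?t = "\<lambda>i. act (xs ! i) (f (omit i xs))"
  let ?t' = "\<lambda>j k. f (lie_bracket L (xs ! j) (xs ! k) # omit j (omit k xs))"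
  let ?P = "{(j, k). j < k \<and> k \<le> n}"
  have finP: "finite ?P" by (rule finite_subset[of _ "{..n} \<times> {..n}"]) auto
  have "(\<Oplus>\<^bsub>G\<^esub>i\<in>{..n}. signed G i (?t i)) = (\<Oplus>\<^bsub>G\<^esub>i\<in>{..n}. sign i (?t i))"
    by (rule abelian_monoid.finsum_cong'[OF abelian_group.axioms(1)[OF abelian_group_sections]])
      (auto simp: t section_signed intro!: sections_sign)
  also have "\<dots> = (\<Sum>i\<le>n. sign i (?t i))"
    by (rule section_finsum) (auto simp: t intro!: sections_sign)
  finally have 1: "(\<Oplus>\<^bsub>G\<^esub>i\<in>{..n}. signed G i (?t i)) = (\<Sum>i\<le>n. sign i (?t i))" .
  have "(\<Oplus>\<^bsub>G\<^esub>p\<in>?P. case p of (j, k) \<Rightarrow> signed G (j + k) (?t' j k)) =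
      (\<Oplus>\<^bsub>G\<^esub>p\<in>?P. case p of (j, k) \<Rightarrow> sign (j + k) (?t' j k))"
    by (rule abelian_monoid.finsum_cong'[OF abelian_group.axioms(1)[OF abelian_group_sections]])
      (auto simp: t' section_signed intro!: sections_sign)
  also have "\<dots> = (\<Sum>p\<in>?P. case p of (j, k) \<Rightarrow> sign (j + k) (?t' j k))"
    by (rule section_finsum[OF finP]) (auto simp: t' intro!: sections_sign)
  also have "\<dots> = (\<Sum>(k, j)\<in>Sigma {..n} (\<lambda>k. {..<k}). sign (j + k) (?t' j k))"
    by (rule sum.reindex_bij_witness[of _ "\<lambda>(k, j). (j, k)" "\<lambda>(j, k). (k, j)"]) auto
  also have "\<dots> = (\<Sum>k\<le>n. \<Sum>j<k. sign (j + k) (?t' j k))"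
    by (rule sum.Sigma[symmetric]) auto
  finally have 2: "(\<Oplus>\<^bsub>G\<^esub>p\<in>?P. case p of (j, k) \<Rightarrow> signed G (j + k) (?t' j k)) =
      (\<Sum>k\<le>n. \<Sum>j<k. sign (j + k) (?t' j k))" .
  have c: "(\<Sum>i\<le>n. sign i (?t i)) \<in> \<Gamma>" "(\<Sum>k\<le>n. \<Sum>j<k. sign (j + k) (?t' j k)) \<in> \<Gamma>"
    by (auto intro!: sections_sum sections_sign t t')
  show ?thesis
    unfolding alt_differential_def using xs
    by (simp only: restrict_apply' 1 2 section_signed[OF c(1)] section_signed[OF c(2)] section_simps
        sign_add[symmetric] ce_differential_def)
qed

lemma mem_alternating_forms:
  "f \<in> alternating_forms (smooth_functions N) L G n \<longleftrightarrow> f \<in> extensional (arguments L n) \<and>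
     (\<forall>xs\<in>arguments L n. f xs \<in> \<Gamma>) \<and>
     (\<forall>xs\<in>arguments L n. \<forall>i<n. \<forall>x\<in>carrier L. \<forall>y\<in>carrier L.
        f (xs[i := x \<oplus>\<^bsub>L\<^esub> y]) = f (xs[i := x]) + f (xs[i := y])) \<and>
     (\<forall>xs\<in>arguments L n. \<forall>i<n. \<forall>a\<in>A. \<forall>x\<in>carrier L.
        f (xs[i := a \<odot>\<^bsub>L\<^esub> x]) = (\<lambda>p. a p *\<^sub>R f (xs[i := x]) p)) \<and>
     (\<forall>xs\<in>arguments L n. \<forall>i<n. \<forall>j<n. i \<noteq> j \<and> xs ! i = xs ! j \<longrightarrow> f xs = 0)"
  unfolding alternating_forms_def by (auto simp: PiE_iff)

lemma alt_complex_simps: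
  "carrier (alt_complex (smooth_functions N) L G n) = alternating_forms (smooth_functions N) L G n"
  "f \<oplus>\<^bsub>alt_complex (smooth_functions N) L G n\<^esub> g = (\<lambda>xs\<in>arguments L n. f xs + g xs)"
  "r \<odot>\<^bsub>alt_complex (smooth_functions N) L G n\<^esub> f = (\<lambda>xs\<in>arguments L n. \<lambda>p. r *\<^sub>R f xs p)"
  "\<zero>\<^bsub>alt_complex (smooth_functions N) L G n\<^esub> = (\<lambda>xs\<in>arguments L n. 0)"
  by (simp_all add: alt_complex_def real_module_def)

lemma module_alt_complex:
  fixes L :: "('a \<Rightarrow> real, 'l) lie_rinehart"
  assumes plus: "\<And>x y. x \<in> carrier L \<Longrightarrow> y \<in> carrier L \<Longrightarrow> x \<oplus>\<^bsub>L\<^esub> y \<in> carrier L"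
    and smult: "\<And>a x. a \<in> A \<Longrightarrow> x \<in> carrier L \<Longrightarrow> a \<odot>\<^bsub>L\<^esub> x \<in> carrier L"
  shows "Module.module real_ring (alt_complex (smooth_functions N) L G n)" (is "module real_ring ?C")
proof -
  have add: "f \<oplus>\<^bsub>?C\<^esub> g \<in> carrier ?C" if "f \<in> carrier ?C" "g \<in> carrier ?C" for f g
    using that unfolding alt_complex_simps mem_alternating_forms
    by (simp add: arguments_update plus smult fun_eq_iff scaleR_add_right)
  have scale: "r \<odot>\<^bsub>?C\<^esub> f \<in> carrier ?C" if "f \<in> carrier ?C" for r f
    using that unfolding alt_complex_simps mem_alternating_forms
    by (simp add: arguments_update plus smult fun_eq_iff scaleR_add_right)
  have zero: "\<zero>\<^bsub>?C\<^esub> \<in> carrier ?C"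
    unfolding alt_complex_simps mem_alternating_forms
    by (simp add: arguments_update plus smult fun_eq_iff)
  have ext: "f = g" if "f \<in> carrier ?C" "g \<in> carrier ?C" "\<And>xs. xs \<in> arguments L n \<Longrightarrow> f xs = g xs" for f g
  proof (rule extensionalityI[of f "arguments L n" g])
    show "f \<in> extensional (arguments L n)" "g \<in> extensional (arguments L n)"
      using that(1,2) unfolding alt_complex_simps mem_alternating_forms by blast+
  qed (rule that(3))
  note s = alt_complex_simps(2-4)
  show ?thesis
  proof (rule moduleI[OF cring_real_ring])
    show "abelian_group ?C"
    proof (rule abelian_groupI)
      fix f assume f: "f \<in> carrier ?C"
      show "\<exists>g\<in>carrier ?C. g \<oplus>\<^bsub>?C\<^esub> f = \<zero>\<^bsub>?C\<^esub>"
      proof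
        show "(-1) \<odot>\<^bsub>?C\<^esub> f \<in> carrier ?C" by (rule scale[OF f])
        show "(-1) \<odot>\<^bsub>?C\<^esub> f \<oplus>\<^bsub>?C\<^esub> f = \<zero>\<^bsub>?C\<^esub>" by (auto simp: s fun_eq_iff)
      qed
      show "\<zero>\<^bsub>?C\<^esub> \<oplus>\<^bsub>?C\<^esub> f = f" by (rule ext[OF add[OF zero f] f]) (simp add: s)
    qed (use add zero in \<open>auto simp: s fun_eq_iff add_ac\<close>)
    show "\<one>\<^bsub>real_ring\<^esub> \<odot>\<^bsub>?C\<^esub> f = f" if "f \<in> carrier ?C" for f
      by (rule ext[OF scale[OF that] that]) (simp add: s real_ring_def)
  qed (use scale in \<open>auto simp: s fun_eq_iff real_ring_def scaleR_add_left scaleR_add_right\<close>)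
qed

end

section \<open>The geometric complex\<close>

lemma lie_rinehart_extend_simps:
  "carrier (module.extend M (lie_rinehart.fields b a)) = carrier M"
  "add (module.extend M (lie_rinehart.fields b a)) = add M"
  "smult (module.extend M (lie_rinehart.fields b a)) = smult M"
  "zero (module.extend M (lie_rinehart.fields b a)) = zero M"
  "lie_bracket (module.extend M (lie_rinehart.fields b a)) = b"
  "anchor (module.extend M (lie_rinehart.fields b a)) = a"
  by (simp_all add: module.defs lie_rinehart.defs)

lemma omit_map: "omit i (map h xs) = map h (omit i xs)"
  by (simp add: omit_def take_map drop_map)

locale poisson_bundle = poisson_manifold N br + smooth_vector_bundle N Z
  for N :: "('a::{t2_space, second_countable_topology}, 'e::euclidean_space) smooth_structure"
    and br :: "('a \<Rightarrow> real) \<Rightarrow> ('a \<Rightarrow> real) \<Rightarrow> 'a \<Rightarrow> real"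
    and Z :: "('a, 'v::real_vector, 'f::euclidean_space) vector_bundle" +
  fixes \<omega> :: "'a one_form \<Rightarrow> ('a \<Rightarrow> 'v) \<Rightarrow> 'a \<Rightarrow> 'v"
  assumes flat_connection: "flat_connection (smooth_functions N) (one_form_lie_rinehart N br) (smooth_sections N Z) \<omega>"
begin

abbreviation "LR \<equiv> one_form_lie_rinehart N br"
abbreviation "KR \<equiv> kaehler_lie_rinehart (smooth_functions N) br"

lemma LR_simps [simp]:
  "carrier LR = one_forms N" "add LR = add D" "smult LR = smult D" "lie_bracket LR = bracket"
  "anchor LR = (\<lambda>\<alpha> f p. sharp N br \<alpha> p f)"
  by (simp_all add: one_form_lie_rinehart_def lie_rinehart_extend_simps)

lemma KR_simps [simp]:
  "carrier KR = carrier \<Omega>" "add KR = add \<Omega>" "smult KR = smult \<Omega>" "lie_bracket KR = kbr"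
  by (simp_all add: kaehler_lie_rinehart_def lie_rinehart_extend_simps)

lemma connection:
  shows conn_closed [simp]: "\<alpha> \<in> one_forms N \<Longrightarrow> s \<in> \<Gamma> \<Longrightarrow> \<omega> \<alpha> s \<in> \<Gamma>"
    and conn_add: "\<alpha> \<in> one_forms N \<Longrightarrow> s \<in> \<Gamma> \<Longrightarrow> t \<in> \<Gamma> \<Longrightarrow> \<omega> \<alpha> (s + t) = \<omega> \<alpha> s + \<omega> \<alpha> t"
    and conn_plus: "\<alpha> \<in> one_forms N \<Longrightarrow> \<beta> \<in> one_forms N \<Longrightarrow> s \<in> \<Gamma> \<Longrightarrow> \<omega> (\<alpha> \<oplus>\<^bsub>D\<^esub> \<beta>) s = \<omega> \<alpha> s + \<omega> \<beta> s"
    and conn_bracket: "\<alpha> \<in> one_forms N \<Longrightarrow> \<beta> \<in> one_forms N \<Longrightarrow> s \<in> \<Gamma> \<Longrightarrow>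
      \<omega> (bracket \<alpha> \<beta>) s = \<omega> \<alpha> (\<omega> \<beta> s) - \<omega> \<beta> (\<omega> \<alpha> s)"
    and conn_smult: "a \<in> A \<Longrightarrow> \<alpha> \<in> one_forms N \<Longrightarrow> s \<in> \<Gamma> \<Longrightarrow> \<omega> (a \<odot>\<^bsub>D\<^esub> \<alpha>) s = (\<lambda>p. a p *\<^sub>R \<omega> \<alpha> s p)"
    and conn_leibniz: "a \<in> A \<Longrightarrow> \<alpha> \<in> one_forms N \<Longrightarrow> s \<in> \<Gamma> \<Longrightarrow>
      \<omega> \<alpha> (\<lambda>p. a p *\<^sub>R s p) = (\<lambda>p. a p *\<^sub>R \<omega> \<alpha> s p) + (\<lambda>p. sharp_field \<alpha> p a *\<^sub>R s p)"
proof -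
  note F = flat_connection[unfolded flat_connection_def]
  have hom: "\<omega> \<alpha> \<in> mod_hom real_ring (real_module (smooth_functions N) G) (real_module (smooth_functions N) G)"
    if "\<alpha> \<in> one_forms N" for \<alpha>
    using F that by simp
  show c: "\<omega> \<alpha> s \<in> \<Gamma>" if "\<alpha> \<in> one_forms N" "s \<in> \<Gamma>" for \<alpha> s
    using hom[OF that(1)] that(2) by (auto simp: mod_hom_def real_module_def)
  show "\<omega> \<alpha> (s + t) = \<omega> \<alpha> s + \<omega> \<alpha> t" if "\<alpha> \<in> one_forms N" "s \<in> \<Gamma>" "t \<in> \<Gamma>" for \<alpha> s t
    using hom[OF that(1)] that(2,3) by (auto simp: mod_hom_def real_module_def)
  show "\<omega> (\<alpha> \<oplus>\<^bsub>D\<^esub> \<beta>) s = \<omega> \<alpha> s + \<omega> \<beta> s" if "\<alpha> \<in> one_forms N" "\<beta> \<in> one_forms N" "s \<in> \<Gamma>" for \<alpha> \<beta> s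
    using F that by simp
  show "\<omega> (bracket \<alpha> \<beta>) s = \<omega> \<alpha> (\<omega> \<beta> s) - \<omega> \<beta> (\<omega> \<alpha> s)" if "\<alpha> \<in> one_forms N" "\<beta> \<in> one_forms N" "s \<in> \<Gamma>" for \<alpha> \<beta> s
    using F that by (simp add: section_a_minus c)
  show "\<omega> (a \<odot>\<^bsub>D\<^esub> \<alpha>) s = (\<lambda>p. a p *\<^sub>R \<omega> \<alpha> s p)" if "a \<in> A" "\<alpha> \<in> one_forms N" "s \<in> \<Gamma>" for a \<alpha> s
    using F that by simp
  show "\<omega> \<alpha> (\<lambda>p. a p *\<^sub>R s p) = (\<lambda>p. a p *\<^sub>R \<omega> \<alpha> s p) + (\<lambda>p. sharp_field \<alpha> p a *\<^sub>R s p)"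
    if "a \<in> A" "\<alpha> \<in> one_forms N" "s \<in> \<Gamma>" for a \<alpha> s
    using F that by (simp add: sharp_eq_sharp_field)
qed

sublocale geo: linear_action "one_forms N" "\<lambda>\<alpha> \<beta>. \<alpha> \<oplus>\<^bsub>D\<^esub> \<beta>" "\<zero>\<^bsub>D\<^esub>" bracket \<omega> \<Gamma>
  A "\<lambda>a \<alpha>. a \<odot>\<^bsub>D\<^esub> \<alpha>" "\<lambda>a s p. a p *\<^sub>R s p" "\<lambda>\<alpha> a p. sharp_field \<alpha> p a"
proof -
  have zero: "\<zero>\<^bsub>D\<^esub> \<oplus>\<^bsub>D\<^esub> \<zero>\<^bsub>D\<^esub> = \<zero>\<^bsub>D\<^esub>"
    by (auto simp: one_form_module_simps fun_eq_iff)
  show "linear_action (one_forms N) (\<lambda>\<alpha> \<beta>. \<alpha> \<oplus>\<^bsub>D\<^esub> \<beta>) \<zero>\<^bsub>D\<^esub> bracket \<omega> \<Gamma>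
      A (\<lambda>a \<alpha>. a \<odot>\<^bsub>D\<^esub> \<alpha>) (\<lambda>a s p. a p *\<^sub>R s p) (\<lambda>\<alpha> a p. sharp_field \<alpha> p a)"
    by unfold_locales
      (simp_all add: zero bracket_closed bracket_add_left bracket_add_right bracket_self conn_add conn_plus
        conn_smult conn_leibniz bracket_smult_right vector_field_smooth[OF sharp_field_vector_field]
        fun_eq_iff scaleR_add_right)
qed

text \<open>By \<open>[du, dv] = d{u, v}\<close>, flatness of the connection makes \<open>u \<mapsto> \<omega>(du)\<close> an action of the Lie algebra of functions.\<close>

sublocale exact: flat_action A "\<lambda>f g p. f p + g p" "\<lambda>p. 0" br "\<lambda>u. \<omega> (exterior_d N u)" \<Gamma>
proof unfold_locales
  show "br x (br y z) = (\<lambda>p. br (br x y) z p + br y (br x z) p)" if "x \<in> A" "y \<in> A" "z \<in> A" for x y z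
  proof
    fix p
    have "br z (br x y) p = - br (br x y) z p"
      by (simp add: br_antisym[OF that(3) br_closed[OF that(1,2)]])
    moreover have "br y (br z x) p = - br y (br x z) p"
      using br_scale_right[OF that(2) br_closed[OF that(1,3)], of "-1"] br_antisym[OF that(3,1)] by simp
    ultimately show "br x (br y z) p = br (br x y) z p + br y (br x z) p"
      using fun_cong[OF br_jacobi[OF that], of p] by simp
  qed
qed (simp_all add: br_add_left br_add_right br_self conn_add exterior_d_add conn_plus
    bracket_exact[symmetric] conn_bracket)

lemma geo_args: "geo.args n = arguments LR n"
  by (simp add: geo.args_def arguments_def)

lemma exact_args: "us \<in> exact.args n \<Longrightarrow> map (exterior_d N) us \<in> geo.args n"
  by (auto simp: exact.args_def geo.args_def)

lemma mem_geo_forms: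
  "f \<in> alternating_forms (smooth_functions N) LR G n \<longleftrightarrow>
    f \<in> extensional (geo.args n) \<and> geo.alternating n f \<and> geo.linear_form n f"
  unfolding mem_alternating_forms geo.alternating_def geo.linear_form_def geo_args by auto

text \<open>Multilinear forms that vanish on exact one-forms vanish: replace the arguments one at a time.\<close>

lemma forms_determined_on_exact:
  assumes f: "geo.alternating n f" and lin: "geo.linear_form n f"
    and exact: "\<And>us. us \<in> exact.args n \<Longrightarrow> f (map (exterior_d N) us) = 0"
    and xs: "xs \<in> geo.args n"
  shows "f xs = 0"
proof -
  have "f xs = 0" if "k \<le> n" "xs \<in> geo.args n" "\<forall>i<n. k \<le> i \<longrightarrow> xs ! i \<in> exterior_d N ` A" for k xs
    using that
  proof (induction k arbitrary: xs)
    case 0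
    have len: "length xs = n" using 0(2) by (rule geo.args_length)
    then have "set xs \<subseteq> exterior_d N ` A" using 0(3) by (auto simp: in_set_conv_nth)
    then have "xs \<in> map (exterior_d N) ` lists A"
      by (metis lists_image lists_eq_set mem_Collect_eq)
    then obtain us where "xs = map (exterior_d N) us" "set us \<subseteq> A" by (auto simp: lists_eq_set)
    then show ?case using exact[of us] len by (auto simp: exact.args_def)
  next
    case (Suc k)
    note xs = Suc.prems(2)
    have k: "k < n" using Suc.prems(1) by simp
    have "f (xs[k := xs ! k]) = (\<lambda>_. 0)"
    proof (rule tensorial_eqI[of "\<lambda>\<beta>. f (xs[k := \<beta>])" "\<lambda>_ _. 0" "xs ! k"])
      fix g assume g: "g \<in> A"
      have "f (xs[k := exterior_d N g]) = 0"
      proof (rule Suc.IH)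
        show "\<forall>i<n. k \<le> i \<longrightarrow> xs[k := exterior_d N g] ! i \<in> exterior_d N ` A"
          using Suc.prems(3) g geo.args_length[OF xs] by (auto simp: nth_list_update)
      qed (use k xs g in auto)
      then show "f (xs[k := exterior_d N g]) = (\<lambda>_. 0)" by (simp add: zero_fun_def)
    qed (simp_all add: geo.alternating_add[OF f xs k] geo.linear_formD[OF lin xs k] geo.args_nth[OF xs k])
    then show ?case by (simp add: zero_fun_def)
  qed
  from this[of n] xs show ?thesis by simp
qed

lemma differential_on_exact:
  assumes "us \<in> exact.args (Suc n)"
  shows "geo.differential n f (map (exterior_d N) us) = exact.differential n (\<lambda>us. f (map (exterior_d N) us)) us"
proof -
  have len: "length us = Suc n" using assms by (rule exact.args_length)
  have "bracket (map (exterior_d N) us ! j) (map (exterior_d N) us ! k) = exterior_d N (br (us ! j) (us ! k))"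
    if "j < k" "k \<le> n" for j k
    using that len exact.args_nth[OF assms] by (simp add: bracket_exact)
  then show ?thesis
    unfolding ce_differential_def by (intro arg_cong2[where f="(+)"] sum.cong refl) (auto simp: len omit_map)
qed

text \<open>
  The square of the differential is again a multilinear form, so it suffices that it vanishes on
  exact forms; there it is the square of the Chevalley-Eilenberg differential of the Lie algebra of
  functions.
\<close>

lemma geo_differential_differential:
  assumes f: "geo.alternating n f" and lin: "geo.linear_form n f" and xs: "xs \<in> geo.args (Suc (Suc n))"
  shows "geo.differential (Suc n) (geo.differential n f) xs = 0"
proof (rule forms_determined_on_exact[OF _ _ _ xs])
  note d = geo.alternating_differential[OF f] geo.linear_form_differential[OF f lin]
  show "geo.alternating (Suc (Suc n)) (geo.differential (Suc n) (geo.differential n f))"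
    by (rule geo.alternating_differential[OF d(1)])
  show "geo.linear_form (Suc (Suc n)) (geo.differential (Suc n) (geo.differential n f))"
    by (rule geo.linear_form_differential[OF d])
  fix us assume us: "us \<in> exact.args (Suc (Suc n))"
  let ?f = "\<lambda>us. f (map (exterior_d N) us)"
  have alt: "exact.alternating n ?f"
    unfolding exact.alternating_def
  proof (intro conjI ballI allI impI)
    fix vs assume vs: "vs \<in> exact.args n"
    show "?f vs \<in> \<Gamma>" by (rule geo.alternating_closed[OF f exact_args[OF vs]])
    show "?f (vs[i := (\<lambda>p. x p + y p)]) = ?f (vs[i := x]) + ?f (vs[i := y])"
      if "i < n" "x \<in> A" "y \<in> A" for i x y
      using geo.alternating_add[OF f exact_args[OF vs] that(1), of "exterior_d N x" "exterior_d N y"] that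
      by (simp add: map_update exterior_d_add)
    show "?f vs = 0" if "i < n" "j < n" "i \<noteq> j \<and> vs ! i = vs ! j" for i j
      using geo.alternating_eq[OF f exact_args[OF vs] that(1,2)] that exact.args_length[OF vs] by simp
  qed
  have "geo.differential (Suc n) (geo.differential n f) (map (exterior_d N) us) =
      exact.differential (Suc n) (\<lambda>us. geo.differential n f (map (exterior_d N) us)) us"
    by (rule differential_on_exact[OF us])
  also have "\<dots> = exact.differential (Suc n) (exact.differential n ?f) us"
    by (rule exact.differential_cong[OF us]) (rule differential_on_exact)
  also have "\<dots> = 0" by (rule exact.differential_differential[OF alt us])
  finally show "geo.differential (Suc n) (geo.differential n f) (map (exterior_d N) us) = 0" .
qed

lemma geo_differential_terms:
  assumes f: "geo.alternating n f" and xs: "xs \<in> geo.args (Suc n)"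
  shows "i \<le> n \<Longrightarrow> \<omega> (xs ! i) (f (omit i xs)) \<in> \<Gamma>"
    and "j < k \<Longrightarrow> k \<le> n \<Longrightarrow> f (bracket (xs ! j) (xs ! k) # omit j (omit k xs)) \<in> \<Gamma>"
  using geo.args_nth[OF xs] geo.args_omit[OF xs] geo.args_bracket[OF xs] geo.alternating_closed[OF f] by auto

lemma geometric_differential_eq:
  assumes f: "geo.alternating n f" and xs: "xs \<in> geo.args (Suc n)"
  shows "geometric_differential N br Z \<omega> n f xs = sign (Suc n) (geo.differential n f xs)"
  unfolding geometric_differential_def
  using alt_differential_eq[of xs LR n \<omega> f] xs geo_differential_terms[OF f xs] by (simp add: geo_args)

lemma geometric_differential_extensional:
  "geometric_differential N br Z \<omega> n f \<in> extensional (geo.args (Suc n))"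
  unfolding geometric_differential_def alt_differential_def geo_args by simp

lemma alternating_sign: "geo.alternating n f \<Longrightarrow> geo.alternating n (\<lambda>xs. sign k (f xs))"
  unfolding geo.alternating_def by (simp add: sign_add) (simp add: sign_def)

lemma linear_form_sign: "geo.linear_form n f \<Longrightarrow> geo.linear_form n (\<lambda>xs. sign k (f xs))"
  unfolding geo.linear_form_def by (simp add: geo.scale_sign)

lemma linear_form_cong:
  assumes "geo.linear_form n f" "\<And>xs. xs \<in> geo.args n \<Longrightarrow> f xs = g xs"
  shows "geo.linear_form n g"
  using assms by (simp add: geo.linear_form_def)

lemma geometric_differential_form:
  assumes "f \<in> alternating_forms (smooth_functions N) LR G n"
  shows "geometric_differential N br Z \<omega> n f \<in> alternating_forms (smooth_functions N) LR G (Suc n)"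
proof -
  have f: "geo.alternating n f" "geo.linear_form n f" using assms by (auto simp: mem_geo_forms)
  note eq = geometric_differential_eq[OF f(1), symmetric]
  show ?thesis
    unfolding mem_geo_forms
    using geometric_differential_extensional
      geo.alternating_cong[OF alternating_sign[OF geo.alternating_differential[OF f(1)]] eq]
      linear_form_cong[OF linear_form_sign[OF geo.linear_form_differential[OF f]] eq]
    by blast
qed

lemma geo_form_eqI:
  assumes "f \<in> alternating_forms (smooth_functions N) LR G n" "g \<in> alternating_forms (smooth_functions N) LR G n"
    and "\<And>xs. xs \<in> geo.args n \<Longrightarrow> f xs = g xs"
  shows "f = g"
proof (rule extensionalityI[of f "geo.args n" g])
  show "f \<in> extensional (geo.args n)" "g \<in> extensional (geo.args n)" using assms(1,2) by (simp_all add: mem_geo_forms)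
qed (rule assms(3))

lemma geo_differential_sign:
  assumes "geo.alternating n f" "xs \<in> geo.args (Suc n)"
  shows "geo.differential n (\<lambda>xs. sign k (f xs)) xs = sign k (geo.differential n f xs)"
  using geo.differential_diff[OF assms(2), of "\<lambda>_. 0" f] geo.differential_zero[OF assms(2)]
    geo.alternating_closed[OF assms(1)] by (simp add: sign_def)

lemma module_geometric_cochains: "Module.module real_ring (geometric_cochains N br Z n)"
  unfolding geometric_cochains_def by (rule module_alt_complex) simp_all

lemma module_algebraic_cochains: "Module.module real_ring (algebraic_cochains (smooth_functions N) br G n)"
proof -
  interpret \<Omega>: module "smooth_functions N" \<Omega> by (rule kd.module_kaehler)
  show ?thesis
    unfolding algebraic_cochains_def by (rule module_alt_complex) simp_all
qed

lemma cochain_complex_geometric: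
  "cochain_complex real_ring (geometric_cochains N br Z) (geometric_differential N br Z \<omega>)"
proof (rule cochain_complex.intro)
  fix n
  let ?C = "geometric_cochains N br Z" and ?d = "geometric_differential N br Z \<omega>"
  note C = geometric_cochains_def alt_complex_simps
  show "Module.module real_ring (?C n)" by (rule module_geometric_cochains)
  interpret M: module real_ring "?C n" by (rule module_geometric_cochains)
  interpret M': module real_ring "?C (Suc n)" by (rule module_geometric_cochains)
  have carr: "carrier (?C m) = alternating_forms (smooth_functions N) LR G m" for m by (simp add: C)
  have closed: "?d n f \<in> carrier (?C (Suc n))" if "f \<in> carrier (?C n)" for f
    using geometric_differential_form that by (simp add: carr)
  have "?d n (f \<oplus>\<^bsub>?C n\<^esub> g) = ?d n f \<oplus>\<^bsub>?C (Suc n)\<^esub> ?d n g" if f: "f \<in> carrier (?C n)" and g: "g \<in> carrier (?C n)" for f g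
  proof (rule geo_form_eqI)
    show "?d n (f \<oplus>\<^bsub>?C n\<^esub> g) \<in> alternating_forms (smooth_functions N) LR G (Suc n)"
      "?d n f \<oplus>\<^bsub>?C (Suc n)\<^esub> ?d n g \<in> alternating_forms (smooth_functions N) LR G (Suc n)"
      using closed f g M.M.add.m_closed M'.M.add.m_closed by (simp_all add: carr[symmetric])
    fix xs assume xs: "xs \<in> geo.args (Suc n)"
    have alt: "geo.alternating n f" "geo.alternating n g" "geo.alternating n (f \<oplus>\<^bsub>?C n\<^esub> g)"
      using f g M.M.add.m_closed[OF f g] by (auto simp: carr mem_geo_forms)
    have "geo.differential n (f \<oplus>\<^bsub>?C n\<^esub> g) xs = geo.differential n (\<lambda>xs. f xs + g xs) xs"
      by (rule geo.differential_cong[OF xs]) (simp add: C geo_args)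
    also have "\<dots> = geo.differential n f xs + geo.differential n g xs"
      by (rule geo.differential_add[OF xs geo.alternating_closed[OF alt(1)] geo.alternating_closed[OF alt(2)]])
    finally show "?d n (f \<oplus>\<^bsub>?C n\<^esub> g) xs = (?d n f \<oplus>\<^bsub>?C (Suc n)\<^esub> ?d n g) xs"
      using xs by (simp add: geometric_differential_eq alt sign_add)
        (simp add: C geo_args geometric_differential_eq alt)
  qed
  moreover have "?d n (r \<odot>\<^bsub>?C n\<^esub> f) = r \<odot>\<^bsub>?C (Suc n)\<^esub> ?d n f" if f: "f \<in> carrier (?C n)" for r f
  proof (rule geo_form_eqI)
    have r: "r \<in> carrier real_ring" by (simp add: real_ring_def)
    show "?d n (r \<odot>\<^bsub>?C n\<^esub> f) \<in> alternating_forms (smooth_functions N) LR G (Suc n)"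
      "r \<odot>\<^bsub>?C (Suc n)\<^esub> ?d n f \<in> alternating_forms (smooth_functions N) LR G (Suc n)"
      using closed f M.smult_closed[OF r] M'.smult_closed[OF r] by (simp_all add: carr[symmetric])
    fix xs assume xs: "xs \<in> geo.args (Suc n)"
    have alt: "geo.alternating n f" "geo.alternating n (r \<odot>\<^bsub>?C n\<^esub> f)"
      using f M.smult_closed[OF r f] by (auto simp: carr mem_geo_forms)
    have "geo.differential n (r \<odot>\<^bsub>?C n\<^esub> f) xs = geo.differential n (\<lambda>xs p. (\<lambda>_. r) p *\<^sub>R f xs p) xs"
      by (rule geo.differential_cong[OF xs]) (simp add: C geo_args)
    also have "\<dots> = (\<lambda>p. r *\<^sub>R geo.differential n f xs p) +
        (\<Sum>k\<le>n. sign k (\<lambda>p. sharp_field (xs ! k) p (\<lambda>_. r) *\<^sub>R f (omit k xs) p))"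
      using geo.differential_scale[OF geo.alternating_closed[OF alt(1)] smooth_const[of r] xs] by simp
    \<comment> \<open>Vector fields annihilate the constant \<open>r\<close>, so the Leibniz terms disappear.\<close>
    also have "(\<Sum>k\<le>n. sign k (\<lambda>p. sharp_field (xs ! k) p (\<lambda>_. r) *\<^sub>R f (omit k xs) p)) = 0"
    proof (rule sum.neutral, rule ballI)
      fix k assume "k \<in> {..n}"
      then have "xs ! k \<in> one_forms N" using geo.args_nth[OF xs, of k] by simp
      then have "sharp_field (xs ! k) p (\<lambda>_. r) = 0" for p
        by (rule tangent_const[OF sharp_field_tangent])
      then show "sign k (\<lambda>p. sharp_field (xs ! k) p (\<lambda>_. r) *\<^sub>R f (omit k xs) p) = 0"
        by (simp add: sign_def fun_eq_iff)
    qed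
    finally have "sign (Suc n) (geo.differential n (r \<odot>\<^bsub>?C n\<^esub> f) xs) = (\<lambda>p. r *\<^sub>R sign (Suc n) (geo.differential n f xs) p)"
      by (simp add: sign_def fun_eq_iff)
    then show "?d n (r \<odot>\<^bsub>?C n\<^esub> f) xs = (r \<odot>\<^bsub>?C (Suc n)\<^esub> ?d n f) xs"
      unfolding geometric_differential_eq[OF alt(2) xs] using xs
      by (simp add: C geo_args geometric_differential_eq[OF alt(1)] del: sign_simps)
  qed
  ultimately show "?d n \<in> mod_hom real_ring (?C n) (?C (Suc n))"
    unfolding mod_hom_def using closed by blast
  show "?d (Suc n) (?d n f) = \<zero>\<^bsub>?C (Suc (Suc n))\<^esub>" if f: "f \<in> carrier (?C n)" for f
  proof (rule geo_form_eqI)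
    interpret M'': module real_ring "?C (Suc (Suc n))" by (rule module_geometric_cochains)
    note form = f[unfolded carr]
    show "?d (Suc n) (?d n f) \<in> alternating_forms (smooth_functions N) LR G (Suc (Suc n))"
      by (intro geometric_differential_form form)
    show "\<zero>\<^bsub>?C (Suc (Suc n))\<^esub> \<in> alternating_forms (smooth_functions N) LR G (Suc (Suc n))"
      using M''.M.zero_closed by (simp add: carr)
    fix xs assume xs: "xs \<in> geo.args (Suc (Suc n))"
    have alt: "geo.alternating n f" "geo.linear_form n f" "geo.alternating (Suc n) (?d n f)"
      using form geometric_differential_form[OF form] by (auto simp: mem_geo_forms)
    have "geo.differential (Suc n) (?d n f) xs = geo.differential (Suc n) (\<lambda>xs. sign (Suc n) (geo.differential n f xs)) xs"
      by (rule geo.differential_cong[OF xs]) (rule geometric_differential_eq[OF alt(1)])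
    also have "\<dots> = 0"
      unfolding geo_differential_sign[OF geo.alternating_differential[OF alt(1)] xs]
        geo_differential_differential[OF alt(1,2) xs] by (simp add: sign_def)
    finally show "?d (Suc n) (?d n f) xs = \<zero>\<^bsub>?C (Suc (Suc n))\<^esub> xs"
      unfolding geometric_differential_eq[OF alt(3) xs] using xs by (simp add: C geo_args sign_def)
  qed
qed


section \<open>Pullback along \<open>q\<close>\<close>

abbreviation "KF \<equiv> alternating_forms (smooth_functions N) KR G"
abbreviation "GF \<equiv> alternating_forms (smooth_functions N) LR G"

lemma q_args: "xs \<in> arguments KR n \<Longrightarrow> map q xs \<in> arguments LR n"
  by (auto simp: arguments_def)

lemma KF_closed: "f \<in> KF n \<Longrightarrow> xs \<in> arguments KR n \<Longrightarrow> f xs \<in> \<Gamma>"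
  by (simp add: mem_alternating_forms)

lemma KF_add: "f \<in> KF n \<Longrightarrow> xs \<in> arguments KR n \<Longrightarrow> i < n \<Longrightarrow> x \<in> carrier \<Omega> \<Longrightarrow> y \<in> carrier \<Omega> \<Longrightarrow>
    f (xs[i := x \<oplus>\<^bsub>\<Omega>\<^esub> y]) = f (xs[i := x]) + f (xs[i := y])"
  by (simp add: mem_alternating_forms)

lemma KF_smult: "f \<in> KF n \<Longrightarrow> xs \<in> arguments KR n \<Longrightarrow> i < n \<Longrightarrow> a \<in> A \<Longrightarrow> x \<in> carrier \<Omega> \<Longrightarrow>
    f (xs[i := a \<odot>\<^bsub>\<Omega>\<^esub> x]) = (\<lambda>p. a p *\<^sub>R f (xs[i := x]) p)"
  by (simp add: mem_alternating_forms)

lemma KF_eq: "f \<in> KF n \<Longrightarrow> xs \<in> arguments KR n \<Longrightarrow> i < n \<Longrightarrow> j < n \<Longrightarrow> i \<noteq> j \<Longrightarrow> xs ! i = xs ! j \<Longrightarrow> f xs = 0"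
  unfolding mem_alternating_forms by blast

text \<open>
  The heart of the matter: a form on formal differentials only sees the cotangent vectors
  \<open>q(x\<^sub>i)\<^sub>p\<close>. With the other arguments fixed, a coordinate of \<open>f(\<dots>, du, \<dots>)\<close> in the fibre at \<open>p\<close> is a
  derivation in \<open>u\<close> at \<open>p\<close>, that is, a tangent vector \<open>v\<close>, and then the same coordinate of
  \<open>f(\<dots>, x, \<dots>)\<close> is \<open>q(x)\<^sub>p(v)\<close>. Coordinates separate points because a trivialization
  identifies the fibre with a Euclidean space.
\<close>

lemma KF_local_slot:
  assumes f: "f \<in> KF n" and xs: "xs \<in> arguments KR n" and i: "i < n"
    and x: "x \<in> carrier \<Omega>" and y: "y \<in> carrier \<Omega>" and qxy: "q x p = q y p"
  shows "f (xs[i := x]) p = f (xs[i := y]) p"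
proof -
  interpret \<Omega>: module "smooth_functions N" \<Omega> by (rule kd.module_kaehler)
  obtain U \<tau> where t: "(U, \<tau>) \<in> trivializations Z" and p: "p \<in> U" by (rule trivialization_at_point)
  let ?\<phi> = "\<lambda>x. f (xs[i := x]) p"
  have fib: "?\<phi> x \<in> fibre Z p" if "x \<in> carrier \<Omega>" for x
    using section_fibre[OF KF_closed[OF f arguments_update[OF xs]]] that by simp
  have slot_add: "\<tau> p (?\<phi> (x \<oplus>\<^bsub>\<Omega>\<^esub> y)) = \<tau> p (?\<phi> x) + \<tau> p (?\<phi> y)" if "x \<in> carrier \<Omega>" "y \<in> carrier \<Omega>" for x y
    using KF_add[OF f xs i that] trivialization_add[OF t p fib[OF that(1)] fib[OF that(2)]] by simp
  have smult: "\<tau> p (?\<phi> (a \<odot>\<^bsub>\<Omega>\<^esub> x)) = a p *\<^sub>R \<tau> p (?\<phi> x)" if "a \<in> A" "x \<in> carrier \<Omega>" for a x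
    using KF_smult[OF f xs i that] trivialization_scale[OF t p fib[OF that(2)]] by simp
  have coord: "\<tau> p (?\<phi> x) \<bullet> b = q x p (\<lambda>u\<in>A. \<tau> p (?\<phi> (du u)) \<bullet> b)" if "x \<in> carrier \<Omega>" for x b
  proof -
    let ?v = "\<lambda>u\<in>A. \<tau> p (?\<phi> (du u)) \<bullet> b"
    have scale: "du (\<lambda>p. c * u p) = (\<lambda>p. c) \<odot>\<^bsub>\<Omega>\<^esub> du u" if "u \<in> A" for c u
      using du_simps(2)[OF smooth_const[of c] that] that by (simp add: du_simps(3))
    have v: "?v \<in> T p"
      unfolding tangent_space_def
      by (auto simp: du_simps slot_add smult scale smooth_mult inner_add_left)
    from that show ?thesis
    proof (induction x rule: kd.kaehler_induct)
      case (gen a u)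
      have "(a \<odot>\<^bsub>D\<^esub> exterior_d N u) p ?v = a p * ?v u"
        by (simp only: one_form_module_simps(3) restrict_apply'[OF v] exterior_d_apply[OF v])
      then have "q (a \<odot>\<^bsub>\<Omega>\<^esub> du u) p ?v = a p * ?v u"
        by (simp only: q_gen[OF gen])
      then show ?case using gen by (simp only: smult[OF gen(1) kd.kaehler_d_closed] restrict_apply' inner_scaleR_left)
    next
      case (add x y)
      have "(q x \<oplus>\<^bsub>D\<^esub> q y) p ?v = q x p ?v + q y p ?v"
        by (simp only: one_form_module_simps(2) restrict_apply'[OF v])
      then have "q (x \<oplus>\<^bsub>\<Omega>\<^esub> y) p ?v = q x p ?v + q y p ?v"
        by (simp only: q_add[OF add.hyps(1,2)])
      then show ?case by (simp only: slot_add[OF add.hyps(1,2)] inner_add_left add.IH)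
    qed
  qed
  have "\<tau> p (?\<phi> x) = \<tau> p (?\<phi> y)"
    by (rule euclidean_eqI) (simp only: coord[OF x] coord[OF y] qxy)
  then show ?thesis
    using trivializations_bij[OF t p] fib[OF x] fib[OF y] by (auto simp: bij_betw_def inj_on_def)
qed

text \<open>Replace the arguments one position at a time.\<close>

lemma KF_local:
  assumes f: "f \<in> KF n" and xs: "xs \<in> arguments KR n" and ys: "ys \<in> arguments KR n"
    and q: "\<And>i. i < n \<Longrightarrow> q (xs ! i) p = q (ys ! i) p"
  shows "f xs p = f ys p"
proof -
  have "f ys p = f xs p"
  proof (rule arguments_replace_induct[OF xs ys, where P="\<lambda>_ zs. f zs p = f xs p"])
    fix zs k assume zs: "zs \<in> arguments KR n" "k < n" "zs ! k = xs ! k" "f zs p = f xs p"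
    have "f (zs[k := ys ! k]) p = f (zs[k := xs ! k]) p"
      by (rule KF_local_slot[OF f zs(1,2)])
        (use arguments_nth[OF ys zs(2)] arguments_nth[OF xs zs(2)] q[OF zs(2)] in auto)
    also have "zs[k := xs ! k] = zs" using zs(3) by (metis list_update_id)
    finally show "f (zs[k := ys ! k]) p = f xs p" using zs(4) by simp
  qed simp
  then show ?thesis by simp
qed

lemma KF_smult_all:
  assumes f: "f \<in> KF n" and xs: "xs \<in> arguments KR n" and a: "a \<in> A"
  shows "f (map (\<lambda>x. a \<odot>\<^bsub>\<Omega>\<^esub> x) xs) = (\<lambda>p. a p ^ n *\<^sub>R f xs p)"
proof -
  interpret \<Omega>: module "smooth_functions N" \<Omega> by (rule kd.module_kaehler)
  have ys: "map (\<lambda>x. a \<odot>\<^bsub>\<Omega>\<^esub> x) xs \<in> arguments KR n"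
    using xs a by (auto simp: arguments_def)
  show ?thesis
  proof (rule arguments_replace_induct[OF xs ys, where P="\<lambda>k zs. f zs = (\<lambda>p. a p ^ k *\<^sub>R f xs p)"])
    fix zs k assume zs: "zs \<in> arguments KR n" "k < n" "zs ! k = xs ! k" "f zs = (\<lambda>p. a p ^ k *\<^sub>R f xs p)"
    have "map (\<lambda>x. a \<odot>\<^bsub>\<Omega>\<^esub> x) xs ! k = a \<odot>\<^bsub>\<Omega>\<^esub> (zs ! k)" using zs(2,3) arguments_length[OF xs] by simp
    moreover have "f (zs[k := a \<odot>\<^bsub>\<Omega>\<^esub> (zs ! k)]) = (\<lambda>p. a p *\<^sub>R f (zs[k := zs ! k]) p)"
      using KF_smult[OF f zs(1,2) a] arguments_nth[OF zs(1,2)] by simp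
    ultimately show "f (zs[k := map (\<lambda>x. a \<odot>\<^bsub>\<Omega>\<^esub> x) xs ! k]) = (\<lambda>p. a p ^ Suc k *\<^sub>R f xs p)"
      using zs(4) by simp
  qed simp
qed

text \<open>
  A formal differential representing the cotangent vector \<open>\<alpha>\<^sub>p\<close>. It is chosen for each \<open>p\<close> separately,
  without any regularity in \<open>p\<close>.
\<close>

definition lift :: "'a \<Rightarrow> 'a one_form \<Rightarrow> (('a \<Rightarrow> real) \<Rightarrow> 'a \<Rightarrow> real) set" where
  "lift p \<alpha> = (SOME x. x \<in> carrier \<Omega> \<and> q x p = \<alpha> p)"

lemma lift:
  assumes "\<alpha> \<in> one_forms N"
  shows "lift p \<alpha> \<in> carrier \<Omega>" "q (lift p \<alpha>) p = \<alpha> p"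
proof -
  obtain x where "x \<in> carrier \<Omega> \<and> q x p = \<alpha> p" using q_surjective_at[OF assms] by blast
  then have "lift p \<alpha> \<in> carrier \<Omega> \<and> q (lift p \<alpha>) p = \<alpha> p"
    unfolding lift_def by (rule someI)
  then show "lift p \<alpha> \<in> carrier \<Omega>" "q (lift p \<alpha>) p = \<alpha> p" by auto
qed

text \<open>
  The form on one-forms induced by \<open>f\<close>: its value at \<open>p\<close> is computed from representatives of the
  arguments at \<open>p\<close>, and by locality any representatives give the same value.
\<close>

definition descend :: "nat \<Rightarrow> ((('a \<Rightarrow> real) \<Rightarrow> 'a \<Rightarrow> real) set list \<Rightarrow> 'a \<Rightarrow> 'v) \<Rightarrow> 'a one_form list \<Rightarrow> 'a \<Rightarrow> 'v" where
  "descend n f = (\<lambda>xs\<in>arguments LR n. \<lambda>p. f (map (lift p) xs) p)"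

lemma lift_args: "xs \<in> arguments LR n \<Longrightarrow> map (lift p) xs \<in> arguments KR n"
  using lift(1) by (auto simp: arguments_def)

lemma descend_eq:
  assumes f: "f \<in> KF n" and xs: "xs \<in> arguments LR n" and ys: "ys \<in> arguments KR n"
    and "\<And>i. i < n \<Longrightarrow> q (ys ! i) p = (xs ! i) p"
  shows "descend n f xs p = f ys p"
proof -
  have "f (map (lift p) xs) p = f ys p"
  proof (rule KF_local[OF f lift_args[OF xs] ys])
    fix i assume i: "i < n"
    then show "q (map (lift p) xs ! i) p = q (ys ! i) p"
      using assms(4)[OF i] lift(2)[of "xs ! i" p] arguments_nth[OF xs i] arguments_length[OF xs] by simp
  qed
  then show ?thesis using xs by (simp add: descend_def)
qed

text \<open>
  Near \<open>p\<close>, choose \<open>x\<^sub>i\<close> with \<open>q(x\<^sub>i) = \<eta> \<alpha>\<^sub>i\<close> once and for all points. Then \<open>\<eta>\<^sup>n\<close> times the descended form is the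
  smooth section \<open>f(x\<^sub>1, \<dots>, x\<^sub>n)\<close>.
\<close>

lemma descend_smooth:
  assumes f: "f \<in> KF n" and xs: "xs \<in> arguments LR n"
  shows "descend n f xs \<in> \<Gamma>"
proof (rule sections_divide)
  interpret \<Omega>: module "smooth_functions N" \<Omega> by (rule kd.module_kaehler)
  show "descend n f xs p \<in> fibre Z p" for p
    using section_fibre[OF KF_closed[OF f lift_args[OF xs]]] xs by (simp add: descend_def)
  fix p
  obtain \<eta> where \<eta>: "\<eta> \<in> A" "\<eta> p \<noteq> 0" "\<And>\<alpha>. \<alpha> \<in> one_forms N \<Longrightarrow> \<exists>x\<in>carrier \<Omega>. q x = \<eta> \<odot>\<^bsub>D\<^esub> \<alpha>"
    using q_locally_surjective[of p] by blast
  define g where "g \<alpha> = (SOME x. x \<in> carrier \<Omega> \<and> q x = \<eta> \<odot>\<^bsub>D\<^esub> \<alpha>)" for \<alpha>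
  have g: "g \<alpha> \<in> carrier \<Omega>" "q (g \<alpha>) = \<eta> \<odot>\<^bsub>D\<^esub> \<alpha>" if \<alpha>: "\<alpha> \<in> one_forms N" for \<alpha>
  proof -
    have "\<exists>x. x \<in> carrier \<Omega> \<and> q x = \<eta> \<odot>\<^bsub>D\<^esub> \<alpha>" using \<eta>(3)[OF \<alpha>] by blast
    from someI_ex[OF this] show "g \<alpha> \<in> carrier \<Omega>" "q (g \<alpha>) = \<eta> \<odot>\<^bsub>D\<^esub> \<alpha>" unfolding g_def by auto
  qed
  have gs: "map g xs \<in> arguments KR n" using xs g(1) by (auto simp: arguments_def)
  have "f (map g xs) y = \<eta> y ^ n *\<^sub>R descend n f xs y" for y
  proof -
    have ls: "map (\<lambda>x. \<eta> \<odot>\<^bsub>\<Omega>\<^esub> x) (map (lift y) xs) \<in> arguments KR n"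
      using lift_args[OF xs, of y] \<eta>(1) by (auto simp: arguments_def)
    have "f (map g xs) y = f (map (\<lambda>x. \<eta> \<odot>\<^bsub>\<Omega>\<^esub> x) (map (lift y) xs)) y"
    proof (rule KF_local[OF f gs ls])
      fix i assume i: "i < n"
      have \<alpha>: "xs ! i \<in> one_forms N" using arguments_nth[OF xs i] by simp
      have "q (\<eta> \<odot>\<^bsub>\<Omega>\<^esub> lift y (xs ! i)) y = (\<eta> \<odot>\<^bsub>D\<^esub> (xs ! i)) y"
        using lift[OF \<alpha>, of y] \<eta>(1) by (simp add: q_smult one_form_module_simps(3))
      then show "q (map g xs ! i) y = q (map (\<lambda>x. \<eta> \<odot>\<^bsub>\<Omega>\<^esub> x) (map (lift y) xs) ! i) y"
        using i g(2)[OF \<alpha>] arguments_length[OF xs] by simp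
    qed
    then show ?thesis
      using KF_smult_all[OF f lift_args[OF xs] \<eta>(1), of y] xs by (simp add: descend_def)
  qed
  then have "(\<lambda>y. \<eta> y ^ n *\<^sub>R descend n f xs y) = f (map g xs)" by auto
  then have "(\<lambda>y. \<eta> y ^ n *\<^sub>R descend n f xs y) \<in> \<Gamma>" using KF_closed[OF f gs] by simp
  then show "\<exists>\<eta>\<in>A. \<eta> p \<noteq> 0 \<and> (\<lambda>x. \<eta> x *\<^sub>R descend n f xs x) \<in> \<Gamma>"
    using \<eta>(1,2) smooth_power[OF \<eta>(1), of n] by (intro bexI[of _ "\<lambda>y. \<eta> y ^ n"]) auto
qed

lemma descend_form:
  assumes f: "f \<in> KF n"
  shows "descend n f \<in> GF n"
  unfolding mem_alternating_forms
proof (intro conjI ballI allI impI)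
  interpret \<Omega>: module "smooth_functions N" \<Omega> by (rule kd.module_kaehler)
  show "descend n f \<in> extensional (arguments LR n)" by (simp add: descend_def)
  fix xs assume xs: "xs \<in> arguments LR n"
  show "descend n f xs \<in> \<Gamma>" by (rule descend_smooth[OF f xs])
  have len: "length xs = n" using xs by (rule arguments_length)
  have lx: "map (lift p) xs \<in> arguments KR n" for p by (rule lift_args[OF xs])
  have upd: "descend n f (xs[i := \<alpha>]) p = f ((map (lift p) xs)[i := x]) p"
    if i: "i < n" and \<alpha>: "\<alpha> \<in> one_forms N" and x: "x \<in> carrier \<Omega>" "q x p = \<alpha> p" for i \<alpha> p x
  proof (rule descend_eq[OF f])
    show "xs[i := \<alpha>] \<in> arguments LR n" "(map (lift p) xs)[i := x] \<in> arguments KR n"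
      using \<alpha> x arguments_update[OF xs] arguments_update[OF lx] by simp_all
    show "q ((map (lift p) xs)[i := x] ! j) p = (xs[i := \<alpha>] ! j) p" if "j < n" for j
      using that x i len lift(2)[of "xs ! j" p] arguments_nth[OF xs that]
      by (cases "j = i") (simp_all add: nth_list_update)
  qed
  show "descend n f (xs[i := \<alpha> \<oplus>\<^bsub>LR\<^esub> \<beta>]) = descend n f (xs[i := \<alpha>]) + descend n f (xs[i := \<beta>])"
    if i: "i < n" and "\<alpha> \<in> carrier LR" "\<beta> \<in> carrier LR" for i \<alpha> \<beta>
  proof
    fix p
    have ab: "\<alpha> \<in> one_forms N" "\<beta> \<in> one_forms N" using that by simp_all
    note l = lift[OF ab(1), of p] lift[OF ab(2), of p]
    have "q (lift p \<alpha> \<oplus>\<^bsub>\<Omega>\<^esub> lift p \<beta>) p = (\<alpha> \<oplus>\<^bsub>D\<^esub> \<beta>) p"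
      using l by (simp add: q_add one_form_module_simps(2))
    then show "descend n f (xs[i := \<alpha> \<oplus>\<^bsub>LR\<^esub> \<beta>]) p = (descend n f (xs[i := \<alpha>]) + descend n f (xs[i := \<beta>])) p"
      using upd[OF i one_forms_add[OF ab], of "lift p \<alpha> \<oplus>\<^bsub>\<Omega>\<^esub> lift p \<beta>"] upd[OF i ab(1) l(1,2)] upd[OF i ab(2) l(3,4)]
        KF_add[OF f lx i l(1,3)] l by simp
  qed
  show "descend n f (xs[i := a \<odot>\<^bsub>LR\<^esub> \<alpha>]) = (\<lambda>p. a p *\<^sub>R descend n f (xs[i := \<alpha>]) p)"
    if i: "i < n" and a: "a \<in> A" and "\<alpha> \<in> carrier LR" for i a \<alpha>
  proof
    fix p
    have \<alpha>: "\<alpha> \<in> one_forms N" using that by simp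
    note l = lift[OF \<alpha>, of p]
    have "q (a \<odot>\<^bsub>\<Omega>\<^esub> lift p \<alpha>) p = (a \<odot>\<^bsub>D\<^esub> \<alpha>) p"
      using l a by (simp add: q_smult one_form_module_simps(3))
    then show "descend n f (xs[i := a \<odot>\<^bsub>LR\<^esub> \<alpha>]) p = a p *\<^sub>R descend n f (xs[i := \<alpha>]) p"
      using upd[OF i one_forms_smult[OF a \<alpha>], of "a \<odot>\<^bsub>\<Omega>\<^esub> lift p \<alpha>"] upd[OF i \<alpha> l]
        KF_smult[OF f lx i a l(1)] l a by simp
  qed
  show "descend n f xs = 0" if "i < n" "j < n" "i \<noteq> j \<and> xs ! i = xs ! j" for i j
  proof
    fix p
    show "descend n f xs p = 0 p"
      using KF_eq[OF f lx that(1,2)] that len xs by (simp add: descend_def)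
  qed
qed

abbreviation "qs \<equiv> q_pullback N br"

lemma q_pullback_apply: "xs \<in> arguments KR n \<Longrightarrow> qs n F xs = F (map q xs)"
  by (simp add: q_pullback_def alt_pullback_def)

lemma q_pullback_form:
  assumes F: "F \<in> GF n"
  shows "qs n F \<in> KF n"
proof -
  interpret \<Omega>: module "smooth_functions N" \<Omega> by (rule kd.module_kaehler)
  have G: "geo.alternating n F" "geo.linear_form n F" using F by (simp_all add: mem_geo_forms)
  have q: "map q xs \<in> geo.args n" if "xs \<in> arguments KR n" for xs using q_args[OF that] by (simp add: geo_args)
  show ?thesis
    unfolding mem_alternating_forms
  proof (intro conjI ballI allI impI)
    show "qs n F \<in> extensional (arguments KR n)" by (simp add: q_pullback_def alt_pullback_def)
    fix xs assume xs: "xs \<in> arguments KR n"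
    show "qs n F xs \<in> \<Gamma>" using geo.alternating_closed[OF G(1) q[OF xs]] xs by (simp add: q_pullback_apply)
    show "qs n F (xs[i := x \<oplus>\<^bsub>KR\<^esub> y]) = qs n F (xs[i := x]) + qs n F (xs[i := y])"
      if "i < n" "x \<in> carrier KR" "y \<in> carrier KR" for i x y
      using that arguments_update[OF xs] geo.alternating_add[OF G(1) q[OF xs] that(1), of "q x" "q y"]
      by (simp add: q_pullback_apply map_update q_add)
    show "qs n F (xs[i := a \<odot>\<^bsub>KR\<^esub> x]) = (\<lambda>p. a p *\<^sub>R qs n F (xs[i := x]) p)"
      if "i < n" "a \<in> A" "x \<in> carrier KR" for i a x
      using that arguments_update[OF xs] geo.linear_formD[OF G(2) q[OF xs] that(1,2), of "q x"]
      by (simp add: q_pullback_apply map_update q_smult)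
    show "qs n F xs = 0" if "i < n" "j < n" "i \<noteq> j \<and> xs ! i = xs ! j" for i j
      using geo.alternating_eq[OF G(1) q[OF xs] that(1,2)] that arguments_length[OF xs] xs
      by (simp add: q_pullback_apply)
  qed
qed

lemma q_pullback_descend:
  assumes f: "f \<in> KF n"
  shows "qs n (descend n f) = f"
proof (rule extensionalityI[of _ "arguments KR n"])
  show "f \<in> extensional (arguments KR n)" using f by (simp add: mem_alternating_forms)
  fix xs assume xs: "xs \<in> arguments KR n"
  have "descend n f (map q xs) p = f xs p" for p
    by (rule descend_eq[OF f q_args[OF xs] xs]) (use arguments_length[OF xs] in simp)
  then show "qs n (descend n f) xs = f xs" using xs by (simp add: q_pullback_apply fun_eq_iff)
qed (simp add: q_pullback_def alt_pullback_def)

text \<open>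
  Injectivity holds because the exact one-forms, which lie in the image of \<open>q\<close>, determine a form;
  surjectivity is the descent of forms.
\<close>

lemma q_pullback_bij: "bij_betw (qs n) (GF n) (KF n)"
proof (rule bij_betwI')
  fix F H assume F: "F \<in> GF n" and H: "H \<in> GF n"
  have "F = H" if eq: "qs n F = qs n H"
  proof (rule geo_form_eqI[OF F H])
    fix xs assume xs: "xs \<in> geo.args n"
    have FH: "geo.alternating n F" "geo.alternating n H" "geo.linear_form n F" "geo.linear_form n H"
      using F H by (simp_all add: mem_geo_forms)
    have "F xs - H xs = 0"
    proof (rule forms_determined_on_exact[OF geo.alternating_diff[OF FH(1,2)] _ _ xs])
      show "geo.linear_form n (\<lambda>xs. F xs - H xs)"
        using FH(3,4) by (simp add: geo.linear_form_def geo.scale_diff fun_diff_def scaleR_diff_right)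
      fix us assume us: "us \<in> exact.args n"
      have args: "map du us \<in> arguments KR n" using us by (auto simp: exact.args_def arguments_def)
      have eqm: "map q (map du us) = map (exterior_d N) us" using us by (auto simp: exact.args_def q_d)
      then show "F (map (exterior_d N) us) - H (map (exterior_d N) us) = 0"
        using fun_cong[OF eq, of "map du us"] unfolding q_pullback_apply[OF args] eqm by simp
    qed
    then show "F xs = H xs" by simp
  qed
  then show "(qs n F = qs n H) = (F = H)" by blast
next
  show "qs n F \<in> KF n" if "F \<in> GF n" for F by (rule q_pullback_form[OF that])
  show "\<exists>F\<in>GF n. f = qs n F" if "f \<in> KF n" for f
    using descend_form[OF that] q_pullback_descend[OF that] by metis
qed

lemma q_pullback_differential:
  assumes F: "F \<in> GF n"
  shows "qs (Suc n) (geometric_differential N br Z \<omega> n F) =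
    algebraic_differential (smooth_functions N) br G (kaehler_connection N \<omega>) n (qs n F)"
proof (rule extensionalityI[of _ "arguments KR (Suc n)"])
  show "qs (Suc n) (geometric_differential N br Z \<omega> n F) \<in> extensional (arguments KR (Suc n))"
    by (simp add: q_pullback_def alt_pullback_def)
  show "algebraic_differential (smooth_functions N) br G (kaehler_connection N \<omega>) n (qs n F) \<in> extensional (arguments KR (Suc n))"
    by (simp add: algebraic_differential_def alt_differential_def)
  fix xs assume xs: "xs \<in> arguments KR (Suc n)"
  have alt: "geo.alternating n F" using F by (simp add: mem_geo_forms)
  have qxs: "map q xs \<in> geo.args (Suc n)" using q_args[OF xs] by (simp add: geo_args)
  have len: "length xs = Suc n" using xs by (rule arguments_length)
  have nth: "xs ! i \<in> carrier \<Omega>" if "i \<le> n" for i using arguments_nth[OF xs, of i] that by simp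
  have omit: "omit i xs \<in> arguments KR n" if "i \<le> n" for i
    using xs that by (auto simp: arguments_def omit_def dest: in_set_takeD in_set_dropD)
  have omit2: "kbr (xs ! j) (xs ! k) # omit j (omit k xs) \<in> arguments KR n" if jk: "j < k" "k \<le> n" for j k
  proof -
    obtain m where m: "n = Suc m" using jk by (cases n) auto
    have "omit j (omit k xs) \<in> arguments KR m"
      using xs m jk by (auto simp: arguments_def omit_def dest!: in_set_takeD in_set_dropD)
    then show ?thesis using nth jk m by (simp add: arguments_def kaehler_bracket_closed)
  qed
  have 1: "kaehler_connection N \<omega> (xs ! i) (qs n F (omit i xs)) = \<omega> (map q xs ! i) (F (omit i (map q xs)))" if "i \<le> n" for i
    using that omit[OF that] len by (simp add: kaehler_connection_def q_pullback_apply omit_map)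
  have 2: "qs n F (kbr (xs ! j) (xs ! k) # omit j (omit k xs)) =
      F (bracket (map q xs ! j) (map q xs ! k) # omit j (omit k (map q xs)))" if "j < k" "k \<le> n" for j k
    using that omit2[OF that] nth len by (simp add: q_pullback_apply q_bracket omit_map)
  have "algebraic_differential (smooth_functions N) br G (kaehler_connection N \<omega>) n (qs n F) xs =
      sign (Suc n) (ce_differential kbr (kaehler_connection N \<omega>) n (qs n F) xs)"
    unfolding algebraic_differential_def
    using alt_differential_eq[of xs KR n "kaehler_connection N \<omega>" "qs n F"] xs 1 2
      geo_differential_terms[OF alt qxs] by simp
  also have "ce_differential kbr (kaehler_connection N \<omega>) n (qs n F) xs = geo.differential n F (map q xs)"
    unfolding ce_differential_def
    by (intro arg_cong2[where f="(+)"] sum.cong refl arg_cong2[where f=sign]) (auto simp: 1 2)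
  finally show "qs (Suc n) (geometric_differential N br Z \<omega> n F) xs =
      algebraic_differential (smooth_functions N) br G (kaehler_connection N \<omega>) n (qs n F) xs"
    using geometric_differential_eq[OF alt qxs] xs by (simp add: q_pullback_apply fun_eq_iff)
qed

lemma q_pullback_mod_iso:
  "qs n \<in> mod_iso real_ring (geometric_cochains N br Z n) (algebraic_cochains (smooth_functions N) br G n)"
proof -
  have upd: "map q xs \<in> arguments LR n" if "xs \<in> arguments KR n" for xs using q_args[OF that] .
  have "qs n \<in> mod_hom real_ring (geometric_cochains N br Z n) (algebraic_cochains (smooth_functions N) br G n)"
    unfolding mod_hom_def geometric_cochains_def algebraic_cochains_def alt_complex_simps
    using q_pullback_form upd by (auto simp: q_pullback_def alt_pullback_def fun_eq_iff)
  then show ?thesis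
    using q_pullback_bij by (simp add: mod_iso_def geometric_cochains_def algebraic_cochains_def alt_complex_simps)
qed

lemma q_pullback_complex_iso:
  "cochain_complex_iso real_ring
     (geometric_cochains N br Z) (geometric_differential N br Z \<omega>)
     (algebraic_cochains (smooth_functions N) br G)
     (algebraic_differential (smooth_functions N) br G (kaehler_connection N \<omega>)) qs"
proof (rule cochain_complex_iso_transport[OF cochain_complex_geometric module_algebraic_cochains q_pullback_mod_iso])
  fix n F assume "F \<in> carrier (geometric_cochains N br Z n)"
  then show "qs (Suc n) (geometric_differential N br Z \<omega> n F) =
      algebraic_differential (smooth_functions N) br G (kaehler_connection N \<omega>) n (qs n F)"
    by (intro q_pullback_differential) (simp add: geometric_cochains_def alt_complex_simps)
qed

end

theorem theorem3p12p13:
  fixes N :: "('a::{t2_space, second_countable_topology}, 'e::euclidean_space) smooth_structure"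
    and br :: "('a \<Rightarrow> real) \<Rightarrow> ('a \<Rightarrow> real) \<Rightarrow> 'a \<Rightarrow> real"
    and Z :: "('a, 'v::real_vector, 'f::euclidean_space) vector_bundle"
    and \<omega> :: "'a one_form \<Rightarrow> ('a \<Rightarrow> 'v) \<Rightarrow> 'a \<Rightarrow> 'v"
  assumes "poisson_manifold N br"
    and "smooth_vector_bundle N Z"
    and "flat_connection (smooth_functions N) (one_form_lie_rinehart N br) (smooth_sections N Z) \<omega>"
  shows "cochain_complex_iso real_ring
           (geometric_cochains N br Z) (geometric_differential N br Z \<omega>)
           (algebraic_cochains (smooth_functions N) br (smooth_sections N Z))
           (algebraic_differential (smooth_functions N) br (smooth_sections N Z) (kaehler_connection N \<omega>))
           (q_pullback N br)
    \<and> (\<forall>n. cohomology_map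
           (algebraic_cochains (smooth_functions N) br (smooth_sections N Z))
           (algebraic_differential (smooth_functions N) br (smooth_sections N Z) (kaehler_connection N \<omega>))
           (q_pullback N br) n
         \<in> mod_iso real_ring
           (manifold_poisson_cohomology N br Z \<omega> n)
           (algebra_poisson_cohomology (smooth_functions N) br (smooth_sections N Z) (kaehler_connection N \<omega>) n))"
proof -
  interpret poisson_bundle N br Z \<omega>
    using assms by (intro poisson_bundle.intro poisson_bundle_axioms.intro)
  have iso: "cochain_complex_iso real_ring
           (geometric_cochains N br Z) (geometric_differential N br Z \<omega>)
           (algebraic_cochains (smooth_functions N) br (smooth_sections N Z))
           (algebraic_differential (smooth_functions N) br (smooth_sections N Z) (kaehler_connection N \<omega>))
           (q_pullback N br)"
    by (rule q_pullback_complex_iso)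
  then show ?thesis
    using cohomology_iso[OF iso] by (simp add: manifold_poisson_cohomology_def algebra_poisson_cohomology_def)
qed

end
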